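(* Let $r\in\mathbb{Z}_{>0}$, $p,q\in\mathbb{C}^*$ with $|p|,|q|<1$, $\epsilon\in\{0,1\}$, and let $t_1,\ldots,t_8\in\mathbb{C}^*$, $n_1,\ldots,n_8\in\mathbb{Z}$ satisfy $$\prod_{a=1}^8t_a=(pq)^2,\qquad \sum_{a=1}^8n_a+4\epsilon=0 .$$ Let $\rho\in\{0,1\}$ be determined by the condition that $\sum_{\ell=1}^4n_\ell+\epsilon-\rho$ is even. Set $$s_a=\frac{\sqrt{t_1t_2t_3t_4}}{t_a}\ (a=1,2,3,4),\qquad s_a=\frac{\sqrt{t_5t_6t_7t_8}}{t_a}\ (a=5,6,7,8),$$ where the square roots are chosen so that $\sqrt{t_1t_2t_3t_4}\,\sqrt{t_5t_6t_7t_8}=pq$, and $$k_a=-n_a+\tfrac12\Big(\sum_{\ell=1}^4n_\ell+\epsilon-\rho\Big)\ (a=1,2,3,4),\qquad k_a=-n_a+\tfrac12\Big(\sum_{\ell=5}^8n_\ell+\epsilon-\rho\Big)\ (a=5,6,7,8).$$ Assume $|t_a|,|s_a|<1$ for all $a$. Then $$V_\epsilon^{(r)}(t_a,n_a;p,q)=\prod_{b=1}^{4}\prod_{c=1}^4\Gamma^{(r)}(t_bt_{c+4},n_b+n_{c+4}+\epsilon)\;V_\rho^{(r)}(s_a,k_a;p,q).$$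
   Context: Notation: $(z;p)_\infty=\prod_{j\ge0}(1-zp^j)$ for $|p|<1$. The elliptic gamma function is $\Gamma(z;p,q)=\prod_{j,k=0}^\infty\frac{1-z^{-1}p^{j+1}q^{k+1}}{1-zp^jq^k}$ for $|p|,|q|<1$, $z\in\mathbb{C}^*$. For $r\in\mathbb{Z}_{>0}$, $m\in\mathbb{Z}$, nonzero $p,q$ with $|p|,|q|<1$, the rarefied elliptic gamma function is the meromorphic function of $z\in\mathbb{C}^*$ $$\Gamma^{(r)}(z,m)=\Gamma^{(r)}(z,m;p,q)=(-z)^{\frac{m(m-1)}{2}}p^{\frac{m(m-1)(m-2)}{6}}q^{-\frac{m(m^2-1)}{6}}\;\Gamma(zp^m;p^r,pq)\,\Gamma(zq^{r-m};q^r,pq)$$ (all exponents are integers). Products and quotients of these functions are understood as meromorphic functions. For $\epsilon\in\{0,1\}$, $t_a\in\mathbb{C}^*$ with $|t_a|<1$, $n_a\in\mathbb{Z}$ ($a=1,\ldots,8$) satisfying $\prod_{a=1}^8t_a=(pq)^2$ and $\sum_{a=1}^8n_a+4\epsilon=0$, the rarefied elliptic hypergeometric function is $$V_\epsilon^{(r)}(t_a,n_a;p,q)=\frac{(p^r;p^r)_\infty(q^r;q^r)_\infty}{4\pi\mathrm{i}}\sum_{m=0}^{r-1}\int_{\mathbb{T}}\frac{\prod_{a=1}^8\Gamma^{(r)}(t_az,n_a+\epsilon+m)\,\Gamma^{(r)}(t_az^{-1},n_a-m)}{\Gamma^{(r)}(z^2,2m+\epsilon)\,\Gamma^{(r)}(z^{-2},-2m-\epsilon)}\frac{dz}{z},$$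 with $\mathbb{T}$ the positively oriented unit circle. *)

theory Defs
  imports "HOL-Complex_Analysis.Complex_Analysis"
begin

definition qpoch_inf :: "complex \<Rightarrow> complex \<Rightarrow> complex" where
  "qpoch_inf z p = (\<Prod>j. 1 - z * p ^ j)"

(* At a pole, one factor has denominator 0, so the value is 0 by the convention x / 0 = 0. *)
definition ell_gamma :: "complex \<Rightarrow> complex \<Rightarrow> complex \<Rightarrow> complex" where
  "ell_gamma z p q =
     (\<Prod>j. \<Prod>k. (1 - inverse z * p ^ (j + 1) * q ^ (k + 1)) / (1 - z * p ^ j * q ^ k))"

(* For m outside {0..r} a zero of one elliptic gamma factor can coincide with a pole of the
   other one. Taking remove_sings in the variable z gives the value of the meromorphic function
   there instead of the junk value of the pointwise product; genuine poles get the value 0.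
   All integer divisions are exact. *)
definition rarefied_gamma :: "nat \<Rightarrow> complex \<Rightarrow> complex \<Rightarrow> complex \<Rightarrow> int \<Rightarrow> complex" where
  "rarefied_gamma r p q z m =
     remove_sings
       (\<lambda>w. (- w) powi (m * (m - 1) div 2)
            * p powi (m * (m - 1) * (m - 2) div 6)
            * q powi (- (m * (m\<^sup>2 - 1) div 6))
            * ell_gamma (w * p powi m) (p ^ r) (p * q)
            * ell_gamma (w * q powi (int r - m)) (q ^ r) (p * q)) z"

(* The parameters t and n are indexed by {1..8}. On the unit circle the gamma functions in the
   denominator have no zeros, and at their finitely many poles x / 0 = 0 is the value of the
   meromorphic integrand. *)
definition rarefied_V ::
  "nat \<Rightarrow> complex \<Rightarrow> complex \<Rightarrow> int \<Rightarrow> (nat \<Rightarrow> complex) \<Rightarrow> (nat \<Rightarrow> int) \<Rightarrow> complex" where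
  "rarefied_V r p q \<epsilon> t n =
     qpoch_inf (p ^ r) (p ^ r) * qpoch_inf (q ^ r) (q ^ r) / (4 * of_real pi * \<i>)
     * (\<Sum>m<r. contour_integral (circlepath 0 1)
          (\<lambda>z. (\<Prod>a=1..8. rarefied_gamma r p q (t a * z) (n a + \<epsilon> + int m)
                        * rarefied_gamma r p q (t a * inverse z) (n a - int m))
               / (rarefied_gamma r p q (z\<^sup>2) (2 * int m + \<epsilon>)
                  * rarefied_gamma r p q (inverse (z\<^sup>2)) (- 2 * int m - \<epsilon>))
               / z))"

end

theory Submission
  imports Defs
begin

text \<open>Let \<open>gam\<close> be the rarefied elliptic gamma function. A product of two integrals over parameters
  \<open>A\<close> and \<open>B\<close> coupled by the kernel \<open>gam (\<xi> z\<^sup>\<plusminus> w\<^sup>\<plusminus>)\<close> can be evaluated in either order by the rarefied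
  elliptic beta integral, which gives a symmetry transformation for a splitting \<open>4 + 4\<close> of the eight
  parameters (Bailey's argument). Two such transformations, for \<open>{1,2,5,6}\<close> and \<open>{1,2,7,8}\<close>, compose to
  the required one on an open set of parameters, and the identity theorem along a path that is
  linear in the logarithms of the parameters gives the general case.

  The beta integral itself is invariant, up to its right hand side, under \<open>q\<close>-shifts of a pair of
  parameters (a telescoping difference equation) and under the period \<open>r\<close> of the discrete
  parameters; the maximum principle then shows that the quotient of both sides is constant, and the
  constant comes from the limit in which two parameters pinch the unit circle.\<close>

section \<open>Infinite products over a geometric progression\<close>

text \<open>Uniqueness arguments of this kind commonly use two independent shifts, one by p and one
  by q. Here the discrete variable replaces the second one: the q-shift of a pair also moves its
  discrete parameters by 1, and r is a period of these, so one shift leaves a compact fundamental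
  domain. That domain has to lie inside the strip, which must therefore be wider than one shift:
  |t_i t_j| < |q| for the moved pair. The condition is inherited by the beta integral and by both
  Bailey steps, and it is the reason why their composition holds at first only on an open set.

  Values of the gamma function at single points are limits, or the default 0 at poles. Functional
  equations are therefore proved for the plain product outside an exceptional set and extended by
  continuity, and the two gamma functions in the denominator of the integrand are replaced by a
  product of two theta functions, regular on the unit circle.

  The prefactors have quadratic and cubic exponents. They are handled as exponentials of polynomials
  in fixed logarithms; such exponents agree only up to integer multiples of 2 pi i, and the integer
  is given explicitly.\<close>

lemma geometric_product:
  fixes h :: "complex \<Rightarrow> complex"
  assumes hol: "h holomorphic_on UNIV" and h0: "h 0 = 1" and x: "norm x < 1"
  shows geometric_product_convergent: "convergent_prod (\<lambda>j. h (z * x ^ j))"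
    and geometric_product_holomorphic: "(\<lambda>z. \<Prod>j. h (z * x ^ j)) holomorphic_on UNIV"
proof -
  \<comment> \<open>\<open>h1\<close> is the entire function with \<open>h z - 1 = z * h1 z\<close>.
    It is bounded on discs, so the j-th factor differs from 1 by O(|x|^j) uniformly on a disc; this
    gives both convergence and holomorphy.\<close>
  define h1 where "h1 = (\<lambda>z. if z = 0 then deriv h 0 else (h z - h 0) / (z - 0))"
  have h1: "h1 holomorphic_on UNIV"
    unfolding h1_def by (rule pole_lemma_open[OF hol]) auto
  have hh1: "h z - 1 = z * h1 z" for z
    by (auto simp: h1_def h0)
  have bound: "\<exists>C. \<forall>z\<in>cball 0 B. \<forall>j. norm (h (z * x ^ j) - 1) \<le> C * norm x ^ j" for B
  proof -
    have "compact (h1 ` cball 0 B)"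
      by (intro compact_continuous_image holomorphic_on_imp_continuous_on)
         (use h1 holomorphic_on_subset in auto)
    then obtain C where C: "norm (h1 z) \<le> C" if "z \<in> cball 0 B" for z
      by (fastforce dest!: compact_imp_bounded simp: bounded_iff)
    show ?thesis
    proof (intro exI[of _ "B * C"] ballI allI)
      fix z j assume z: "z \<in> cball (0::complex) B"
      have xj: "norm x ^ j \<le> 1" using x by (simp add: power_le_one)
      have B0: "B \<ge> 0" using z by (simp add: dist_norm) (meson norm_ge_zero order_trans)
      have "norm (z * x ^ j) \<le> B"
        using z xj mult_mono[of "norm z" B "norm x ^ j" 1] B0 by (auto simp: norm_mult norm_power)
      then have "norm (h1 (z * x ^ j)) \<le> C" by (intro C) auto
      moreover have "norm (z * x ^ j) \<le> B * norm x ^ j"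
        using z by (auto simp: norm_mult norm_power intro!: mult_right_mono)
      ultimately have "norm (z * x ^ j) * norm (h1 (z * x ^ j)) \<le> (B * norm x ^ j) * C"
        by (intro mult_mono) (use B0 in auto)
      then show "norm (h (z * x ^ j) - 1) \<le> B * C * norm x ^ j"
        by (simp only: hh1 norm_mult) (simp add: mult_ac)
    qed
  qed
  have summ: "summable (\<lambda>j. C * norm x ^ j)" for C
    using x by (intro summable_mult summable_geometric) auto
  show conv: "convergent_prod (\<lambda>j. h (z * x ^ j))" for z
  proof -
    obtain C where "\<forall>w\<in>cball 0 (norm z). \<forall>j. norm (h (w * x ^ j) - 1) \<le> C * norm x ^ j"
      using bound by blast
    then have "\<And>j. norm (h (z * x ^ j) - 1) \<le> C * norm x ^ j" by auto
    then have "summable (\<lambda>j. norm (h (z * x ^ j) - 1))"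
      by (intro summable_comparison_test[OF _ summ[of C]]) auto
    then show ?thesis
      by (intro abs_convergent_prod_imp_convergent_prod summable_imp_abs_convergent_prod)
  qed
  show "(\<lambda>z. \<Prod>j. h (z * x ^ j)) holomorphic_on UNIV"
  proof (rule holomorphic_uniform_sequence)
    show "(\<lambda>z. \<Prod>j<n. h (z * x ^ j)) holomorphic_on UNIV" for n
      by (intro holomorphic_intros holomorphic_on_compose[OF _ holomorphic_on_subset[OF hol], unfolded o_def]) auto
    fix w :: complex
    obtain C where C: "\<forall>z\<in>cball 0 (norm w + 1). \<forall>j. norm (h (z * x ^ j) - 1) \<le> C * norm x ^ j"
      using bound by blast
    have sub: "cball w 1 \<subseteq> cball 0 (norm w + 1)"
    proof
      fix y assume "y \<in> cball w 1"
      then show "y \<in> cball 0 (norm w + 1)"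
        using norm_triangle_sub[of y w] by (auto simp: dist_norm norm_minus_commute)
    qed
    have "uniformly_convergent_on (cball w 1) (\<lambda>N z. \<Prod>j<N. h (z * x ^ j))"
    proof (rule uniformly_convergent_on_prod')
      show "continuous_on (cball w 1) (\<lambda>z. h (z * x ^ n))" for n
        by (intro continuous_on_compose2[OF holomorphic_on_imp_continuous_on[OF hol]] continuous_intros) auto
      show "uniformly_convergent_on (cball w 1) (\<lambda>N z. \<Sum>n<N. norm (h (z * x ^ n) - 1))"
        by (rule Weierstrass_m_test'[OF _ summ[of C]]) (use C sub in auto)
    qed auto
    then have "uniform_limit (cball w 1) (\<lambda>N z. \<Prod>j<N. h (z * x ^ j))
        (\<lambda>z. lim (\<lambda>N. \<Prod>j<N. h (z * x ^ j))) sequentially"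
      by (simp add: uniformly_convergent_uniform_limit_iff)
    moreover have "lim (\<lambda>N. \<Prod>j<N. h (z * x ^ j)) = (\<Prod>j. h (z * x ^ j))" for z
      using convergent_prod_LIMSEQ[OF conv] LIMSEQ_lessThan_iff_atMost by (intro limI) blast
    ultimately show "\<exists>d>0. cball w d \<subseteq> UNIV \<and>
        uniform_limit (cball w d) (\<lambda>n z. \<Prod>j<n. h (z * x ^ j)) (\<lambda>z. \<Prod>j. h (z * x ^ j)) sequentially"
      by (intro exI[of _ 1]) auto
  qed auto
qed

lemma geometric_product_split:
  fixes h :: "complex \<Rightarrow> complex"
  assumes hol: "h holomorphic_on UNIV" and h0: "h 0 = 1" and x: "norm x < 1"
  shows "(\<Prod>j. h (z * x ^ j)) = h z * (\<Prod>j. h (z * x * x ^ j))"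
proof -
  have c: "convergent_prod (\<lambda>j. h (z * x ^ j))" for z
    using geometric_product_convergent[OF assms] .
  have "(\<lambda>j. if j = 0 then h z else 1) has_prod h z"
    using has_prod_single[of 0 "\<lambda>_. h z"] by simp
  \<comment> \<open>The factor at index 0 is replaced by 1 because the shift rule
    \<open>has_prod_Suc_iff\<close> asks for a nonzero first factor, while \<open>h z\<close> may
    vanish.\<close>
  moreover have "(\<lambda>j. if j = 0 then 1 else h (z * x ^ j)) has_prod (\<Prod>j. h (z * x * x ^ j))"
  proof -
    have "(\<lambda>j. h (z * x * x ^ j)) has_prod (\<Prod>j. h (z * x * x ^ j))"
      using c[of "z * x"] by (simp add: has_prod_iff)
    then have "(\<lambda>j. (\<lambda>j. if j = 0 then 1 else h (z * x ^ j)) (Suc j)) has_prod (\<Prod>j. h (z * x * x ^ j))"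
      by (simp add: mult_ac)
    then show ?thesis
      by (subst (asm) has_prod_Suc_iff) auto
  qed
  ultimately have "(\<lambda>j. (if j = 0 then h z else 1) * (if j = 0 then 1 else h (z * x ^ j)))
      has_prod (h z * (\<Prod>j. h (z * x * x ^ j)))"
    by (rule has_prod_mult)
  moreover have "(\<lambda>j. (if j = 0 then h z else 1) * (if j = 0 then 1 else h (z * x ^ j))) = (\<lambda>j. h (z * x ^ j))"
    by auto
  ultimately show ?thesis using has_prod_unique by fastforce
qed

lemma geometric_product_nonzero:
  fixes h :: "complex \<Rightarrow> complex"
  assumes hol: "h holomorphic_on UNIV" and h0: "h 0 = 1" and x: "norm x < 1"
    and nz: "\<And>j. h (z * x ^ j) \<noteq> 0"
  shows "(\<Prod>j. h (z * x ^ j)) \<noteq> 0"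
  using prodinf_nonzero[OF geometric_product_convergent[OF hol h0 x] nz] .

section \<open>Theta functions and double products\<close>

lemma qpoch_factor_holomorphic: "(\<lambda>z::complex. 1 - z) holomorphic_on UNIV"
  by (intro holomorphic_intros)

context
  fixes x :: complex
  assumes x: "norm x < 1"
begin

lemma qpoch_convergent: "convergent_prod (\<lambda>k. 1 - z * x ^ k)"
  using geometric_product_convergent[OF qpoch_factor_holomorphic _ x] by simp

lemma qpoch_holomorphic: "(\<lambda>z. qpoch_inf z x) holomorphic_on UNIV"
  unfolding qpoch_inf_def using geometric_product_holomorphic[OF qpoch_factor_holomorphic _ x] by simp

lemma qpoch_split: "qpoch_inf z x = (1 - z) * qpoch_inf (z * x) x"
  unfolding qpoch_inf_def using geometric_product_split[OF qpoch_factor_holomorphic _ x, of z] by simp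

lemma qpoch_nonzero: "(\<And>k. z * x ^ k \<noteq> 1) \<Longrightarrow> qpoch_inf z x \<noteq> 0"
  unfolding qpoch_inf_def using geometric_product_nonzero[OF qpoch_factor_holomorphic _ x, of z] by simp

lemma qpoch_nonzero_norm:
  assumes "norm z < 1" shows "qpoch_inf z x \<noteq> 0"
proof (rule qpoch_nonzero)
  fix k
  have "norm (z * x ^ k) \<le> norm z * 1"
    unfolding norm_mult norm_power by (intro mult_left_mono power_le_one) (use x in auto)
  then show "z * x ^ k \<noteq> 1" using assms by (metis mult.right_neutral norm_one not_le)
qed

end

lemma qpoch_0 [simp]: "qpoch_inf 0 x = 1"
  by (simp add: qpoch_inf_def)

text \<open>The double product (z; x, y)_infinity, taken row by row so that
  \<open>geometric_product\<close> applies with the entire function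
  \<open>qpoch_inf _ y\<close>.\<close>

definition qpoch2 :: "complex \<Rightarrow> complex \<Rightarrow> complex \<Rightarrow> complex" where
  "qpoch2 z x y = (\<Prod>j. qpoch_inf (z * x ^ j) y)"

text \<open>The multiplicative theta function of nome x; for 0 < |x| < 1 its zeros are simple and
  are exactly the integer powers of x.\<close>

definition theta :: "complex \<Rightarrow> complex \<Rightarrow> complex" where
  "theta z x = qpoch_inf z x * qpoch_inf (x / z) x"

context
  fixes x y :: complex
  assumes x: "norm x < 1" and y: "norm y < 1"
begin

lemma qpoch2_convergent: "convergent_prod (\<lambda>j. qpoch_inf (z * x ^ j) y)"
  using geometric_product_convergent[OF qpoch_holomorphic[OF y] _ x] by simp

lemma qpoch2_holomorphic: "(\<lambda>z. qpoch2 z x y) holomorphic_on UNIV"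
  unfolding qpoch2_def using geometric_product_holomorphic[OF qpoch_holomorphic[OF y] _ x] by simp

lemma qpoch2_split: "qpoch2 z x y = qpoch_inf z y * qpoch2 (z * x) x y"
  unfolding qpoch2_def using geometric_product_split[OF qpoch_holomorphic[OF y] _ x, of z] by simp

text \<open>A column is split off instead of a row: the first factor of every row is pulled out, so
  the order of the double product never has to be exchanged.\<close>

lemma qpoch2_split': "qpoch2 z x y = qpoch_inf z x * qpoch2 (z * y) x y"
proof -
  have "qpoch_inf z x * qpoch2 (z * y) x y = (\<Prod>j. (1 - z * x ^ j) * qpoch_inf (z * y * x ^ j) y)"
    unfolding qpoch2_def by (subst qpoch_inf_def) (rule prodinf_mult[OF qpoch_convergent[OF x] qpoch2_convergent])
  also have "\<dots> = qpoch2 z x y"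
  proof -
    have "qpoch_inf (z * x ^ j) y = (1 - z * x ^ j) * qpoch_inf (z * y * x ^ j) y" for j
      using qpoch_split[OF y, of "z * x ^ j"] by (simp add: mult_ac)
    then show ?thesis unfolding qpoch2_def by simp
  qed
  finally show ?thesis ..
qed

lemma qpoch2_nonzero:
  assumes "\<And>j k. z * x ^ j * y ^ k \<noteq> 1" shows "qpoch2 z x y \<noteq> 0"
  unfolding qpoch2_def
  by (intro geometric_product_nonzero[OF qpoch_holomorphic[OF y] _ x] qpoch_nonzero[OF y]) (use assms in auto)

lemma qpoch2_nonzero_norm:
  assumes "norm z < 1" shows "qpoch2 z x y \<noteq> 0"
proof (rule qpoch2_nonzero)
  fix j k
  have "norm (z * x ^ j * y ^ k) \<le> norm z * 1 * 1"
    unfolding norm_mult norm_power by (intro mult_mono power_le_one) (use x y in auto)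
  then show "z * x ^ j * y ^ k \<noteq> 1" using assms by auto
qed

text \<open>The poles are covered as well: there one factor on the left is a division by 0, hence 0,
  and so is the quotient on the right.\<close>

lemma ell_gamma_eq: "ell_gamma z x y = qpoch2 (x * y / z) x y / qpoch2 z x y"
proof -
  have "(\<Prod>k. (1 - inverse z * x ^ (j + 1) * y ^ (k + 1)) / (1 - z * x ^ j * y ^ k)) =
      qpoch_inf (x * y / z * x ^ j) y / qpoch_inf (z * x ^ j) y" for j
    unfolding qpoch_inf_def
    by (subst prodinf_divide[OF qpoch_convergent[OF y] qpoch_convergent[OF y]])
       (simp add: divide_inverse mult_ac)
  then have "ell_gamma z x y = (\<Prod>j. qpoch_inf (x * y / z * x ^ j) y / qpoch_inf (z * x ^ j) y)"
    unfolding ell_gamma_def by simp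
  also have "\<dots> = qpoch2 (x * y / z) x y / qpoch2 z x y"
    unfolding qpoch2_def by (rule prodinf_divide[OF qpoch2_convergent qpoch2_convergent, symmetric])
  finally show ?thesis .
qed

end

lemma qpoch2_0 [simp]: "qpoch2 0 x y = 1"
  by (simp add: qpoch2_def)

text \<open>A shift by one base produces a theta function whose nome is the other base. The
  condition on \<open>qpoch2\<close> excludes the poles, where the default value 0 on the right
  could meet a nonzero value on the left.\<close>

lemma ell_gamma_shift_fst:
  assumes x: "norm x < 1" "x \<noteq> 0" and y: "norm y < 1" and z: "z \<noteq> 0" and nz: "qpoch2 z x y \<noteq> 0"
  shows "ell_gamma (z * x) x y = theta z y * ell_gamma z x y"
proof -
  have "qpoch2 (y / z) x y = qpoch_inf (y / z) y * qpoch2 (x * y / z) x y"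
    by (subst qpoch2_split[OF x(1) y]) (simp add: mult_ac)
  moreover have "qpoch2 z x y = qpoch_inf z y * qpoch2 (z * x) x y"
    by (rule qpoch2_split[OF x(1) y])
  moreover have "x * y / (z * x) = y / z" using x by simp
  ultimately show ?thesis using nz unfolding ell_gamma_eq[OF x(1) y] theta_def by (simp add: field_simps)
qed

lemma ell_gamma_shift_snd:
  assumes x: "norm x < 1" and y: "norm y < 1" "y \<noteq> 0" and z: "z \<noteq> 0" and nz: "qpoch2 z x y \<noteq> 0"
  shows "ell_gamma (z * y) x y = theta z x * ell_gamma z x y"
proof -
  have "qpoch2 (x / z) x y = qpoch_inf (x / z) x * qpoch2 (x * y / z) x y"
    by (subst qpoch2_split'[OF x y(1)]) (simp add: mult_ac)
  moreover have "qpoch2 z x y = qpoch_inf z x * qpoch2 (z * y) x y"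
    by (rule qpoch2_split'[OF x y(1)])
  moreover have "x * y / (z * y) = x / z" using y by simp
  ultimately show ?thesis using nz unfolding ell_gamma_eq[OF x y(1)] theta_def by (simp add: field_simps)
qed

context
  fixes x :: complex
  assumes x: "norm x < 1" "x \<noteq> 0"
begin

lemma theta_holomorphic: "(\<lambda>z. theta z x) holomorphic_on (- {0})"
  unfolding theta_def
  by (intro holomorphic_intros holomorphic_on_compose[OF _ holomorphic_on_subset[OF qpoch_holomorphic[OF x(1)]], unfolded o_def]
        holomorphic_on_subset[OF qpoch_holomorphic[OF x(1)]]) auto

lemma theta_inverse:
  assumes "z \<noteq> 0" shows "theta (1 / z) x = - theta z x / z"
proof -
  have "qpoch_inf z x = (1 - z) * qpoch_inf (z * x) x" "qpoch_inf (1 / z) x = (1 - 1 / z) * qpoch_inf (x / z) x"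
    by (subst qpoch_split[OF x(1)], simp)+
  then have "theta z x = (1 - z) * qpoch_inf (z * x) x * qpoch_inf (x / z) x"
    "theta (1 / z) x = (1 - 1 / z) * qpoch_inf (x / z) x * qpoch_inf (z * x) x"
    unfolding theta_def by (simp_all add: mult_ac)
  then show ?thesis using assms by (simp only:) (simp add: field_simps)
qed

lemma theta_shift:
  assumes "z \<noteq> 0" shows "theta (z * x) x = - theta z x / z"
proof -
  have "qpoch_inf z x = (1 - z) * qpoch_inf (z * x) x" "qpoch_inf (1 / z) x = (1 - 1 / z) * qpoch_inf (x / z) x"
    by (subst qpoch_split[OF x(1)], simp)+
  moreover have "x / (z * x) = 1 / z" using x by simp
  ultimately have "theta z x = (1 - z) * qpoch_inf (z * x) x * qpoch_inf (x / z) x"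
    "theta (z * x) x = qpoch_inf (z * x) x * ((1 - 1 / z) * qpoch_inf (x / z) x)"
    unfolding theta_def by (simp_all only:)
  then show ?thesis using assms by (simp only:) (simp add: field_simps)
qed

lemma theta_1 [simp]: "theta 1 x = 0"
  unfolding theta_def by (subst qpoch_split[OF x(1)]) simp

lemma theta_nonzero:
  assumes "z \<noteq> 0" "\<And>k::int. z \<noteq> x powi k" shows "theta z x \<noteq> 0"
proof -
  have "z * x ^ k \<noteq> 1" for k
    using assms(2)[of "- int k"] x by (auto simp: power_int_minus field_simps)
  moreover have "x / z * x ^ k \<noteq> 1" for k
    using assms(2)[of "int (Suc k)"] assms(1) by (auto simp: field_simps simp del: of_nat_Suc)
  ultimately show ?thesis unfolding theta_def using qpoch_nonzero[OF x(1)] by auto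
qed

lemma theta_nonzero_norm:
  assumes "norm x < norm z" "norm z < 1" shows "theta z x \<noteq> 0"
proof -
  have z: "z \<noteq> 0" using assms by auto
  then have "norm (x / z) < 1" using assms by (auto simp: norm_divide)
  then show ?thesis using assms unfolding theta_def by (simp add: qpoch_nonzero_norm[OF x(1)])
qed

lemma theta_factor:
  assumes "z \<noteq> 0" shows "theta z x = (1 - z) * (qpoch_inf (z * x) x * qpoch_inf (x / z) x)"
  unfolding theta_def by (subst qpoch_split[OF x(1)]) simp

end

section \<open>Elliptic functions and a theta function identity\<close>

lemma connected_punctured_plane: "connected (- {0 :: complex})"
  by (rule connected_punctured_universe) simp

text \<open>Near a zero z of \<open>D\<close>, both functions are divided by w - z; since the zero
  is simple, the new denominator is nonzero at z, and the value there is the quotient of the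
  derivatives.\<close>

lemma holomorphic_quotient_simple_zeros:
  fixes F D :: "complex \<Rightarrow> complex"
  assumes S: "open S" and F: "F holomorphic_on S" and D: "D holomorphic_on S"
    and zeros: "\<And>z. z \<in> S \<Longrightarrow> D z = 0 \<Longrightarrow> F z = 0 \<and> deriv D z \<noteq> 0"
  shows "(\<lambda>z. if D z = 0 then deriv F z / deriv D z else F z / D z) holomorphic_on S"
  unfolding holomorphic_on_open[OF S]
proof
  fix z assume z: "z \<in> S"
  let ?f = "\<lambda>z. if D z = 0 then deriv F z / deriv D z else F z / D z"
  show "\<exists>f'. (?f has_field_derivative f') (at z)"
  proof (cases "D z = 0")
    case False
    have "continuous_on S D" using D by (rule holomorphic_on_imp_continuous_on)
    then have op: "open (S \<inter> D -` (- {0}))"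
      by (metis open_Compl closed_singleton continuous_open_preimage S)
    have "(\<lambda>z. F z / D z) holomorphic_on (S \<inter> D -` (- {0}))"
      by (intro holomorphic_intros holomorphic_on_subset[OF F] holomorphic_on_subset[OF D]) auto
    then have "?f holomorphic_on (S \<inter> D -` (- {0}))"
      by (rule holomorphic_transform) auto
    then show ?thesis using op z False holomorphic_on_open by blast
  next
    case True
    define F1 where "F1 = (\<lambda>w. if w = z then deriv F z else (F w - F z) / (w - z))"
    define D1 where "D1 = (\<lambda>w. if w = z then deriv D z else (D w - D z) / (w - z))"
    have F1: "F1 holomorphic_on S" and D1: "D1 holomorphic_on S"
      unfolding F1_def D1_def using pole_lemma_open F D S by blast+
    have "continuous_on S D1" using D1 by (rule holomorphic_on_imp_continuous_on)
    then have op: "open (S \<inter> D1 -` (- {0}))"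
      by (metis open_Compl closed_singleton continuous_open_preimage S)
    have zz: "z \<in> S \<inter> D1 -` (- {0})" using zeros[OF z True] z by (auto simp: D1_def)
    have "(\<lambda>w. F1 w / D1 w) holomorphic_on (S \<inter> D1 -` (- {0}))"
      by (intro holomorphic_intros holomorphic_on_subset[OF F1] holomorphic_on_subset[OF D1]) auto
    moreover have "F1 w / D1 w = ?f w" if "w \<in> S \<inter> D1 -` (- {0})" for w
      using that zeros[OF z True] True by (auto simp: F1_def D1_def)
    ultimately have "?f holomorphic_on (S \<inter> D1 -` (- {0}))"
      by (rule holomorphic_transform)
    then show ?thesis using op zz holomorphic_on_open by blast
  qed
qed

text \<open>All values are taken on a compact annulus, so the function is bounded, and Liouville's
  theorem applies to its pullback under \<open>exp\<close>, which is entire.\<close>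

lemma multiplicatively_periodic_constant:
  fixes f :: "complex \<Rightarrow> complex"
  assumes f: "f holomorphic_on - {0}" and x: "norm x < 1" "x \<noteq> 0"
    and per: "\<And>z. z \<noteq> 0 \<Longrightarrow> f (z * x) = f z"
  obtains c where "\<And>z. z \<noteq> 0 \<Longrightarrow> f z = c"
proof -
  have pern: "f (z * x powi k) = f z" if "z \<noteq> 0" for z k
  proof (induction k rule: int_induct[where k = 0])
    case (step1 i)
    have "f (z * x powi (i + 1)) = f (z * x powi i * x)"
      using x by (simp add: power_int_add mult_ac)
    then show ?case using step1 per[of "z * x powi i"] that x by simp
  next
    case (step2 i)
    have "f (z * x powi (i - 1) * x) = f (z * x powi i)"
      using x by (simp add: power_int_diff mult_ac)
    then show ?case using step2 per[of "z * x powi (i - 1)"] that x by simp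
  qed simp
  define K where "K = {z::complex. norm x \<le> norm z \<and> norm z \<le> 1}"
  have "K = cball 0 1 - ball 0 (norm x)" by (auto simp: K_def)
  then have "compact K" by (simp add: compact_diff)
  moreover have "K \<subseteq> - {0}" using x by (auto simp: K_def)
  ultimately have "compact (f ` K)"
    using f by (meson compact_continuous_image continuous_on_subset holomorphic_on_imp_continuous_on)
  then obtain M where M: "\<And>z. z \<in> K \<Longrightarrow> norm (f z) \<le> M"
    by (meson bounded_iff compact_imp_bounded imageI)
  have bd: "norm (f z) \<le> M" if z: "z \<noteq> 0" for z
  proof -
    define l where "l = - ln (norm x)"
    have l: "l > 0" using x by (simp add: l_def)
    \<comment> \<open>This power of x moves the modulus of z into the fundamental annulus between
      |x| and 1.\<close>
    define k where "k = \<lceil>ln (norm z) / l\<rceil>"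
    have k1: "ln (norm z) \<le> k * l" "k * l < ln (norm z) + l"
      unfolding k_def using l
      by (auto simp flip: pos_divide_le_eq simp: le_of_int_ceiling)
         (metis add_divide_distrib ceiling_correct diff_less_eq div_self less_irrefl pos_less_divide_eq)
    have n: "norm (z * x powi k) = exp (ln (norm z) - k * l)"
      using z x by (simp add: norm_mult norm_power_int exp_diff l_def exp_minus exp_power_int flip: powr_real_of_int')
        (simp add: powr_def field_simps exp_minus exp_add)
    have "exp (ln (norm z) - k * l) \<le> 1" using k1 by simp
    moreover have "exp (ln (norm z) - k * l) \<ge> exp (- l)" using k1 by simp
    moreover have "exp (- l) = norm x" using x by (simp add: l_def)
    ultimately have "z * x powi k \<in> K" unfolding K_def n[symmetric] by simp
    then show ?thesis using M pern[OF z] by metis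
  qed
  have "(\<lambda>w. f (exp w)) holomorphic_on UNIV"
    by (intro holomorphic_on_compose[OF _ holomorphic_on_subset[OF f], unfolded o_def] holomorphic_intros) auto
  then have "(\<lambda>w. f (exp w)) constant_on UNIV"
    by (rule Liouville_theorem) (auto simp: bounded_iff intro!: bd exI[of _ M])
  then obtain c where "\<And>w. f (exp w) = c" by (auto simp: constant_on_def)
  then show ?thesis using that by (metis exp_Ln)
qed

text \<open>The quotient \<open>F / D\<close> is an elliptic function without poles, hence constant; it has a zero.\<close>
lemma quasi_periodic_zero:
  fixes F D :: "complex \<Rightarrow> complex"
  assumes x: "norm x < 1" "x \<noteq> 0"
    and F: "F holomorphic_on - {0}" and D: "D holomorphic_on - {0}"
    and qF: "\<And>z. z \<noteq> 0 \<Longrightarrow> F (z * x) = m z * F z"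
    and qD: "\<And>z. z \<noteq> 0 \<Longrightarrow> D (z * x) = m z * D z"
    and m: "\<And>z. z \<noteq> 0 \<Longrightarrow> m z \<noteq> 0"
    and zeros: "\<And>z. z \<noteq> 0 \<Longrightarrow> D z = 0 \<Longrightarrow> F z = 0 \<and> deriv D z \<noteq> 0"
    and c: "c \<noteq> 0" "D c \<noteq> 0" "F c = 0" and z: "z \<noteq> 0"
  shows "F z = 0"
proof -
  define f where "f = (\<lambda>z. if D z = 0 then deriv F z / deriv D z else F z / D z)"
  have f: "f holomorphic_on - {0}"
    unfolding f_def by (rule holomorphic_quotient_simple_zeros) (use F D zeros in auto)
  then have contf: "isCont f z" if "z \<noteq> 0" for z
    using that by (metis Compl_iff continuous_on_eq_continuous_at holomorphic_on_imp_continuous_on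
        open_Compl closed_singleton singletonD)
  have per: "f (z * x) = f z" if "z \<noteq> 0" for z
  proof -
    \<comment> \<open>The periodicity of \<open>f\<close> is immediate where \<open>D\<close> does
      not vanish. Since \<open>D c \<noteq> 0\<close>, the zeros of \<open>D\<close> are isolated,
      and continuity covers them.\<close>
    have ev: "eventually (\<lambda>w. D w \<noteq> 0 \<and> w \<in> - {0}) (at z)"
      by (rule non_zero_neighbour_alt[OF D _ connected_punctured_plane _ _ c(2)]) (use that c in auto)
    have "((\<lambda>w. f (w * x)) \<longlongrightarrow> f (z * x)) (at z)"
      by (intro isCont_tendsto_compose[OF contf] tendsto_intros) (use that x in auto)
    moreover have "(f \<longlongrightarrow> f z) (at z)" using contf[OF that] by (simp add: isCont_def)
    moreover have "eventually (\<lambda>w. f w = f (w * x)) (at z)"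
      using ev by eventually_elim (auto simp: f_def qF qD m)
    ultimately have "(f \<longlongrightarrow> f (z * x)) (at z)" by (simp cong: tendsto_cong)
    then show ?thesis using \<open>(f \<longlongrightarrow> f z) (at z)\<close> tendsto_unique trivial_limit_at by blast
  qed
  obtain k where k: "\<And>z. z \<noteq> 0 \<Longrightarrow> f z = k"
    using multiplicatively_periodic_constant[OF f x per] by blast
  have "k = 0" using k[OF c(1)] c by (simp add: f_def)
  then show ?thesis using k[OF z] zeros[OF z] by (auto simp: f_def split: if_splits)
qed

context
  fixes x :: complex
  assumes x: "norm x < 1" "x \<noteq> 0"
begin

text \<open>At 1 the factor 1 - z of \<open>theta_factor\<close> gives the simple zero; the shift
  equation transports it to all powers of x in both directions.\<close>

lemma theta_simple_zero_powi:
  "\<exists>d. d \<noteq> 0 \<and> theta (x powi k) x = 0 \<and> ((\<lambda>z. theta z x) has_field_derivative d) (at (x powi k))"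
proof (induction k rule: int_induct[where k = 0])
  case base
  define F where "F = (\<lambda>z. qpoch_inf (z * x) x * qpoch_inf (x / z) x)"
  have F1: "F 1 \<noteq> 0" using x by (simp add: F_def qpoch_nonzero_norm)
  have "F holomorphic_on - {0}"
    unfolding F_def
    by (intro holomorphic_intros holomorphic_on_compose[OF _ holomorphic_on_subset[OF qpoch_holomorphic[OF x(1)]], unfolded o_def]) auto
  then obtain F' where "(F has_field_derivative F') (at 1)"
    by (metis Compl_iff closed_singleton holomorphic_on_open open_Compl singletonD zero_neq_one)
  then have "((\<lambda>z. (1 - z) * F z) has_field_derivative - F 1) (at 1)"
    by (auto intro!: derivative_eq_intros)
  then have "((\<lambda>z. theta z x) has_field_derivative - F 1) (at 1)"
    by (rule has_field_derivative_transform_within_open[where S = "- {0}"]) (auto simp: F_def theta_factor[OF x])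
  then show ?case using F1 theta_1[OF x] by (intro exI[of _ "- F 1"]) auto
next
  case (step1 i)
  then obtain d where d: "d \<noteq> 0" "theta (x powi i) x = 0"
    "((\<lambda>z. theta z x) has_field_derivative d) (at (x powi i))" by blast
  let ?w = "x powi i"
  have w: "x powi (i + 1) = ?w * x" "?w \<noteq> 0" using x by (simp_all add: power_int_add)
  have "((\<lambda>z. theta (z / x) x) has_field_derivative d * (1 / x)) (at (?w * x))"
    by (rule DERIV_chain2[where f = "\<lambda>z. theta z x"]) (use d x in \<open>auto intro!: derivative_eq_intros\<close>)
  then have "((\<lambda>z. - theta (z / x) x / (z / x)) has_field_derivative - (d / x) / ?w) (at (?w * x))"
    using x w d by (auto intro!: derivative_eq_intros simp: field_simps)
  then have "((\<lambda>z. theta z x) has_field_derivative - (d / x) / ?w) (at (?w * x))"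
  proof (rule has_field_derivative_transform_within_open[where S = "- {0}"])
    fix z :: complex assume "z \<in> - {0}"
    then show "- theta (z / x) x / (z / x) = theta z x"
      using theta_shift[OF x, of "z / x"] x by simp
  qed (use w x in auto)
  then show ?case using d w x theta_shift[OF x w(2)] by (intro exI[of _ "- (d / x) / ?w"]) simp
next
  case (step2 i)
  then obtain d where d: "d \<noteq> 0" "theta (x powi i) x = 0"
    "((\<lambda>z. theta z x) has_field_derivative d) (at (x powi i))" by blast
  let ?w = "x powi i / x"
  have w: "x powi (i - 1) = ?w" "?w \<noteq> 0" "?w * x = x powi i" using x by (simp_all add: power_int_diff)
  have "((\<lambda>z. theta (z * x) x) has_field_derivative d * x) (at ?w)"
    by (rule DERIV_chain2[where f = "\<lambda>z. theta z x"]) (use d w in \<open>auto intro!: derivative_eq_intros\<close>)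
  then have "((\<lambda>z. - z * theta (z * x) x) has_field_derivative - ?w * (d * x)) (at ?w)"
    using w d by (auto intro!: derivative_eq_intros)
  then have "((\<lambda>z. theta z x) has_field_derivative - ?w * (d * x)) (at ?w)"
  proof (rule has_field_derivative_transform_within_open[where S = "- {0}"])
    fix z :: complex assume "z \<in> - {0}"
    then show "- z * theta (z * x) x = theta z x"
      using theta_shift[OF x, of z] by simp
  qed (use w in auto)
  then show ?case using d w x theta_shift[OF x w(2)] by (intro exI[of _ "- ?w * (d * x)"]) auto
qed

lemma theta_simple_zero:
  assumes "theta w x = 0" "w \<noteq> 0"
  shows "\<exists>d. d \<noteq> 0 \<and> ((\<lambda>z. theta z x) has_field_derivative d) (at w)"
  using theta_nonzero[OF x assms(2)] assms(1) theta_simple_zero_powi by metis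

lemma theta_eq_0_iff:
  assumes "w \<noteq> 0"
  shows "theta w x = 0 \<longleftrightarrow> (\<exists>k::int. w = x powi k)"
  using theta_nonzero[OF x assms] theta_simple_zero_powi by metis

lemma theta_nonzero_eventually:
  assumes c: "c \<noteq> 0" and n: "n > 0" and z: "z \<noteq> 0"
  shows "eventually (\<lambda>w. theta (c * w ^ n) x \<noteq> 0) (at z)"
proof -
  \<comment> \<open>A point of modulus sqrt |x| lies in the open annulus between |x| and 1, where
    theta has no zeros. An n-th root of w0 / c is thus a witness that the function does not vanish
    identically.\<close>
  define w0 where "w0 = complex_of_real (sqrt (norm x))"
  have w0: "norm x < norm w0" "norm w0 < 1" "w0 \<noteq> 0"
  proof -
    have "norm x * norm x < norm x * 1" using x by (intro mult_strict_left_mono) auto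
    then have "sqrt ((norm x)\<^sup>2) < sqrt (norm x)"
      by (intro real_sqrt_less_mono) (simp add: power2_eq_square)
    then show "norm x < norm w0" by (simp add: w0_def)
  qed (use x in \<open>auto simp: w0_def\<close>)
  define \<beta> where "\<beta> = exp (Ln (w0 / c) / n)"
  have "\<beta> ^ n = exp (of_nat n * (Ln (w0 / c) / n))" by (simp only: \<beta>_def exp_of_nat_mult)
  also have "\<dots> = w0 / c" using n c w0 by simp
  finally have \<beta>: "c * \<beta> ^ n = w0" using c by simp
  have "(\<lambda>w. theta (c * w ^ n) x) holomorphic_on - {0}"
    by (intro holomorphic_on_compose[OF _ holomorphic_on_subset[OF theta_holomorphic[OF x]], unfolded o_def]
        holomorphic_intros) (use c in auto)
  then have "eventually (\<lambda>w. theta (c * w ^ n) x \<noteq> 0 \<and> w \<in> - {0}) (at z)"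
  proof (rule non_zero_neighbour_alt[OF _ _ connected_punctured_plane])
    show "theta (c * \<beta> ^ n) x \<noteq> 0" unfolding \<beta> by (rule theta_nonzero_norm[OF x w0(1,2)])
  qed (use z in \<open>auto simp: \<beta>_def\<close>)
  then show ?thesis by eventually_elim auto
qed

text \<open>With \<open>a = T * (\<Prod>b\<in>B. t b)\<close>, both summands are theta functions of degree two in \<open>z\<close> after
  clearing the denominator \<open>theta (z\<^sup>2) x\<close>; they are compared at the zeros of
  \<open>theta (z\<^sup>2) x * theta (a * z) x * theta (a / z) x\<close> and at \<open>z = T\<close>.\<close>
lemma theta_identity_generic:
  fixes t :: "'b \<Rightarrow> complex"
  assumes B: "finite B" "card B = 4" and T: "T \<noteq> 0" and t: "\<And>b. b \<in> B \<Longrightarrow> t b \<noteq> 0"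
    and a: "a = T * (\<Prod>b\<in>B. t b)"
    and gen: "theta (a\<^sup>2) x \<noteq> 0" "theta (T\<^sup>2) x \<noteq> 0" "theta (a * T) x \<noteq> 0" "theta (a / T) x \<noteq> 0"
    and z: "z \<noteq> 0"
  shows "theta (z\<^sup>2) x * ((\<Prod>b\<in>B. theta (a / t b) x) * theta (T * z) x * theta (T / z) x
            - (\<Prod>b\<in>B. theta (T * t b) x) * theta (a * z) x * theta (a / z) x)
         + theta (T * a) x * T *
           (theta (T * z) x * (\<Prod>b\<in>B. theta (t b * z) x) * theta (a / z) x / z
            - theta (T / z) x * (\<Prod>b\<in>B. theta (t b / z) x) * theta (a * z) x * z ^ 3) = 0"
proof -
  have a0: "a \<noteq> 0" using a T t B by auto
  define u where "u = (\<lambda>z. theta (T * z) x * (\<Prod>b\<in>B. theta (t b * z) x) * theta (a / z) x / z)"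
  define v where "v = (\<lambda>z. theta (T / z) x * (\<Prod>b\<in>B. theta (t b / z) x) * theta (a * z) x * z ^ 3)"
  define c1 where "c1 = (\<Prod>b\<in>B. theta (a / t b) x)"
  define c2 where "c2 = (\<Prod>b\<in>B. theta (T * t b) x)"
  define F where "F = (\<lambda>z. theta (z\<^sup>2) x * (c1 * theta (T * z) x * theta (T / z) x
      - c2 * theta (a * z) x * theta (a / z) x) + theta (T * a) x * T * (u z - v z))"
  define D where "D = (\<lambda>z. theta (z\<^sup>2) x * theta (a * z) x * theta (a / z) x)"
  \<comment> \<open>The common multiplier under z -> z x. The product condition on \<open>a\<close>
    evaluates the products over \<open>B\<close> in \<open>u\<close> and \<open>v\<close>, so that
    all summands of \<open>F\<close> have the multiplier of \<open>D\<close>.\<close>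
  define m where "m = (\<lambda>z. 1 / (x\<^sup>2 * z ^ 6))"
  have s1: "theta (c * (z * x)) x = - theta (c * z) x / (c * z)" if "c \<noteq> 0" "z \<noteq> 0" for c z
    using theta_shift[OF x, of "c * z"] that by (simp add: mult_ac)
  have s2: "theta (c / (z * x)) x = - (c / (z * x)) * theta (c / z) x" if "c \<noteq> 0" "z \<noteq> 0" for c z
    using theta_shift[OF x, of "c / (z * x)"] that x by (simp add: field_simps)
  have s3: "theta ((z * x)\<^sup>2) x = theta (z\<^sup>2) x / (x * z ^ 4)" if "z \<noteq> 0" for z
  proof -
    have "theta ((z * x)\<^sup>2) x = theta (z\<^sup>2 * x * x) x" by (simp add: power2_eq_square mult_ac)
    also have "\<dots> = theta (z\<^sup>2) x / (x * z ^ 4)"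
      using theta_shift[OF x, of "z\<^sup>2 * x"] theta_shift[OF x, of "z\<^sup>2"] that x
      by (simp add: power2_eq_square power4_eq_xxxx)
    finally show ?thesis .
  qed
  have pB: "(\<Prod>b\<in>B. t b) = a / T" using a T by simp
  have qu: "u (z * x) = m z * u z" if z: "z \<noteq> 0" for z
  proof -
    have "(\<Prod>b\<in>B. theta (t b * (z * x)) x) = (\<Prod>b\<in>B. theta (t b * z) x * (1 / t b) * (- 1 / z))"
      by (intro prod.cong refl) (use s1 t z in auto)
    also have "\<dots> = (\<Prod>b\<in>B. theta (t b * z) x) * (T / a) / z ^ 4"
      by (simp only: prod.distrib prod_dividef prod_constant B pB) simp
    finally show ?thesis using z x T a0
      by (simp only: u_def s1[OF T z] s2[OF a0 z]) (simp add: m_def field_simps power_numeral_reduce)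
  qed
  have qv: "v (z * x) = m z * v z" if z: "z \<noteq> 0" for z
  proof -
    have "(\<Prod>b\<in>B. theta (t b / (z * x)) x) = (\<Prod>b\<in>B. theta (t b / z) x * t b * (- 1 / (z * x)))"
      by (intro prod.cong refl) (use s2 t z in auto)
    also have "\<dots> = (\<Prod>b\<in>B. theta (t b / z) x) * (a / T) / (z * x) ^ 4"
      by (simp only: prod.distrib prod_dividef prod_constant B pB) (simp add: power_mult_distrib)
    finally show ?thesis using z x T a0
      by (simp only: v_def s1[OF a0 z] s2[OF T z]) (simp add: m_def field_simps power_numeral_reduce)
  qed
  have qF: "F (z * x) = m z * F z" if z: "z \<noteq> 0" for z
    unfolding F_def using z T a0 x
    by (simp only: s1[OF T z] s1[OF a0 z] s2[OF T z] s2[OF a0 z] s3[OF z] qu[OF z] qv[OF z])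
       (simp add: m_def field_simps power_numeral_reduce)
  have qD: "D (z * x) = m z * D z" if z: "z \<noteq> 0" for z
    unfolding D_def using z T a0 x
    by (simp only: s1[OF a0 z] s2[OF a0 z] s3[OF z]) (simp add: m_def field_simps power_numeral_reduce)
  have m0: "m z \<noteq> 0" if "z \<noteq> 0" for z using that x by (simp add: m_def)
  have Fz: "F (z * x powi k) = 0 \<longleftrightarrow> F z = 0" if z: "z \<noteq> 0" for z k
  proof (induction k rule: int_induct[where k = 0])
    case (step1 i)
    have "F (z * x powi (i + 1)) = F (z * x powi i * x)" using x by (simp add: power_int_add mult_ac)
    then show ?case using qF[of "z * x powi i"] m0[of "z * x powi i"] step1 z x by simp
  next
    case (step2 i)
    have "F (z * x powi i) = F (z * x powi (i - 1) * x)" using x by (simp add: power_int_diff mult_ac)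
    then show ?case using qF[of "z * x powi (i - 1)"] m0[of "z * x powi (i - 1)"] step2 z x by simp
  qed simp
  have vu: "v z = u (1 / z) * z\<^sup>2" if "z \<noteq> 0" for z
    using that by (simp add: u_def v_def power_numeral_reduce)
  have pw2: "(x powi j)\<^sup>2 = x powi (2 * j)" for j
    using power_int_add[of x j j] x by (simp add: power2_eq_square flip: mult_2)
  \<comment> \<open>A power of x moves a zero of theta at z^2 to a point z0 with z0^2 = 1 or z0^2 =
    x. There z0 equals 1 / z0 or x / z0, and the reflection \<open>vu\<close>, in the second case
    with the multiplier, gives u z0 = v z0; both parts of \<open>F\<close> vanish.\<close>
  have F1: "F z = 0" if z: "z \<noteq> 0" and th: "theta (z\<^sup>2) x = 0" for z
  proof -
    obtain k :: int where k: "z\<^sup>2 = x powi k" using th theta_eq_0_iff[of "z\<^sup>2"] z by auto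
    define z0 where "z0 = z * x powi (- (k div 2))"
    have z0: "z0 \<noteq> 0" using z x by (simp add: z0_def)
    have "z0\<^sup>2 = x powi k * x powi (- 2 * (k div 2))"
      unfolding z0_def power_mult_distrib k pw2 by simp
    also have "\<dots> = x powi (k mod 2)"
      using x by (simp add: power_int_add[symmetric] minus_mult_div_eq_mod)
    finally have zz: "z0\<^sup>2 = 1 \<or> z0\<^sup>2 = x" by (cases "even k") (auto simp: odd_iff_mod_2_eq_one even_iff_mod_2_eq_zero)
    have "u z0 = v z0"
      using zz
    proof
      assume "z0\<^sup>2 = 1"
      moreover from this have "1 / z0 = z0" using z0 by (simp add: power2_eq_square field_simps)
      ultimately show ?thesis using vu[OF z0] by simp
    next
      assume q: "z0\<^sup>2 = x"
      then have e: "z0 = 1 / z0 * x" using z0 by (simp add: power2_eq_square field_simps)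
      have "u z0 = m (1 / z0) * u (1 / z0)"
        using qu[of "1 / z0"] z0 by (subst e) auto
      also have "m (1 / z0) = z0\<^sup>2"
        using z0 by (simp add: m_def q[symmetric] field_simps flip: power_mult power_add)
      finally show ?thesis using vu[OF z0] by simp
    qed
    moreover have "theta (z0\<^sup>2) x = 0" using zz
      using theta_1[OF x] theta_shift[OF x, of 1] by auto
    ultimately have "F z0 = 0" by (simp add: F_def)
    then show ?thesis using Fz[OF z] by (simp add: z0_def)
  qed
  \<comment> \<open>At z = a the factor theta (a / z) removes \<open>u\<close> and the term with
    \<open>c2\<close>; the two remaining terms cancel after inverting the arguments t b / a.\<close>
  have Fa: "F a = 0"
  proof -
    have "(\<Prod>b\<in>B. theta (t b / a) x) = (\<Prod>b\<in>B. theta (a / t b) x * t b * (- 1 / a))"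
    proof (intro prod.cong refl)
      fix b assume "b \<in> B"
      then show "theta (t b / a) x = theta (a / t b) x * t b * (- 1 / a)"
        using theta_inverse[OF x, of "a / t b"] t a0 by simp
    qed
    also have "\<dots> = c1 * (a / T) / a ^ 4"
      by (simp only: prod.distrib prod_dividef prod_constant B pB c1_def) simp
    finally have *: "(\<Prod>b\<in>B. theta (t b / a) x) = c1 * (a / T) / a ^ 4" .
    show ?thesis
      using a0 T theta_1[OF x] unfolding F_def u_def v_def *
      by (simp add: power2_eq_square field_simps power_numeral_reduce)
  qed
  have Fa': "F (1 / a) = 0"
  proof -
    have "F (1 / z) = - F z / z ^ 2" if "z \<noteq> 0" for z
    proof -
      have "theta ((1 / z)\<^sup>2) x = - theta (z\<^sup>2) x / z\<^sup>2"
        using theta_inverse[OF x, of "z\<^sup>2"] that by (simp add: power_one_over)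
      moreover have "u (1 / z) = v z / z\<^sup>2" "v (1 / z) = u z / z\<^sup>2"
        using vu[of z] vu[of "1 / z"] that by (auto simp: field_simps)
      ultimately show ?thesis using that unfolding F_def by (simp only:) (simp add: field_simps)
    qed
    then show ?thesis using Fa a0 by simp
  qed
  have FT: "F T = 0"
    using T theta_1[OF x] unfolding F_def u_def v_def c2_def
    by (simp add: power2_eq_square mult_ac)
  have DT: "D T \<noteq> 0" using gen by (simp add: D_def)
  have holth: "(\<lambda>z. theta (f z) x) holomorphic_on - {0}"
    if "f holomorphic_on - {0}" "\<And>z. z \<noteq> 0 \<Longrightarrow> f z \<noteq> 0" for f
  proof -
    have "f ` (- {0}) \<subseteq> - {0}" by (rule image_subsetI) (simp add: that(2))
    from holomorphic_on_compose[OF that(1) holomorphic_on_subset[OF theta_holomorphic[OF x] this]]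
    show ?thesis by (simp add: o_def)
  qed
  have holu: "u holomorphic_on - {0}" and holv: "v holomorphic_on - {0}"
    unfolding u_def v_def by (intro holomorphic_intros holth; use T t a0 in auto)+
  have holF: "F holomorphic_on - {0}" unfolding F_def
    by (intro holomorphic_intros holth holu holv) (use T t a0 in auto)
  have holD: "D holomorphic_on - {0}" unfolding D_def
    by (intro holomorphic_intros holth) (use T t a0 in auto)
  have "F z = 0"
  proof (rule quasi_periodic_zero[OF x holF holD qF qD m0])
    fix z :: complex assume z: "z \<noteq> 0" and Dz: "D z = 0"
    have dth: "\<exists>d. ((\<lambda>z. theta z x) has_field_derivative d) (at w)" if "w \<noteq> 0" for w
      using theta_holomorphic[OF x] that by (metis Compl_iff closed_singleton holomorphic_on_open open_Compl singletonD)
    obtain d1 where d1: "((\<lambda>z. theta z x) has_field_derivative d1) (at (z\<^sup>2))" "theta (z\<^sup>2) x = 0 \<Longrightarrow> d1 \<noteq> 0"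
      using dth[of "z\<^sup>2"] theta_simple_zero[of "z\<^sup>2"] z by (metis zero_eq_power2)
    obtain d2 where d2: "((\<lambda>z. theta z x) has_field_derivative d2) (at (a * z))" "theta (a * z) x = 0 \<Longrightarrow> d2 \<noteq> 0"
      using dth[of "a * z"] theta_simple_zero[of "a * z"] z a0 by (metis mult_eq_0_iff)
    obtain d3 where d3: "((\<lambda>z. theta z x) has_field_derivative d3) (at (a / z))" "theta (a / z) x = 0 \<Longrightarrow> d3 \<noteq> 0"
      using dth[of "a / z"] theta_simple_zero[of "a / z"] z a0 by (metis divide_eq_0_iff)
    have "((\<lambda>z. theta (z\<^sup>2) x) has_field_derivative d1 * (2 * z)) (at z)"
      by (rule DERIV_chain2[where f = "\<lambda>z. theta z x" and g = "\<lambda>z. z\<^sup>2", OF d1(1)]) (auto intro!: derivative_eq_intros)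
    moreover have "((\<lambda>z. theta (a * z) x) has_field_derivative d2 * a) (at z)"
      by (rule DERIV_chain2[where f = "\<lambda>z. theta z x" and g = "\<lambda>z. a * z", OF d2(1)]) (auto intro!: derivative_eq_intros)
    moreover have "((\<lambda>z. theta (a / z) x) has_field_derivative d3 * (- a / z\<^sup>2)) (at z)"
      by (rule DERIV_chain2[where f = "\<lambda>z. theta z x" and g = "\<lambda>z. a / z", OF d3(1)])
         (use z in \<open>auto intro!: derivative_eq_intros simp: power2_eq_square\<close>)
    ultimately have "(D has_field_derivative d1 * (2 * z) * theta (a * z) x * theta (a / z) x
        + theta (z\<^sup>2) x * (d2 * a) * theta (a / z) x + theta (z\<^sup>2) x * theta (a * z) x * (d3 * (- a / z\<^sup>2))) (at z)"
      unfolding D_def by (auto intro!: derivative_eq_intros simp: algebra_simps)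
    then have dD: "deriv D z = d1 * (2 * z) * theta (a * z) x * theta (a / z) x
        + theta (z\<^sup>2) x * (d2 * a) * theta (a / z) x + theta (z\<^sup>2) x * theta (a * z) x * (d3 * (- a / z\<^sup>2))"
      by (rule DERIV_imp_deriv)
    \<comment> \<open>If two factors of \<open>D\<close> vanished together, a^2 would be a power of
      x, against the first genericity assumption. Hence all zeros of \<open>D\<close> are
      simple.\<close>
    have no12: "theta (a * z) x \<noteq> 0 \<or> theta (z\<^sup>2) x \<noteq> 0"
    proof (rule ccontr)
      assume "\<not> ?thesis"
      then obtain k l :: int where kl: "a * z = x powi k" "z\<^sup>2 = x powi l"
        using theta_eq_0_iff z a0 by (metis mult_eq_0_iff zero_eq_power2)
      have "a\<^sup>2 = (a * z)\<^sup>2 / z\<^sup>2" using z by (simp add: power_mult_distrib)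
      also have "\<dots> = x powi (2 * k - l)"
        unfolding kl pw2 using x by (simp add: power_int_diff)
      finally show False using gen(1) theta_simple_zero_powi by metis
    qed
    have no13: "theta (a / z) x \<noteq> 0 \<or> theta (z\<^sup>2) x \<noteq> 0"
    proof (rule ccontr)
      assume "\<not> ?thesis"
      then obtain k l :: int where kl: "a / z = x powi k" "z\<^sup>2 = x powi l"
        using theta_eq_0_iff z a0 by (metis divide_eq_0_iff zero_eq_power2)
      have "a\<^sup>2 = (a / z)\<^sup>2 * z\<^sup>2" using z by (simp add: power_divide)
      also have "\<dots> = x powi (2 * k + l)"
        unfolding kl pw2 using x by (simp add: power_int_add)
      finally show False using gen(1) theta_simple_zero_powi by metis
    qed
    have no23: "theta (a * z) x \<noteq> 0 \<or> theta (a / z) x \<noteq> 0"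
    proof (rule ccontr)
      assume "\<not> ?thesis"
      then obtain k l :: int where kl: "a * z = x powi k" "a / z = x powi l"
        using theta_eq_0_iff z a0 by (metis divide_eq_0_iff mult_eq_0_iff)
      have "a\<^sup>2 = (a * z) * (a / z)" using z by (simp add: power2_eq_square)
      also have "\<dots> = x powi (k + l)"
        unfolding kl using x by (simp add: power_int_add)
      finally show False using gen(1) theta_simple_zero_powi by metis
    qed
    show "F z = 0 \<and> deriv D z \<noteq> 0"
    proof
      show "deriv D z \<noteq> 0"
        using Dz[unfolded D_def] no12 no13 no23 d1 d2 d3 z a0 unfolding dD by auto
      consider "theta (z\<^sup>2) x = 0" | "theta (a * z) x = 0" | "theta (a / z) x = 0"
        using Dz by (auto simp: D_def)
      then show "F z = 0"
      proof cases
        case 1 then show ?thesis using F1 z by blast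
      next
        case 2
        then obtain k :: int where "a * z = x powi k" using theta_eq_0_iff z a0 by (metis mult_eq_0_iff)
        then have "z = 1 / a * x powi k" using a0 by (simp add: field_simps)
        then show ?thesis using Fz[of "1 / a" k] Fa' a0 by simp
      next
        case 3
        then obtain k :: int where "a / z = x powi k" using theta_eq_0_iff z a0 by (metis divide_eq_0_iff)
        then have "z = a * x powi (- k)" using a0 z x by (simp add: field_simps power_int_minus)
        then show ?thesis using Fz[of a "- k"] Fa a0 by simp
      qed
    qed
  qed (use T DT FT z in auto)
  then show ?thesis by (simp add: F_def u_def v_def c1_def c2_def)
qed

text \<open>Genericity is removed by a limit. Scaling T and the four t b by s, and a by s^5, keeps a
  equal to T times the product of the t b; for s close to 1 but different from 1 the scaled
  parameters are generic.\<close>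

lemma theta_identity:
  fixes t :: "'b \<Rightarrow> complex"
  assumes B: "finite B" "card B = 4" and T: "T \<noteq> 0" and t: "\<And>b. b \<in> B \<Longrightarrow> t b \<noteq> 0"
    and a: "a = T * (\<Prod>b\<in>B. t b)" and z: "z \<noteq> 0"
  shows "theta (z\<^sup>2) x * ((\<Prod>b\<in>B. theta (a / t b) x) * theta (T * z) x * theta (T / z) x
            - (\<Prod>b\<in>B. theta (T * t b) x) * theta (a * z) x * theta (a / z) x)
         + theta (T * a) x * T *
           (theta (T * z) x * (\<Prod>b\<in>B. theta (t b * z) x) * theta (a / z) x / z
            - theta (T / z) x * (\<Prod>b\<in>B. theta (t b / z) x) * theta (a * z) x * z ^ 3) = 0"
    (is "?G T t a = 0")
proof -
  have a0: "a \<noteq> 0" using a T t B by auto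
  have ct: "isCont (\<lambda>z. theta z x) w" if "w \<noteq> 0" for w
    using theta_holomorphic[OF x] that
    by (metis Compl_iff continuous_on_eq_continuous_at holomorphic_on_imp_continuous_on
        open_Compl closed_singleton singletonD)
  have c: "((\<lambda>s. theta (f s) x) \<longlongrightarrow> theta (f 1) x) (at 1)" if "(f \<longlongrightarrow> f 1) (at 1)" "f 1 \<noteq> 0" for f :: "complex \<Rightarrow> complex"
    by (rule isCont_tendsto_compose[OF ct that(1)]) (rule that(2))
  have "((\<lambda>s. ?G (T * s) (\<lambda>b. t b * s) (a * s ^ 5)) \<longlongrightarrow> ?G (T * 1) (\<lambda>b. t b * 1) (a * 1 ^ 5)) (at 1)"
    by (intro tendsto_intros c) (use T t a0 z in auto)
  moreover have ev: "eventually (\<lambda>s. ?G (T * s) (\<lambda>b. t b * s) (a * s ^ 5) = 0) (at 1)"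
  proof -
    have "eventually (\<lambda>s. theta (a\<^sup>2 * s ^ 10) x \<noteq> 0) (at 1)" "eventually (\<lambda>s. theta (T\<^sup>2 * s ^ 2) x \<noteq> 0) (at 1)"
         "eventually (\<lambda>s. theta (a * T * s ^ 6) x \<noteq> 0) (at 1)" "eventually (\<lambda>s. theta (a / T * s ^ 4) x \<noteq> 0) (at 1)"
         "eventually (\<lambda>s::complex. s \<noteq> 0) (at 1)"
      by (intro theta_nonzero_eventually; use a0 T in simp)+ (auto intro!: eventually_neq_at_within)
    then show ?thesis
    proof eventually_elim
      case (elim s)
      show ?case
      proof (rule theta_identity_generic[OF B])
        show "a * s ^ 5 = T * s * (\<Prod>b\<in>B. t b * s)"
          by (simp add: prod.distrib B a power_numeral_reduce mult_ac)
        show "theta ((a * s ^ 5)\<^sup>2) x \<noteq> 0" "theta ((T * s)\<^sup>2) x \<noteq> 0" "theta (a * s ^ 5 * (T * s)) x \<noteq> 0"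
          "theta (a * s ^ 5 / (T * s)) x \<noteq> 0"
          using elim T by (simp_all add: power_mult_distrib power_numeral_reduce mult_ac)
      qed (use elim T t z in auto)
    qed
  qed
  ultimately have "((\<lambda>_. 0) \<longlongrightarrow> ?G (T * 1) (\<lambda>b. t b * 1) (a * 1 ^ 5)) (at (1::complex))"
    by (rule Lim_transform_eventually)
  then have "?G (T * 1) (\<lambda>b. t b * 1) (a * 1 ^ 5) = 0"
    by (rule tendsto_unique[OF trivial_limit_at _ tendsto_const])
  then show ?thesis by (simp only: mult_1_right power_one)
qed

end

section \<open>The rarefied elliptic gamma function\<close>

lemma six_dvd_prod3: "(6::int) dvd m * (m - 1) * (m - 2)"
proof -
  have "(2::int) dvd m * (m - 1) * (m - 2)" by simp
  moreover have "(3::int) dvd m * (m - 1) * (m - 2)"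
  proof -
    have "m mod 3 = 0 \<or> m mod 3 = 1 \<or> m mod 3 = 2" by presburger
    then have "3 dvd m \<or> 3 dvd m - 1 \<or> 3 dvd m - 2" by presburger
    then show ?thesis by (auto intro: dvd_mult dvd_mult2)
  qed
  moreover have "coprime (2::int) 3" by simp
  ultimately have "2 * 3 dvd m * (m - 1) * (m - 2)" by (intro divides_mult)
  then show ?thesis by simp
qed

lemma of_int_choose2: "of_int (m * (m - 1) div 2) = (of_int m * (of_int m - 1) / 2 :: complex)"
proof -
  have "2 dvd m * (m - 1)" by simp
  then show ?thesis by (simp add: of_int_div)
qed

lemma of_int_choose3: "of_int (m * (m - 1) * (m - 2) div 6) = (of_int m * (of_int m - 1) * (of_int m - 2) / 6 :: complex)"
  using six_dvd_prod3[of m] by (simp add: of_int_div)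

lemma of_int_choose3': "of_int (m * (m\<^sup>2 - 1) div 6) = (of_int m * ((of_int m)\<^sup>2 - 1) / 6 :: complex)"
proof -
  have "m * (m\<^sup>2 - 1) = (m + 1) * (m + 1 - 1) * (m + 1 - 2)"
    by (simp add: power2_eq_square algebra_simps)
  then have "6 dvd m * (m\<^sup>2 - 1)" using six_dvd_prod3[of "m + 1"] by (simp only:)
  then show ?thesis by (simp add: of_int_div)
qed

lemma minus_exp: "- exp x = exp (x + \<i> * pi)" for x :: complex
  by (simp add: exp_add)

lemma exp_2pi_int: "exp (2 * of_int k * (\<i> * pi)) = 1"
  using exp_integer_2pi[of "of_int k"] by (simp add: mult_ac)

text \<open>The tool for all prefactor computations: exponents are compared as polynomials in
  logarithms, and \<open>k\<close> is the integer by which they differ in units of 2 pi i.\<close>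

lemma exp_eq_exp_2pi: "a = b + 2 * of_int k * (\<i> * pi) \<Longrightarrow> exp a = (exp b :: complex)"
  by (simp add: exp_add exp_2pi_int)

lemma eventually_compose_at:
  fixes \<phi> :: "complex \<Rightarrow> complex"
  assumes "eventually P (at (\<phi> z))" "isCont \<phi> z" "eventually (\<lambda>w. \<phi> w \<noteq> \<phi> z) (at z)"
  shows "eventually (\<lambda>w. P (\<phi> w)) (at z)"
proof -
  have "filterlim \<phi> (at (\<phi> z)) (at z)"
    using assms(2,3) by (intro filterlim_atI) (simp_all add: isCont_def)
  then show ?thesis using assms(1) by (auto simp: filterlim_iff)
qed

text \<open>This carries identities from a punctured neighbourhood, where no default value occurs,
  to the point itself.\<close>

lemma eventually_eq_imp_eq:
  fixes f g :: "complex \<Rightarrow> complex"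
  assumes "eventually (\<lambda>w. f w = g w) (at z)" "isCont f z" "isCont g z"
  shows "f z = g z"
proof -
  have "(f \<longlongrightarrow> f z) (at z)" "(g \<longlongrightarrow> g z) (at z)" using assms by (simp_all add: isCont_def)
  from Lim_transform_eventually[OF this(1) assms(1)] this(2) show ?thesis
    by (rule tendsto_unique[OF trivial_limit_at])
qed

lemma entire_nonzero_eventually:
  assumes f: "f holomorphic_on UNIV" "f 0 = (1::complex)" and c: "c \<noteq> 0" and z: "z \<noteq> 0"
  shows "eventually (\<lambda>w. f (c * w) \<noteq> 0) (at z)" "eventually (\<lambda>w. f (c / w) \<noteq> 0) (at z)"
proof -
  have *: "eventually (\<lambda>w. f w \<noteq> 0) (at y)" for y
    using non_zero_neighbour_alt[OF f(1) open_UNIV connected_UNIV, of y 0] f(2) by simp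
  show "eventually (\<lambda>w. f (c * w) \<noteq> 0) (at z)"
    by (rule eventually_compose_at[OF *])
       (use c in \<open>auto simp: eventually_at_filter\<close>)
  have "eventually (\<lambda>w. c / w \<noteq> c / z) (at z)"
    using eventually_neq_at_within[of z] by eventually_elim (use c z in \<open>auto simp: field_simps\<close>)
  then show "eventually (\<lambda>w. f (c / w) \<noteq> 0) (at z)"
    by (intro eventually_compose_at[OF *] continuous_intros) (use z in auto)
qed

lemma theta_powi_shift:
  assumes l: "Re l < 0"
  shows "theta (exp (x + of_int m * l)) (exp l) =
    exp (- of_int m * (x + \<i> * pi) - of_int m * (of_int m - 1) / 2 * l) * theta (exp x) (exp l)"
proof -
  have n: "norm (exp l) < 1" "exp l \<noteq> 0" using l by auto
  have s: "theta (exp (y + l)) (exp l) = exp (- y - \<i> * pi) * theta (exp y) (exp l)" for y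
    using theta_shift[OF n, of "exp y"] by (simp add: exp_add exp_diff exp_minus field_simps)
  show ?thesis
  proof (induction m rule: int_induct[where k = 0])
    case (step1 i)
    have "theta (exp (x + of_int (i + 1) * l)) (exp l) = theta (exp ((x + of_int i * l) + l)) (exp l)"
      by (simp add: algebra_simps)
    also have "\<dots> = exp (- (x + of_int i * l) - \<i> * pi) * theta (exp (x + of_int i * l)) (exp l)" by (rule s)
    also have "\<dots> = exp (- (x + of_int i * l) - \<i> * pi + (- of_int i * (x + \<i> * pi) - of_int i * (of_int i - 1) / 2 * l))
         * theta (exp x) (exp l)"
      unfolding step1 by (simp only: exp_add mult.assoc)
    also have "- (x + of_int i * l) - \<i> * pi + (- of_int i * (x + \<i> * pi) - of_int i * (of_int i - 1) / 2 * l)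
        = - of_int (i + 1) * (x + \<i> * pi) - of_int (i + 1) * (of_int (i + 1) - 1) / 2 * l"
      by (simp add: field_simps)
    finally show ?case .
  next
    case (step2 i)
    have "theta (exp (x + of_int i * l)) (exp l) = theta (exp ((x + of_int (i - 1) * l) + l)) (exp l)"
      by (simp add: algebra_simps)
    also have "\<dots> = exp (- (x + of_int (i - 1) * l) - \<i> * pi) * theta (exp (x + of_int (i - 1) * l)) (exp l)" by (rule s)
    finally have "theta (exp (x + of_int (i - 1) * l)) (exp l) =
        exp (x + of_int (i - 1) * l + \<i> * pi) * theta (exp (x + of_int i * l)) (exp l)"
      by (simp add: exp_add exp_diff exp_minus field_simps)
    also have "\<dots> = exp (x + of_int (i - 1) * l + \<i> * pi + (- of_int i * (x + \<i> * pi) - of_int i * (of_int i - 1) / 2 * l))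
         * theta (exp x) (exp l)"
      unfolding step2 by (simp only: exp_add mult.assoc)
    also have "x + of_int (i - 1) * l + \<i> * pi + (- of_int i * (x + \<i> * pi) - of_int i * (of_int i - 1) / 2 * l)
        = - of_int (i - 1) * (x + \<i> * pi) - of_int (i - 1) * (of_int (i - 1) - 1) / 2 * l"
      by (simp add: field_simps)
    finally show ?case .
  qed simp
qed

locale rarefied =
  fixes r :: nat and p q :: complex
  assumes r: "r > 0" and p: "norm p < 1" "p \<noteq> 0" and q: "norm q < 1" "q \<noteq> 0"
begin

abbreviation "gam \<equiv> \<lambda>z m. rarefied_gamma r p q z m"

text \<open>The plain product under \<open>remove_sings\<close>. It can take default values where a
  denominator vanishes, so its functional equations carry side conditions.\<close>

definition raw :: "complex \<Rightarrow> int \<Rightarrow> complex" where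
  "raw w m = (- w) powi (m * (m - 1) div 2)
            * p powi (m * (m - 1) * (m - 2) div 6)
            * q powi (- (m * (m\<^sup>2 - 1) div 6))
            * ell_gamma (w * p powi m) (p ^ r) (p * q)
            * ell_gamma (w * q powi (int r - m)) (q ^ r) (p * q)"

lemma gam_def': "gam z m = remove_sings (\<lambda>w. raw w m) z"
  unfolding rarefied_gamma_def raw_def ..

definition lp where "lp = Ln p"
definition lq where "lq = Ln q"

lemma exp_lp [simp]: "exp lp = p" and exp_lq [simp]: "exp lq = q"
  using p q by (simp_all add: lp_def lq_def)

lemma Re_lp: "Re lp < 0" and Re_lq: "Re lq < 0"
  using p q by (simp_all add: lp_def lq_def)

lemma p_powi: "p powi k = exp (of_int k * lp)" and q_powi: "q powi k = exp (of_int k * lq)"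
  using exp_power_int[of lp k] exp_power_int[of lq k] by simp_all

lemma pr: "p ^ r = exp (of_nat r * lp)" and qr: "q ^ r = exp (of_nat r * lq)" and pq: "p * q = exp (lp + lq)"
  using exp_of_nat_mult[of r lp] exp_of_nat_mult[of r lq] by (simp_all add: exp_add)

lemma norms: "norm (p ^ r) < 1" "p ^ r \<noteq> 0" "norm (q ^ r) < 1" "q ^ r \<noteq> 0" "norm (p * q) < 1" "p * q \<noteq> 0"
proof -
  show "norm (p ^ r) < 1" "norm (q ^ r) < 1" using p q r by (auto simp: norm_power power_less_one_iff)
  have "norm p * norm q < 1 * 1" using p q by (intro mult_strict_mono) auto
  then show "norm (p * q) < 1" by (simp add: norm_mult)
qed (use p q in auto)

definition nrm :: "complex \<Rightarrow> int \<Rightarrow> complex" where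
  "nrm x m = of_int m * (of_int m - 1) / 2 * (x + \<i> * pi)
     + of_int m * (of_int m - 1) * (of_int m - 2) / 6 * lp
     - of_int m * ((of_int m)\<^sup>2 - 1) / 6 * lq"

lemma raw_exp: "raw (exp x) m = exp (nrm x m) * ell_gamma (exp (x + of_int m * lp)) (p ^ r) (p * q)
    * ell_gamma (exp (x + (of_nat r - of_int m) * lq)) (q ^ r) (p * q)"
proof -
  have "nrm x m = of_int m * (of_int m - 1) / 2 * (x + \<i> * pi)
     + of_int m * (of_int m - 1) * (of_int m - 2) / 6 * lp
     + - (of_int m * ((of_int m)\<^sup>2 - 1) / 6) * lq" by (simp add: nrm_def)
  then show ?thesis
    unfolding raw_def p_powi q_powi minus_exp exp_power_int of_int_choose2 of_int_choose3 of_int_minus of_int_choose3'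
    by (simp only: exp_add of_int_diff of_int_of_nat_eq)
qed

text \<open>The factor picked up by the gamma function under (w, m) -> (q w, m + 1);
  \<open>theta_q\<close> belongs to (w, m) -> (p w, m - 1).\<close>

definition theta_p :: "complex \<Rightarrow> int \<Rightarrow> complex" where
  "theta_p w m = (- w) powi m * p powi (m * (m - 1) div 2) * theta (w * p powi m) (p ^ r)"

definition theta_q :: "complex \<Rightarrow> int \<Rightarrow> complex" where
  "theta_q w m = (- w) powi (1 - m) * q powi (m * (m - 1) div 2) * theta (w * q powi (int r - m)) (q ^ r)"

lemma theta_p_exp: "theta_p (exp x) m =
    exp (of_int m * (x + \<i> * pi) + of_int m * (of_int m - 1) / 2 * lp) * theta (exp (x + of_int m * lp)) (p ^ r)"
  unfolding theta_p_def p_powi minus_exp exp_power_int of_int_choose2 by (simp add: exp_add)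

lemma theta_q_exp: "theta_q (exp x) m =
    exp ((1 - of_int m) * (x + \<i> * pi) + of_int m * (of_int m - 1) / 2 * lq) * theta (exp (x + (of_nat r - of_int m) * lq)) (q ^ r)"
  unfolding theta_q_def q_powi minus_exp exp_power_int of_int_choose2 by (simp add: exp_add)

text \<open>Neither denominator of \<open>raw\<close> vanishes, so its value is not a
  default.\<close>

definition good :: "complex \<Rightarrow> int \<Rightarrow> bool" where
  "good w m \<longleftrightarrow> w \<noteq> 0 \<and> qpoch2 (w * p powi m) (p ^ r) (p * q) \<noteq> 0 \<and>
     qpoch2 (w * q powi (int r - m)) (q ^ r) (p * q) \<noteq> 0"

lemma good_exp: "good (exp x) m \<longleftrightarrow> qpoch2 (exp (x + of_int m * lp)) (p ^ r) (p * q) \<noteq> 0 \<and>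
     qpoch2 (exp (x + (of_nat r - of_int m) * lq)) (q ^ r) (p * q) \<noteq> 0"
  unfolding good_def p_powi q_powi by (simp add: exp_add)

lemma good_eventually:
  assumes "z \<noteq> 0" shows "eventually (\<lambda>w. good w m) (at z)"
proof -
  have "eventually (\<lambda>w. w \<noteq> 0) (at z)"
    using assms eventually_neq_at_within[of 0 z] by simp
  moreover have "eventually (\<lambda>w. qpoch2 (p powi m * w) (p ^ r) (p * q) \<noteq> 0) (at z)"
    "eventually (\<lambda>w. qpoch2 (q powi (int r - m) * w) (q ^ r) (p * q) \<noteq> 0) (at z)"
    using entire_nonzero_eventually(1)[OF qpoch2_holomorphic[OF norms(1,5)] qpoch2_0 _ assms, of "p powi m"]
      entire_nonzero_eventually(1)[OF qpoch2_holomorphic[OF norms(3,5)] qpoch2_0 _ assms, of "q powi (int r - m)"] p q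
    by simp_all
  ultimately show ?thesis by eventually_elim (simp add: good_def mult_ac)
qed

text \<open>Since q w p^(m+1) = (w p^m)(p q) and q w q^(r-m-1) = w q^(r-m), only the first elliptic
  gamma factor changes, by its shift in the base p q; this leaves a theta function of nome
  p^r.\<close>

lemma raw_shift_q:
  assumes "good w m" shows "raw (q * w) (m + 1) = theta_p w m * raw w m"
proof -
  define x where "x = Ln w"
  have w: "w = exp x" using assms by (simp add: x_def good_def)
  have g: "qpoch2 (exp (x + of_int m * lp)) (p ^ r) (p * q) \<noteq> 0" using assms unfolding w good_exp by simp
  have qw: "q * w = exp (x + lq)" by (simp add: w exp_add)
  have "exp (x + lq + of_int (m + 1) * lp) = exp (x + of_int m * lp) * (p * q)"
    by (simp add: exp_add algebra_simps)
  then have e1: "ell_gamma (exp (x + lq + of_int (m + 1) * lp)) (p ^ r) (p * q) =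
     theta (exp (x + of_int m * lp)) (p ^ r) * ell_gamma (exp (x + of_int m * lp)) (p ^ r) (p * q)"
    using ell_gamma_shift_snd[OF norms(1,5,6) _ g] by simp
  have e2: "x + lq + (of_nat r - of_int (m + 1)) * lq = x + (of_nat r - of_int m) * lq"
    by (simp add: algebra_simps)
  have e3: "nrm (x + lq) (m + 1) = of_int m * (x + \<i> * pi) + of_int m * (of_int m - 1) / 2 * lp + nrm x m"
    unfolding nrm_def by (simp add: field_simps power2_eq_square)
  show ?thesis unfolding qw unfolding w raw_exp theta_p_exp e1 e2 e3 by (simp add: exp_add)
qed

lemma raw_shift_p:
  assumes "good w m" shows "raw (p * w) (m - 1) = theta_q w m * raw w m"
proof -
  define x where "x = Ln w"
  have w: "w = exp x" using assms by (simp add: x_def good_def)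
  have g: "qpoch2 (exp (x + (of_nat r - of_int m) * lq)) (q ^ r) (p * q) \<noteq> 0" using assms unfolding w good_exp by simp
  have qw: "p * w = exp (x + lp)" by (simp add: w exp_add)
  have "exp (x + lp + (of_nat r - of_int (m - 1)) * lq) = exp (x + (of_nat r - of_int m) * lq) * (p * q)"
    by (simp add: exp_add exp_diff algebra_simps)
  then have e1: "ell_gamma (exp (x + lp + (of_nat r - of_int (m - 1)) * lq)) (q ^ r) (p * q) =
     theta (exp (x + (of_nat r - of_int m) * lq)) (q ^ r) * ell_gamma (exp (x + (of_nat r - of_int m) * lq)) (q ^ r) (p * q)"
    using ell_gamma_shift_snd[OF norms(3,5,6) _ g] by simp
  have e2: "x + lp + of_int (m - 1) * lp = x + of_int m * lp"
    by (simp add: algebra_simps)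
  have e3: "nrm (x + lp) (m - 1) = (1 - of_int m) * (x + \<i> * pi) + of_int m * (of_int m - 1) / 2 * lq + nrm x m
      + 2 * of_int (m - 1) * (\<i> * pi) - 2 * of_int (m - 1) * (\<i> * pi)"
    unfolding nrm_def by (simp add: field_simps power2_eq_square)
  show ?thesis unfolding qw unfolding w raw_exp theta_q_exp e1 e2 e3 by (simp add: exp_add)
qed

text \<open>The logarithm of the factor picked up under m -> m + r, where x is a logarithm of the
  argument.\<close>

definition per :: "complex \<Rightarrow> int \<Rightarrow> complex" where
  "per x m = (of_nat r - 1) * ((of_int m + of_nat r / 2) * (x + \<i> * pi)
     + ((of_int m)\<^sup>2 + (of_nat r - 1) * of_int m + of_nat r * (of_nat r - 2) / 3) / 2 * lp
     - ((of_int m)\<^sup>2 + (of_nat r + 1) * of_int m + of_nat r * (of_nat r + 1) / 3) / 2 * lq)"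

lemma theta_pq_ratio: "theta (exp (x + of_int m * lp)) (p * q) =
    exp (- of_int m * (x - of_int m * lq + \<i> * pi) - of_int m * (of_int m - 1) / 2 * (lp + lq))
      * theta (exp (x - of_int m * lq)) (p * q)"
proof -
  have "Re (lp + lq) < 0" using Re_lp Re_lq by simp
  from theta_powi_shift[OF this, of "x - of_int m * lq" m] show ?thesis
    by (simp add: pq algebra_simps)
qed

text \<open>Raising m by r multiplies the argument of one elliptic gamma factor by p^r and divides
  that of the other by q^r. Both changes produce theta functions of the same nome p q, at w p^m and
  w q^(-m). These arguments differ by (p q)^m, so the theta functions cancel up to an
  exponential.\<close>

lemma raw_period:
  assumes w: "w = exp x" and g: "good w m" "good w (m + int r)" and t: "theta (w * q powi (- m)) (p * q) \<noteq> 0"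
  shows "raw w (m + int r) = exp (per x m) * raw w m"
proof -
  have g1: "qpoch2 (exp (x + of_int m * lp)) (p ^ r) (p * q) \<noteq> 0" using g unfolding w good_exp by simp
  have g2: "qpoch2 (exp (x - of_int m * lq)) (q ^ r) (p * q) \<noteq> 0" using g unfolding w good_exp by simp
  have t': "theta (exp (x - of_int m * lq)) (p * q) \<noteq> 0"
    using t unfolding w q_powi by (simp add: exp_add exp_diff exp_minus divide_inverse)
  have "exp (x + of_int (m + int r) * lp) = exp (x + of_int m * lp) * p ^ r"
    by (simp add: exp_add algebra_simps pr)
  then have e1: "ell_gamma (exp (x + of_int (m + int r) * lp)) (p ^ r) (p * q) =
     theta (exp (x + of_int m * lp)) (p * q) * ell_gamma (exp (x + of_int m * lp)) (p ^ r) (p * q)"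
    using ell_gamma_shift_fst[OF norms(1,2,5) _ g1] by simp
  have "exp (x + (of_nat r - of_int m) * lq) = exp (x - of_int m * lq) * q ^ r"
    by (simp add: exp_add exp_diff algebra_simps qr)
  then have e2: "ell_gamma (exp (x + (of_nat r - of_int m) * lq)) (q ^ r) (p * q) =
     theta (exp (x - of_int m * lq)) (p * q) * ell_gamma (exp (x - of_int m * lq)) (q ^ r) (p * q)"
    using ell_gamma_shift_fst[OF norms(3,4,5) _ g2] by simp
  have e3: "x + (of_nat r - of_int (m + int r)) * lq = x - of_int m * lq" by (simp add: algebra_simps)
  have e4: "nrm x (m + int r) + (- of_int m * (x - of_int m * lq + \<i> * pi) - of_int m * (of_int m - 1) / 2 * (lp + lq))
     = per x m + nrm x m"
    unfolding nrm_def per_def by (simp add: field_simps power2_eq_square power3_eq_cube)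
  have "raw w (m + int r) = exp (nrm x (m + int r) + (- of_int m * (x - of_int m * lq + \<i> * pi) - of_int m * (of_int m - 1) / 2 * (lp + lq)))
     * theta (exp (x - of_int m * lq)) (p * q) * ell_gamma (exp (x + of_int m * lp)) (p ^ r) (p * q)
     * ell_gamma (exp (x - of_int m * lq)) (q ^ r) (p * q)"
    unfolding w raw_exp e1 e3 theta_pq_ratio by (simp add: exp_add)
  also have "\<dots> = exp (per x m) * raw w m"
    unfolding e4 unfolding w raw_exp e2 by (simp add: exp_add)
  finally show ?thesis .
qed

lemma ell_gamma_reflect:
  assumes "norm x < 1" "norm y < 1" "z \<noteq> 0" "x * y \<noteq> 0" "qpoch2 z x y \<noteq> 0" "qpoch2 (x * y / z) x y \<noteq> 0"
  shows "ell_gamma z x y * ell_gamma (x * y / z) x y = 1"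
  using assms by (simp add: ell_gamma_eq)

text \<open>Each elliptic gamma factor has its own reflection, but the arguments in the second
  \<open>raw\<close> miss the reflected points by the factors p^r and q^r. The two corrections are
  theta functions of nome p q whose quotient is an exponential, and it cancels the prefactors. The
  side conditions keep all these functions away from zeros.\<close>

lemma raw_reflect:
  assumes g: "good w m" "good (p * q / w) (- m)" and t: "theta (p * q / w * p powi (- m)) (p * q) \<noteq> 0"
    and n: "qpoch2 (p * q / w * p powi (int r - m)) (p ^ r) (p * q) \<noteq> 0" "qpoch2 (p * q / w * q powi m) (q ^ r) (p * q) \<noteq> 0"
  shows "raw w m * raw (p * q / w) (- m) = 1"
proof -
  define x where "x = Ln w"
  have w: "w = exp x" using g by (simp add: x_def good_def)
  define y where "y = lp + lq - x"
  have yw: "p * q / w = exp y" by (simp add: y_def w exp_add exp_diff)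
  have g1: "qpoch2 (exp (x + of_int m * lp)) (p ^ r) (p * q) \<noteq> 0"
       "qpoch2 (exp (x + (of_nat r - of_int m) * lq)) (q ^ r) (p * q) \<noteq> 0" using g(1) unfolding w good_exp by simp_all
  have g2: "qpoch2 (exp (y - of_int m * lp)) (p ^ r) (p * q) \<noteq> 0"
       "qpoch2 (exp (y + (of_nat r + of_int m) * lq)) (q ^ r) (p * q) \<noteq> 0" using g(2) unfolding yw good_exp by simp_all
  have n1: "qpoch2 (exp (y + (of_nat r - of_int m) * lp)) (p ^ r) (p * q) \<noteq> 0"
       "qpoch2 (exp (y + of_int m * lq)) (q ^ r) (p * q) \<noteq> 0"
    using n unfolding yw p_powi q_powi by (simp_all add: exp_add)
  have t1: "theta (exp (y - of_int m * lp)) (p * q) \<noteq> 0"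
    using t unfolding yw p_powi by (simp add: exp_diff exp_minus divide_inverse)
  have a1: "ell_gamma (exp (x + of_int m * lp)) (p ^ r) (p * q) * ell_gamma (exp (y + (of_nat r - of_int m) * lp)) (p ^ r) (p * q) = 1"
  proof -
    have "p ^ r * (p * q) / exp (x + of_int m * lp) = exp (y + (of_nat r - of_int m) * lp)"
      unfolding pr pq y_def by (simp add: field_simps flip: exp_add exp_diff)
    then show ?thesis
      using ell_gamma_reflect[OF norms(1,5) _ _ g1(1)] norms n1 by simp
  qed
  have a2: "ell_gamma (exp (x + (of_nat r - of_int m) * lq)) (q ^ r) (p * q) * ell_gamma (exp (y + of_int m * lq)) (q ^ r) (p * q) = 1"
  proof -
    have "q ^ r * (p * q) / exp (x + (of_nat r - of_int m) * lq) = exp (y + of_int m * lq)"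
      unfolding qr pq y_def by (simp add: field_simps flip: exp_add exp_diff)
    then show ?thesis
      using ell_gamma_reflect[OF norms(3,5) _ _ g1(2)] norms n1 by simp
  qed
  have "exp (y + (of_nat r - of_int m) * lp) = exp (y - of_int m * lp) * p ^ r"
    by (simp add: pr algebra_simps flip: exp_add)
  then have a3: "ell_gamma (exp (y + (of_nat r - of_int m) * lp)) (p ^ r) (p * q) =
      theta (exp (y - of_int m * lp)) (p * q) * ell_gamma (exp (y - of_int m * lp)) (p ^ r) (p * q)"
    using ell_gamma_shift_fst[OF norms(1,2,5) _ g2(1)] by simp
  have "exp (y + (of_nat r + of_int m) * lq) = exp (y + of_int m * lq) * q ^ r"
    by (simp add: qr algebra_simps flip: exp_add)
  then have a4: "ell_gamma (exp (y + (of_nat r + of_int m) * lq)) (q ^ r) (p * q) =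
      theta (exp (y + of_int m * lq)) (p * q) * ell_gamma (exp (y + of_int m * lq)) (q ^ r) (p * q)"
    using ell_gamma_shift_fst[OF norms(3,4,5) _ n1(2)] by simp
  have a5: "theta (exp (y - of_int m * lp)) (p * q) =
    exp (of_int m * (y + of_int m * lq + \<i> * pi) - of_int m * (of_int m + 1) / 2 * (lp + lq))
      * theta (exp (y + of_int m * lq)) (p * q)"
    using theta_pq_ratio[of y "- m"] by (simp add: algebra_simps)
  have "nrm x m + nrm y (- m) = of_int m * (y + of_int m * lq + \<i> * pi) - of_int m * (of_int m + 1) / 2 * (lp + lq)
       + 2 * of_int (m * (m - 1) div 2) * (\<i> * pi)"
    unfolding nrm_def y_def of_int_choose2 by (simp add: field_simps power2_eq_square)
  then have e: "exp (nrm x m + nrm y (- m)) = exp (of_int m * (y + of_int m * lq + \<i> * pi) - of_int m * (of_int m + 1) / 2 * (lp + lq))"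
    by (rule exp_eq_exp_2pi)
  have "raw w m * raw (p * q / w) (- m) = exp (nrm x m + nrm y (- m)) *
     (ell_gamma (exp (x + of_int m * lp)) (p ^ r) (p * q) * ell_gamma (exp (y - of_int m * lp)) (p ^ r) (p * q)) *
     (ell_gamma (exp (x + (of_nat r - of_int m) * lq)) (q ^ r) (p * q) * ell_gamma (exp (y + of_int m * lq)) (q ^ r) (p * q)) *
     theta (exp (y + of_int m * lq)) (p * q)"
    unfolding yw unfolding w raw_exp of_int_minus by (simp add: a4 exp_add[of "nrm x m" "nrm y (- m)"])
  also have "\<dots> = theta (exp (y - of_int m * lp)) (p * q) *
     (ell_gamma (exp (x + of_int m * lp)) (p ^ r) (p * q) * ell_gamma (exp (y - of_int m * lp)) (p ^ r) (p * q))"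
    unfolding a2 e a5 by simp
  also have "\<dots> = 1" using a1 unfolding a3 by (simp add: mult_ac)
  finally show ?thesis .
qed

end

section \<open>Poles and values of the rarefied gamma function near the closed unit disc\<close>

lemma entire_compose_holomorphic:
  assumes "f holomorphic_on UNIV"
  shows "(\<lambda>w. f (c * w)) holomorphic_on S" "0 \<notin> S \<Longrightarrow> (\<lambda>w. f (c / w)) holomorphic_on S"
proof -
  have *: "f \<circ> g holomorphic_on S" if "g holomorphic_on S" for g
    using holomorphic_on_compose[OF that holomorphic_on_subset[OF assms subset_UNIV]] .
  show "(\<lambda>w. f (c * w)) holomorphic_on S" using *[of "\<lambda>w. c * w"] by (simp add: o_def holomorphic_intros)
  show "(\<lambda>w. f (c / w)) holomorphic_on S" if "0 \<notin> S"
  proof -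
    have "(\<lambda>w. c / w) holomorphic_on S" by (intro holomorphic_intros) (use that in auto)
    from *[OF this] show ?thesis by (simp add: o_def)
  qed
qed

context rarefied
begin

text \<open>A punctured disc slightly larger than the unit disc, in which 1 is the only possible
  pole of each \<open>gam _ m\<close>.\<close>

definition dom :: "complex set" where
  "dom = {z. z \<noteq> 0 \<and> norm z * norm p < 1 \<and> norm z * norm q < 1}"

lemma open_dom: "open dom"
  unfolding dom_def by (intro open_Collect_conj open_Collect_neq open_Collect_less continuous_intros)

lemma dom_unit: "z \<noteq> 0 \<Longrightarrow> norm z \<le> 1 \<Longrightarrow> z \<in> dom"
  unfolding dom_def using p q by (auto intro: le_less_trans[OF mult_right_mono[of "norm z" 1 "norm p"]]
   le_less_trans[OF mult_right_mono[of "norm z" 1 "norm q"]])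

lemma raw_qpoch2: "raw w m = (- w) powi (m * (m - 1) div 2)
            * p powi (m * (m - 1) * (m - 2) div 6) * q powi (- (m * (m\<^sup>2 - 1) div 6))
            * (qpoch2 (p ^ r * (p * q) / p powi m / w) (p ^ r) (p * q) / qpoch2 (p powi m * w) (p ^ r) (p * q))
            * (qpoch2 (q ^ r * (p * q) / q powi (int r - m) / w) (q ^ r) (p * q) / qpoch2 (q powi (int r - m) * w) (q ^ r) (p * q))"
  unfolding raw_def ell_gamma_eq[OF norms(1,5)] ell_gamma_eq[OF norms(3,5)] by (simp add: mult.commute)

text \<open>\<open>h\<close> is the holomorphic version of (1 - w) raw w m. The last clause records
  that 1 can be a pole only if r divides m; it decides which residues survive in the pinching
  limit.\<close>

definition regular :: "int \<Rightarrow> (complex \<Rightarrow> complex) \<Rightarrow> bool" where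
  "regular m h \<longleftrightarrow> h holomorphic_on dom \<and> (\<forall>z\<in>dom. eventually (\<lambda>w. raw w m = h w / (1 - w)) (at z))
     \<and> (h 1 = 0 \<or> int r dvd m)"

lemma norm_power_int_le: "norm x < 1 \<Longrightarrow> m \<ge> 1 \<Longrightarrow> norm (x powi m) \<le> norm (x::complex)"
proof -
  assume "norm x < 1" "m \<ge> 1"
  define k where "k = nat m - 1"
  have k: "m = int (Suc k)" using \<open>m \<ge> 1\<close> by (simp add: k_def)
  have "norm x * norm x ^ k \<le> norm x * 1"
    by (intro mult_left_mono power_le_one) (use \<open>norm x < 1\<close> in auto)
  then show ?thesis unfolding k power_int_of_nat by (simp add: norm_power norm_mult)
qed

text \<open>For m = 0 the zero at 1 comes from the first factor of (w; p^r, p q) alone and is split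
  off by hand. The value of \<open>h\<close> at 1, the negative of the residue, is the origin of the
  constant in \<open>beta_integral\<close>.\<close>

lemma regular_0: "\<exists>h. regular 0 h \<and> h 1 = 1 / (qpoch_inf (p ^ r) (p ^ r) * qpoch_inf (q ^ r) (q ^ r))"
proof -
  define h where "h = (\<lambda>w. qpoch2 (p ^ r * (p * q) / w) (p ^ r) (p * q) * qpoch2 (p * q / w) (q ^ r) (p * q) /
     (qpoch_inf (p * q * w) (p * q) * qpoch2 (p ^ r * w) (p ^ r) (p * q) * qpoch2 (q ^ r * w) (q ^ r) (p * q)))"
  have small: "norm (p ^ r * w) < 1" "norm (q ^ r * w) < 1" "norm (p * q * w) < 1" if w: "w \<in> dom" for w
  proof -
    have "norm w * norm (p ^ r) \<le> norm w * norm p" "norm w * norm (q ^ r) \<le> norm w * norm q"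
      using norm_power_int_le[OF p(1), of "int r"] norm_power_int_le[OF q(1), of "int r"] r
      by (auto intro!: mult_left_mono)
    moreover have "norm w * norm p < 1" "norm w * norm q < 1" using w by (simp_all add: dom_def)
    ultimately have "norm w * norm (p ^ r) < 1" "norm w * norm (q ^ r) < 1" by (meson le_less_trans)+
    then show "norm (p ^ r * w) < 1" "norm (q ^ r * w) < 1" by (simp_all add: norm_mult mult.commute)
    have "norm (p * q * w) = (norm w * norm p) * norm q" by (simp add: norm_mult)
    also have "\<dots> < 1 * 1" by (intro mult_strict_mono) (use w q in \<open>auto simp: dom_def\<close>)
    finally show "norm (p * q * w) < 1" by simp
  qed
  have nz: "qpoch_inf (p * q * w) (p * q) \<noteq> 0" "qpoch2 (p ^ r * w) (p ^ r) (p * q) \<noteq> 0"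
      "qpoch2 (q ^ r * w) (q ^ r) (p * q) \<noteq> 0" if "w \<in> dom" for w
    using small[OF that] norms by (simp_all add: qpoch_nonzero_norm qpoch2_nonzero_norm)
  have 0: "0 \<notin> dom" by (simp add: dom_def)
  have hol: "h holomorphic_on dom" unfolding h_def
    by (intro holomorphic_intros entire_compose_holomorphic[OF qpoch2_holomorphic[OF norms(1,5)]]
      entire_compose_holomorphic[OF qpoch2_holomorphic[OF norms(3,5)]] entire_compose_holomorphic[OF qpoch_holomorphic[OF norms(5)]])
       (use nz 0 in auto)
  have eq: "raw w 0 = h w / (1 - w)" for w
  proof -
    have "qpoch2 w (p ^ r) (p * q) = (1 - w) * qpoch_inf (p * q * w) (p * q) * qpoch2 (p ^ r * w) (p ^ r) (p * q)"
      by (subst qpoch2_split[OF norms(1,5)], subst qpoch_split[OF norms(5)]) (simp add: mult_ac)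
    then show ?thesis unfolding raw_qpoch2 h_def using norms by simp
  qed
  have one: "h 1 = 1 / (qpoch_inf (p ^ r) (p ^ r) * qpoch_inf (q ^ r) (q ^ r))"
  proof -
    let ?P = "p ^ r" and ?R = "q ^ r" and ?Q = "p * q"
    have "1 \<in> dom" by (rule dom_unit) auto
    note nz1 = nz[OF this]
    have a: "qpoch2 ?P ?P ?Q = qpoch_inf ?P ?P * qpoch2 (?P * ?Q) ?P ?Q"
      by (rule qpoch2_split'[OF norms(1,5)])
    have b: "qpoch2 ?R ?R ?Q = qpoch_inf ?R ?R * qpoch2 (?R * ?Q) ?R ?Q"
      by (rule qpoch2_split'[OF norms(3,5)])
    have c: "qpoch2 ?Q ?R ?Q = qpoch_inf ?Q ?Q * qpoch2 (?R * ?Q) ?R ?Q"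
      by (subst qpoch2_split[OF norms(3,5)]) (simp add: mult_ac)
    show ?thesis using nz1 unfolding h_def by (simp add: a b c)
  qed
  show ?thesis unfolding regular_def using hol eq one by (intro exI[of _ h]) auto
qed

text \<open>For 0 < m < r both p^m w and q^(r-m) w stay in the open unit disc for w in
  \<open>dom\<close>, so no denominator vanishes; the factor 1 - w only makes the form
  uniform.\<close>

lemma regular_base:
  assumes m: "0 < m" "m < int r" shows "\<exists>h. regular m h"
proof -
  define h where "h = (\<lambda>w. (1 - w) * raw w m)"
  have small: "norm (p powi m * w) < 1" "norm (q powi (int r - m) * w) < 1" if w: "w \<in> dom" for w
  proof -
    have "norm w * norm (p powi m) \<le> norm w * norm p" "norm w * norm (q powi (int r - m)) \<le> norm w * norm q"
      using norm_power_int_le[OF p(1), of m] norm_power_int_le[OF q(1), of "int r - m"] m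
      by (auto intro!: mult_left_mono)
    moreover have "norm w * norm p < 1" "norm w * norm q < 1" using w by (simp_all add: dom_def)
    ultimately have "norm w * norm (p powi m) < 1" "norm w * norm (q powi (int r - m)) < 1" by (meson le_less_trans)+
    then show "norm (p powi m * w) < 1" "norm (q powi (int r - m) * w) < 1" by (simp_all add: norm_mult mult.commute)
  qed
  have nz: "qpoch2 (p powi m * w) (p ^ r) (p * q) \<noteq> 0" "qpoch2 (q powi (int r - m) * w) (q ^ r) (p * q) \<noteq> 0" if "w \<in> dom" for w
    using small[OF that] norms by (simp_all add: qpoch2_nonzero_norm)
  have 0: "0 \<notin> dom" by (simp add: dom_def)
  have "h holomorphic_on dom" unfolding h_def raw_qpoch2
    by (intro holomorphic_intros entire_compose_holomorphic[OF qpoch2_holomorphic[OF norms(1,5)]]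
      entire_compose_holomorphic[OF qpoch2_holomorphic[OF norms(3,5)]])
       (use nz 0 p q in auto)
  moreover have "eventually (\<lambda>w. raw w m = h w / (1 - w)) (at z)" for z
    using eventually_neq_at_within[of 1 z] by eventually_elim (auto simp: h_def)
  ultimately show ?thesis unfolding regular_def using m by (intro exI[of _ h]) (auto simp: h_def)
qed

text \<open>This is exp (per x m) as a function of w = exp x. The coefficient of x in
  \<open>per\<close> is an integer, so no logarithm of w is involved and the factor is holomorphic
  and nonzero.\<close>

definition cper :: "complex \<Rightarrow> int \<Rightarrow> complex" where
  "cper w m = (- w) powi ((int r - 1) * m + int r * (int r - 1) div 2) *
     exp ((of_nat r - 1) * (((of_int m)\<^sup>2 + (of_nat r - 1) * of_int m + of_nat r * (of_nat r - 2) / 3) / 2 * lp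
     - ((of_int m)\<^sup>2 + (of_nat r + 1) * of_int m + of_nat r * (of_nat r + 1) / 3) / 2 * lq))"

lemma cper_exp: "cper (exp x) m = exp (per x m)"
proof -
  let ?e = "(int r - 1) * m + int r * (int r - 1) div 2"
  have e: "of_int ?e = (of_nat r - 1) * (of_int m + of_nat r / 2 :: complex)"
    by (simp only: of_int_add of_int_choose2) (simp add: field_simps)
  show ?thesis
    unfolding cper_def minus_exp exp_power_int e per_def by (simp add: algebra_simps flip: exp_add)
qed

lemma cper_nonzero: "w \<noteq> 0 \<Longrightarrow> cper w m \<noteq> 0"
  by (simp add: cper_def)

lemma cper_holomorphic: "(\<lambda>w. cper w m) holomorphic_on dom"
  unfolding cper_def by (intro holomorphic_intros) (auto simp: dom_def)

lemma raw_period_eventually: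
  assumes "z \<noteq> 0"
  shows "eventually (\<lambda>w. raw w (m + int r) = cper w m * raw w m) (at z)"
proof -
  have "eventually (\<lambda>w. theta (w * q powi (- m)) (p * q) \<noteq> 0) (at z)"
    using theta_nonzero_eventually[OF norms(5,6), of "q powi (- m)" 1 z] assms q by (simp add: mult.commute)
  moreover have "eventually (\<lambda>w. w \<noteq> 0) (at z)"
    using assms eventually_neq_at_within[of 0 z] by simp
  ultimately show ?thesis using good_eventually[OF assms, of m] good_eventually[OF assms, of "m + int r"]
  proof eventually_elim
    case (elim w)
    then show ?case using raw_period[of w "Ln w" m] cper_exp[of "Ln w" m] by simp
  qed
qed

lemma regular_add:
  assumes "regular m h" shows "regular (m + int r) (\<lambda>w. cper w m * h w)"
  unfolding regular_def
proof (intro conjI ballI)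
  show "(\<lambda>w. cper w m * h w) holomorphic_on dom"
    by (intro holomorphic_intros cper_holomorphic) (use assms in \<open>auto simp: regular_def\<close>)
  fix z assume z: "z \<in> dom"
  then have "eventually (\<lambda>w. raw w m = h w / (1 - w)) (at z)" using assms by (auto simp: regular_def)
  then show "eventually (\<lambda>w. raw w (m + int r) = cper w m * h w / (1 - w)) (at z)"
    using raw_period_eventually[of z m] z by (auto simp: dom_def elim: eventually_elim2)
qed (use assms in \<open>auto simp: regular_def\<close>)

lemma regular_diff:
  assumes "regular m h" shows "regular (m - int r) (\<lambda>w. h w / cper w (m - int r))"
  unfolding regular_def
proof (intro conjI ballI)
  show "(\<lambda>w. h w / cper w (m - int r)) holomorphic_on dom"
    by (intro holomorphic_intros cper_holomorphic) (use assms in \<open>auto simp: regular_def dom_def cper_nonzero\<close>)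
  fix z assume z: "z \<in> dom"
  then have "eventually (\<lambda>w. raw w m = h w / (1 - w)) (at z)" "eventually (\<lambda>w. w \<noteq> 0) (at z)"
    using assms eventually_neq_at_within[of 0 z] by (auto simp: regular_def dom_def)
  moreover have "eventually (\<lambda>w. raw w m = cper w (m - int r) * raw w (m - int r)) (at z)"
    using raw_period_eventually[of z "m - int r"] z by (auto simp: dom_def)
  ultimately show "eventually (\<lambda>w. raw w (m - int r) = h w / cper w (m - int r) / (1 - w)) (at z)"
  proof eventually_elim
    case (elim w)
    have "h w / cper w (m - int r) / (1 - w) = (h w / (1 - w)) / cper w (m - int r)" by simp
    also have "\<dots> = raw w (m - int r)"
      using elim cper_nonzero[of w "m - int r"] by (metis nonzero_mult_div_cancel_left)
    finally show ?case ..
  qed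
qed (use assms in \<open>auto simp: regular_def dvd_diff_commute\<close>)

text \<open>The range 0 <= m < r is explicit; other m are reached by steps of r in either direction,
  each a multiplication or division by the nonvanishing \<open>cper\<close>.\<close>

lemma regular_exists: "\<exists>h. regular m h"
proof -
  have "\<exists>h. regular (m mod int r + k * int r) h" for k
  proof (induction k rule: int_induct[where k = 0])
    case base
    have "m mod int r = 0 \<or> 0 < m mod int r" "m mod int r < int r"
      using r pos_mod_sign[of "int r" m] pos_mod_bound[of "int r" m] by linarith+
    then have "\<exists>h. regular (m mod int r) h"
      using regular_0 regular_base[of "m mod int r"] by metis
    then show ?case by simp
  next
    case (step1 i)
    then show ?case using regular_add[of "m mod int r + i * int r"] by (auto simp: algebra_simps)
  next
    case (step2 i)
    then show ?case using regular_diff[of "m mod int r + i * int r"] by (auto simp: algebra_simps)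
  qed
  from this[of "m div int r"] show ?thesis by simp
qed

text \<open>The continuous form of (1 - z) gam z m, which stays meaningful at the pole z =
  1.\<close>

definition Gh :: "int \<Rightarrow> complex \<Rightarrow> complex" where "Gh m = (SOME h. regular m h)"

lemma regular_Gh: "regular m (Gh m)"
  unfolding Gh_def using regular_exists someI_ex by metis

lemma holomorphic_isCont_dom: "f holomorphic_on dom \<Longrightarrow> z \<in> dom \<Longrightarrow> isCont f z"
  using continuous_on_eq_continuous_at[OF open_dom] holomorphic_on_imp_continuous_on by blast

lemma Gh_holomorphic: "Gh m holomorphic_on dom"
  using regular_Gh by (simp add: regular_def)

lemma raw_Gh: "z \<in> dom \<Longrightarrow> eventually (\<lambda>w. raw w m = Gh m w / (1 - w)) (at z)"
  using regular_Gh by (simp add: regular_def)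

lemma Gh_1_eq_0: "\<not> int r dvd m \<Longrightarrow> Gh m 1 = 0"
  using regular_Gh[of m] by (simp add: regular_def)

lemma Gh_0_1: "Gh 0 1 = 1 / (qpoch_inf (p ^ r) (p ^ r) * qpoch_inf (q ^ r) (q ^ r))"
proof -
  obtain h where h: "regular 0 h" "h 1 = 1 / (qpoch_inf (p ^ r) (p ^ r) * qpoch_inf (q ^ r) (q ^ r))"
    using regular_0 by blast
  have 1: "1 \<in> dom" by (rule dom_unit) auto
  have "Gh 0 1 = h 1"
  proof (rule eventually_eq_imp_eq[where f = "Gh 0" and g = h])
    have "eventually (\<lambda>w. raw w 0 = h w / (1 - w)) (at 1)" using h 1 by (auto simp: regular_def)
    moreover have "eventually (\<lambda>w::complex. w \<noteq> 1) (at 1)" by (simp add: eventually_neq_at_within)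
    ultimately show "eventually (\<lambda>w. Gh 0 w = h w) (at 1)" using raw_Gh[OF 1, of 0]
      by eventually_elim auto
    show "isCont (Gh 0) 1" "isCont h 1"
      using h 1 Gh_holomorphic by (auto simp: regular_def intro: holomorphic_isCont_dom)
  qed
  then show ?thesis using h by simp
qed

lemma gam_Gh:
  assumes "z \<in> dom" "z \<noteq> 1" shows "gam z m = Gh m z / (1 - z)"
  unfolding gam_def'
proof (rule remove_sings_eqI)
  have "isCont (\<lambda>w. Gh m w / (1 - w)) z"
    by (intro continuous_intros holomorphic_isCont_dom Gh_holomorphic) (use assms in auto)
  then have "((\<lambda>w. Gh m w / (1 - w)) \<longlongrightarrow> Gh m z / (1 - z)) (at z)" by (simp add: isCont_def)
  then show "((\<lambda>w. raw w m) \<longlongrightarrow> Gh m z / (1 - z)) (at z)"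
    by (rule Lim_transform_eventually) (use raw_Gh[OF assms(1), of m] in \<open>auto elim: eventually_mono\<close>)
qed

lemma open_dom1: "open (dom - {1})" using open_dom by auto

lemma gam_holomorphic: "(\<lambda>z. gam z m) holomorphic_on dom - {1}"
proof -
  have "(\<lambda>z. Gh m z / (1 - z)) holomorphic_on dom - {1}"
    by (intro holomorphic_intros holomorphic_on_subset[OF Gh_holomorphic]) auto
  then show ?thesis by (rule holomorphic_transform) (auto simp: gam_Gh)
qed

lemma gam_isCont: "z \<in> dom \<Longrightarrow> z \<noteq> 1 \<Longrightarrow> isCont (\<lambda>z. gam z m) z"
  using continuous_on_eq_continuous_at[OF open_dom1] holomorphic_on_imp_continuous_on[OF gam_holomorphic] by blast

lemma raw_gam: "z \<in> dom \<Longrightarrow> eventually (\<lambda>w. raw w m = gam w m) (at z)"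
proof -
  assume z: "z \<in> dom"
  have "eventually (\<lambda>w. w \<in> dom) (at z)"
    using eventually_at_in_open'[OF open_dom z] .
  moreover have "eventually (\<lambda>w. w \<noteq> 1) (at z)" by (simp add: eventually_neq_at_within)
  ultimately show ?thesis using raw_Gh[OF z, of m]
    by eventually_elim (simp add: gam_Gh)
qed

lemma isCont_gam_compose:
  assumes "isCont \<phi> z" "\<phi> z \<in> dom" "\<phi> z \<noteq> 1" shows "isCont (\<lambda>z. gam (\<phi> z) m) z"
  using isCont_o2[OF assms(1) gam_isCont[OF assms(2,3)]] .

lemma raw_gam_compose:
  fixes \<phi> :: "complex \<Rightarrow> complex"
  assumes "isCont \<phi> z" "\<phi> z \<in> dom" "eventually (\<lambda>w. \<phi> w \<noteq> \<phi> z) (at z)"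
  shows "eventually (\<lambda>w. raw (\<phi> w) m = gam (\<phi> w) m) (at z)"
proof -
  have "eventually (\<lambda>y. raw y m = gam y m) (at (\<phi> z))" by (rule raw_gam) (rule assms)
  from eventually_compose_at[OF this assms(1,3)] show ?thesis .
qed

lemma theta_isCont:
  assumes "norm x < 1" "x \<noteq> 0" "z \<noteq> 0" shows "isCont (\<lambda>z. theta z x) z"
  using theta_holomorphic[OF assms(1,2)] assms(3)
  by (metis Compl_iff continuous_on_eq_continuous_at holomorphic_on_imp_continuous_on
        open_Compl closed_singleton singletonD)

lemma isCont_theta_compose:
  assumes "norm x < 1" "x \<noteq> 0" "isCont \<phi> z" "\<phi> z \<noteq> 0" shows "isCont (\<lambda>z. theta (\<phi> z) x) z"
  using isCont_o2[OF assms(3) theta_isCont[OF assms(1,2,4)]] .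

lemma mult_dom:
  assumes "z \<in> dom" shows "q * z \<in> dom" "p * z \<in> dom" "q * z \<noteq> 1" "p * z \<noteq> 1"
proof -
  have 1: "norm (q * z) < 1" "norm (p * z) < 1" using assms by (auto simp: dom_def norm_mult mult.commute)
  have "z \<noteq> 0" using assms by (simp add: dom_def)
  then show "q * z \<in> dom" "p * z \<in> dom" using 1 p q by (simp_all add: dom_unit)
  show "q * z \<noteq> 1" "p * z \<noteq> 1" using 1 by auto
qed

text \<open>In a punctured neighbourhood of each point of \<open>dom\<close>, \<open>gam\<close> and
  \<open>raw\<close> agree and \<open>raw\<close> is free of default values; both sides are
  continuous at the point. The p-shift, the period and the reflection follow the same
  scheme.\<close>

lemma gam_shift_q:
  assumes "z \<in> dom" "z \<noteq> 1" shows "gam (q * z) (m + 1) = theta_p z m * gam z m"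
proof (rule eventually_eq_imp_eq[where f = "\<lambda>z. gam (q * z) (m + 1)" and g = "\<lambda>z. theta_p z m * gam z m"])
  have z0: "z \<noteq> 0" using assms by (auto simp: dom_def)
  have "eventually (\<lambda>w. q * w \<noteq> q * z) (at z)" using eventually_neq_at_within[of z z UNIV] q by simp
  then have "eventually (\<lambda>w. raw (q * w) (m + 1) = gam (q * w) (m + 1)) (at z)"
    by (intro raw_gam_compose) (use mult_dom[OF assms(1)] in auto)
  then show "eventually (\<lambda>w. gam (q * w) (m + 1) = theta_p w m * gam w m) (at z)"
    using raw_gam[OF assms(1), of m] good_eventually[OF z0, of m]
    by eventually_elim (use raw_shift_q in simp)
  show "isCont (\<lambda>w. gam (q * w) (m + 1)) z"
    by (intro isCont_gam_compose) (use mult_dom[OF assms(1)] in auto)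
  show "isCont (\<lambda>w. theta_p w m * gam w m) z"
    unfolding theta_p_def
    by (intro continuous_intros isCont_theta_compose gam_isCont norms) (use assms z0 p in auto)
qed

lemma gam_shift_p:
  assumes "z \<in> dom" "z \<noteq> 1" shows "gam (p * z) (m - 1) = theta_q z m * gam z m"
proof (rule eventually_eq_imp_eq[where f = "\<lambda>z. gam (p * z) (m - 1)" and g = "\<lambda>z. theta_q z m * gam z m"])
  have z0: "z \<noteq> 0" using assms by (auto simp: dom_def)
  have "eventually (\<lambda>w. p * w \<noteq> p * z) (at z)" using eventually_neq_at_within[of z z UNIV] p by simp
  then have "eventually (\<lambda>w. raw (p * w) (m - 1) = gam (p * w) (m - 1)) (at z)"
    by (intro raw_gam_compose) (use mult_dom[OF assms(1)] in auto)
  then show "eventually (\<lambda>w. gam (p * w) (m - 1) = theta_q w m * gam w m) (at z)"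
    using raw_gam[OF assms(1), of m] good_eventually[OF z0, of m]
    by eventually_elim (use raw_shift_p in simp)
  show "isCont (\<lambda>w. gam (p * w) (m - 1)) z"
    by (intro isCont_gam_compose) (use mult_dom[OF assms(1)] in auto)
  show "isCont (\<lambda>w. theta_q w m * gam w m) z"
    unfolding theta_q_def
    by (intro continuous_intros isCont_theta_compose gam_isCont norms) (use assms z0 q in auto)
qed

lemma gam_period:
  assumes "z \<in> dom" "z \<noteq> 1" shows "gam z (m + int r) = cper z m * gam z m"
proof (rule eventually_eq_imp_eq[where f = "\<lambda>z. gam z (m + int r)" and g = "\<lambda>z. cper z m * gam z m"])
  have z0: "z \<noteq> 0" using assms by (auto simp: dom_def)
  show "eventually (\<lambda>w. gam w (m + int r) = cper w m * gam w m) (at z)"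
    using raw_gam[OF assms(1), of m] raw_gam[OF assms(1), of "m + int r"] raw_period_eventually[OF z0, of m]
    by eventually_elim simp
  show "isCont (\<lambda>w. gam w (m + int r)) z" using gam_isCont assms by blast
  show "isCont (\<lambda>w. cper w m * gam w m) z"
    by (intro continuous_intros gam_isCont holomorphic_isCont_dom cper_holomorphic assms)
qed

lemma gam_reflect:
  assumes z: "z \<in> dom" "z \<noteq> 1" and z': "norm (p * q) < norm z"
  shows "gam z m * gam (p * q / z) (- m) = 1"
proof (rule eventually_eq_imp_eq[where f = "\<lambda>z. gam z m * gam (p * q / z) (- m)" and g = "\<lambda>_. 1"])
  have z0: "z \<noteq> 0" using z by (auto simp: dom_def)
  let ?\<phi> = "\<lambda>w. p * q / w"
  have small: "norm (?\<phi> z) < 1" using z' z0 by (simp add: norm_divide)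
  then have d: "?\<phi> z \<in> dom" "?\<phi> z \<noteq> 1" using z0 p q by (auto intro!: dom_unit)
  have c: "isCont ?\<phi> z" using z0 by (intro continuous_intros)
  have ne: "eventually (\<lambda>w. ?\<phi> w \<noteq> ?\<phi> z) (at z)"
    using eventually_neq_at_within[of z z UNIV] eventually_neq_at_within[of 0 z UNIV]
    by eventually_elim (use z0 p q in \<open>auto simp: field_simps\<close>)
  have d0: "?\<phi> z \<noteq> 0" using d by (auto simp: dom_def)
  have e1: "eventually (\<lambda>w. good (?\<phi> w) (- m)) (at z)"
    by (rule eventually_compose_at[OF good_eventually[OF d0] c ne])
  have e2: "eventually (\<lambda>w. theta (?\<phi> w * p powi (- m)) (p * q) \<noteq> 0) (at z)"
    by (rule eventually_compose_at[OF _ c ne])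
       (use theta_nonzero_eventually[OF norms(5,6), of "p powi (- m)" 1 "?\<phi> z"] d0 p in \<open>simp add: mult.commute\<close>)
  have e3: "eventually (\<lambda>w. qpoch2 (?\<phi> w * p powi (int r - m)) (p ^ r) (p * q) \<noteq> 0) (at z)"
    by (rule eventually_compose_at[OF _ c ne])
       (use entire_nonzero_eventually(1)[OF qpoch2_holomorphic[OF norms(1,5)] qpoch2_0 _ d0, of "p powi (int r - m)"] p in \<open>simp add: mult.commute\<close>)
  have e4: "eventually (\<lambda>w. qpoch2 (?\<phi> w * q powi m) (q ^ r) (p * q) \<noteq> 0) (at z)"
    by (rule eventually_compose_at[OF _ c ne])
       (use entire_nonzero_eventually(1)[OF qpoch2_holomorphic[OF norms(3,5)] qpoch2_0 _ d0, of "q powi m"] q in \<open>simp add: mult.commute\<close>)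
  show "eventually (\<lambda>w. gam w m * gam (?\<phi> w) (- m) = 1) (at z)"
    using raw_gam[OF z(1), of m] raw_gam_compose[OF c d(1) ne, of "- m"] good_eventually[OF z0, of m] e1 e2 e3 e4
    by eventually_elim (use raw_reflect in metis)
  show "isCont (\<lambda>w. gam w m * gam (?\<phi> w) (- m)) z"
    by (intro continuous_intros gam_isCont isCont_gam_compose z c d)
qed auto

lemma gam_nonzero:
  assumes "z \<in> dom" "z \<noteq> 1" "norm (p * q) < norm z" shows "gam z m \<noteq> 0"
  using gam_reflect[OF assms, of m] by auto

text \<open>The kernel: the value of \<open>1 / (gam x m * gam (1 / x) (- m))\<close>, entire in \<open>x \<noteq> 0\<close>.\<close>
definition ker :: "complex \<Rightarrow> int \<Rightarrow> complex" where
  "ker x m = (p * q) powi (m * (m - 1) div 2) * theta (x * p powi m) (p ^ r) * theta (q powi m / x) (q ^ r)"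

lemma ker_exp: "ker (exp x) m = exp (of_int m * (of_int m - 1) / 2 * (lp + lq))
   * theta (exp (x + of_int m * lp)) (p ^ r) * theta (exp (of_int m * lq - x)) (q ^ r)"
  unfolding ker_def pq p_powi q_powi exp_power_int of_int_choose2 by (simp add: exp_add exp_diff)

lemma ker_theta_p_theta_q:
  assumes "x \<noteq> 0" shows "ker x m = theta_p (1 / x) (- m) * theta_q (q / x) (1 - m)"
proof -
  define y where "y = Ln x"
  have x: "x = exp y" using assms by (simp add: y_def)
  have qx: "q / x = exp (lq - y)" "1 / x = exp (- y)" by (simp_all add: x exp_diff exp_minus divide_inverse)
  have a: "theta (exp (- y - of_int m * lp)) (p ^ r) = exp (- y - of_int m * lp + \<i> * pi) * theta (exp (y + of_int m * lp)) (p ^ r)"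
    using theta_inverse[OF norms(1,2), of "exp (y + of_int m * lp)"]
    by (simp add: exp_add exp_diff exp_minus field_simps)
  have b: "theta (exp (lq - y + (of_nat r - (1 - of_int m)) * lq)) (q ^ r) = exp (y - of_int m * lq + \<i> * pi) * theta (exp (of_int m * lq - y)) (q ^ r)"
  proof -
    have "exp (lq - y + (of_nat r - (1 - of_int m)) * lq) = exp (of_int m * lq - y) * q ^ r"
      by (simp add: qr algebra_simps flip: exp_add)
    then show ?thesis using theta_shift[OF norms(3,4), of "exp (of_int m * lq - y)"]
      by (simp add: exp_add exp_diff exp_minus field_simps)
  qed
  have e: "- of_int m * (- y + \<i> * pi) + of_int m * (of_int m + 1) / 2 * lp
      + (- y - of_int m * lp + \<i> * pi) + (of_int m * (lq - y + \<i> * pi) + (1 - of_int m) * (- of_int m) / 2 * lq)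
      + (y - of_int m * lq + \<i> * pi)
      = of_int m * (of_int m - 1) / 2 * (lp + lq) + 2 * of_int 1 * (\<i> * pi)"
    by (simp add: field_simps)
  have "theta_p (1 / x) (- m) * theta_q (q / x) (1 - m) =
     exp (- of_int m * (- y + \<i> * pi) + of_int m * (of_int m + 1) / 2 * lp
      + (- y - of_int m * lp + \<i> * pi) + (of_int m * (lq - y + \<i> * pi) + (1 - of_int m) * (- of_int m) / 2 * lq)
      + (y - of_int m * lq + \<i> * pi)) * theta (exp (y + of_int m * lp)) (p ^ r) * theta (exp (of_int m * lq - y)) (q ^ r)"
  proof -
    have "theta_p (exp (- y)) (- m) = exp (- of_int m * (- y + \<i> * pi) + of_int m * (of_int m + 1) / 2 * lp)
        * theta (exp (- y - of_int m * lp)) (p ^ r)"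
      using theta_p_exp[of "- y" "- m"] by (simp add: algebra_simps)
    moreover have "theta_q (exp (lq - y)) (1 - m) = exp (of_int m * (lq - y + \<i> * pi) + (1 - of_int m) * (- of_int m) / 2 * lq)
        * theta (exp (lq - y + (of_nat r - (1 - of_int m)) * lq)) (q ^ r)"
      using theta_q_exp[of "lq - y" "1 - m"] by simp
    ultimately show ?thesis unfolding qx a b by (simp only: exp_add mult_ac)
  qed
  also have "\<dots> = ker x m"
    unfolding x ker_exp exp_eq_exp_2pi[OF e] ..
  finally show ?thesis ..
qed

text \<open>A q-shift followed by a p-shift leads from (1 / x, - m) to (p q / x, - m) at the cost of
  the two theta factors in the kernel, and gam (p q / x) (- m) is the inverse of gam x m by
  reflection.\<close>

lemma ker_eq:
  assumes x: "x \<in> dom" "1 / x \<in> dom" "x \<noteq> 1"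
  shows "gam x m * gam (1 / x) (- m) * ker x m = 1"
proof -
  have x0: "x \<noteq> 0" using x by (auto simp: dom_def)
  have "norm (p * q) < norm x"
  proof -
    have "norm p < norm x" using x x0 by (auto simp: dom_def norm_divide field_simps)
    moreover have "norm p * norm q \<le> norm p * 1" using q by (intro mult_left_mono) auto
    ultimately show ?thesis by (simp add: norm_mult)
  qed
  then have *: "gam x m * gam (p * q / x) (- m) = 1" by (intro gam_reflect x)
  have "gam (q * (1 / x)) (- m + 1) = theta_p (1 / x) (- m) * gam (1 / x) (- m)"
    by (rule gam_shift_q) (use x x0 in auto)
  moreover have "gam (p * (q * (1 / x))) (1 - m - 1) = theta_q (q * (1 / x)) (1 - m) * gam (q * (1 / x)) (1 - m)"
    by (rule gam_shift_p) (use mult_dom[OF x(2)] in auto)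
  ultimately have "gam (p * q / x) (- m) = theta_q (q / x) (1 - m) * (theta_p (1 / x) (- m) * gam (1 / x) (- m))"
    by (simp add: mult_ac)
  then show ?thesis using * unfolding ker_theta_p_theta_q[OF x0] by (simp add: mult_ac)
qed

end

section \<open>Integrals over the unit circle\<close>

definition circ :: "(complex \<Rightarrow> complex) \<Rightarrow> complex" where
  "circ F = contour_integral (circlepath 0 1) (\<lambda>z. F z / z)"

lemma circlepath_integrable:
  assumes "continuous_on (sphere 0 R) F" "R > 0"
  shows "F contour_integrable_on circlepath 0 R"
  by (rule contour_integrable_continuous_circlepath) (use assms in simp)

lemma circ_integrable:
  assumes "continuous_on (sphere 0 1) F"
  shows "(\<lambda>z. F z / z) contour_integrable_on circlepath 0 1"
  by (intro circlepath_integrable continuous_intros assms) auto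

lemma circ_cong:
  assumes "\<And>z. norm z = 1 \<Longrightarrow> F z = G z" shows "circ F = circ G"
  unfolding circ_def by (rule contour_integral_cong) (use assms in auto)

lemma circ_add:
  "continuous_on (sphere 0 1) F \<Longrightarrow> continuous_on (sphere 0 1) G \<Longrightarrow> circ (\<lambda>z. F z + G z) = circ F + circ G"
  unfolding circ_def by (simp add: add_divide_distrib contour_integral_add circ_integrable)

lemma circ_diff:
  "continuous_on (sphere 0 1) F \<Longrightarrow> continuous_on (sphere 0 1) G \<Longrightarrow> circ (\<lambda>z. F z - G z) = circ F - circ G"
  unfolding circ_def by (simp add: diff_divide_distrib contour_integral_diff circ_integrable)

lemma circ_cmult: "continuous_on (sphere 0 1) F \<Longrightarrow> circ (\<lambda>z. c * F z) = c * circ F"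
  unfolding circ_def using contour_integral_lmul[OF circ_integrable, of F c] by simp

lemma circ_sum:
  assumes "finite A" "\<And>a. a \<in> A \<Longrightarrow> continuous_on (sphere 0 1) (F a)"
  shows "circ (\<lambda>z. \<Sum>a\<in>A. F a z) = (\<Sum>a\<in>A. circ (F a))"
  unfolding circ_def sum_divide_distrib
  by (rule contour_integral_sum) (use assms circ_integrable in auto)

lemma circlepath_integral:
  assumes "R > 0"
  shows "contour_integral (circlepath 0 R) (\<lambda>z. F z / z) =
    integral {0..1} (\<lambda>t. 2 * pi * \<i> * F (R * exp (2 * pi * \<i> * of_real t)))"
proof -
  have "contour_integral (circlepath 0 R) (\<lambda>z. F z / z) =
     integral {0..1} (\<lambda>t. F (circlepath 0 R t) / circlepath 0 R t * vector_derivative (circlepath 0 R) (at t))"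
    by (rule contour_integral_integral)
  also have "\<dots> = integral {0..1} (\<lambda>t. 2 * pi * \<i> * F (R * exp (2 * pi * \<i> * of_real t)))"
    unfolding vector_derivative_circlepath by (rule integral_cong) (use assms in \<open>simp add: circlepath\<close>)
  finally show ?thesis .
qed

text \<open>With \<open>\<Phi>\<close> a primitive of \<open>F \<circ> exp\<close> on the strip, the integral is \<open>\<Phi> (x + 2 \<pi> \<i>) - \<Phi> x\<close> with
  \<open>exp x = c\<close>, and this does not depend on \<open>x\<close>.\<close>
lemma circle_integral_dilation:
  assumes F: "F holomorphic_on {z. a < norm z \<and> norm z < b}" and a: "0 < a"
  obtains k where "\<And>c. a < norm c \<Longrightarrow> norm c < b \<Longrightarrow>
    integral {0..1} (\<lambda>t. 2 * pi * \<i> * F (c * exp (2 * pi * \<i> * of_real t))) = k"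
proof (cases "\<exists>c0::complex. a < norm c0 \<and> norm c0 < b")
  case False
  then show ?thesis using that by blast
next
  case True
  then obtain c0 :: complex where c0: "a < norm c0" "norm c0 < b" by blast
  define U where "U = {x::complex. ln a < Re x \<and> Re x < ln b}"
  have ab: "a < b" using c0 by linarith
  have U: "open U" "convex U"
  proof -
    have "U = {x. ln a < Re x} \<inter> {x. Re x < ln b}" by (auto simp: U_def)
    then show "open U" "convex U"
      by (auto intro!: open_Int convex_Int open_halfspace_Re_gt open_halfspace_Re_lt convex_halfspace_Re_gt convex_halfspace_Re_lt)
  qed
  have expU: "exp ` U \<subseteq> {z. a < norm z \<and> norm z < b}"
  proof (rule image_subsetI)
    fix x assume "x \<in> U"
    then have "exp (ln a) < exp (Re x)" "exp (Re x) < exp (ln b)" by (simp_all add: U_def)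
    then show "exp x \<in> {z. a < norm z \<and> norm z < b}" using a ab by simp
  qed
  have "(F \<circ> exp) holomorphic_on U"
    by (rule holomorphic_on_compose[OF _ holomorphic_on_subset[OF F expU]]) (intro holomorphic_intros)
  then obtain \<Phi> where \<Phi>: "\<And>x. x \<in> U \<Longrightarrow> (\<Phi> has_field_derivative F (exp x)) (at x)"
    using holomorphic_convex_primitive'[OF U(2,1)] by (metis U(1) at_within_open comp_apply)
  have sh: "x + 2 * pi * \<i> * of_real t \<in> U \<longleftrightarrow> x \<in> U" for x t by (auto simp: U_def)
  have "\<exists>k. \<forall>x\<in>U. \<Phi> (x + 2 * pi * \<i>) - \<Phi> x = k"
  proof (rule has_field_derivative_zero_constant[OF U(2)])
    fix x assume x: "x \<in> U"
    have "((\<lambda>x. \<Phi> (x + 2 * pi * \<i>)) has_field_derivative F (exp (x + 2 * pi * \<i>)) * 1) (at x)"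
      by (rule DERIV_chain2[where f = \<Phi>]) (use \<Phi> sh[of x 1] x in \<open>auto intro!: derivative_eq_intros\<close>)
    then have "((\<lambda>x. \<Phi> (x + 2 * pi * \<i>) - \<Phi> x) has_field_derivative F (exp (x + 2 * pi * \<i>)) * 1 - F (exp x)) (at x)"
      by (intro derivative_intros \<Phi> x)
    then show "((\<lambda>x. \<Phi> (x + 2 * pi * \<i>) - \<Phi> x) has_field_derivative 0) (at x within U)"
      by (simp add: exp_add has_field_derivative_at_within)
  qed
  then obtain k where k: "\<And>x. x \<in> U \<Longrightarrow> \<Phi> (x + 2 * pi * \<i>) - \<Phi> x = k" by blast
  show ?thesis
  proof (rule that)
    fix c :: complex assume c: "a < norm c" "norm c < b"
    define x where "x = Ln c"
    have c0: "c \<noteq> 0" using c a by auto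
    then have x: "exp x = c" by (simp add: x_def)
    have xU: "x \<in> U" using c a c0 by (simp add: x_def U_def)
    have "((\<lambda>t. 2 * pi * \<i> * F (c * exp (2 * pi * \<i> * of_real t))) has_integral \<Phi> (x + 2 * pi * \<i> * of_real 1) - \<Phi> (x + 2 * pi * \<i> * of_real 0)) {0..1}"
    proof (rule fundamental_theorem_of_calculus)
      fix t :: real assume "t \<in> {0..1}"
      have "((\<lambda>t. \<Phi> (x + 2 * pi * \<i> * t)) has_field_derivative F (exp (x + 2 * pi * \<i> * of_real t)) * (2 * pi * \<i>)) (at (of_real t))"
        by (rule DERIV_chain2[where f = \<Phi>]) (use \<Phi> sh[of x t] xU in \<open>auto intro!: derivative_eq_intros\<close>)
      then have "((\<lambda>t. \<Phi> (x + 2 * pi * \<i> * of_real t)) has_vector_derivative F (exp (x + 2 * pi * \<i> * of_real t)) * (2 * pi * \<i>)) (at t)"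
        by (rule has_vector_derivative_real_field)
      then show "((\<lambda>t. \<Phi> (x + 2 * pi * \<i> * of_real t)) has_vector_derivative 2 * pi * \<i> * F (c * exp (2 * pi * \<i> * of_real t))) (at t within {0..1})"
        by (simp add: exp_add x mult_ac has_vector_derivative_at_within)
    qed auto
    then show "integral {0..1} (\<lambda>t. 2 * pi * \<i> * F (c * exp (2 * pi * \<i> * of_real t))) = k"
      by (subst integral_unique, assumption) (use k[OF xU] in simp)
  qed
qed

text \<open>The factor c may be complex, because the dilation needed for the difference equation is
  by 1 / q.\<close>

lemma circ_dilation:
  assumes F: "F holomorphic_on {z. a < norm z \<and> norm z < b}" and a: "0 < a" "a < 1" "1 < b"
    and c: "a < norm c" "norm c < b"
  shows "circ (\<lambda>z. F (c * z)) = circ F"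
proof -
  obtain k where k: "\<And>c. a < norm c \<Longrightarrow> norm c < b \<Longrightarrow>
    integral {0..1} (\<lambda>t. 2 * pi * \<i> * F (c * exp (2 * pi * \<i> * of_real t))) = k"
    using circle_integral_dilation[OF F a(1)] by blast
  have "circ (\<lambda>z. F (c * z)) = integral {0..1} (\<lambda>t. 2 * pi * \<i> * F (c * exp (2 * pi * \<i> * of_real t)))"
    unfolding circ_def using circlepath_integral[of 1 "\<lambda>z. F (c * z)"] by simp
  moreover have "circ F = integral {0..1} (\<lambda>t. 2 * pi * \<i> * F (1 * exp (2 * pi * \<i> * of_real t)))"
    unfolding circ_def using circlepath_integral[of 1 F] by simp
  ultimately show ?thesis using k[OF c] k[of 1] a by simp
qed

lemma circlepath_radius:
  assumes F: "F holomorphic_on {z. a < norm z \<and> norm z < b}" and a: "0 < a" "a < 1" "1 < b"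
    and R: "a < R" "R < b"
  shows "contour_integral (circlepath 0 R) (\<lambda>z. F z / z) = circ F"
proof -
  obtain k where k: "\<And>c. a < norm c \<Longrightarrow> norm c < b \<Longrightarrow>
    integral {0..1} (\<lambda>t. 2 * pi * \<i> * F (c * exp (2 * pi * \<i> * of_real t))) = k"
    using circle_integral_dilation[OF F a(1)] by blast
  have "circ F = integral {0..1} (\<lambda>t. 2 * pi * \<i> * F (1 * exp (2 * pi * \<i> * of_real t)))"
    unfolding circ_def using circlepath_integral[of 1 F] by simp
  moreover have "contour_integral (circlepath 0 R) (\<lambda>z. F z / z) = integral {0..1} (\<lambda>t. 2 * pi * \<i> * F (R * exp (2 * pi * \<i> * of_real t)))"
    using circlepath_integral[of R F] R a by simp
  ultimately show ?thesis using k[of 1] k[of "of_real R"] a R by simp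
qed

lemma circ_swap:
  assumes "continuous_on (sphere 0 1 \<times> sphere 0 1) (\<lambda>(z, w). F z w)"
  shows "circ (\<lambda>z. circ (\<lambda>w. F z w)) = circ (\<lambda>w. circ (\<lambda>z. F z w))"
proof -
  have vc: "continuous_on {0..1} (\<lambda>t. vector_derivative (circlepath 0 1) (at t))"
    by (simp add: vector_derivative_circlepath) (intro continuous_intros)
  have c: "continuous_on (sphere 0 1 \<times> sphere 0 1) (\<lambda>(z, w). F z w / (z * w))"
  proof -
    have "continuous_on (sphere 0 1 \<times> sphere 0 1) (\<lambda>x. (\<lambda>(z, w). F z w) x / (fst x * snd x))"
      by (intro continuous_intros assms) auto
    then show ?thesis by (simp add: case_prod_unfold)
  qed
  have cz: "continuous_on (sphere 0 1) (\<lambda>w. F z w)" if "norm z = 1" for z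
  proof -
    have "continuous_on (sphere 0 1) (\<lambda>w. (\<lambda>(z, w). F z w) (z, w))"
      by (rule continuous_on_compose2[OF assms]) (use that in \<open>auto intro!: continuous_intros\<close>)
    then show ?thesis by simp
  qed
  have cw: "continuous_on (sphere 0 1) (\<lambda>z. F z w)" if "norm w = 1" for w
  proof -
    have "continuous_on (sphere 0 1) (\<lambda>z. (\<lambda>(z, w). F z w) (z, w))"
      by (rule continuous_on_compose2[OF assms]) (use that in \<open>auto intro!: continuous_intros\<close>)
    then show ?thesis by simp
  qed
  have "circ (\<lambda>z. circ (\<lambda>w. F z w)) = contour_integral (circlepath 0 1) (\<lambda>z. contour_integral (circlepath 0 1) (\<lambda>w. F z w / (z * w)))"
    unfolding circ_def
  proof (rule contour_integral_cong)
    fix z :: complex assume "z \<in> path_image (circlepath 0 1)"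
    then have "norm z = 1" by auto
    from contour_integral_lmul[OF circ_integrable[OF cz[OF this]], of "1 / z"]
    show "contour_integral (circlepath 0 1) (\<lambda>w. F z w / w) / z = contour_integral (circlepath 0 1) (\<lambda>w. F z w / (z * w))"
      by (simp add: field_simps)
  qed auto
  also have "\<dots> = contour_integral (circlepath 0 1) (\<lambda>w. contour_integral (circlepath 0 1) (\<lambda>z. F z w / (z * w)))"
    by (rule contour_integral_swap) (use c vc in auto)
  also have "\<dots> = circ (\<lambda>w. circ (\<lambda>z. F z w))"
    unfolding circ_def
  proof (rule contour_integral_cong)
    fix w :: complex assume "w \<in> path_image (circlepath 0 1)"
    then have "norm w = 1" by auto
    from contour_integral_lmul[OF circ_integrable[OF cw[OF this]], of "1 / w"]
    show "contour_integral (circlepath 0 1) (\<lambda>z. F z w / (z * w)) = contour_integral (circlepath 0 1) (\<lambda>z. F z w / z) / w"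
      by (simp add: field_simps)
  qed auto
  finally show ?thesis .
qed

lemma circlepath_param_continuous:
  assumes R: "R > 0" and c: "continuous_on (U \<times> sphere 0 R) (\<lambda>(y, z). F y z)"
  shows "continuous_on U (\<lambda>y. contour_integral (circlepath 0 R) (\<lambda>z. F y z / z))"
proof -
  have "continuous_on (U \<times> cbox 0 1) (\<lambda>x. (\<lambda>(y, z). F y z) (fst x, R * exp (2 * pi * \<i> * of_real (snd x))))"
    by (rule continuous_on_compose2[OF c]) (use R in \<open>auto intro!: continuous_intros simp: norm_mult\<close>)
  then have "continuous_on (U \<times> cbox 0 1) (\<lambda>(y, t::real). 2 * pi * \<i> * F y (R * exp (2 * pi * \<i> * of_real t)))"
    unfolding case_prod_unfold fst_conv snd_conv by (intro continuous_intros)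
  from integral_continuous_on_param[OF this] show ?thesis
    using R by (simp add: circlepath_integral)
qed

lemma circ_param_continuous:
  "continuous_on (U \<times> sphere 0 1) (\<lambda>(y, z). F y z) \<Longrightarrow> continuous_on U (\<lambda>y. circ (F y))"
  unfolding circ_def using circlepath_param_continuous[of 1 U F] by simp

text \<open>Morera's theorem: the integral over a triangle is exchanged with the circle integral,
  and the inner triangle integral vanishes by Cauchy's theorem.\<close>

lemma circ_param_holomorphic:
  assumes U: "open U" and c: "continuous_on (U \<times> sphere 0 1) (\<lambda>(y, z). F y z)"
    and hol: "\<And>z. norm z = 1 \<Longrightarrow> (\<lambda>y. F y z) holomorphic_on U"
  shows "(\<lambda>y. circ (F y)) holomorphic_on U"
proof -
  have cont: "continuous_on U (\<lambda>y. circ (F y))" by (rule circ_param_continuous[OF c])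
  have vc: "continuous_on {0..1} (\<lambda>t. vector_derivative (circlepath 0 1) (at t))"
    by (simp add: vector_derivative_circlepath) (intro continuous_intros)
  have c': "continuous_on (U \<times> sphere 0 1) (\<lambda>(y, z). F y z / z)"
  proof -
    have "continuous_on (U \<times> sphere 0 1) (\<lambda>x. (\<lambda>(z, w). F z w) x / snd x)"
      by (intro continuous_intros c) auto
    then show ?thesis by (simp add: case_prod_unfold)
  qed
  have sw: "contour_integral (linepath a b) (\<lambda>y. circ (F y)) = circ (\<lambda>z. contour_integral (linepath a b) (\<lambda>y. F y z))"
    if "closed_segment a b \<subseteq> U" for a b
  proof -
    have "contour_integral (linepath a b) (\<lambda>y. circ (F y)) =
       contour_integral (circlepath 0 1) (\<lambda>z. contour_integral (linepath a b) (\<lambda>y. F y z / z))"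
      unfolding circ_def
      by (rule contour_integral_swap) (use vc that in \<open>auto intro!: continuous_on_subset[OF c']\<close>)
    also have "\<dots> = circ (\<lambda>z. contour_integral (linepath a b) (\<lambda>y. F y z))"
      unfolding circ_def
    proof (rule contour_integral_cong)
      fix z :: complex assume "z \<in> path_image (circlepath 0 1)"
      then have z: "norm z = 1" by auto
      have "(\<lambda>y. F y z) contour_integrable_on linepath a b"
        by (intro contour_integrable_continuous_linepath continuous_on_subset[OF holomorphic_on_imp_continuous_on[OF hol[OF z]]] that)
      from contour_integral_lmul[OF this, of "1 / z"]
      show "contour_integral (linepath a b) (\<lambda>y. F y z / z) = contour_integral (linepath a b) (\<lambda>y. F y z) / z"
        by simp
    qed auto
    finally show ?thesis .
  qed
  have "(\<lambda>y. circ (F y)) analytic_on U"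
  proof (rule Morera_triangle[OF cont U], rule impI)
    fix a b d :: complex assume sub: "convex hull {a, b, d} \<subseteq> U"
    have seg: "closed_segment a b \<subseteq> convex hull {a, b, d}" "closed_segment b d \<subseteq> convex hull {a, b, d}" "closed_segment d a \<subseteq> convex hull {a, b, d}"
      unfolding segment_convex_hull by (intro hull_mono; auto)+
    have cs: "continuous_on (sphere 0 1) (\<lambda>z. contour_integral (linepath a b) (\<lambda>y. F y z))" if "closed_segment a b \<subseteq> U" for a b
    proof -
      have "continuous_on (sphere 0 1 \<times> cbox 0 1) (\<lambda>x. (\<lambda>(y, z). F y z) (linepath a b (snd x), fst x))"
      proof (rule continuous_on_compose2[OF c])
        show "(\<lambda>x. (linepath a b (snd x), fst x)) ` (sphere 0 1 \<times> cbox 0 1) \<subseteq> U \<times> sphere 0 1"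
          using that linepath_in_path by fastforce
      qed (auto simp: linepath_def intro!: continuous_intros)
      then have "continuous_on (sphere 0 1 \<times> cbox 0 1) (\<lambda>(z, t::real). F (linepath a b t) z * (b - a))"
        unfolding case_prod_unfold fst_conv snd_conv by (intro continuous_intros)
      from integral_continuous_on_param[OF this] show ?thesis
        by (simp add: contour_integral_integral)
    qed
    have "circ (\<lambda>z. contour_integral (linepath a b) (\<lambda>y. F y z)) + circ (\<lambda>z. contour_integral (linepath b d) (\<lambda>y. F y z))
        + circ (\<lambda>z. contour_integral (linepath d a) (\<lambda>y. F y z))
      = circ (\<lambda>z. contour_integral (linepath a b) (\<lambda>y. F y z) + contour_integral (linepath b d) (\<lambda>y. F y z)
        + contour_integral (linepath d a) (\<lambda>y. F y z))"
      using seg sub by (simp add: circ_add continuous_on_add cs)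
    also have "\<dots> = circ (\<lambda>z. 0)"
    proof (rule circ_cong)
      fix z :: complex assume z: "norm z = 1"
      have "((\<lambda>y. F y z) has_contour_integral 0) (linepath a b +++ linepath b d +++ linepath d a)"
        by (rule Cauchy_theorem_triangle[OF holomorphic_on_subset[OF hol[OF z] sub]])
      moreover have "(\<lambda>y. F y z) contour_integrable_on linepath u v" if "closed_segment u v \<subseteq> U" for u v
        by (intro contour_integrable_continuous_linepath continuous_on_subset[OF holomorphic_on_imp_continuous_on[OF hol[OF z]]] that)
      ultimately show "contour_integral (linepath a b) (\<lambda>y. F y z) + contour_integral (linepath b d) (\<lambda>y. F y z)
        + contour_integral (linepath d a) (\<lambda>y. F y z) = 0"
        using seg sub by (auto dest!: contour_integral_unique simp: add.assoc subset_trans contour_integrable_join)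
    qed
    also have "\<dots> = 0" by (simp add: circ_def)
    finally show "contour_integral (linepath a b) (\<lambda>y. circ (F y)) + contour_integral (linepath b d) (\<lambda>y. circ (F y)) +
        contour_integral (linepath d a) (\<lambda>y. circ (F y)) = 0"
      using seg sub by (simp add: sw subset_trans)
  qed
  then show ?thesis by (rule analytic_imp_holomorphic)
qed

section \<open>The difference equation of the rarefied elliptic beta integrand\<close>

context rarefied
begin

text \<open>The part of the kernel with nome q^r, with its own power of z. The theta identity acts
  in nome p^r only, so this part is carried along into the telescoping function.\<close>

definition bq :: "int \<Rightarrow> complex \<Rightarrow> int \<Rightarrow> complex" where
  "bq \<epsilon> z m = z powi (- 2 * (2 * m + \<epsilon>) - 1) * q powi ((2 * m + \<epsilon>) * (2 * m + \<epsilon> - 1) div 2)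
     * theta (q powi (2 * m + \<epsilon>) / z\<^sup>2) (q ^ r)"

lemma bq_exp: "bq \<epsilon> (exp y) m = exp ((- 2 * (2 * of_int m + of_int \<epsilon>) - 1) * y
     + (2 * of_int m + of_int \<epsilon>) * (2 * of_int m + of_int \<epsilon> - 1) / 2 * lq)
     * theta (exp ((2 * of_int m + of_int \<epsilon>) * lq - 2 * y)) (q ^ r)"
proof -
  have "exp y ^ 2 = exp (2 * y)" by (simp add: exp_double)
  then show ?thesis
    unfolding bq_def q_powi exp_power_int of_int_choose2 by (simp add: exp_add exp_diff)
qed

lemma theta_neg: "theta (exp (- u)) x = exp (\<i> * pi - u) * theta (exp u) x" if "norm x < 1" "x \<noteq> 0"
  using theta_inverse[OF that, of "exp u"] by (simp add: exp_diff exp_minus exp_add field_simps)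

lemma theta_shift_exp: "theta (exp (u + of_nat r * lq)) (q ^ r) = exp (\<i> * pi - u) * theta (exp u) (q ^ r)"
  using theta_shift[OF norms(3,4), of "exp u"] by (simp add: exp_diff exp_add qr)

text \<open>The exponent produced by \<open>theta_p (exp (x + y)) (n + e + m)\<close>.\<close>
definition al :: "complex \<Rightarrow> complex \<Rightarrow> complex \<Rightarrow> complex \<Rightarrow> complex \<Rightarrow> complex" where
  "al e x n m y = (n + e + m) * (x + y + \<i> * pi) + (n + e + m) * (n + e + m - 1) / 2 * lp"

lemma al_expand: "al e x n m y = al e x n 0 0 + (m * x + (y + m * lp) * n + ((e + m) * y + m * (\<i> * pi) + (m * e + m * (m - 1) / 2) * lp))"
  unfolding al_def by (simp add: field_simps)

lemma al_sum:
  assumes "finite B" "card B = 4"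
  shows "(\<Sum>b\<in>B. al e (x b) (n b) m y) = (\<Sum>b\<in>B. al e (x b) (n b) 0 0) + m * (\<Sum>b\<in>B. x b)
     + (y + m * lp) * (\<Sum>b\<in>B. n b) + 4 * ((e + m) * y + m * (\<i> * pi) + (m * e + m * (m - 1) / 2) * lp)"
proof -
  have "(\<Sum>b\<in>B. al e (x b) (n b) m y) = (\<Sum>b\<in>B. al e (x b) (n b) 0 0 + (m * x b + (y + m * lp) * n b + ((e + m) * y + m * (\<i> * pi) + (m * e + m * (m - 1) / 2) * lp)))"
    by (subst al_expand) (rule refl)
  also have "\<dots> = (\<Sum>b\<in>B. al e (x b) (n b) 0 0) + (m * (\<Sum>b\<in>B. x b)
     + (y + m * lp) * (\<Sum>b\<in>B. n b) + 4 * ((e + m) * y + m * (\<i> * pi) + (m * e + m * (m - 1) / 2) * lp))"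
    using assms by (simp only: sum.distrib sum_distrib_left[symmetric] sum_constant) simp
  finally show ?thesis by (simp only: add.assoc)
qed

definition kexp :: "complex \<Rightarrow> complex \<Rightarrow> complex \<Rightarrow> complex \<Rightarrow> complex \<Rightarrow> complex \<Rightarrow> complex \<Rightarrow> complex \<Rightarrow> complex" where
  "kexp e xi ni xj nj s m y = (2 * m + e) * (2 * m + e - 1) / 2 * lp
     + ((nj - m - 1) * (xj - lq - y + \<i> * pi) + (nj - m - 1) * (nj - m - 2) / 2 * lp)
     - (lp + lq - xj - (nj + e / 2) * lp) + (xi + (ni + e / 2) * lp) - 2 * (y + (m + e / 2) * lp) - \<i> * pi
     - (al e xi ni m y + s) + (2 * (2 * m + e) + 1) * y"

text \<open>\<open>kexp\<close> is the exponent that the coefficient of the telescoping terms must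
  have, and it seems to depend on m and y. Under the balancing conditions it changes only by -6 m pi
  i, a period of exp for integer m, so the coefficient is a constant; this is what makes telescoping
  possible.\<close>

lemma kexp_const:
  assumes B: "finite B" "card B = 4" and sx: "(\<Sum>b\<in>B. x b) = lp + lq - xi - xj"
    and sn: "(\<Sum>b\<in>B. n b) = - 3 * e - ni - nj"
  shows "kexp e xi ni xj nj (\<Sum>b\<in>B. al e (x b) (n b) m y) m y =
     kexp e xi ni xj nj (\<Sum>b\<in>B. al e (x b) (n b) 0 0) 0 0 + 2 * (- 3 * m) * (\<i> * pi)"
  unfolding al_sum[OF B, of _ _ _ m y] sx sn kexp_def
  by (simp add: al_def field_simps)

text \<open>In each summand the products of x b and n b cancel, so the sum depends on the parameters
  in B only through the two balanced sums.\<close>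

lemma gamma_delta_sum:
  assumes B: "finite B" "card B = 4" and sx: "(\<Sum>b\<in>B. x b) = lp + lq - xi - xj"
    and sn: "(\<Sum>b\<in>B. n b) = - 3 * e - ni - nj"
    and xa: "xa = lp + lq - xj - (nj + e / 2) * lp"
  shows "(\<Sum>b\<in>B. ((nj - 1 + n b + e) * (xj - lq + x b + \<i> * pi) + (nj - 1 + n b + e) * (nj - 2 + n b + e) / 2 * lp)
        + (x b + (n b + e / 2) * lp - xa + \<i> * pi)
        - ((ni + n b + e) * (xi + x b + \<i> * pi) + (ni + n b + e) * (ni + n b + e - 1) / 2 * lp))
     + al e xi ni m y + al e xi ni (- m - e) (- y)
     = ((nj + e + m - 1) * (xj - lq + y + \<i> * pi) + (nj + e + m - 1) * (nj + e + m - 2) / 2 * lp)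
      + ((nj - m - 1) * (xj - lq - y + \<i> * pi) + (nj - m - 1) * (nj - m - 2) / 2 * lp) - 2 * xa
      + 2 * (1 + nj - ni) * (\<i> * pi)"
proof -
  have "(\<Sum>b\<in>B. ((nj - 1 + n b + e) * (xj - lq + x b + \<i> * pi) + (nj - 1 + n b + e) * (nj - 2 + n b + e) / 2 * lp)
        + (x b + (n b + e / 2) * lp - xa + \<i> * pi)
        - ((ni + n b + e) * (xi + x b + \<i> * pi) + (ni + n b + e) * (ni + n b + e - 1) / 2 * lp))
   = (\<Sum>b\<in>B. (nj - ni) * x b + (xj - lq - xi + (nj - ni) * lp) * n b
      + ((nj - 1 + e) * (xj - lq + \<i> * pi) - (ni + e) * (xi + \<i> * pi) + ((nj - 1 + e) * (nj - 2 + e) - (ni + e) * (ni + e - 1)) / 2 * lp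
        + e / 2 * lp - xa + \<i> * pi))"
    by (rule sum.cong) (simp_all add: field_simps)
  also have "\<dots> = (nj - ni) * (\<Sum>b\<in>B. x b) + (xj - lq - xi + (nj - ni) * lp) * (\<Sum>b\<in>B. n b)
      + 4 * ((nj - 1 + e) * (xj - lq + \<i> * pi) - (ni + e) * (xi + \<i> * pi) + ((nj - 1 + e) * (nj - 2 + e) - (ni + e) * (ni + e - 1)) / 2 * lp
        + e / 2 * lp - xa + \<i> * pi)"
    using B by (simp only: sum.distrib sum_distrib_left[symmetric] sum_constant) simp
  finally show ?thesis unfolding sx sn
    by (rule ssubst) (simp add: al_def xa field_simps)
qed

text \<open>The theta quotient comes from \<open>theta_identity\<close> divided by its product of
  theta (T t b); the exponential is \<open>kexp\<close> evaluated at m = 0, y = 0, as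
  \<open>kexp_const\<close> permits.\<close>

definition kap :: "int \<Rightarrow> nat \<Rightarrow> nat \<Rightarrow> nat set \<Rightarrow> (nat \<Rightarrow> complex) \<Rightarrow> (nat \<Rightarrow> int) \<Rightarrow> complex" where
  "kap \<epsilon> i j B x n =
     theta (exp (x i + (of_int (n i) + of_int \<epsilon> / 2) * lp + (lp + lq - x j - (of_int (n j) + of_int \<epsilon> / 2) * lp))) (p ^ r)
     / (\<Prod>b\<in>B. theta (exp (x i + (of_int (n i) + of_int \<epsilon> / 2) * lp + (x b + (of_int (n b) + of_int \<epsilon> / 2) * lp))) (p ^ r))
     * exp (kexp (of_int \<epsilon>) (x i) (of_int (n i)) (x j) (of_int (n j)) (\<Sum>b\<in>B. al (of_int \<epsilon>) (x b) (of_int (n b)) 0 0) 0 0)"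

lemma theta_p_al: "theta_p (exp (x + y)) (n + \<epsilon> + m) = exp (al (of_int \<epsilon>) x (of_int n) (of_int m) y)
   * theta (exp (x + (of_int n + of_int \<epsilon> / 2) * lp + (y + (of_int m + of_int \<epsilon> / 2) * lp))) (p ^ r)"
proof -
  have *: "x + y + of_int (n + \<epsilon> + m) * lp = x + (of_int n + of_int \<epsilon> / 2) * lp + (y + (of_int m + of_int \<epsilon> / 2) * lp)"
    by (simp add: field_simps)
  show ?thesis unfolding theta_p_exp al_def * by simp
qed

lemma theta_p_al': "theta_p (exp (x - y)) (n - m) = exp (al (of_int \<epsilon>) x (of_int n) (- of_int m - of_int \<epsilon>) (- y))
   * theta (exp (x + (of_int n + of_int \<epsilon> / 2) * lp - (y + (of_int m + of_int \<epsilon> / 2) * lp))) (p ^ r)"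
proof -
  have *: "x - y + of_int (n - m) * lp = x + (of_int n + of_int \<epsilon> / 2) * lp - (y + (of_int m + of_int \<epsilon> / 2) * lp)"
    by (simp add: field_simps)
  have **: "of_int n + of_int \<epsilon> + (- of_int m - of_int \<epsilon>) = (of_int (n - m) :: complex)" by simp
  show ?thesis unfolding theta_p_exp al_def * ** by simp
qed

text \<open>This is \<open>theta_identity\<close> in nome p^r, multiplied by the part of the kernel
  with nome q^r. The discrete variables enter as powers of p in the arguments; the offsets by half
  of \<epsilon> make (y, m) -> (- y, - m - \<epsilon>) the reflection Y -> - Y. The remaining work
  is to match the exponential prefactors.\<close>

lemma shift_theta_relation:
  assumes B: "finite B" "card B = 4" and ij: "i \<notin> B"
    and sx: "(\<Sum>b\<in>B. x b) = lp + lq - x i - x j" and sn: "(\<Sum>b\<in>B. n b) = - 3 * \<epsilon> - n i - n j"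
    and nz: "(\<Prod>b\<in>B. theta_p (exp (x i + x b)) (n i + n b + \<epsilon>)) \<noteq> 0"
  shows "(\<Prod>b\<in>B. theta_p (exp (x j - lq + x b)) (n j - 1 + n b + \<epsilon>) / theta_p (exp (x i + x b)) (n i + n b + \<epsilon>))
       * ker (exp (2 * y)) (2 * m + \<epsilon>) * theta_p (exp (x i + y)) (n i + \<epsilon> + m) * theta_p (exp (x i - y)) (n i - m)
     - ker (exp (2 * y)) (2 * m + \<epsilon>) * theta_p (exp (x j - lq + y)) (n j - 1 + \<epsilon> + m) * theta_p (exp (x j - lq - y)) (n j - 1 - m)
     + kap \<epsilon> i j B x n * ((\<Prod>a\<in>insert i B. theta_p (exp (x a + y)) (n a + \<epsilon> + m)) * theta_p (exp (x j - lq + y)) (n j - 1 + \<epsilon> + m) * bq \<epsilon> (exp y) m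
       + (\<Prod>a\<in>insert i B. theta_p (exp (x a - y)) (n a - m)) * theta_p (exp (x j - lq - y)) (n j - 1 - m) * bq \<epsilon> (exp (- y)) (- m - \<epsilon>)) = 0"
proof -
  define e M N where "e = complex_of_int \<epsilon>" and "M = complex_of_int m" and "N = (\<lambda>b. complex_of_int (n b))"
  define X where "X = (\<lambda>b. x b + (N b + e / 2) * lp)"
  define Y where "Y = y + (M + e / 2) * lp"
  define XA where "XA = lp + lq - x j - (N j + e / 2) * lp"
  define \<mu> where "\<mu> = 2 * M + e"
  define th where "th = (\<lambda>u. theta (exp u) (p ^ r))"
  define thq where "thq = theta (exp (\<mu> * lq - 2 * y)) (q ^ r)"
  define \<beta> where "\<beta> = (N j + e + M - 1) * (x j - lq + y + \<i> * pi) + (N j + e + M - 1) * (N j + e + M - 2) / 2 * lp"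
  define \<beta>' where "\<beta>' = (N j - M - 1) * (x j - lq - y + \<i> * pi) + (N j - M - 1) * (N j - M - 2) / 2 * lp"
  define G where "G = (\<lambda>b. (N j - 1 + N b + e) * (x j - lq + x b + \<i> * pi) + (N j - 1 + N b + e) * (N j - 2 + N b + e) / 2 * lp)"
  define D where "D = (\<lambda>b. (N i + N b + e) * (x i + x b + \<i> * pi) + (N i + N b + e) * (N i + N b + e - 1) / 2 * lp)"
  define K where "K = \<mu> * (\<mu> - 1) / 2 * (lp + lq)"
  define k0 where "k0 = kexp e (x i) (N i) (x j) (N j) (\<Sum>b\<in>B. al e (x b) (N b) 0 0) 0 0"
  define \<omega> where "\<omega> = K + \<beta> + \<beta>' - 2 * XA"
  have fB: "finite B" by (rule B)
  have sN: "(\<Sum>b\<in>B. N b) = - 3 * e - N i - N j"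
    unfolding N_def e_def of_int_sum[symmetric] sn by simp
  have thneg: "th (- u) = exp (\<i> * pi - u) * th u" for u
    unfolding th_def by (rule theta_neg[OF norms(1,2)])
  have tP: "theta_p (exp (x b + y)) (n b + \<epsilon> + m) = exp (al e (x b) (N b) M y) * th (X b + Y)" for b
    unfolding theta_p_al e_def N_def M_def th_def X_def Y_def ..
  have tM: "theta_p (exp (x b - y)) (n b - m) = exp (al e (x b) (N b) (- M - e) (- y)) * th (X b - Y)" for b
    unfolding theta_p_al'[of _ _ _ _ \<epsilon>] e_def N_def M_def th_def X_def Y_def ..
  have tJ: "theta_p (exp (x j - lq + y)) (n j - 1 + \<epsilon> + m) = exp (\<beta> + Y - XA + \<i> * pi) * th (XA - Y)"
  proof -
    have "x j - lq + y + of_int (n j - 1 + \<epsilon> + m) * lp = - (XA - Y)"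
      by (simp add: XA_def Y_def N_def e_def M_def field_simps)
    moreover have "of_int (n j - 1 + \<epsilon> + m) * (x j - lq + y + \<i> * pi) + of_int (n j - 1 + \<epsilon> + m) * (of_int (n j - 1 + \<epsilon> + m) - 1) / 2 * lp = \<beta>"
      by (simp add: \<beta>_def N_def e_def M_def field_simps)
    ultimately have "theta_p (exp (x j - lq + y)) (n j - 1 + \<epsilon> + m) = exp \<beta> * th (- (XA - Y))"
      unfolding theta_p_exp th_def by simp
    also have "\<dots> = exp (\<beta> + (\<i> * pi - (XA - Y))) * th (XA - Y)"
      unfolding thneg by (simp only: exp_add mult.assoc)
    also have "\<beta> + (\<i> * pi - (XA - Y)) = \<beta> + Y - XA + \<i> * pi" by simp
    finally show ?thesis .
  qed
  have tJ': "theta_p (exp (x j - lq - y)) (n j - 1 - m) = exp (\<beta>' - Y - XA + \<i> * pi) * th (XA + Y)"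
  proof -
    have "x j - lq - y + of_int (n j - 1 - m) * lp = - (XA + Y)"
      by (simp add: XA_def Y_def N_def e_def M_def field_simps)
    moreover have "of_int (n j - 1 - m) * (x j - lq - y + \<i> * pi) + of_int (n j - 1 - m) * (of_int (n j - 1 - m) - 1) / 2 * lp = \<beta>'"
      by (simp add: \<beta>'_def N_def e_def M_def field_simps)
    ultimately have "theta_p (exp (x j - lq - y)) (n j - 1 - m) = exp \<beta>' * th (- (XA + Y))"
      unfolding theta_p_exp th_def by simp
    also have "\<dots> = exp (\<beta>' + (\<i> * pi - (XA + Y))) * th (XA + Y)"
      unfolding thneg by (simp only: exp_add mult.assoc)
    also have "\<beta>' + (\<i> * pi - (XA + Y)) = \<beta>' - Y - XA + \<i> * pi" by simp
    finally show ?thesis .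
  qed
  have tG: "theta_p (exp (x j - lq + x b)) (n j - 1 + n b + \<epsilon>) = exp (G b + (X b - XA + \<i> * pi)) * th (XA - X b)" for b
  proof -
    have "x j - lq + x b + of_int (n j - 1 + n b + \<epsilon>) * lp = - (XA - X b)"
      by (simp add: XA_def X_def N_def e_def M_def field_simps)
    moreover have "of_int (n j - 1 + n b + \<epsilon>) * (x j - lq + x b + \<i> * pi) + of_int (n j - 1 + n b + \<epsilon>) * (of_int (n j - 1 + n b + \<epsilon>) - 1) / 2 * lp = G b"
      by (simp add: G_def N_def e_def field_simps)
    ultimately have "theta_p (exp (x j - lq + x b)) (n j - 1 + n b + \<epsilon>) = exp (G b) * th (- (XA - X b))"
      unfolding theta_p_exp th_def by simp
    also have "\<dots> = exp (G b + (\<i> * pi - (XA - X b))) * th (XA - X b)"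
      unfolding thneg by (simp only: exp_add mult.assoc)
    also have "\<i> * pi - (XA - X b) = X b - XA + \<i> * pi" by simp
    finally show ?thesis .
  qed
  have tD: "theta_p (exp (x i + x b)) (n i + n b + \<epsilon>) = exp (D b) * th (X i + X b)" for b
  proof -
    have "x i + x b + of_int (n i + n b + \<epsilon>) * lp = X i + X b"
      by (simp add: X_def N_def e_def M_def field_simps)
    moreover have "of_int (n i + n b + \<epsilon>) * (x i + x b + \<i> * pi) + of_int (n i + n b + \<epsilon>) * (of_int (n i + n b + \<epsilon>) - 1) / 2 * lp = D b"
      by (simp add: D_def N_def e_def field_simps)
    ultimately show ?thesis unfolding theta_p_exp th_def by simp
  qed
  have kr: "ker (exp (2 * y)) (2 * m + \<epsilon>) = exp K * th (2 * Y) * thq"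
  proof -
    have "2 * y + of_int (2 * m + \<epsilon>) * lp = 2 * Y" "of_int (2 * m + \<epsilon>) = \<mu>"
      by (simp_all add: Y_def M_def e_def \<mu>_def field_simps)
    then show ?thesis unfolding ker_exp K_def th_def thq_def by simp
  qed
  have b1: "bq \<epsilon> (exp y) m = exp ((- 2 * \<mu> - 1) * y + \<mu> * (\<mu> - 1) / 2 * lq) * thq"
    unfolding bq_exp thq_def \<mu>_def M_def e_def ..
  have b2: "bq \<epsilon> (exp (- y)) (- m - \<epsilon>) = exp ((1 - 2 * \<mu>) * y + \<mu> * (\<mu> + 1) / 2 * lq + (\<i> * pi - (\<mu> * lq - 2 * y))) * thq"
  proof -
    have "bq \<epsilon> (exp (- y)) (- m - \<epsilon>) = exp ((1 - 2 * \<mu>) * y + \<mu> * (\<mu> + 1) / 2 * lq) * theta (exp (- (\<mu> * lq - 2 * y))) (q ^ r)"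
    proof -
      have "(- 2 * (2 * of_int (- m - \<epsilon>) + of_int \<epsilon>) - 1) * - y
         + (2 * of_int (- m - \<epsilon>) + of_int \<epsilon>) * (2 * of_int (- m - \<epsilon>) + of_int \<epsilon> - 1) / 2 * lq = (1 - 2 * \<mu>) * y + \<mu> * (\<mu> + 1) / 2 * lq"
        by (simp add: \<mu>_def M_def e_def field_simps)
      moreover have "(2 * of_int (- m - \<epsilon>) + of_int \<epsilon>) * lq - 2 * - y = - (\<mu> * lq - 2 * y)"
        by (simp add: \<mu>_def M_def e_def field_simps)
      ultimately show ?thesis unfolding bq_exp by simp
    qed
    then show ?thesis unfolding theta_neg[OF norms(3,4)] thq_def by (simp only: exp_add mult.assoc)
  qed
  define c1 c2 where "c1 = (\<Prod>b\<in>B. th (XA - X b))" and "c2 = (\<Prod>b\<in>B. th (X i + X b))"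
  have c2: "c2 \<noteq> 0" using nz unfolding tD c2_def by (simp add: prod.distrib fB)
  define NP NM where "NP = th (X i + Y) * (\<Prod>b\<in>B. th (X b + Y))" and "NM = th (X i - Y) * (\<Prod>b\<in>B. th (X b - Y))"
  \<comment> \<open>Here T = exp (X i), t b = exp (X b), a = exp XA and z = exp Y; the balancing
    conditions say that XA is X i plus the sum of the X b.\<close>
  have id: "th (2 * Y) * (c1 * th (X i + Y) * th (X i - Y) - c2 * th (XA + Y) * th (XA - Y))
      + th (X i + XA) * exp (X i) * (NP * th (XA - Y) / exp Y - NM * th (XA + Y) * exp Y ^ 3) = 0"
  proof -
    have "exp XA = exp (X i + (\<Sum>b\<in>B. X b))"
    proof -
      have "(\<Sum>b\<in>B. X b) = (\<Sum>b\<in>B. x b) + ((\<Sum>b\<in>B. N b) + 2 * e) * lp"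
        using B by (simp add: X_def sum.distrib sum_distrib_right[symmetric] distrib_right)
      then have "X i + (\<Sum>b\<in>B. X b) = XA"
        unfolding sx sN by (rule ssubst) (simp add: X_def XA_def field_simps)
      then show ?thesis by simp
    qed
    then have "exp XA = exp (X i) * (\<Prod>b\<in>B. exp (X b))" by (simp add: exp_add exp_sum fB)
    from theta_identity[OF norms(1,2) B _ _ this, of "exp Y"]
    have "theta ((exp Y)\<^sup>2) (p ^ r) * (c1 * th (X i + Y) * th (X i - Y) - c2 * th (XA + Y) * th (XA - Y))
      + th (X i + XA) * exp (X i) * (NP * th (XA - Y) / exp Y - NM * th (XA + Y) * exp Y ^ 3) = 0"
      unfolding th_def c1_def c2_def NP_def NM_def by (simp add: exp_add exp_diff mult_ac)
    then show ?thesis by (simp only: th_def exp_double)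
  qed
  have kp: "kap \<epsilon> i j B x n = th (X i + XA) / c2 * exp k0"
    unfolding kap_def th_def c2_def k0_def X_def XA_def N_def e_def ..
  \<comment> \<open>The prefactors of the four terms are all reduced to exp \<omega>, up to the
    monomials in exp (X i) and exp Y that the identity contains; \<open>k\<close> counts the
    leftover multiples of 2 pi i.\<close>
  have E1: "exp ((\<Sum>b\<in>B. G b + (X b - XA + \<i> * pi) - D b) + K + al e (x i) (N i) M y + al e (x i) (N i) (- M - e) (- y)) = exp \<omega>"
  proof (rule exp_eq_exp_2pi[where k = "1 + n j - n i"])
    have "(\<Sum>b\<in>B. G b + (X b - XA + \<i> * pi) - D b) + al e (x i) (N i) M y + al e (x i) (N i) (- M - e) (- y)
       = \<beta> + \<beta>' - 2 * XA + 2 * (1 + N j - N i) * (\<i> * pi)"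
      using gamma_delta_sum[OF B sx sN XA_def, of M y] unfolding G_def D_def X_def \<beta>_def \<beta>'_def by simp
    then show "(\<Sum>b\<in>B. G b + (X b - XA + \<i> * pi) - D b) + K + al e (x i) (N i) M y + al e (x i) (N i) (- M - e) (- y)
       = \<omega> + 2 * of_int (1 + n j - n i) * (\<i> * pi)"
      unfolding \<omega>_def N_def by (simp add: algebra_simps)
  qed
  have E3: "exp (k0 + (al e (x i) (N i) M y + (\<Sum>b\<in>B. al e (x b) (N b) M y)) + (\<beta> + Y - XA + \<i> * pi)
       + ((- 2 * \<mu> - 1) * y + \<mu> * (\<mu> - 1) / 2 * lq)) = exp (\<omega> + X i - Y)"
  proof (rule exp_eq_exp_2pi[where k = "3 * m"])
    have "kexp e (x i) (N i) (x j) (N j) (\<Sum>b\<in>B. al e (x b) (N b) M y) M y = k0 + 2 * (- 3 * M) * (\<i> * pi)"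
      unfolding k0_def by (rule kexp_const[OF B sx sN])
    then have k: "k0 = kexp e (x i) (N i) (x j) (N j) (\<Sum>b\<in>B. al e (x b) (N b) M y) M y + 2 * (3 * M) * (\<i> * pi)"
      by (simp add: algebra_simps)
    show "k0 + (al e (x i) (N i) M y + (\<Sum>b\<in>B. al e (x b) (N b) M y)) + (\<beta> + Y - XA + \<i> * pi)
       + ((- 2 * \<mu> - 1) * y + \<mu> * (\<mu> - 1) / 2 * lq) = \<omega> + X i - Y + 2 * of_int (3 * m) * (\<i> * pi)"
      unfolding k kexp_def \<omega>_def K_def \<beta>'_def X_def Y_def XA_def \<mu>_def by (simp add: M_def field_simps)
  qed
  have E4: "exp (k0 + (al e (x i) (N i) (- M - e) (- y) + (\<Sum>b\<in>B. al e (x b) (N b) (- M - e) (- y))) + (\<beta>' - Y - XA + \<i> * pi)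
       + ((1 - 2 * \<mu>) * y + \<mu> * (\<mu> + 1) / 2 * lq + (\<i> * pi - (\<mu> * lq - 2 * y)))) = exp (\<omega> + X i + 3 * Y + \<i> * pi)"
  proof (rule exp_eq_exp_2pi[where k = "3 * (- m - \<epsilon>)"])
    have "kexp e (x i) (N i) (x j) (N j) (\<Sum>b\<in>B. al e (x b) (N b) (- M - e) (- y)) (- M - e) (- y) = k0 + 2 * (- 3 * (- M - e)) * (\<i> * pi)"
      unfolding k0_def by (rule kexp_const[OF B sx sN])
    then have k: "k0 = kexp e (x i) (N i) (x j) (N j) (\<Sum>b\<in>B. al e (x b) (N b) (- M - e) (- y)) (- M - e) (- y) + 2 * (3 * (- M - e)) * (\<i> * pi)"
      by (simp add: algebra_simps)
    show "k0 + (al e (x i) (N i) (- M - e) (- y) + (\<Sum>b\<in>B. al e (x b) (N b) (- M - e) (- y))) + (\<beta>' - Y - XA + \<i> * pi)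
       + ((1 - 2 * \<mu>) * y + \<mu> * (\<mu> + 1) / 2 * lq + (\<i> * pi - (\<mu> * lq - 2 * y))) = \<omega> + X i + 3 * Y + \<i> * pi + 2 * of_int (3 * (- m - \<epsilon>)) * (\<i> * pi)"
      unfolding k kexp_def \<omega>_def K_def \<beta>_def X_def Y_def XA_def \<mu>_def by (simp add: M_def e_def field_simps)
  qed
  have T1: "(\<Prod>b\<in>B. theta_p (exp (x j - lq + x b)) (n j - 1 + n b + \<epsilon>) / theta_p (exp (x i + x b)) (n i + n b + \<epsilon>))
       * ker (exp (2 * y)) (2 * m + \<epsilon>) * theta_p (exp (x i + y)) (n i + \<epsilon> + m) * theta_p (exp (x i - y)) (n i - m)
     = exp \<omega> * (c1 / c2 * th (2 * Y) * thq * th (X i + Y) * th (X i - Y))"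
  proof -
    have "(\<Prod>b\<in>B. theta_p (exp (x j - lq + x b)) (n j - 1 + n b + \<epsilon>) / theta_p (exp (x i + x b)) (n i + n b + \<epsilon>))
      = (\<Prod>b\<in>B. exp (G b + (X b - XA + \<i> * pi) - D b) * (th (XA - X b) / th (X i + X b)))"
      unfolding tG tD by (simp add: exp_diff)
    also have "\<dots> = exp (\<Sum>b\<in>B. G b + (X b - XA + \<i> * pi) - D b) * (c1 / c2)"
      by (simp only: prod.distrib prod_dividef exp_sum[OF fB] c1_def c2_def)
    finally show ?thesis unfolding kr tP tM E1[symmetric] by (simp only: exp_add mult_ac)
  qed
  have T2: "ker (exp (2 * y)) (2 * m + \<epsilon>) * theta_p (exp (x j - lq + y)) (n j - 1 + \<epsilon> + m) * theta_p (exp (x j - lq - y)) (n j - 1 - m)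
     = exp \<omega> * (th (2 * Y) * thq * th (XA - Y) * th (XA + Y))"
  proof -
    have "exp (K + (\<beta> + Y - XA + \<i> * pi) + (\<beta>' - Y - XA + \<i> * pi)) = exp \<omega>"
      by (rule exp_eq_exp_2pi[where k = 1]) (simp add: \<omega>_def)
    then show ?thesis unfolding kr tJ tJ'
      by (rule subst) (simp only: exp_add[of "K + _"] exp_add[of K] mult_ac)
  qed
  have T3: "kap \<epsilon> i j B x n * ((\<Prod>a\<in>insert i B. theta_p (exp (x a + y)) (n a + \<epsilon> + m)) * theta_p (exp (x j - lq + y)) (n j - 1 + \<epsilon> + m) * bq \<epsilon> (exp y) m)
     = exp (\<omega> + X i - Y) * (th (X i + XA) / c2 * NP * th (XA - Y) * thq)"
  proof -
    have "(\<Prod>a\<in>insert i B. theta_p (exp (x a + y)) (n a + \<epsilon> + m)) = exp (al e (x i) (N i) M y + (\<Sum>b\<in>B. al e (x b) (N b) M y)) * NP"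
      unfolding tP NP_def using ij fB by (simp add: prod.distrib exp_sum exp_add)
    then show ?thesis unfolding kp tJ b1 E3[symmetric]
      by (simp only: exp_add[of "k0 + _ + _"] exp_add[of "k0 + _"] exp_add[of k0] mult_ac)
  qed
  have T4: "kap \<epsilon> i j B x n * ((\<Prod>a\<in>insert i B. theta_p (exp (x a - y)) (n a - m)) * theta_p (exp (x j - lq - y)) (n j - 1 - m) * bq \<epsilon> (exp (- y)) (- m - \<epsilon>))
     = exp (\<omega> + X i + 3 * Y + \<i> * pi) * (th (X i + XA) / c2 * NM * th (XA + Y) * thq)"
  proof -
    have "(\<Prod>a\<in>insert i B. theta_p (exp (x a - y)) (n a - m)) = exp (al e (x i) (N i) (- M - e) (- y) + (\<Sum>b\<in>B. al e (x b) (N b) (- M - e) (- y))) * NM"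
      unfolding tM NM_def using ij fB by (simp add: prod.distrib exp_sum exp_add)
    then show ?thesis unfolding kp tJ' b2 E4[symmetric]
      by (simp only: exp_add[of "k0 + _ + _"] exp_add[of "k0 + _"] exp_add[of k0] mult_ac)
  qed
  have x1: "exp (\<omega> + X i - Y) = exp \<omega> * (exp (X i) / exp Y)" by (simp add: exp_add exp_diff)
  have x2: "exp (\<omega> + X i + 3 * Y + \<i> * pi) = - exp \<omega> * (exp (X i) * exp Y ^ 3)"
  proof -
    have "exp (3 * Y) = exp Y ^ 3" using exp_of_nat_mult[of 3 Y] by simp
    then show ?thesis by (simp add: exp_add)
  qed
  have "exp \<omega> * (c1 / c2 * th (2 * Y) * thq * th (X i + Y) * th (X i - Y)) - exp \<omega> * (th (2 * Y) * thq * th (XA - Y) * th (XA + Y))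
     + (exp (\<omega> + X i - Y) * (th (X i + XA) / c2 * NP * th (XA - Y) * thq) + exp (\<omega> + X i + 3 * Y + \<i> * pi) * (th (X i + XA) / c2 * NM * th (XA + Y) * thq))
   = exp \<omega> * thq / c2 * (th (2 * Y) * (c1 * th (X i + Y) * th (X i - Y) - c2 * th (XA + Y) * th (XA - Y))
      + th (X i + XA) * exp (X i) * (NP * th (XA - Y) / exp Y - NM * th (XA + Y) * exp Y ^ 3))"
    unfolding x1 x2 using c2 by (simp add: field_simps)
  also have "\<dots> = 0" unfolding id by simp
  finally show ?thesis unfolding T1 T2 distrib_left[of "kap \<epsilon> i j B x n"] T3 T4 .
qed

end

section \<open>Shift invariance of the rarefied elliptic beta integral\<close>

context rarefied
begin

text \<open>The logarithm of the factor for a balanced move: the discrete parameter m at exp u goes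
  up by r and k at exp v goes down by r.\<close>

definition dper :: "complex \<Rightarrow> complex \<Rightarrow> complex \<Rightarrow> complex \<Rightarrow> complex" where
  "dper u m v k = (of_nat r - 1) * ((m + of_nat r / 2) * (u + \<i> * pi) - (k - of_nat r / 2) * (v + \<i> * pi)
     + (m - k + of_nat r) * ((m + k - 1) * lp - (m + k + 1) * lq) / 2)"

lemma gam_pair_period:
  assumes "exp u \<in> dom" "exp u \<noteq> 1" "exp v \<in> dom" "exp v \<noteq> 1"
  shows "gam (exp u) (m + int r) * gam (exp v) (k - int r) = exp (dper u (of_int m) v (of_int k)) * (gam (exp u) m * gam (exp v) k)"
proof -
  have a: "gam (exp u) (m + int r) = exp (per u m) * gam (exp u) m"
    using gam_period[OF assms(1,2), of m] by (simp add: cper_exp)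
  have b: "gam (exp v) k = exp (per v (k - int r)) * gam (exp v) (k - int r)"
    using gam_period[OF assms(3,4), of "k - int r"] by (simp add: cper_exp)
  have c: "per u m - per v (k - int r) = dper u (of_int m) v (of_int k)"
    unfolding per_def dper_def by (simp add: field_simps power2_eq_square)
  have "exp (dper u (of_int m) v (of_int k)) = exp (per u m) / exp (per v (k - int r))"
    by (simp add: exp_diff flip: c)
  then show ?thesis unfolding a b by simp
qed

text \<open>The reciprocal of the two gamma functions in the denominator is written as
  \<open>ker\<close>, which is regular also at z^2 = 1. The index set is left open: six parameters
  for the beta integral, eight for the transformation, four inside Bailey's double integral.\<close>

definition W :: "nat set \<Rightarrow> int \<Rightarrow> (nat \<Rightarrow> complex) \<Rightarrow> (nat \<Rightarrow> int) \<Rightarrow> complex \<Rightarrow> int \<Rightarrow> complex" where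
  "W I \<epsilon> t n z m = (\<Prod>a\<in>I. gam (t a * z) (n a + \<epsilon> + m) * gam (t a / z) (n a - m)) * ker (z\<^sup>2) (2 * m + \<epsilon>)"

definition BI :: "nat set \<Rightarrow> int \<Rightarrow> (nat \<Rightarrow> complex) \<Rightarrow> (nat \<Rightarrow> int) \<Rightarrow> complex" where
  "BI I \<epsilon> t n = (\<Sum>m<r. circ (\<lambda>z. W I \<epsilon> t n z (int m)))"

definition pairs :: "nat set \<Rightarrow> nat set set" where
  "pairs I = {X. X \<subseteq> I \<and> card X = 2}"

definition RH :: "nat set \<Rightarrow> int \<Rightarrow> (nat \<Rightarrow> complex) \<Rightarrow> (nat \<Rightarrow> int) \<Rightarrow> complex" where
  "RH I \<epsilon> t n = (\<Prod>X\<in>pairs I. gam (\<Prod>a\<in>X. t a) ((\<Sum>a\<in>X. n a) + \<epsilon>))"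

lemma pairs_insert: "i \<notin> A \<Longrightarrow> pairs (insert i A) = pairs A \<union> (\<lambda>b. {i, b}) ` A"
proof -
  assume i: "i \<notin> A"
  show ?thesis
  proof (intro equalityI subsetI)
    fix X assume X: "X \<in> pairs (insert i A)"
    show "X \<in> pairs A \<union> (\<lambda>b. {i, b}) ` A"
    proof (cases "i \<in> X")
      case False
      then show ?thesis using X by (auto simp: pairs_def)
    next
      case True
      then obtain b where "X = {i, b}" "b \<noteq> i" using X unfolding pairs_def card_2_iff by auto
      then show ?thesis using X by (auto simp: pairs_def)
    qed
  next
    fix X assume "X \<in> pairs A \<union> (\<lambda>b. {i, b}) ` A"
    then show "X \<in> pairs (insert i A)" using i by (auto simp: pairs_def card_2_iff)
  qed
qed

lemma finite_pairs: "finite I \<Longrightarrow> finite (pairs I)"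
  unfolding pairs_def by (rule finite_subset[of _ "Pow I"]) auto

lemma RH_insert:
  assumes "finite A" "i \<notin> A"
  shows "RH (insert i A) \<epsilon> t n = RH A \<epsilon> t n * (\<Prod>b\<in>A. gam (t i * t b) (n i + n b + \<epsilon>))"
proof -
  have inj: "inj_on (\<lambda>b. {i, b}) A" using assms by (auto simp: inj_on_def doubleton_eq_iff)
  have "RH (insert i A) \<epsilon> t n = RH A \<epsilon> t n * (\<Prod>X\<in>(\<lambda>b. {i, b}) ` A. gam (\<Prod>a\<in>X. t a) ((\<Sum>a\<in>X. n a) + \<epsilon>))"
    unfolding RH_def pairs_insert[OF assms(2)]
    by (rule prod.union_disjoint) (use assms finite_pairs in \<open>auto simp: pairs_def\<close>)
  also have "(\<Prod>X\<in>(\<lambda>b. {i, b}) ` A. gam (\<Prod>a\<in>X. t a) ((\<Sum>a\<in>X. n a) + \<epsilon>)) = (\<Prod>b\<in>A. gam (t i * t b) (n i + n b + \<epsilon>))"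
    unfolding prod.reindex[OF inj]
  proof (intro prod.cong refl)
    fix b assume "b \<in> A"
    then have "i \<noteq> b" using assms by auto
    then show "((\<lambda>X. gam (\<Prod>a\<in>X. t a) ((\<Sum>a\<in>X. n a) + \<epsilon>)) \<circ> (\<lambda>b. {i, b})) b = gam (t i * t b) (n i + n b + \<epsilon>)" by simp
  qed
  finally show ?thesis .
qed

lemma RH_cong:
  assumes "\<And>a. a \<in> I \<Longrightarrow> t a = t' a" "\<And>a. a \<in> I \<Longrightarrow> n a = n' a"
  shows "RH I \<epsilon> t n = RH I \<epsilon> t' n'"
  unfolding RH_def
proof (intro prod.cong refl)
  fix X assume "X \<in> pairs I"
  then have X: "X \<subseteq> I" by (auto simp: pairs_def)
  have "(\<Prod>a\<in>X. t a) = (\<Prod>a\<in>X. t' a)" "(\<Sum>a\<in>X. n a) = (\<Sum>a\<in>X. n' a)"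
    using X assms by (auto intro!: prod.cong sum.cong)
  then show "gam (\<Prod>a\<in>X. t a) ((\<Sum>a\<in>X. n a) + \<epsilon>) = gam (\<Prod>a\<in>X. t' a) ((\<Sum>a\<in>X. n' a) + \<epsilon>)" by simp
qed

lemma W_cong:
  assumes "\<And>a. a \<in> I \<Longrightarrow> t a = t' a" "\<And>a. a \<in> I \<Longrightarrow> n a = n' a"
  shows "W I \<epsilon> t n z m = W I \<epsilon> t' n' z m"
  unfolding W_def using assms by (auto intro!: prod.cong)

lemma unit_dom:
  assumes "z \<noteq> 0" "norm z < 1" shows "z \<in> dom" "z \<noteq> 1"
  using dom_unit[OF assms(1)] assms by auto

lemma gam_compose_holomorphic:
  assumes "f holomorphic_on S" "\<And>z. z \<in> S \<Longrightarrow> f z \<noteq> 0 \<and> norm (f z) < 1"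
  shows "(\<lambda>z. gam (f z) m) holomorphic_on S"
proof -
  have "f ` S \<subseteq> dom - {1}"
  proof (rule image_subsetI)
    fix z assume "z \<in> S"
    then show "f z \<in> dom - {1}" using assms(2)[of z] unit_dom[of "f z"] by simp
  qed
  from holomorphic_on_compose[OF assms(1) holomorphic_on_subset[OF gam_holomorphic this]]
  show ?thesis by (simp add: o_def)
qed

lemma gam_compose_continuous:
  assumes "continuous_on S f" "\<And>z. z \<in> S \<Longrightarrow> f z \<noteq> 0 \<and> norm (f z) < 1"
  shows "continuous_on S (\<lambda>z. gam (f z) m)"
proof -
  have "f ` S \<subseteq> dom - {1}"
  proof (rule image_subsetI)
    fix z assume "z \<in> S"
    then show "f z \<in> dom - {1}" using assms(2)[of z] unit_dom[of "f z"] by simp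
  qed
  with assms(1) show ?thesis
    by (intro continuous_on_compose2[OF holomorphic_on_imp_continuous_on[OF gam_holomorphic]])
qed

lemma theta_compose_holomorphic:
  assumes "norm x < 1" "x \<noteq> 0" "f holomorphic_on S" "\<And>z. z \<in> S \<Longrightarrow> f z \<noteq> 0"
  shows "(\<lambda>z. theta (f z) x) holomorphic_on S"
proof -
  have "f ` S \<subseteq> - {0}" by (rule image_subsetI) (simp add: assms(4))
  from holomorphic_on_compose[OF assms(3) holomorphic_on_subset[OF theta_holomorphic[OF assms(1,2)] this]]
  show ?thesis by (simp add: o_def)
qed

lemma theta_compose_continuous:
  assumes "norm x < 1" "x \<noteq> 0" "continuous_on S f" "\<And>z. z \<in> S \<Longrightarrow> f z \<noteq> 0"
  shows "continuous_on S (\<lambda>z. theta (f z) x)"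
proof -
  have "f ` S \<subseteq> - {0}" by (rule image_subsetI) (simp add: assms(4))
  with assms show ?thesis
    by (intro continuous_on_compose2[OF holomorphic_on_imp_continuous_on[OF theta_holomorphic]])
qed

lemma ker_holomorphic: "0 \<notin> S \<Longrightarrow> (\<lambda>z. ker (z\<^sup>2) m) holomorphic_on S"
  unfolding ker_def
  by (intro holomorphic_intros theta_compose_holomorphic norms) (use p q in auto)

lemma ker_continuous: "continuous_on S f \<Longrightarrow> (\<And>z. z \<in> S \<Longrightarrow> f z \<noteq> 0) \<Longrightarrow> continuous_on S (\<lambda>z. ker ((f z)\<^sup>2) m)"
  unfolding ker_def
  by (intro continuous_intros theta_compose_continuous norms) (use p q in auto)

lemma bq_holomorphic: "0 \<notin> S \<Longrightarrow> (\<lambda>z. bq \<epsilon> z m) holomorphic_on S"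
  unfolding bq_def
  by (intro holomorphic_intros theta_compose_holomorphic norms) (use p q in auto)

lemma W_continuous:
  assumes "\<And>a. a \<in> I \<Longrightarrow> t a \<noteq> 0 \<and> norm (t a) < 1"
  shows "continuous_on (sphere 0 1) (\<lambda>z. W I \<epsilon> t n z m)"
  unfolding W_def
  by (intro continuous_intros gam_compose_continuous ker_continuous)
     (use assms in \<open>auto simp: norm_mult norm_divide\<close>)

definition adm :: "nat set \<Rightarrow> int \<Rightarrow> (nat \<Rightarrow> complex) \<Rightarrow> (nat \<Rightarrow> int) \<Rightarrow> bool" where
  "adm I \<epsilon> t n \<longleftrightarrow> finite I \<and> card I = 6 \<and> (\<forall>a\<in>I. t a \<noteq> 0 \<and> norm (t a) < 1) \<and>
     (\<Prod>a\<in>I. t a) = p * q \<and> (\<Sum>a\<in>I. n a) + 3 * \<epsilon> = 0"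

text \<open>Principal logarithms need not add up to \<open>l\<close>; the parameter with index
  \<open>j\<close> absorbs the discrepancy.\<close>

lemma exists_logs:
  assumes "finite I" "\<And>a. a \<in> I \<Longrightarrow> t a \<noteq> (0::complex)" "(\<Prod>a\<in>I. t a) = exp l" "j \<in> I"
  obtains x where "\<And>a. a \<in> I \<Longrightarrow> t a = exp (x a)" "(\<Sum>a\<in>I. x a) = l"
proof
  define x where "x = (\<lambda>a. if a = j then l - (\<Sum>b\<in>I - {j}. Ln (t b)) else Ln (t a))"
  have s: "(\<Sum>a\<in>I - {j}. x a) = (\<Sum>b\<in>I - {j}. Ln (t b))" by (intro sum.cong) (auto simp: x_def)
  show "(\<Sum>a\<in>I. x a) = l"
    using assms s by (simp add: sum.remove[of I j]) (simp add: x_def)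
  have e: "exp (\<Sum>b\<in>I - {j}. Ln (t b)) = (\<Prod>b\<in>I - {j}. t b)"
    using assms by (simp add: exp_sum)
  have nz: "(\<Prod>b\<in>I - {j}. t b) \<noteq> 0" using assms by simp
  have "t j * (\<Prod>b\<in>I - {j}. t b) = exp l" using assms by (simp add: prod.remove[of I j])
  then have "t j = exp (x j)" using nz by (simp add: x_def exp_diff e field_simps)
  then show "t a = exp (x a)" if "a \<in> I" for a using assms that by (cases "a = j") (auto simp: x_def)
qed

lemma adm_logs:
  assumes "adm I \<epsilon> t n"
  obtains x where "\<And>a. a \<in> I \<Longrightarrow> t a = exp (x a)" "(\<Sum>a\<in>I. x a) = lp + lq"
proof -
  obtain j where "j \<in> I" using assms unfolding adm_def by fastforce
  from exists_logs[of I t "lp + lq" j] assms this show ?thesis using that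
    unfolding adm_def pq by metis
qed

text \<open>The lower bound holds because the product of the other four parameters has modulus below
  1. It places the arguments occurring in \<open>RH\<close> in the region where
  \<open>gam_nonzero\<close> applies.\<close>

lemma adm_pair_norm:
  assumes "adm I \<epsilon> t n" "a \<in> I" "b \<in> I" "a \<noteq> b"
  shows "norm (p * q) < norm (t a * t b)" "norm (t a * t b) < 1"
proof -
  have fin: "finite I" and t: "\<And>c. c \<in> I \<Longrightarrow> t c \<noteq> 0 \<and> norm (t c) < 1" using assms by (auto simp: adm_def)
  have "(\<Prod>c\<in>I. t c) = t a * t b * (\<Prod>c\<in>I - {a} - {b}. t c)"
    using assms fin by (simp add: prod.remove[of I a] prod.remove[of "I - {a}" b])
  then have e: "norm (p * q) = norm (t a * t b) * (\<Prod>c\<in>I - {a} - {b}. norm (t c))"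
    using assms(1) unfolding adm_def prod_norm norm_mult[symmetric] by metis
  have "card (I - {a} - {b}) = 4" using assms fin by (simp add: adm_def)
  then have "I - {a} - {b} \<noteq> {}" by (metis card.empty zero_neq_numeral)
  then obtain c where c: "c \<in> I - {a} - {b}" by blast
  have "(\<Prod>c\<in>I - {a} - {b} - {c}. norm (t c)) \<le> 1"
    by (intro prod_le_1) (use t in \<open>auto intro: less_imp_le\<close>)
  then have "norm (t c) * (\<Prod>c\<in>I - {a} - {b} - {c}. norm (t c)) \<le> norm (t c) * 1" by (intro mult_left_mono) auto
  also have "norm (t c) * 1 < 1" using t c by auto
  finally have "(\<Prod>c\<in>I - {a} - {b}. norm (t c)) < 1"
    using c fin by (simp add: prod.remove[of "I - {a} - {b}" c])
  then have "norm (t a * t b) * (\<Prod>c\<in>I - {a} - {b}. norm (t c)) < norm (t a * t b) * 1"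
    using t assms by (intro mult_strict_left_mono) auto
  then show "norm (p * q) < norm (t a * t b)" unfolding e by simp
  show "norm (t a * t b) < 1"
    using t[OF assms(2)] t[OF assms(3)] mult_strict_mono[of "norm (t a)" 1 "norm (t b)" 1] by (simp add: norm_mult)
qed

text \<open>This antisymmetry turns the telescoping term at 1 / z into a q-shift of the term at
  z.\<close>

lemma bq_shift:
  assumes "z \<noteq> 0" shows "bq \<epsilon> (z / q) (m - 1) = - bq \<epsilon> (1 / z) (- m - \<epsilon>)"
proof -
  define y where "y = Ln z"
  define \<mu> where "\<mu> = 2 * of_int m + complex_of_int \<epsilon>"
  have z: "z = exp y" using assms by (simp add: y_def)
  have e: "z / q = exp (y - lq)" "1 / z = exp (- y)" by (simp_all add: z exp_diff exp_minus divide_inverse)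
  have a: "bq \<epsilon> (exp (y - lq)) (m - 1) = exp ((3 - 2 * \<mu>) * y + \<mu> * (\<mu> - 1) / 2 * lq) * theta (exp (\<mu> * lq - 2 * y)) (q ^ r)"
  proof -
    have 1: "(- 2 * (2 * of_int (m - 1) + of_int \<epsilon>) - 1) * (y - lq)
       + (2 * of_int (m - 1) + of_int \<epsilon>) * (2 * of_int (m - 1) + of_int \<epsilon> - 1) / 2 * lq = (3 - 2 * \<mu>) * y + \<mu> * (\<mu> - 1) / 2 * lq"
      by (simp add: \<mu>_def field_simps)
    have 2: "(2 * of_int (m - 1) + of_int \<epsilon>) * lq - 2 * (y - lq) = \<mu> * lq - 2 * y"
      by (simp add: \<mu>_def field_simps)
    show ?thesis unfolding bq_exp 1 2 ..
  qed
  have b: "bq \<epsilon> (exp (- y)) (- m - \<epsilon>) = exp ((1 - 2 * \<mu>) * y + \<mu> * (\<mu> + 1) / 2 * lq + (\<i> * pi - (\<mu> * lq - 2 * y))) * theta (exp (\<mu> * lq - 2 * y)) (q ^ r)"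
  proof -
    have "bq \<epsilon> (exp (- y)) (- m - \<epsilon>) = exp ((1 - 2 * \<mu>) * y + \<mu> * (\<mu> + 1) / 2 * lq) * theta (exp (- (\<mu> * lq - 2 * y))) (q ^ r)"
    proof -
      have "(- 2 * (2 * of_int (- m - \<epsilon>) + of_int \<epsilon>) - 1) * - y
         + (2 * of_int (- m - \<epsilon>) + of_int \<epsilon>) * (2 * of_int (- m - \<epsilon>) + of_int \<epsilon> - 1) / 2 * lq = (1 - 2 * \<mu>) * y + \<mu> * (\<mu> + 1) / 2 * lq"
        by (simp add: \<mu>_def field_simps)
      moreover have "(2 * of_int (- m - \<epsilon>) + of_int \<epsilon>) * lq - 2 * - y = - (\<mu> * lq - 2 * y)"
        by (simp add: \<mu>_def field_simps)
      ultimately show ?thesis unfolding bq_exp by simp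
    qed
    then show ?thesis unfolding theta_neg[OF norms(3,4)] by (simp only: exp_add mult.assoc)
  qed
  have c: "(1 - 2 * \<mu>) * y + \<mu> * (\<mu> + 1) / 2 * lq + (\<i> * pi - (\<mu> * lq - 2 * y)) = ((3 - 2 * \<mu>) * y + \<mu> * (\<mu> - 1) / 2 * lq) + \<i> * pi"
    by (simp add: field_simps)
  show ?thesis unfolding e a b c by (simp add: exp_add)
qed

lemma bq_period: "bq \<epsilon> (exp y) (m + int r) = exp ((of_nat r - 1) * (- 4 * y + 2 * (2 * of_int m + of_int \<epsilon>) * lq + 2 * of_nat r * lq)) * bq \<epsilon> (exp y) m"
proof -
  define \<mu> where "\<mu> = 2 * of_int m + complex_of_int \<epsilon>"
  have 1: "2 * of_int (m + int r) + of_int \<epsilon> = \<mu> + 2 * of_nat r" by (simp add: \<mu>_def)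
  have 2: "theta (exp ((\<mu> + 2 * of_nat r) * lq - 2 * y)) (q ^ r) = exp ((\<i> * pi - (\<mu> * lq - 2 * y + of_nat r * lq)) + (\<i> * pi - (\<mu> * lq - 2 * y))) * theta (exp (\<mu> * lq - 2 * y)) (q ^ r)"
  proof -
    have "(\<mu> + 2 * of_nat r) * lq - 2 * y = (\<mu> * lq - 2 * y + of_nat r * lq) + of_nat r * lq" by (simp add: algebra_simps)
    then have "theta (exp ((\<mu> + 2 * of_nat r) * lq - 2 * y)) (q ^ r) = exp (\<i> * pi - (\<mu> * lq - 2 * y + of_nat r * lq))
        * (exp (\<i> * pi - (\<mu> * lq - 2 * y)) * theta (exp (\<mu> * lq - 2 * y)) (q ^ r))"
      by (simp only: theta_shift_exp)
    then show ?thesis by (simp only: exp_add[of "\<i> * pi - (\<mu> * lq - 2 * y + of_nat r * lq)"] mult.assoc)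
  qed
  have "bq \<epsilon> (exp y) (m + int r) = exp ((- 2 * (\<mu> + 2 * of_nat r) - 1) * y + (\<mu> + 2 * of_nat r) * (\<mu> + 2 * of_nat r - 1) / 2 * lq
     + ((\<i> * pi - (\<mu> * lq - 2 * y + of_nat r * lq)) + (\<i> * pi - (\<mu> * lq - 2 * y)))) * theta (exp (\<mu> * lq - 2 * y)) (q ^ r)"
    unfolding bq_exp 1 2 by (simp only: exp_add mult.assoc)
  also have "\<dots> = exp ((of_nat r - 1) * (- 4 * y + 2 * \<mu> * lq + 2 * of_nat r * lq) + ((- 2 * \<mu> - 1) * y + \<mu> * (\<mu> - 1) / 2 * lq)) * theta (exp (\<mu> * lq - 2 * y)) (q ^ r)"
    by (rule arg_cong2[where f = times], rule exp_eq_exp_2pi[where k = 1]) (simp_all add: field_simps power2_eq_square)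
  finally show ?thesis unfolding bq_exp \<mu>_def[symmetric] by (simp only: exp_add mult.assoc)
qed

lemma sum_affine:
  fixes x n :: "nat \<Rightarrow> complex"
  assumes S: "finite S" "card S = N"
  shows "(\<Sum>a\<in>S. k * (u * x a + v * n a + w)) = k * (u * (\<Sum>a\<in>S. x a) + v * (\<Sum>a\<in>S. n a) + of_nat N * w)"
  using S by (simp add: sum.distrib sum_distrib_left[symmetric])

text \<open>For the two arguments belonging to z and 1 / z the products of x a and n a cancel in
  \<open>dper\<close>. It becomes affine in x a and n a, so the sum depends only on the balanced
  sums.\<close>

lemma dper_sum_aux:
  fixes x n :: "nat \<Rightarrow> complex"
  assumes S: "finite S" "card S = N"
  shows "(\<Sum>a\<in>S. dper (x a + c + y) (n a + e + m + d) (x a - y) (n a - m)) = (of_nat r - 1) *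
     ((2 * m + e + d + of_nat r) * (\<Sum>a\<in>S. x a) + (2 * y + c + (2 * m + e + d + of_nat r) * (lp - lq)) * (\<Sum>a\<in>S. n a)
      + of_nat N * ((e + m + d + of_nat r / 2) * (c + y + \<i> * pi) + (- m - of_nat r / 2) * (y - \<i> * pi)
       + (2 * m + e + d + of_nat r) * ((e + d - 1) * lp - (e + d + 1) * lq) / 2))"
proof -
  have "(\<Sum>a\<in>S. dper (x a + c + y) (n a + e + m + d) (x a - y) (n a - m)) =
    (\<Sum>a\<in>S. (of_nat r - 1) * ((2 * m + e + d + of_nat r) * x a + (2 * y + c + (2 * m + e + d + of_nat r) * (lp - lq)) * n a
      + ((e + m + d + of_nat r / 2) * (c + y + \<i> * pi) + (- m - of_nat r / 2) * (y - \<i> * pi)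
       + (2 * m + e + d + of_nat r) * ((e + d - 1) * lp - (e + d + 1) * lq) / 2)))"
    unfolding dper_def by (intro sum.cong refl arg_cong[where f = "\<lambda>x. _ * x"]) (simp add: field_simps)
  also have "\<dots> = (of_nat r - 1) * ((2 * m + e + d + of_nat r) * (\<Sum>a\<in>S. x a) + (2 * y + c + (2 * m + e + d + of_nat r) * (lp - lq)) * (\<Sum>a\<in>S. n a)
      + of_nat N * ((e + m + d + of_nat r / 2) * (c + y + \<i> * pi) + (- m - of_nat r / 2) * (y - \<i> * pi)
       + (2 * m + e + d + of_nat r) * ((e + d - 1) * lp - (e + d + 1) * lq) / 2))"
    by (rule sum_affine[OF S])
  finally show ?thesis .
qed

lemma prod_pair_period:
  assumes S: "finite S" and dm: "\<And>a. a \<in> S \<Longrightarrow> exp (u a) \<in> dom \<and> exp (u a) \<noteq> 1 \<and> exp (v a) \<in> dom \<and> exp (v a) \<noteq> 1"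
  shows "(\<Prod>a\<in>S. gam (exp (u a)) (m a + int r) * gam (exp (v a)) (k a - int r)) =
    exp (\<Sum>a\<in>S. dper (u a) (of_int (m a)) (v a) (of_int (k a))) * (\<Prod>a\<in>S. gam (exp (u a)) (m a) * gam (exp (v a)) (k a))"
proof -
  have "(\<Prod>a\<in>S. gam (exp (u a)) (m a + int r) * gam (exp (v a)) (k a - int r)) =
    (\<Prod>a\<in>S. exp (dper (u a) (of_int (m a)) (v a) (of_int (k a))) * (gam (exp (u a)) (m a) * gam (exp (v a)) (k a)))"
    by (intro prod.cong refl gam_pair_period) (use dm in auto)
  then show ?thesis by (simp only: prod.distrib exp_sum[OF S])
qed

text \<open>The telescoping function is \<open>CC\<close> times the theta terms at z of
  \<open>shift_theta_relation\<close>. The theta factors are absorbed by q-shifting the gamma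
  functions of t a z, a form in which the region of holomorphy can be read off.\<close>

definition gfun :: "int \<Rightarrow> nat \<Rightarrow> nat set \<Rightarrow> (nat \<Rightarrow> complex) \<Rightarrow> (nat \<Rightarrow> int) \<Rightarrow> complex \<Rightarrow> int \<Rightarrow> complex" where
  "gfun \<epsilon> j S t n z m = (\<Prod>a\<in>S. gam (q * t a * z) (n a + \<epsilon> + m + 1) * gam (t a / z) (n a - m))
     * (gam (t j * z) (n j + \<epsilon> + m) * gam (t j / q / z) (n j - 1 - m)) * bq \<epsilon> z m"

lemma gfun_shift:
  assumes "z \<noteq> 0" shows "gfun \<epsilon> j S t n (z / q) (m - 1) = - gfun \<epsilon> j S t n (1 / z) (- m - \<epsilon>)"
proof -
  have "(\<Prod>a\<in>S. gam (q * t a * (z / q)) (n a + \<epsilon> + (m - 1) + 1) * gam (t a / (z / q)) (n a - (m - 1)))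
      = (\<Prod>a\<in>S. gam (q * t a * (1 / z)) (n a + \<epsilon> + (- m - \<epsilon>) + 1) * gam (t a / (1 / z)) (n a - (- m - \<epsilon>)))"
    by (intro prod.cong refl) (use q in \<open>simp add: algebra_simps\<close>)
  moreover have "gam (t j * (z / q)) (n j + \<epsilon> + (m - 1)) * gam (t j / q / (z / q)) (n j - 1 - (m - 1))
     = gam (t j * (1 / z)) (n j + \<epsilon> + (- m - \<epsilon>)) * gam (t j / q / (1 / z)) (n j - 1 - (- m - \<epsilon>))"
    using q by (simp add: algebra_simps)
  ultimately show ?thesis unfolding gfun_def bq_shift[OF assms] by simp
qed

text \<open>By the balancing conditions the exponents from the five pairs in S, the pair of j and
  \<open>bq\<close> add up to a multiple of 2 pi i. The periodicity closes the telescoping sum over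
  m.\<close>

lemma gfun_period:
  assumes S: "finite S" "card S = 5" and sx: "(\<Sum>a\<in>S. x a) = lp + lq - x j" and sn: "(\<Sum>a\<in>S. n a) = - 3 * \<epsilon> - n j"
    and t: "\<And>a. a \<in> insert j S \<Longrightarrow> t a = exp (x a) \<and> norm (t a) < 1" and tj: "norm (t j) < norm q" and z: "norm z = 1"
  shows "gfun \<epsilon> j S t n z (m + int r) = gfun \<epsilon> j S t n z m"
proof -
  define y where "y = Ln z"
  have "z \<noteq> 0" using z by auto
  then have zy: "z = exp y" by (simp add: y_def)
  define e M N where "e = complex_of_int \<epsilon>" and "M = complex_of_int m" and "N = (\<lambda>b. complex_of_int (n b))"
  have sN: "(\<Sum>a\<in>S. N a) = - 3 * e - N j"
    unfolding N_def e_def of_int_sum[symmetric] sn by simp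
  have nq: "norm (q * w) < 1" if "norm w < 1" for w
    using mult_strict_mono[of "norm q" 1 "norm w" 1] that q by (simp add: norm_mult)
  have nj: "norm (t j / q) < 1" using tj q by (simp add: norm_divide)
  have dm: "exp (x a + lq + y) \<in> dom \<and> exp (x a + lq + y) \<noteq> 1 \<and> exp (x a - y) \<in> dom \<and> exp (x a - y) \<noteq> 1" if "a \<in> S" for a
  proof -
    have "exp (x a + lq + y) = q * (t a * z)" "exp (x a - y) = t a / z"
      using t[of a] that by (simp_all add: zy exp_add exp_diff mult_ac)
    then show ?thesis using t[of a] that z nq[of "t a * z"] unit_dom[of "q * (t a * z)"] unit_dom[of "t a / z"] q \<open>z \<noteq> 0\<close>
      by (auto simp: norm_mult norm_divide)
  qed
  have dj: "exp (x j + y) \<in> dom" "exp (x j + y) \<noteq> 1" "exp (x j - lq - y) \<in> dom" "exp (x j - lq - y) \<noteq> 1"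
  proof -
    have "exp (x j + y) = t j * z" "exp (x j - lq - y) = t j / q / z"
      using t[of j] by (simp_all add: zy exp_add exp_diff mult_ac)
    then show "exp (x j + y) \<in> dom" "exp (x j + y) \<noteq> 1" "exp (x j - lq - y) \<in> dom" "exp (x j - lq - y) \<noteq> 1"
      using t[of j] z unit_dom[of "t j * z"] unit_dom[of "t j / q / z"] nj \<open>z \<noteq> 0\<close>
      by (auto simp: norm_mult norm_divide q)
  qed
  have conv: "gfun \<epsilon> j S t n z k = (\<Prod>a\<in>S. gam (exp (x a + lq + y)) (n a + \<epsilon> + k + 1) * gam (exp (x a - y)) (n a - k))
     * (gam (exp (x j + y)) (n j + \<epsilon> + k) * gam (exp (x j - lq - y)) (n j - 1 - k)) * bq \<epsilon> (exp y) k" for k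
  proof -
    have "(\<Prod>a\<in>S. gam (q * t a * z) (n a + \<epsilon> + k + 1) * gam (t a / z) (n a - k)) =
      (\<Prod>a\<in>S. gam (exp (x a + lq + y)) (n a + \<epsilon> + k + 1) * gam (exp (x a - y)) (n a - k))"
      by (intro prod.cong refl) (use t in \<open>simp add: zy exp_add exp_diff mult_ac\<close>)
    then show ?thesis unfolding gfun_def using t[of j] by (simp add: zy exp_add exp_diff mult_ac)
  qed
  have P1: "(\<Prod>a\<in>S. gam (exp (x a + lq + y)) (n a + \<epsilon> + (m + int r) + 1) * gam (exp (x a - y)) (n a - (m + int r)))
    = exp (\<Sum>a\<in>S. dper (x a + lq + y) (N a + e + M + 1) (x a - y) (N a - M)) *
      (\<Prod>a\<in>S. gam (exp (x a + lq + y)) (n a + \<epsilon> + m + 1) * gam (exp (x a - y)) (n a - m))"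
    using prod_pair_period[OF S(1), of "\<lambda>a. x a + lq + y" "\<lambda>a. x a - y" "\<lambda>a. n a + \<epsilon> + m + 1" "\<lambda>a. n a - m"] dm
    by (simp add: algebra_simps N_def e_def M_def)
  have P2: "gam (exp (x j + y)) (n j + \<epsilon> + (m + int r)) * gam (exp (x j - lq - y)) (n j - 1 - (m + int r)) =
     exp (dper (x j + y) (N j + e + M) (x j - lq - y) (N j - 1 - M)) * (gam (exp (x j + y)) (n j + \<epsilon> + m) * gam (exp (x j - lq - y)) (n j - 1 - m))"
    using gam_pair_period[OF dj, of "n j + \<epsilon> + m" "n j - 1 - m"] by (simp add: algebra_simps N_def e_def M_def)
  have E: "exp ((\<Sum>a\<in>S. dper (x a + lq + y) (N a + e + M + 1) (x a - y) (N a - M)) + dper (x j + y) (N j + e + M) (x j - lq - y) (N j - 1 - M)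
     + (of_nat r - 1) * (- 4 * y + 2 * (2 * M + e) * lq + 2 * of_nat r * lq)) = exp 0"
    unfolding dper_sum_aux[OF S] sx sN
    by (rule exp_eq_exp_2pi[where k = "3 * (int r - 1) * (2 * m + \<epsilon> + 1 + int r)"])
       (simp add: dper_def M_def e_def field_simps)
  have "gfun \<epsilon> j S t n z (m + int r) = exp ((\<Sum>a\<in>S. dper (x a + lq + y) (N a + e + M + 1) (x a - y) (N a - M)) + dper (x j + y) (N j + e + M) (x j - lq - y) (N j - 1 - M)
     + (of_nat r - 1) * (- 4 * y + 2 * (2 * M + e) * lq + 2 * of_nat r * lq)) * gfun \<epsilon> j S t n z m"
    unfolding conv P1 P2 bq_period M_def[symmetric] e_def[symmetric] by (simp only: exp_add mult_ac)
  then show ?thesis unfolding E by simp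
qed

definition CC :: "int \<Rightarrow> nat \<Rightarrow> nat set \<Rightarrow> (nat \<Rightarrow> complex) \<Rightarrow> (nat \<Rightarrow> int) \<Rightarrow> complex \<Rightarrow> int \<Rightarrow> complex" where
  "CC \<epsilon> j S t n z m = (\<Prod>a\<in>S. gam (t a * z) (n a + \<epsilon> + m) * gam (t a / z) (n a - m))
     * (gam (t j / q * z) (n j - 1 + \<epsilon> + m) * gam (t j / q / z) (n j - 1 - m))"

lemma CC_inverse: "CC \<epsilon> j S t n (1 / z) (- m - \<epsilon>) = CC \<epsilon> j S t n z m"
  unfolding CC_def by (simp add: algebra_simps)

lemma gam_q_shift_mult:
  assumes "t \<noteq> 0" "norm t < 1" "norm z = 1"
  shows "gam (q * t * z) (m + 1) = theta_p (t * z) m * gam (t * z) m"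
proof -
  have "z \<noteq> 0" using assms(3) by auto
  then have "t * z \<noteq> 0" "norm (t * z) < 1" using assms by (simp_all add: norm_mult)
  then have "gam (q * (t * z)) (m + 1) = theta_p (t * z) m * gam (t * z) m" by (intro gam_shift_q unit_dom)
  then show ?thesis by (simp only: mult.assoc)
qed

lemma gfun_factor:
  assumes t: "\<And>a. a \<in> insert j S \<Longrightarrow> t a \<noteq> 0 \<and> norm (t a) < 1" and tj: "norm (t j) < norm q" and z: "norm z = 1"
  shows "gfun \<epsilon> j S t n z m = CC \<epsilon> j S t n z m * ((\<Prod>a\<in>S. theta_p (t a * z) (n a + \<epsilon> + m)) * theta_p (t j / q * z) (n j - 1 + \<epsilon> + m) * bq \<epsilon> z m)"
proof -
  have nj: "norm (t j / q) < 1" "t j / q \<noteq> 0" using tj q t[of j] by (simp_all add: norm_divide)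
  have "(\<Prod>a\<in>S. gam (q * t a * z) (n a + \<epsilon> + m + 1) * gam (t a / z) (n a - m)) =
     (\<Prod>a\<in>S. theta_p (t a * z) (n a + \<epsilon> + m) * (gam (t a * z) (n a + \<epsilon> + m) * gam (t a / z) (n a - m)))"
    by (intro prod.cong refl) (use t z gam_q_shift_mult in simp)
  also have "\<dots> = (\<Prod>a\<in>S. theta_p (t a * z) (n a + \<epsilon> + m)) * (\<Prod>a\<in>S. gam (t a * z) (n a + \<epsilon> + m) * gam (t a / z) (n a - m))"
    by (rule prod.distrib)
  finally have e1: "(\<Prod>a\<in>S. gam (q * t a * z) (n a + \<epsilon> + m + 1) * gam (t a / z) (n a - m)) =
    (\<Prod>a\<in>S. theta_p (t a * z) (n a + \<epsilon> + m)) * (\<Prod>a\<in>S. gam (t a * z) (n a + \<epsilon> + m) * gam (t a / z) (n a - m))" .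
  have e2: "gam (t j * z) (n j + \<epsilon> + m) = theta_p (t j / q * z) (n j - 1 + \<epsilon> + m) * gam (t j / q * z) (n j - 1 + \<epsilon> + m)"
    using gam_q_shift_mult[OF nj(2,1) z, of "n j - 1 + \<epsilon> + m"] q by (simp add: algebra_simps)
  show ?thesis unfolding gfun_def CC_def e1 e2 by (simp only: mult_ac)
qed

text \<open>The q-shifted arguments let the annulus reach beyond |z| = 1 / |q|, and |t j| < |q|
  keeps the poles coming from t j / (q z) inside the unit circle. Hence the contour can be moved
  between the radii 1 and 1 / |q|.\<close>

lemma gfun_holomorphic:
  assumes S: "finite S" and t: "\<And>a. a \<in> insert j S \<Longrightarrow> t a \<noteq> 0 \<and> norm (t a) < 1" and tj: "norm (t j) < norm q"
  obtains \<delta> where "0 < \<delta>" "\<delta> < 1" "\<And>m. (\<lambda>z. gfun \<epsilon> j S t n z m) holomorphic_on {z. \<delta> < norm z \<and> norm z < 1 / (norm q * \<delta>)}"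
proof
  define D where "D = insert (norm (t j / q)) ((\<lambda>a. norm (t a)) ` S)"
  have nj: "norm (t j / q) < 1" "t j / q \<noteq> 0" using tj q t[of j] by (simp_all add: norm_divide)
  have D: "finite D" "D \<noteq> {}" using S by (auto simp: D_def)
  define \<delta> where "\<delta> = Max D"
  show d1: "\<delta> < 1" unfolding \<delta>_def using D t nj by (subst Max_less_iff) (auto simp: D_def)
  have "norm (t j / q) \<le> \<delta>" unfolding \<delta>_def using D by (intro Max_ge) (auto simp: D_def)
  then show d0: "0 < \<delta>" using nj by (metis less_le_trans zero_less_norm_iff)
  have ta: "norm (t a) \<le> \<delta>" if "a \<in> S" for a unfolding \<delta>_def using D that by (intro Max_ge) (auto simp: D_def)
  have tjd: "norm (t j / q) \<le> \<delta>" by fact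
  show "(\<lambda>z. gfun \<epsilon> j S t n z m) holomorphic_on {z. \<delta> < norm z \<and> norm z < 1 / (norm q * \<delta>)}" for m
  proof -
    let ?A = "{z::complex. \<delta> < norm z \<and> norm z < 1 / (norm q * \<delta>)}"
    have z0: "z \<noteq> 0" if "z \<in> ?A" for z using that d0 by auto
    have qz: "norm (q * c * z) < 1" if "z \<in> ?A" "norm c \<le> \<delta>" for z c
    proof -
      have "norm (q * c * z) \<le> norm q * \<delta> * norm z"
        unfolding norm_mult using that by (intro mult_right_mono mult_left_mono) auto
      also have "\<dots> < 1" using that d0 q by (simp add: field_simps)
      finally show ?thesis .
    qed
    have dz: "norm (c / z) < 1" if "z \<in> ?A" "norm c \<le> \<delta>" for z c
      using that z0[OF that(1)] by (simp add: norm_divide)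
    have jz: "norm (t j * z) < 1" if "z \<in> ?A" for z
      using qz[OF that tjd] q by simp
    have "0 \<notin> ?A" using d0 by auto
    show ?thesis unfolding gfun_def
    proof (intro holomorphic_intros bq_holomorphic gam_compose_holomorphic)
      fix z a assume "a \<in> S" and z: "z \<in> ?A"
      then show "q * t a * z \<noteq> 0 \<and> norm (q * t a * z) < 1" "t a / z \<noteq> 0 \<and> norm (t a / z) < 1"
        using qz[OF z ta] dz[OF z ta] t z0[OF z] q by auto
    next
      fix z assume z: "z \<in> ?A"
      show "t j * z \<noteq> 0 \<and> norm (t j * z) < 1" "t j / q / z \<noteq> 0 \<and> norm (t j / q / z) < 1"
        using jz[OF z] dz[OF z tjd] t[of j] z0[OF z] q by auto
    qed (use z0 \<open>0 \<notin> ?A\<close> in auto)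
  qed
qed

definition shift_t :: "nat \<Rightarrow> nat \<Rightarrow> (nat \<Rightarrow> complex) \<Rightarrow> nat \<Rightarrow> complex" where
  "shift_t i j t = t(i := q * t i, j := t j / q)"

definition shift_n :: "nat \<Rightarrow> nat \<Rightarrow> (nat \<Rightarrow> int) \<Rightarrow> nat \<Rightarrow> int" where
  "shift_n i j n = n(i := n i + 1, j := n j - 1)"

lemma adm_shift:
  assumes a: "adm I \<epsilon> t n" and ij: "i \<in> I" "j \<in> I" "i \<noteq> j" and tj: "norm (t j) < norm q"
  shows "adm I \<epsilon> (shift_t i j t) (shift_n i j n)"
proof -
  define B where "B = I - {i, j}"
  have I: "I = insert i (insert j B)" "finite B" "i \<notin> B" "j \<notin> B" using a ij by (auto simp: B_def adm_def)
  have p1: "(\<Prod>b\<in>B. shift_t i j t b) = (\<Prod>b\<in>B. t b)" "(\<Sum>b\<in>B. shift_n i j n b) = (\<Sum>b\<in>B. n b)"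
    by (intro prod.cong sum.cong refl; use I in \<open>auto simp: shift_t_def shift_n_def\<close>)+
  have v: "shift_t i j t i = q * t i" "shift_t i j t j = t j / q" "shift_n i j n i = n i + 1" "shift_n i j n j = n j - 1"
    using ij by (simp_all add: shift_t_def shift_n_def)
  have "(\<Prod>a\<in>I. shift_t i j t a) = (\<Prod>a\<in>I. t a)" "(\<Sum>a\<in>I. shift_n i j n a) = (\<Sum>a\<in>I. n a)"
    unfolding I(1) using I ij q by (simp_all add: p1 v)
  moreover have "shift_t i j t a \<noteq> 0 \<and> norm (shift_t i j t a) < 1" if "a \<in> I" for a
  proof -
    have t: "t a \<noteq> 0" "norm (t a) < 1" using a that by (auto simp: adm_def)
    have "norm q * norm (t i) < 1 * 1" using a ij q by (intro mult_strict_mono) (auto simp: adm_def)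
    then show ?thesis using t q tj by (auto simp: shift_t_def norm_mult norm_divide)
  qed
  ultimately show ?thesis using a unfolding adm_def by simp
qed

text \<open>After weighting by the quotient of the right hand sides, the two integrands differ by a
  multiple of g(z / q, m - 1) - g(z, m). Moving the contour removes the q-shift in z, and the sum
  over a full period in m removes the shift in m.\<close>

theorem BI_shift:
  assumes a: "adm I \<epsilon> t n" and ij: "i \<in> I" "j \<in> I" "i \<noteq> j" and tj: "norm (t j) < norm q"
  shows "BI I \<epsilon> (shift_t i j t) (shift_n i j n) * RH I \<epsilon> t n = BI I \<epsilon> t n * RH I \<epsilon> (shift_t i j t) (shift_n i j n)"
proof -
  define t' n' where "t' = shift_t i j t" and "n' = shift_n i j n"
  have a': "adm I \<epsilon> t' n'" unfolding t'_def n'_def by (rule adm_shift[OF assms])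
  define B where "B = I - {i, j}"
  have I: "I = insert i (insert j B)" and B: "finite B" "i \<notin> B" "j \<notin> B" using a ij by (auto simp: B_def adm_def)
  have cB: "card B = 4" using a ij B unfolding adm_def I by simp
  define S where "S = insert i B"
  have S: "finite S" "card S = 5" "j \<notin> S" "insert j S = I" using B cB ij by (auto simp: S_def I)
  have t: "t b \<noteq> 0 \<and> norm (t b) < 1" if "b \<in> I" for b using a that by (auto simp: adm_def)
  have nj: "norm (t j / q) < 1" "t j / q \<noteq> 0" using tj q t[of j] ij by (simp_all add: norm_divide)
  obtain x where x: "\<And>b. b \<in> I \<Longrightarrow> t b = exp (x b)" "(\<Sum>b\<in>I. x b) = lp + lq" using adm_logs[OF a] by blast
  have sxB: "(\<Sum>b\<in>B. x b) = lp + lq - x i - x j"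
    using x(2) B ij unfolding I by (simp add: algebra_simps)
  have sxS: "(\<Sum>b\<in>S. x b) = lp + lq - x j" using sxB B by (simp add: S_def)
  have sn0: "(\<Sum>b\<in>I. n b) + 3 * \<epsilon> = 0" using a by (simp add: adm_def)
  have snB: "(\<Sum>b\<in>B. n b) = - 3 * \<epsilon> - n i - n j" using sn0 B ij unfolding I by simp
  have snS: "(\<Sum>b\<in>S. n b) = - 3 * \<epsilon> - n j" using snB B by (simp add: S_def)
  have v: "t' i = q * t i" "t' j = t j / q" "n' i = n i + 1" "n' j = n j - 1"
    using ij by (simp_all add: t'_def n'_def shift_t_def shift_n_def)
  have vB: "t' b = t b" "n' b = n b" if "b \<in> B" for b using that B by (auto simp: t'_def n'_def shift_t_def shift_n_def)
  have tib: "gam (q * (t i * t b)) (n i + n b + \<epsilon> + 1) = theta_p (t i * t b) (n i + n b + \<epsilon>) * gam (t i * t b) (n i + n b + \<epsilon>)" if "b \<in> B" for b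
    by (rule gam_shift_q; rule unit_dom) (use adm_pair_norm[OF a ij(1), of b] t[of i] t[of b] that B ij in \<open>auto simp: I\<close>)
  \<comment> \<open>The shifted parameters are admissible too, so gam is nonzero at q t i t b, and
    the factor that leads there cannot vanish.\<close>
  have tib0: "theta_p (t i * t b) (n i + n b + \<epsilon>) \<noteq> 0" if "b \<in> B" for b
  proof -
    have b: "b \<in> I" "i \<noteq> b" using that B by (auto simp: I)
    have n2: "norm (p * q) < norm (q * (t i * t b))" "norm (q * (t i * t b)) < 1"
      using adm_pair_norm[OF a' ij(1) b] vB[OF that] by (simp_all add: v mult_ac)
    have "gam (q * (t i * t b)) (n i + n b + \<epsilon> + 1) \<noteq> 0"
      by (rule gam_nonzero[OF unit_dom]) (use n2 t[OF b(1)] t[OF ij(1)] q unit_dom(2) in auto)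
    then show ?thesis unfolding tib[OF that] by auto
  qed
  have tjb: "gam (t j * t b) (n j + n b + \<epsilon>) = theta_p (t j / q * t b) (n j - 1 + n b + \<epsilon>) * gam (t j / q * t b) (n j - 1 + n b + \<epsilon>)" if "b \<in> B" for b
  proof -
    have b: "b \<in> I" using that by (auto simp: I)
    have "norm (t j / q) * norm (t b) < 1 * 1" using nj t[OF b] by (intro mult_strict_mono) auto
    then have "norm (t j / q * t b) < 1" by (simp only: norm_mult)
    then have "gam (q * (t j / q * t b)) (n j - 1 + n b + \<epsilon> + 1) = theta_p (t j / q * t b) (n j - 1 + n b + \<epsilon>) * gam (t j / q * t b) (n j - 1 + n b + \<epsilon>)"
      using nj t[OF b] by (intro gam_shift_q unit_dom) auto
    then show ?thesis using q by (simp add: algebra_simps)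
  qed
  define c where "c = (\<Prod>b\<in>B. theta_p (t j / q * t b) (n j - 1 + n b + \<epsilon>) / theta_p (t i * t b) (n i + n b + \<epsilon>))"
  have RHc: "RH I \<epsilon> t n = c * RH I \<epsilon> t' n'"
  proof -
    have "RH B \<epsilon> t' n' = RH B \<epsilon> t n" by (rule RH_cong) (use vB in auto)
    moreover have "(\<Prod>b\<in>B. gam (t' i * t' b) (n' i + n' b + \<epsilon>)) = (\<Prod>b\<in>B. theta_p (t i * t b) (n i + n b + \<epsilon>) * gam (t i * t b) (n i + n b + \<epsilon>))"
    proof (intro prod.cong refl)
      fix b assume b: "b \<in> B"
      have "gam (t' i * t' b) (n' i + n' b + \<epsilon>) = gam (q * (t i * t b)) (n i + n b + \<epsilon> + 1)"
        by (simp add: v vB[OF b] algebra_simps)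
      then show "gam (t' i * t' b) (n' i + n' b + \<epsilon>) = theta_p (t i * t b) (n i + n b + \<epsilon>) * gam (t i * t b) (n i + n b + \<epsilon>)"
        using tib[OF b] by simp
    qed
    moreover have "(\<Prod>b\<in>B. gam (t j * t b) (n j + n b + \<epsilon>)) = (\<Prod>b\<in>B. theta_p (t j / q * t b) (n j - 1 + n b + \<epsilon>) * gam (t' j * t' b) (n' j + n' b + \<epsilon>))"
      by (intro prod.cong refl) (simp add: v vB tjb)
    moreover have "gam (t' i * t' j) (n' i + n' j + \<epsilon>) = gam (t i * t j) (n i + n j + \<epsilon>)" using q by (simp add: v)
    moreover have "(\<Prod>b\<in>B. theta_p (t i * t b) (n i + n b + \<epsilon>)) \<noteq> 0" using tib0 B by simp
    ultimately show ?thesis unfolding I c_def using B ij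
      by (simp add: RH_insert prod.distrib prod_dividef)
  qed
  define k where "k = kap \<epsilon> i j B x n"
  \<comment> \<open>All terms share the factor \<open>CC\<close>, which is invariant under (z, m) ->
    (1 / z, - m - \<epsilon>); what is left is the theta relation, with \<open>gfun_shift\<close>
    rewriting the reflected term.\<close>
  have point: "c * W I \<epsilon> t' n' z m - W I \<epsilon> t n z m = k * gfun \<epsilon> j S t n (z / q) (m - 1) - k * gfun \<epsilon> j S t n z m" if z: "norm z = 1" for z m
  proof -
    define y where "y = Ln z"
    have z0: "z \<noteq> 0" using z by auto
    then have zy: "z = exp y" by (simp add: y_def)
    have CB: "CC \<epsilon> j S t n z m = (\<Prod>a\<in>B. gam (t a * z) (n a + \<epsilon> + m) * gam (t a / z) (n a - m))
       * (gam (t i * z) (n i + \<epsilon> + m) * gam (t i / z) (n i - m))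
       * (gam (t j / q * z) (n j - 1 + \<epsilon> + m) * gam (t j / q / z) (n j - 1 - m))"
      unfolding CC_def S_def using B by simp
    have zi: "norm (1 / z) = 1" using z by (simp add: norm_divide)
    have W1: "W I \<epsilon> t n z m = CC \<epsilon> j S t n z m * (ker (z\<^sup>2) (2 * m + \<epsilon>) * theta_p (t j / q * z) (n j - 1 + \<epsilon> + m) * theta_p (t j / q / z) (n j - 1 - m))"
    proof -
      have "gam (t j * z) (n j + \<epsilon> + m) = theta_p (t j / q * z) (n j - 1 + \<epsilon> + m) * gam (t j / q * z) (n j - 1 + \<epsilon> + m)"
        using gam_q_shift_mult[OF nj(2,1) z, of "n j - 1 + \<epsilon> + m"] q by (simp add: algebra_simps)
      moreover have "gam (t j / z) (n j - m) = theta_p (t j / q / z) (n j - 1 - m) * gam (t j / q / z) (n j - 1 - m)"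
        using gam_q_shift_mult[OF nj(2,1) zi, of "n j - 1 - m"] q by (simp add: algebra_simps)
      ultimately show ?thesis unfolding W_def CB I using B ij by (simp add: mult_ac)
    qed
    have W2: "W I \<epsilon> t' n' z m = CC \<epsilon> j S t n z m * (ker (z\<^sup>2) (2 * m + \<epsilon>) * theta_p (t i * z) (n i + \<epsilon> + m) * theta_p (t i / z) (n i - m))"
    proof -
      have ti: "t i \<noteq> 0" "norm (t i) < 1" using t ij by auto
      have "gam (q * t i * z) (n i + 1 + \<epsilon> + m) = theta_p (t i * z) (n i + \<epsilon> + m) * gam (t i * z) (n i + \<epsilon> + m)"
        using gam_q_shift_mult[OF ti z, of "n i + \<epsilon> + m"] by (simp add: algebra_simps)
      moreover have "gam (q * t i / z) (n i + 1 - m) = theta_p (t i / z) (n i - m) * gam (t i / z) (n i - m)"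
        using gam_q_shift_mult[OF ti zi, of "n i - m"] by (simp add: algebra_simps)
      moreover have "(\<Prod>a\<in>B. gam (t' a * z) (n' a + \<epsilon> + m) * gam (t' a / z) (n' a - m)) = (\<Prod>a\<in>B. gam (t a * z) (n a + \<epsilon> + m) * gam (t a / z) (n a - m))"
        by (intro prod.cong refl) (simp add: vB)
      ultimately show ?thesis unfolding W_def CB I using B ij by (simp add: v mult_ac)
    qed
    have G1: "gfun \<epsilon> j S t n z m = CC \<epsilon> j S t n z m * ((\<Prod>a\<in>S. theta_p (t a * z) (n a + \<epsilon> + m)) * theta_p (t j / q * z) (n j - 1 + \<epsilon> + m) * bq \<epsilon> z m)"
      by (rule gfun_factor) (use t S tj z in auto)
    have G2: "gfun \<epsilon> j S t n (1 / z) (- m - \<epsilon>) = CC \<epsilon> j S t n z m * ((\<Prod>a\<in>S. theta_p (t a / z) (n a - m)) * theta_p (t j / q / z) (n j - 1 - m) * bq \<epsilon> (1 / z) (- m - \<epsilon>))"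
      using gfun_factor[of j S t "1 / z" \<epsilon> n "- m - \<epsilon>"] t S tj zi by (simp add: CC_inverse algebra_simps)
    have e1: "exp (x b + y) = t b * z" "exp (x b - y) = t b / z" if "b \<in> I" for b using x(1)[OF that] by (simp_all add: zy exp_add exp_diff)
    have e2: "exp (x j - lq + y) = t j / q * z" "exp (x j - lq - y) = t j / q / z" using x(1)[OF ij(2)] by (simp_all add: zy exp_add exp_diff)
    have e3: "exp (x j - lq + x b) = t j / q * t b" "exp (x i + x b) = t i * t b" if "b \<in> I" for b using x(1)[OF ij(2)] x(1)[OF ij(1)] x(1)[OF that] by (simp_all add: exp_add exp_diff)
    have e4: "exp (2 * y) = z\<^sup>2" "exp (- y) = 1 / z" by (simp_all add: zy exp_double exp_minus divide_inverse)
    have BI': "b \<in> I" if "b \<in> B" for b using that by (simp add: I)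
    have SI: "b \<in> I" if "b \<in> insert i B" for b using that by (auto simp: I)
    have q1: "(\<Prod>b\<in>B. theta_p (exp (x i + x b)) (n i + n b + \<epsilon>)) = (\<Prod>b\<in>B. theta_p (t i * t b) (n i + n b + \<epsilon>))"
      by (intro prod.cong refl) (simp add: e3 BI')
    have q2: "(\<Prod>b\<in>B. theta_p (exp (x j - lq + x b)) (n j - 1 + n b + \<epsilon>) / theta_p (exp (x i + x b)) (n i + n b + \<epsilon>)) = c"
      unfolding c_def by (intro prod.cong refl) (simp add: e3 BI')
    have q3: "(\<Prod>a\<in>insert i B. theta_p (exp (x a + y)) (n a + \<epsilon> + m)) = (\<Prod>a\<in>S. theta_p (t a * z) (n a + \<epsilon> + m))"
      "(\<Prod>a\<in>insert i B. theta_p (exp (x a - y)) (n a - m)) = (\<Prod>a\<in>S. theta_p (t a / z) (n a - m))"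
      unfolding S_def by (intro prod.cong refl; simp only: e1[OF SI])+
    have "(\<Prod>b\<in>B. theta_p (exp (x i + x b)) (n i + n b + \<epsilon>)) \<noteq> 0" unfolding q1 using tib0 B by simp
    from shift_theta_relation[OF B(1) cB B(2) sxB snB this, of y m]
    have rel: "c * ker (z\<^sup>2) (2 * m + \<epsilon>) * theta_p (t i * z) (n i + \<epsilon> + m) * theta_p (t i / z) (n i - m)
       - ker (z\<^sup>2) (2 * m + \<epsilon>) * theta_p (t j / q * z) (n j - 1 + \<epsilon> + m) * theta_p (t j / q / z) (n j - 1 - m)
       + k * ((\<Prod>a\<in>S. theta_p (t a * z) (n a + \<epsilon> + m)) * theta_p (t j / q * z) (n j - 1 + \<epsilon> + m) * bq \<epsilon> z m
       + (\<Prod>a\<in>S. theta_p (t a / z) (n a - m)) * theta_p (t j / q / z) (n j - 1 - m) * bq \<epsilon> (1 / z) (- m - \<epsilon>)) = 0"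
      unfolding q2 q3 e4 e2 e1[OF ij(1)] k_def[symmetric] zy[symmetric] .
    have alg: "c * (C * (K * t1 * t2)) - C * (K * t3 * t4) = k * - (C * (p2 * t4 * b2)) - k * (C * (p1 * t3 * b1))"
      if "c * K * t1 * t2 - K * t3 * t4 + k * (p1 * t3 * b1 + p2 * t4 * b2) = 0" for C K t1 t2 t3 t4 p1 p2 b1 b2 :: complex
    proof -
      have "c * (C * (K * t1 * t2)) - C * (K * t3 * t4) - (k * - (C * (p2 * t4 * b2)) - k * (C * (p1 * t3 * b1)))
        = C * (c * K * t1 * t2 - K * t3 * t4 + k * (p1 * t3 * b1 + p2 * t4 * b2))" by (simp add: algebra_simps)
      then show ?thesis unfolding that by simp
    qed
    show ?thesis unfolding W1 W2 gfun_shift[OF z0] G1 G2 by (rule alg[OF rel])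
  qed
  obtain \<delta> where \<delta>: "0 < \<delta>" "\<delta> < 1" "\<And>m. (\<lambda>z. gfun \<epsilon> j S t n z m) holomorphic_on {z. \<delta> < norm z \<and> norm z < 1 / (norm q * \<delta>)}"
    using gfun_holomorphic[OF S(1), of j t \<epsilon> n] t S tj by metis
  have b: "1 < 1 / (norm q * \<delta>)" "norm (1 / q) < 1 / (norm q * \<delta>)" "\<delta> < norm (1 / q)"
  proof -
    have "norm q * \<delta> < 1 * 1" using \<delta> q by (intro mult_strict_mono) auto
    then show "1 < 1 / (norm q * \<delta>)" using \<delta> q by (simp add: field_simps)
    show "norm (1 / q) < 1 / (norm q * \<delta>)" using \<delta> q by (simp add: norm_divide field_simps)
    have "\<delta> * norm q < 1 * 1" using \<delta> q by (intro mult_strict_mono) auto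
    then show "\<delta> < norm (1 / q)" using q by (simp add: norm_divide field_simps)
  qed
  have gc: "continuous_on (sphere 0 1) (\<lambda>z. gfun \<epsilon> j S t n z m)" for m
    by (rule continuous_on_subset[OF holomorphic_on_imp_continuous_on[OF \<delta>(3)]]) (use \<delta> b in auto)
  have gc': "continuous_on (sphere 0 1) (\<lambda>z. gfun \<epsilon> j S t n (z / q) m)" for m
    by (rule continuous_on_compose2[OF holomorphic_on_imp_continuous_on[OF \<delta>(3)]])
       (use \<delta> b q in \<open>auto intro!: continuous_intros simp: norm_divide\<close>)
  \<comment> \<open>The circle of radius 1 / |q| is moved back to the unit circle within the annulus
    of holomorphy.\<close>
  have gdil: "circ (\<lambda>z. gfun \<epsilon> j S t n (z / q) m) = circ (\<lambda>z. gfun \<epsilon> j S t n z m)" for m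
    using circ_dilation[OF \<delta>(3) \<delta>(1,2) b(1,3,2), of m] by simp
  have Wc: "continuous_on (sphere 0 1) (\<lambda>z. W I \<epsilon> t n z m)" "continuous_on (sphere 0 1) (\<lambda>z. W I \<epsilon> t' n' z m)" for m
    by (rule W_continuous; use a a' in \<open>auto simp: adm_def\<close>)+
  have step: "c * circ (\<lambda>z. W I \<epsilon> t' n' z m) - circ (\<lambda>z. W I \<epsilon> t n z m) = k * (circ (\<lambda>z. gfun \<epsilon> j S t n z (m - 1)) - circ (\<lambda>z. gfun \<epsilon> j S t n z m))" for m
  proof -
    have "c * circ (\<lambda>z. W I \<epsilon> t' n' z m) - circ (\<lambda>z. W I \<epsilon> t n z m) = circ (\<lambda>z. c * W I \<epsilon> t' n' z m - W I \<epsilon> t n z m)"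
      by (simp add: circ_diff circ_cmult Wc continuous_on_mult_left)
    also have "\<dots> = circ (\<lambda>z. k * gfun \<epsilon> j S t n (z / q) (m - 1) - k * gfun \<epsilon> j S t n z m)"
      by (rule circ_cong) (rule point)
    also have "\<dots> = k * circ (\<lambda>z. gfun \<epsilon> j S t n (z / q) (m - 1)) - k * circ (\<lambda>z. gfun \<epsilon> j S t n z m)"
      by (simp add: circ_diff circ_cmult gc gc' continuous_on_mult_left)
    finally show ?thesis by (simp add: gdil right_diff_distrib)
  qed
  have "c * BI I \<epsilon> t' n' - BI I \<epsilon> t n = (\<Sum>m<r. k * (circ (\<lambda>z. gfun \<epsilon> j S t n z (int m - 1)) - circ (\<lambda>z. gfun \<epsilon> j S t n z (int m))))"
    unfolding BI_def sum_distrib_left sum_subtractf[symmetric] by (intro sum.cong refl step)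
  also have "\<dots> = k * (\<Sum>m<r. circ (\<lambda>z. gfun \<epsilon> j S t n z (int m - 1)) - circ (\<lambda>z. gfun \<epsilon> j S t n z (int (Suc m) - 1)))"
    by (simp add: sum_distrib_left)
  also have "\<dots> = k * (circ (\<lambda>z. gfun \<epsilon> j S t n z (int 0 - 1)) - circ (\<lambda>z. gfun \<epsilon> j S t n z (int r - 1)))"
    by (subst sum_lessThan_telescope') simp
  \<comment> \<open>The telescoped ends are m = - 1 and m = r - 1, one period apart.\<close>
  also have "circ (\<lambda>z. gfun \<epsilon> j S t n z (int r - 1)) = circ (\<lambda>z. gfun \<epsilon> j S t n z (int 0 - 1))"
  proof (rule circ_cong)
    fix z :: complex assume "norm z = 1"
    then have "gfun \<epsilon> j S t n z (- 1 + int r) = gfun \<epsilon> j S t n z (- 1)"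
      by (intro gfun_period[where x = x] S sxS snS tj) (use x(1) t S(4) in auto)
    then show "gfun \<epsilon> j S t n z (int r - 1) = gfun \<epsilon> j S t n z (int 0 - 1)" by (simp add: algebra_simps)
  qed
  finally have "BI I \<epsilon> t n = c * BI I \<epsilon> t' n'" by simp
  then show ?thesis unfolding RHc t'_def[symmetric] n'_def[symmetric] by simp
qed

end

section \<open>The rarefied elliptic beta integral up to a constant\<close>

text \<open>By the shifts every pair \<open>(k, y)\<close> can be moved into a compact fundamental domain inside the open
  strip, so that some \<open>f k\<close> attains its maximal modulus at an interior point.\<close>
lemma strip_constant:
  fixes f :: "int \<Rightarrow> complex \<Rightarrow> complex" and l :: complex and a :: real and r :: nat
  defines "S \<equiv> {y. a < Re y \<and> Re y < 0}"
  assumes r: "r > 0" and l: "Re l < 0" "a < Re l"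
    and hol: "\<And>k. f k holomorphic_on S"
    and per: "\<And>k y. f k (y + 2 * pi * \<i>) = f k y"
    and perk: "\<And>k y. y \<in> S \<Longrightarrow> f (k + int r) y = f k y"
    and shift: "\<And>k y. y \<in> S \<Longrightarrow> y + l \<in> S \<Longrightarrow> f (k + 1) (y + l) = f k y"
    and y: "y \<in> S" "y' \<in> S"
  shows "f k y = f k' y'"
proof -
  define Q where "Q = - Re l"
  \<comment> \<open>The real parts in [s - Q, s] form an interval of length one shift, centred at
    the middle a / 2 of the strip. It lies inside the open strip because the strip is wider than
    Q.\<close>
  define s where "s = (a + Q) / 2"
  have Q: "Q > 0" and s: "s < 0" "a < s - Q" using l by (auto simp: Q_def s_def field_simps)
  have S: "open S" "connected S"
  proof -
    have "S = {x. a < Re x} \<inter> {x. Re x < 0}" by (auto simp: S_def)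
    then show "open S" "connected S"
      by (auto intro!: open_Int convex_connected convex_Int open_halfspace_Re_gt open_halfspace_Re_lt convex_halfspace_Re_gt convex_halfspace_Re_lt)
  qed
  have perI: "f k (y + 2 * pi * \<i> * of_int n) = f k y" for k y n
  proof (induction n rule: int_induct[where k = 0])
    case (step1 i)
    have "y + 2 * pi * \<i> * of_int (i + 1) = y + 2 * pi * \<i> * of_int i + 2 * pi * \<i>" by (simp add: algebra_simps)
    then show ?case using step1 per by metis
  next
    case (step2 i)
    have "y + 2 * pi * \<i> * of_int i = y + 2 * pi * \<i> * of_int (i - 1) + 2 * pi * \<i>" by (simp add: algebra_simps)
    then show ?case using step2 per by metis
  qed simp
  have perK: "f (k + int r * n) y = f k y" if "y \<in> S" for k n y
  proof (induction n rule: int_induct[where k = 0])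
    case (step1 i)
    have "k + int r * (i + 1) = (k + int r * i) + int r" by (simp add: algebra_simps)
    then show ?case using step1 perk[OF that] by metis
  next
    case (step2 i)
    have "k + int r * i = (k + int r * (i - 1)) + int r" by (simp add: algebra_simps)
    then show ?case using step2 perk[OF that] by metis
  qed simp
  \<comment> \<open>Induction on the number of shifts needed to reach the fundamental interval; the
    point stays in the strip at every step, so \<open>shift\<close> applies.\<close>
  have down: "\<exists>k' y'. y' \<in> S \<and> s - Q \<le> Re y' \<and> Re y' \<le> s \<and> f k y = f k' y'"
    if "y \<in> S" "s - Q \<le> Re y" "Re y \<le> s + of_nat n * Q" for n k y
    using that
  proof (induction n arbitrary: k y)
    case (Suc n)
    show ?case
    proof (cases "Re y \<le> s")
      case False
      have 1: "y + l \<in> S" using Suc.prems False s l by (auto simp: S_def Q_def)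
      have 2: "s - Q \<le> Re (y + l)" "Re (y + l) \<le> s + of_nat n * Q" using Suc.prems False by (auto simp: Q_def algebra_simps)
      obtain k' y' where "y' \<in> S" "s - Q \<le> Re y'" "Re y' \<le> s" "f (k + 1) (y + l) = f k' y'" using Suc.IH[OF 1 2] by blast
      then show ?thesis using shift[OF Suc.prems(1) 1] by metis
    qed (use Suc.prems in blast)
  qed auto
  have up: "\<exists>k' y'. y' \<in> S \<and> s - Q \<le> Re y' \<and> Re y' \<le> s \<and> f k y = f k' y'"
    if "y \<in> S" "Re y \<le> s" "s - Q - of_nat n * Q \<le> Re y" for n k y
    using that
  proof (induction n arbitrary: k y)
    case (Suc n)
    show ?case
    proof (cases "s - Q \<le> Re y")
      case False
      have 1: "y - l \<in> S" using Suc.prems False s l by (auto simp: S_def Q_def)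
      have 2: "Re (y - l) \<le> s" "s - Q - of_nat n * Q \<le> Re (y - l)" using Suc.prems False by (auto simp: Q_def algebra_simps)
      obtain k' y' where "y' \<in> S" "s - Q \<le> Re y'" "Re y' \<le> s" "f (k - 1) (y - l) = f k' y'" using Suc.IH[OF 1 2] by blast
      moreover have "f (k - 1 + 1) (y - l + l) = f (k - 1) (y - l)" using shift[OF 1, of "k - 1"] Suc.prems by simp
      ultimately show ?thesis by (metis diff_add_cancel)
    qed (use Suc.prems in blast)
  qed auto
  define K where "K = cbox (Complex (s - Q) 0) (Complex s (2 * pi))"
  have KS: "K \<subseteq> S" using s by (auto simp: K_def S_def in_cbox_complex_iff)
  have red: "\<exists>k' \<in> {0..<int r}. \<exists>y' \<in> K. f k y = f k' y'" if "y \<in> S" for k y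
  proof -
    have "\<exists>k' y'. y' \<in> S \<and> s - Q \<le> Re y' \<and> Re y' \<le> s \<and> f k y = f k' y'"
    proof (cases "Re y \<le> s")
      case True
      obtain n where "s - Q - Re y \<le> of_nat n * Q" using Q by (metis ex_less_of_nat_mult less_imp_le)
      then show ?thesis using up[OF that True, of n] by auto
    next
      case False
      obtain n where "Re y - s \<le> of_nat n * Q" using Q by (metis ex_less_of_nat_mult less_imp_le)
      then show ?thesis using down[OF that, of n] False Q by auto
    qed
    then obtain k1 y1 where 1: "y1 \<in> S" "s - Q \<le> Re y1" "Re y1 \<le> s" "f k y = f k1 y1" by blast
    define n where "n = - \<lfloor>Im y1 / (2 * pi)\<rfloor>"
    define y2 where "y2 = y1 + 2 * pi * \<i> * of_int n"
    have i1: "of_int \<lfloor>Im y1 / (2 * pi)\<rfloor> * (2 * pi) \<le> Im y1" "Im y1 < (of_int \<lfloor>Im y1 / (2 * pi)\<rfloor> + 1) * (2 * pi)"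
      by (simp_all add: pos_le_divide_eq[symmetric] pos_divide_less_eq[symmetric])
    have "Re y2 = Re y1" "0 \<le> Im y2" "Im y2 \<le> 2 * pi"
      using i1 by (simp_all add: y2_def n_def algebra_simps)
    then have y2: "y2 \<in> K" using 1 by (auto simp: K_def in_cbox_complex_iff)
    have "f k1 y1 = f k1 y2" unfolding y2_def by (rule perI[symmetric])
    also have "\<dots> = f (k1 mod int r) y2"
      using perK[of y2 "k1 mod int r" "k1 div int r"] y2 KS by (auto simp: algebra_simps)
    finally have "f k y = f (k1 mod int r) y2" using 1(4) by simp
    moreover have "k1 mod int r \<in> {0..<int r}" using r by simp
    ultimately show ?thesis using y2 by blast
  qed
  have Kne: "K \<noteq> {}" using Q by (auto simp: K_def box_ne_empty Basis_complex_def)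
  have "\<exists>y0\<in>K. \<forall>y\<in>K. norm (f k y) \<le> norm (f k y0)" for k
  proof (rule continuous_attains_sup)
    show "continuous_on K (\<lambda>y. norm (f k y))"
      by (intro continuous_intros holomorphic_on_imp_continuous_on holomorphic_on_subset[OF hol KS])
  qed (use Kne in \<open>auto simp: K_def\<close>)
  then obtain Y where Y: "\<And>k. Y k \<in> K" "\<And>k y. y \<in> K \<Longrightarrow> norm (f k y) \<le> norm (f k (Y k))" by metis
  obtain k0 where k0: "k0 \<in> {0..<int r}" "\<And>k. k \<in> {0..<int r} \<Longrightarrow> norm (f k (Y k)) \<le> norm (f k0 (Y k0))"
  proof -
    let ?A = "(\<lambda>k. norm (f k (Y k))) ` {0..<int r}"
    have "Max ?A \<in> ?A" using r by (intro Max_in) auto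
    then obtain k0 where "k0 \<in> {0..<int r}" "Max ?A = norm (f k0 (Y k0))" by auto
    moreover have "norm (f k (Y k)) \<le> Max ?A" if "k \<in> {0..<int r}" for k
      using that by (intro Max_ge) auto
    ultimately show ?thesis using that[of k0] by simp
  qed
  have bound: "norm (f k y) \<le> norm (f k0 (Y k0))" if "y \<in> S" for k y
    using red[OF that, of k] Y(2) k0(2) by (metis order_trans)
  have "f k0 constant_on S"
    by (rule maximum_modulus_principle[OF hol S S(1) order_refl, of "Y k0"]) (use Y(1) KS bound in auto)
  then obtain c where c: "\<And>y. y \<in> S \<Longrightarrow> f k0 y = c" by (auto simp: constant_on_def)
  \<comment> \<open>One shift determines a neighbouring function only on the overlap of the strip
    with its translate; the identity theorem extends the value c to the whole strip. The overlap is
    nonempty because the strip is wider than the shift.\<close>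
  have ext: "\<forall>y\<in>S. f k y = c" if "\<And>y. y \<in> S \<Longrightarrow> y + v \<in> S \<Longrightarrow> f k y = c" "v = l \<or> v = - l" for k v
  proof
    fix y assume y: "y \<in> S"
    let ?V = "{y \<in> S. y + v \<in> S}"
    have "?V = S \<inter> (\<lambda>y. y + v) -` S" by auto
    then have "open ?V" using S(1) by (auto intro!: open_Int open_vimage continuous_intros)
    moreover have "?V \<noteq> {}"
    proof -
      have "of_real (a / 2 - Re v / 2) \<in> ?V" using that(2) l by (auto simp: S_def)
      then show ?thesis by blast
    qed
    ultimately show "f k y = c"
      by (rule analytic_continuation_open[where f = "f k" and g = "\<lambda>_. c" and s = ?V and s' = S, OF _ S(1) _ S(2) _ hol])
         (simp_all add: y that(1))
  qed
  have all: "\<forall>y\<in>S. f k y = c" for k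
  proof (induction k rule: int_induct[where k = k0])
    case base
    show ?case using c by blast
  next
    case (step1 i)
    show ?case
    proof (rule ext[where v = "- l"])
      fix y assume "y \<in> S" "y + - l \<in> S"
      then show "f (i + 1) y = c" using shift[of "y - l" i] step1 by simp
    qed auto
  next
    case (step2 i)
    show ?case
    proof (rule ext[where v = l])
      fix y assume "y \<in> S" "y + l \<in> S"
      then show "f (i - 1) y = c" using shift[of y "i - 1"] step2 by simp
    qed auto
  qed
  show ?thesis using all y by simp
qed

section \<open>Moves of two parameters that preserve the quotient of the two sides\<close>

context rarefied
begin

lemma RH_nonzero: assumes "adm I \<epsilon> t n" shows "RH I \<epsilon> t n \<noteq> 0"
  unfolding RH_def
proof (subst prod_zero_iff)
  show "finite (pairs I)" using assms by (auto simp: adm_def intro: finite_pairs)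
  have "gam (\<Prod>a\<in>X. t a) ((\<Sum>a\<in>X. n a) + \<epsilon>) \<noteq> 0" if "X \<in> pairs I" for X
  proof -
    have "X \<subseteq> I" "card X = 2" using that by (simp_all add: pairs_def)
    then obtain a b where X: "X = {a, b}" "a \<noteq> b" "a \<in> I" "b \<in> I" by (auto simp: card_2_iff)
    have "t a * t b \<noteq> 0" using assms X by (auto simp: adm_def)
    then have "gam (t a * t b) (n a + n b + \<epsilon>) \<noteq> 0"
      using gam_nonzero[OF unit_dom] adm_pair_norm[OF assms X(3,4,2)] unit_dom(2) by blast
    then show ?thesis using X by simp
  qed
  then show "\<not> (\<exists>X\<in>pairs I. gam (\<Prod>a\<in>X. t a) ((\<Sum>a\<in>X. n a) + \<epsilon>) = 0)" by blast
qed

text \<open>The variables y and m drop out, so the factor can be taken out of the integral and of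
  the sum.\<close>

lemma dper_n_period_W:
  "dper (xi + y) (ni + e + m) (xj + y) (nj + e + m) + dper (xi - y) (ni - m) (xj - y) (nj - m)
   = (of_nat r - 1) * ((2 * ni + e + of_nat r) * (xi + \<i> * pi) - (2 * nj + e - of_nat r) * (xj + \<i> * pi)
      + (ni - nj + of_nat r) * ((ni + nj + e - 1) * lp - (ni + nj + e + 1) * lq))"
  unfolding dper_def by (simp add: field_simps)

text \<open>The right hand side acquires the factor of \<open>dper_n_period_W\<close>; for integer
  parameters the extra term is a multiple of 2 pi i.\<close>

lemma dper_n_period_RH:
  fixes x n :: "nat \<Rightarrow> complex"
  assumes B: "finite B" "card B = 4" and sx: "(\<Sum>b\<in>B. x b) = lp + lq - xi - xj"
    and sn: "(\<Sum>b\<in>B. n b) = - 3 * e - ni - nj"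
  shows "(\<Sum>b\<in>B. dper (xi + x b) (ni + n b + e) (xj + x b) (nj + n b + e))
   = (of_nat r - 1) * ((2 * ni + e + of_nat r) * (xi + \<i> * pi) - (2 * nj + e - of_nat r) * (xj + \<i> * pi)
      + (ni - nj + of_nat r) * ((ni + nj + e - 1) * lp - (ni + nj + e + 1) * lq))
    + 2 * ((of_nat r - 1) * (ni - nj + of_nat r)) * (\<i> * pi)"
proof -
  have "(\<Sum>b\<in>B. dper (xi + x b) (ni + n b + e) (xj + x b) (nj + n b + e))
    = (\<Sum>b\<in>B. (of_nat r - 1) * ((ni - nj + of_nat r) * x b + (xi - xj + (ni - nj + of_nat r) * (lp - lq)) * n b
       + ((ni + e + of_nat r / 2) * (xi + \<i> * pi) - (nj + e - of_nat r / 2) * (xj + \<i> * pi)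
       + (ni - nj + of_nat r) * ((ni + nj + 2 * e - 1) * lp - (ni + nj + 2 * e + 1) * lq) / 2)))"
    unfolding dper_def by (intro sum.cong refl arg_cong[where f = "\<lambda>x. _ * x"]) (simp add: field_simps)
  also have "\<dots> = (of_nat r - 1) * ((ni - nj + of_nat r) * (\<Sum>b\<in>B. x b) + (xi - xj + (ni - nj + of_nat r) * (lp - lq)) * (\<Sum>b\<in>B. n b)
       + of_nat 4 * ((ni + e + of_nat r / 2) * (xi + \<i> * pi) - (nj + e - of_nat r / 2) * (xj + \<i> * pi)
       + (ni - nj + of_nat r) * ((ni + nj + 2 * e - 1) * lp - (ni + nj + 2 * e + 1) * lq) / 2))"
    by (rule sum_affine[OF B])
  finally show ?thesis unfolding sx sn by (rule ssubst) (simp add: field_simps)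
qed

lemma W_split2:
  assumes "finite B" "i \<notin> B" "j \<notin> B" "i \<noteq> j"
  shows "W (insert i (insert j B)) \<epsilon> t n z m = (gam (t i * z) (n i + \<epsilon> + m) * gam (t j * z) (n j + \<epsilon> + m))
     * (gam (t i / z) (n i - m) * gam (t j / z) (n j - m)) * W B \<epsilon> t n z m"
  unfolding W_def using assms by (simp add: mult_ac)

lemma ratio_n_period:
  assumes a: "adm I \<epsilon> t n" and ij: "i \<in> I" "j \<in> I" "i \<noteq> j"
  defines "n' \<equiv> n(i := n i + int r, j := n j - int r)"
  shows "BI I \<epsilon> t n' * RH I \<epsilon> t n = BI I \<epsilon> t n * RH I \<epsilon> t n'"
proof -
  define B where "B = I - {i, j}"
  have I: "I = insert i (insert j B)" and B: "finite B" "i \<notin> B" "j \<notin> B" using a ij by (auto simp: B_def adm_def)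
  have cB: "card B = 4" using a ij B unfolding adm_def I by simp
  have t: "t b \<noteq> 0 \<and> norm (t b) < 1" if "b \<in> I" for b using a that by (auto simp: adm_def)
  obtain x where x: "\<And>b. b \<in> I \<Longrightarrow> t b = exp (x b)" "(\<Sum>b\<in>I. x b) = lp + lq" using adm_logs[OF a] by blast
  have sx: "(\<Sum>b\<in>B. x b) = lp + lq - x i - x j"
    using x(2) B ij unfolding I by (simp add: algebra_simps)
  have "(\<Sum>b\<in>I. n b) + 3 * \<epsilon> = 0" using a by (simp add: adm_def)
  then have "(\<Sum>b\<in>B. n b) = - 3 * \<epsilon> - n i - n j" using B ij unfolding I by simp
  then have sn: "(\<Sum>b\<in>B. of_int (n b)) = - 3 * complex_of_int \<epsilon> - of_int (n i) - of_int (n j)"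
    unfolding of_int_sum[symmetric] by simp
  have v: "n' i = n i + int r" "n' j = n j - int r" and vB: "\<And>b. b \<in> B \<Longrightarrow> n' b = n b" using ij B by (auto simp: n'_def)
  define E where "E = (of_nat r - 1) * ((2 * of_int (n i) + of_int \<epsilon> + of_nat r) * (x i + \<i> * pi) - (2 * of_int (n j) + of_int \<epsilon> - of_nat r) * (x j + \<i> * pi)
      + (of_int (n i) - of_int (n j) + of_nat r) * ((of_int (n i) + of_int (n j) + of_int \<epsilon> - 1) * lp - (of_int (n i) + of_int (n j) + of_int \<epsilon> + 1) * lq))"
  have Wp: "W I \<epsilon> t n' z m = exp E * W I \<epsilon> t n z m" if z: "norm z = 1" for z m
  proof -
    define y where "y = Ln z"
    have z0: "z \<noteq> 0" using z by auto
    then have zy: "z = exp y" by (simp add: y_def)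
    have e1: "exp (x b + y) = t b * z" "exp (x b - y) = t b / z" if "b \<in> I" for b using x(1)[OF that] by (simp_all add: zy exp_add exp_diff)
    have d: "t b * z \<in> dom" "t b * z \<noteq> 1" "t b / z \<in> dom" "t b / z \<noteq> 1" if "b \<in> I" for b
      using t[OF that] z z0 unit_dom[of "t b * z"] unit_dom[of "t b / z"] by (simp_all add: norm_mult norm_divide)
    have 1: "gam (t i * z) (n' i + \<epsilon> + m) * gam (t j * z) (n' j + \<epsilon> + m) = exp (dper (x i + y) (of_int (n i) + of_int \<epsilon> + of_int m) (x j + y) (of_int (n j) + of_int \<epsilon> + of_int m))
       * (gam (t i * z) (n i + \<epsilon> + m) * gam (t j * z) (n j + \<epsilon> + m))"
      using gam_pair_period[of "x i + y" "x j + y" "n i + \<epsilon> + m" "n j + \<epsilon> + m", unfolded e1[OF ij(1)] e1[OF ij(2)]] d ij by (simp add: v algebra_simps)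
    have 2: "gam (t i / z) (n' i - m) * gam (t j / z) (n' j - m) = exp (dper (x i - y) (of_int (n i) - of_int m) (x j - y) (of_int (n j) - of_int m))
       * (gam (t i / z) (n i - m) * gam (t j / z) (n j - m))"
      using gam_pair_period[of "x i - y" "x j - y" "n i - m" "n j - m", unfolded e1[OF ij(1)] e1[OF ij(2)]] d ij by (simp add: v algebra_simps)
    have 3: "W B \<epsilon> t n' z m = W B \<epsilon> t n z m" by (rule W_cong) (simp_all add: vB)
    have 4: "exp E = exp (dper (x i + y) (of_int (n i) + of_int \<epsilon> + of_int m) (x j + y) (of_int (n j) + of_int \<epsilon> + of_int m))
       * exp (dper (x i - y) (of_int (n i) - of_int m) (x j - y) (of_int (n j) - of_int m))"
      unfolding exp_add[symmetric] E_def dper_n_period_W ..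
    show ?thesis
      unfolding I W_split2[OF B ij(3)] 1 2 3 4 by (simp only: mult_ac)
  qed
  have "BI I \<epsilon> t n' = (\<Sum>m<r. circ (\<lambda>z. exp E * W I \<epsilon> t n z (int m)))"
    unfolding BI_def by (intro sum.cong refl circ_cong Wp)
  also have "\<dots> = exp E * BI I \<epsilon> t n"
    unfolding BI_def sum_distrib_left by (intro sum.cong refl circ_cmult W_continuous t)
  finally have 1: "BI I \<epsilon> t n' = exp E * BI I \<epsilon> t n" .
  have "RH I \<epsilon> t n' = exp E * RH I \<epsilon> t n"
  proof -
    have d: "exp (x a + x b) \<in> dom" "exp (x a + x b) \<noteq> 1" if "a \<in> I" "b \<in> I" "a \<noteq> b" for a b
      using adm_pair_norm[OF a that] t[OF that(1)] t[OF that(2)] unit_dom[of "t a * t b"] x(1)[OF that(1)] x(1)[OF that(2)]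
      by (simp_all add: exp_add)
    have "(\<Prod>b\<in>B. gam (exp (x i + x b)) (n i + n b + \<epsilon> + int r) * gam (exp (x j + x b)) (n j + n b + \<epsilon> - int r))
      = exp (\<Sum>b\<in>B. dper (x i + x b) (of_int (n i + n b + \<epsilon>)) (x j + x b) (of_int (n j + n b + \<epsilon>))) *
        (\<Prod>b\<in>B. gam (exp (x i + x b)) (n i + n b + \<epsilon>) * gam (exp (x j + x b)) (n j + n b + \<epsilon>))"
      by (rule prod_pair_period[OF B(1)]) (use d ij B in \<open>auto simp: I\<close>)
    also have "exp (\<Sum>b\<in>B. dper (x i + x b) (of_int (n i + n b + \<epsilon>)) (x j + x b) (of_int (n j + n b + \<epsilon>))) = exp E"
    proof (rule exp_eq_exp_2pi[where k = "(int r - 1) * (n i - n j + int r)"])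
      show "(\<Sum>b\<in>B. dper (x i + x b) (of_int (n i + n b + \<epsilon>)) (x j + x b) (of_int (n j + n b + \<epsilon>)))
         = E + 2 * of_int ((int r - 1) * (n i - n j + int r)) * (\<i> * pi)"
        using dper_n_period_RH[OF B(1) cB sx sn] unfolding E_def by simp
    qed
    finally have 1: "(\<Prod>b\<in>B. gam (exp (x i + x b)) (n i + n b + \<epsilon> + int r) * gam (exp (x j + x b)) (n j + n b + \<epsilon> - int r))
      = exp E * (\<Prod>b\<in>B. gam (exp (x i + x b)) (n i + n b + \<epsilon>) * gam (exp (x j + x b)) (n j + n b + \<epsilon>))" .
    have tt: "t i * t b = exp (x i + x b)" "t j * t b = exp (x j + x b)" if "b \<in> B" for b
      using x(1)[of b] x(1)[OF ij(1)] x(1)[OF ij(2)] that by (simp_all add: I exp_add)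
    have 2: "(\<Prod>b\<in>B. gam (t i * t b) (n' i + n' b + \<epsilon>)) * (\<Prod>b\<in>B. gam (t j * t b) (n' j + n' b + \<epsilon>))
      = (\<Prod>b\<in>B. gam (exp (x i + x b)) (n i + n b + \<epsilon> + int r) * gam (exp (x j + x b)) (n j + n b + \<epsilon> - int r))"
      unfolding prod.distrib[symmetric]
    proof (intro prod.cong refl)
      fix b assume b: "b \<in> B"
      have "n' i + n' b + \<epsilon> = n i + n b + \<epsilon> + int r" "n' j + n' b + \<epsilon> = n j + n b + \<epsilon> - int r"
        by (simp_all add: v vB[OF b])
      then show "gam (t i * t b) (n' i + n' b + \<epsilon>) * gam (t j * t b) (n' j + n' b + \<epsilon>) =
        gam (exp (x i + x b)) (n i + n b + \<epsilon> + int r) * gam (exp (x j + x b)) (n j + n b + \<epsilon> - int r)"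
        by (simp only: tt[OF b])
    qed
    have 3: "(\<Prod>b\<in>B. gam (t i * t b) (n i + n b + \<epsilon>)) * (\<Prod>b\<in>B. gam (t j * t b) (n j + n b + \<epsilon>))
      = (\<Prod>b\<in>B. gam (exp (x i + x b)) (n i + n b + \<epsilon>) * gam (exp (x j + x b)) (n j + n b + \<epsilon>))"
      unfolding prod.distrib[symmetric] by (intro prod.cong refl) (simp add: tt)
    have 4: "RH B \<epsilon> t n' = RH B \<epsilon> t n" by (rule RH_cong) (simp_all add: vB)
    have 5: "n' i + n' j = n i + n j" by (simp add: v)
    have sp: "RH I \<epsilon> t k = RH B \<epsilon> t k * gam (t i * t j) (k i + k j + \<epsilon>) * ((\<Prod>b\<in>B. gam (t i * t b) (k i + k b + \<epsilon>)) * (\<Prod>b\<in>B. gam (t j * t b) (k j + k b + \<epsilon>)))" for k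
      unfolding I using B ij by (simp add: RH_insert mult_ac)
    show ?thesis unfolding sp 2 3 4 5 1 by simp
  qed
  then show ?thesis unfolding 1 by simp
qed

definition ratio :: "nat set \<Rightarrow> int \<Rightarrow> (nat \<Rightarrow> complex) \<Rightarrow> (nat \<Rightarrow> int) \<Rightarrow> complex" where
  "ratio I \<epsilon> t n = BI I \<epsilon> t n / RH I \<epsilon> t n"

lemma BI_cong:
  assumes "\<And>a. a \<in> I \<Longrightarrow> t a = t' a" "\<And>a. a \<in> I \<Longrightarrow> n a = n' a"
  shows "BI I \<epsilon> t n = BI I \<epsilon> t' n'"
  unfolding BI_def by (intro sum.cong refl circ_cong W_cong assms)

lemma ratio_cong:
  assumes "\<And>a. a \<in> I \<Longrightarrow> t a = t' a" "\<And>a. a \<in> I \<Longrightarrow> n a = n' a"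
  shows "ratio I \<epsilon> t n = ratio I \<epsilon> t' n'"
  unfolding ratio_def using BI_cong[OF assms] RH_cong[OF assms] by simp

lemma W_param_continuous:
  assumes "finite I" "\<And>a. a \<in> I \<Longrightarrow> continuous_on U (\<lambda>y. t y a)"
    and "\<And>a y. a \<in> I \<Longrightarrow> y \<in> U \<Longrightarrow> t y a \<noteq> 0 \<and> norm (t y a) < 1"
  shows "continuous_on (U \<times> sphere 0 1) (\<lambda>(y, z). W I \<epsilon> (t y) n z m)"
proof -
  have c: "continuous_on (U \<times> sphere 0 1) (\<lambda>x. t (fst x) a)" if "a \<in> I" for a
    by (rule continuous_on_compose2[OF assms(2)[OF that]]) (auto intro!: continuous_intros)
  have "continuous_on (U \<times> sphere 0 1) (\<lambda>x. W I \<epsilon> (t (fst x)) n (snd x) m)"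
    unfolding W_def
    by (intro continuous_intros gam_compose_continuous ker_continuous c)
       (use assms in \<open>auto simp: norm_mult norm_divide\<close>)
  then show ?thesis by (simp add: case_prod_unfold)
qed

lemma BI_holomorphic:
  assumes "finite I" "open U" "\<And>a. a \<in> I \<Longrightarrow> (\<lambda>y. t y a) holomorphic_on U"
    and "\<And>a y. a \<in> I \<Longrightarrow> y \<in> U \<Longrightarrow> t y a \<noteq> 0 \<and> norm (t y a) < 1"
  shows "(\<lambda>y. BI I \<epsilon> (t y) n) holomorphic_on U"
  unfolding BI_def
proof (intro holomorphic_intros circ_param_holomorphic assms(2))
  fix m
  show "continuous_on (U \<times> sphere 0 1) (\<lambda>(y, z). W I \<epsilon> (t y) n z (int m))"
    by (intro W_param_continuous assms holomorphic_on_imp_continuous_on)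
  fix z :: complex assume "norm z = 1"
  then show "(\<lambda>y. W I \<epsilon> (t y) n z (int m)) holomorphic_on U"
    unfolding W_def
    by (intro holomorphic_intros gam_compose_holomorphic assms(3))
       (use assms in \<open>auto simp: norm_mult norm_divide\<close>)
qed

lemma RH_holomorphic:
  assumes "finite I" "\<And>a. a \<in> I \<Longrightarrow> (\<lambda>y. t y a) holomorphic_on U"
    and t: "\<And>a y. a \<in> I \<Longrightarrow> y \<in> U \<Longrightarrow> t y a \<noteq> 0 \<and> norm (t y a) < 1"
  shows "(\<lambda>y. RH I \<epsilon> (t y) n) holomorphic_on U"
  unfolding RH_def
proof (intro holomorphic_intros gam_compose_holomorphic)
  fix X a assume "X \<in> pairs I" "a \<in> X"
  then show "(\<lambda>y. t y a) holomorphic_on U" using assms(2) by (auto simp: pairs_def)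
next
  fix X y assume "X \<in> pairs I" and y: "y \<in> U"
  then have "X \<subseteq> I" "card X = 2" by (simp_all add: pairs_def)
  then obtain a b where X: "X = {a, b}" "a \<noteq> b" "a \<in> I" "b \<in> I" by (auto simp: card_2_iff)
  then show "(\<Prod>a\<in>X. t y a) \<noteq> 0 \<and> norm (\<Prod>a\<in>X. t y a) < 1"
    using t[OF X(3) y] t[OF X(4) y] mult_strict_mono[of "norm (t y a)" 1 "norm (t y b)" 1] by (simp add: norm_mult)
qed

lemma adm_upd:
  assumes a: "adm I \<epsilon> t n" and ij: "i \<in> I" "j \<in> I" "i \<noteq> j"
    and u: "u * v = t i * t j" "norm u < 1" "norm v < 1" and k: "k + l = n i + n j"
  shows "adm I \<epsilon> (t(i := u, j := v)) (n(i := k, j := l))"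
proof -
  define B where "B = I - {i, j}"
  have I: "I = insert i (insert j B)" and B: "finite B" "i \<notin> B" "j \<notin> B" using a ij by (auto simp: B_def adm_def)
  have c: "(\<Prod>b\<in>B. (t(i := u, j := v)) b) = (\<Prod>b\<in>B. t b)" "(\<Sum>b\<in>B. (n(i := k, j := l)) b) = (\<Sum>b\<in>B. n b)"
    by (intro prod.cong sum.cong refl; use B in auto)+
  have "t i * t j \<noteq> 0" using a ij by (simp add: adm_def)
  then have "u \<noteq> 0" "v \<noteq> 0" using u(1) by auto
  moreover have "(\<Prod>b\<in>I. (t(i := u, j := v)) b) = (\<Prod>b\<in>I. t b)" "(\<Sum>b\<in>I. (n(i := k, j := l)) b) = (\<Sum>b\<in>I. n b)"
    unfolding I prod.insert[OF finite.insertI[OF B(1)]] using B ij u k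
    by (simp_all add: c mult.assoc[symmetric] del: fun_upd_apply add: fun_upd_same fun_upd_other)
  ultimately show ?thesis using a u unfolding adm_def by auto
qed

text \<open>With t i t j and n i + n j fixed, the quotient is a function of the discrete parameter
  at i and of the logarithm y of the parameter at i, for y in a vertical strip.
  \<open>BI_shift\<close> and \<open>ratio_n_period\<close> are the two invariances required by
  \<open>strip_constant\<close>.\<close>

lemma ratio_pair_move:
  assumes a: "adm I \<epsilon> t n" and ij: "i \<in> I" "j \<in> I" "i \<noteq> j" and small: "norm (t i * t j) < norm q"
    and u: "u * v = t i * t j" "norm u < 1" "norm v < 1" and k: "k + l = n i + n j"
  shows "ratio I \<epsilon> (t(i := u, j := v)) (n(i := k, j := l)) = ratio I \<epsilon> t n"
proof -
  define c where "c = t i * t j"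
  define lc where "lc = Ln c"
  have c0: "c \<noteq> 0" using a ij by (simp add: adm_def c_def)
  then have lc: "exp lc = c" by (simp add: lc_def)
  define S where "S = {y. Re lc < Re y \<and> Re y < 0}"
  define T where "T = (\<lambda>y. t(i := exp y, j := exp (lc - y)))"
  define N where "N = (\<lambda>k. n(i := k, j := n i + n j - k))"
  have ad: "adm I \<epsilon> (T y) (N k)" if "y \<in> S" for y k
    unfolding T_def N_def by (rule adm_upd[OF a ij]) (use that lc in \<open>auto simp: S_def c_def simp flip: exp_add\<close>)
  have SO: "open S"
  proof -
    have "S = {x. Re lc < Re x} \<inter> {x. Re x < 0}" by (auto simp: S_def)
    then show "open S" by (auto intro!: open_Int open_halfspace_Re_gt open_halfspace_Re_lt)
  qed
  have Thol: "(\<lambda>y. T y b) holomorphic_on S" for b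
    unfolding T_def by (cases "b = j"; cases "b = i") (auto intro!: holomorphic_intros)
  define f where "f = (\<lambda>k y. ratio I \<epsilon> (T y) (N k))"
  have fin: "finite I" using a by (simp add: adm_def)
  have TS: "T y b \<noteq> 0 \<and> norm (T y b) < 1" if "b \<in> I" "y \<in> S" for b y
    using ad[OF that(2), of 0] that(1) by (simp add: adm_def)
  \<comment> \<open>The smallness of t i t j is used here: it makes the strip wider than one shift
    by lq.\<close>
  have slc: "Re lc < Re lq"
  proof -
    have "exp (Re lc) < exp (Re lq)" using small lc by (metis c_def exp_lq norm_exp_eq_Re)
    then show ?thesis by simp
  qed
  have Tij: "T y i = exp y" "T y j = exp (lc - y)" for y using ij by (simp_all add: T_def)
  have key: "f k1 y1 = f k2 y2" if "y1 \<in> S" "y2 \<in> S" for k1 k2 y1 y2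
  proof (rule strip_constant[OF r Re_lq slc, of f, folded S_def])
    show "y1 \<in> S" "y2 \<in> S" by (fact that)+
    show "f k holomorphic_on S" for k
      unfolding f_def ratio_def
      by (intro holomorphic_intros BI_holomorphic RH_holomorphic Thol SO fin RH_nonzero TS ad)
    show "f k (y + 2 * pi * \<i>) = f k y" for k y
    proof -
      have "T (y + 2 * pi * \<i>) = T y" by (simp add: T_def exp_add exp_diff diff_diff_eq[symmetric])
      then show ?thesis by (simp add: f_def)
    qed
    show "f (k + int r) y = f k y" if "y \<in> S" for k y
    proof -
      have "(N k)(i := N k i + int r, j := N k j - int r) = N (k + int r)" using ij by (auto simp: N_def fun_eq_iff)
      with ratio_n_period[OF ad[OF that] ij, of k] have "BI I \<epsilon> (T y) (N (k + int r)) * RH I \<epsilon> (T y) (N k) = BI I \<epsilon> (T y) (N k) * RH I \<epsilon> (T y) (N (k + int r))"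
        by simp
      then show ?thesis using RH_nonzero[OF ad[OF that]] by (simp add: f_def ratio_def frac_eq_eq)
    qed
    show "f (k + 1) (y + lq) = f k y" if "y \<in> S" "y + lq \<in> S" for k y
    proof -
      have "norm (T y j) < norm q"
      proof -
        have "exp (Re (lc - y)) < exp (Re lq)" using that by (simp add: S_def)
        then show ?thesis unfolding Tij by (metis exp_lq norm_exp_eq_Re)
      qed
      from BI_shift[OF ad[OF that(1)] ij this, of k]
      have "BI I \<epsilon> (T (y + lq)) (N (k + 1)) * RH I \<epsilon> (T y) (N k) = BI I \<epsilon> (T y) (N k) * RH I \<epsilon> (T (y + lq)) (N (k + 1))"
      proof -
        have "shift_t i j (T y) = T (y + lq)" using ij by (auto simp: shift_t_def T_def fun_eq_iff exp_add exp_diff)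
        moreover have "shift_n i j (N k) = N (k + 1)" using ij by (auto simp: shift_n_def N_def fun_eq_iff)
        ultimately show "BI I \<epsilon> (shift_t i j (T y)) (shift_n i j (N k)) * RH I \<epsilon> (T y) (N k) =
            BI I \<epsilon> (T y) (N k) * RH I \<epsilon> (shift_t i j (T y)) (shift_n i j (N k)) \<Longrightarrow> ?thesis" by simp
      qed
      then show ?thesis using RH_nonzero[OF ad[OF that(1)], of k] RH_nonzero[OF ad[OF that(2)], of "k + 1"] by (simp add: f_def ratio_def frac_eq_eq)
    qed
  qed
  have in_S: "Ln w \<in> S" "T (Ln w) i = w" "T (Ln w) j = w'" if "w * w' = c" "norm w < 1" "norm w' < 1" for w w'
  proof -
    have w: "w \<noteq> 0" "w' \<noteq> 0" using that(1) c0 by auto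
    have "norm c < norm w" using mult_strict_left_mono[OF that(3), of "norm w"] w by (simp add: norm_mult flip: that(1))
    then show "Ln w \<in> S" using w that c0 by (simp add: S_def lc_def)
    show "T (Ln w) i = w" "T (Ln w) j = w'" using w that(1) by (auto simp: Tij exp_diff lc field_simps)
  qed
  have tt: "norm (t i) < 1" "norm (t j) < 1" using a ij by (auto simp: adm_def)
  have "f k (Ln u) = f (n i) (Ln (t i))"
    by (rule key) (use in_S u tt in \<open>auto simp: c_def\<close>)
  moreover have "f k (Ln u) = ratio I \<epsilon> (t(i := u, j := v)) (n(i := k, j := l))"
  proof -
    have "T (Ln u) = t(i := u, j := v)" using in_S(2,3)[of u v] u c_def ij by (auto simp: fun_eq_iff T_def)
    moreover have "N k = n(i := k, j := l)" using k by (auto simp: N_def fun_eq_iff)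
    ultimately show ?thesis by (simp add: f_def)
  qed
  moreover have "f (n i) (Ln (t i)) = ratio I \<epsilon> t n"
  proof -
    have "T (Ln (t i)) = t" using in_S(2,3)[of "t i" "t j"] tt c_def ij by (auto simp: fun_eq_iff T_def)
    moreover have "N (n i) = n" by (auto simp: N_def fun_eq_iff)
    ultimately show ?thesis by (simp add: f_def)
  qed
  ultimately show ?thesis by simp
qed

text \<open>The parameters other than i are replaced one at a time, each in a pair move with i.
  Their moduli only grow, so |t i| only shrinks and the smallness condition survives every move; at
  the end the balancing conditions force the value at i.\<close>

lemma ratio_increase:
  assumes u: "adm I \<epsilon> u nu" and w: "adm I \<epsilon> w nw" and i: "i \<in> I" and small: "norm (u i) < norm q"
    and le: "\<And>k. k \<in> I - {i} \<Longrightarrow> norm (u k) \<le> norm (w k)"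
  shows "ratio I \<epsilon> u nu = ratio I \<epsilon> w nw"
proof -
  have fin: "finite I" using u by (simp add: adm_def)
  have "\<exists>t n. adm I \<epsilon> t n \<and> ratio I \<epsilon> t n = ratio I \<epsilon> u nu \<and> (\<forall>k\<in>A. t k = w k \<and> n k = nw k) \<and>
     (\<forall>k\<in>I - {i} - A. t k = u k) \<and> norm (t i) \<le> norm (u i)" if "A \<subseteq> I - {i}" for A
    using finite_subset[OF that finite_Diff[OF fin]] that
  proof (induction A rule: finite_induct)
    case empty
    show ?case using u by (intro exI[of _ u] exI[of _ nu]) auto
  next
    case (insert k A)
    then obtain t n where tn: "adm I \<epsilon> t n" "ratio I \<epsilon> t n = ratio I \<epsilon> u nu" "\<And>k. k \<in> A \<Longrightarrow> t k = w k \<and> n k = nw k"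
      "\<And>k. k \<in> I - {i} - A \<Longrightarrow> t k = u k" "norm (t i) \<le> norm (u i)" by auto
    have k: "k \<in> I" "k \<noteq> i" "t k = u k" using insert tn(4) by auto
    have t: "t k \<noteq> 0" "norm (t k) < 1" "norm (t i) < 1" using tn(1) k i by (auto simp: adm_def)
    have wk: "w k \<noteq> 0" "norm (w k) < 1" using w k by (auto simp: adm_def)
    define v where "v = t i * t k / w k"
    have "norm (t i) * norm (t k) \<le> norm (t i) * norm (w k)" using le[of k] k by (intro mult_left_mono) auto
    then have v: "norm v \<le> norm (t i)" using wk by (simp add: v_def norm_mult norm_divide field_simps)
    have sm: "norm (t i * t k) < norm q"
    proof -
      have "norm (t i * t k) \<le> norm (t i) * 1" unfolding norm_mult using t by (intro mult_left_mono) auto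
      then show ?thesis using tn(5) small by linarith
    qed
    have vw: "v * w k = t i * t k" using wk by (simp add: v_def)
    let ?t = "t(i := v, k := w k)" and ?n = "n(i := n i + n k - nw k, k := nw k)"
    have "adm I \<epsilon> ?t ?n" by (rule adm_upd[OF tn(1) i k(1)]) (use k vw v t wk in auto)
    moreover have "ratio I \<epsilon> ?t ?n = ratio I \<epsilon> t n"
      by (rule ratio_pair_move[OF tn(1) i k(1) _ sm]) (use k vw v t wk in auto)
    moreover have "\<forall>k'\<in>insert k A. ?t k' = w k' \<and> ?n k' = nw k'" using tn(3) k insert by auto
    moreover have "\<forall>k'\<in>I - {i} - insert k A. ?t k' = u k'" using tn(4) by auto
    moreover have "norm (?t i) \<le> norm (u i)" using v tn(5) k by simp
    ultimately show ?case unfolding tn(2) by (intro exI[of _ ?t] exI[of _ ?n] conjI)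
  qed
  from this[OF order_refl] obtain t n where tn: "adm I \<epsilon> t n" "ratio I \<epsilon> t n = ratio I \<epsilon> u nu"
    "\<And>k. k \<in> I - {i} \<Longrightarrow> t k = w k \<and> n k = nw k" by blast
  have p1: "(\<Prod>k\<in>I - {i}. t k) = (\<Prod>k\<in>I - {i}. w k)" "(\<Sum>k\<in>I - {i}. n k) = (\<Sum>k\<in>I - {i}. nw k)"
    using tn(3) by (auto intro!: prod.cong sum.cong)
  have "(\<Prod>k\<in>I - {i}. w k) \<noteq> 0" using w fin by (auto simp: adm_def)
  moreover have "t i * (\<Prod>k\<in>I - {i}. t k) = w i * (\<Prod>k\<in>I - {i}. w k)"
    using tn(1) w fin i by (simp add: adm_def prod.remove[symmetric])
  ultimately have "t i = w i" using p1 by simp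
  moreover have "n i + (\<Sum>k\<in>I - {i}. n k) = nw i + (\<Sum>k\<in>I - {i}. nw k)"
    using tn(1) w fin i by (simp add: adm_def sum.remove[symmetric])
  ultimately have "ratio I \<epsilon> t n = ratio I \<epsilon> w nw"
    using tn(3) p1 by (intro ratio_cong) (metis Diff_iff add_right_cancel empty_iff insert_iff)+
  then show ?thesis using tn(2) by simp
qed

text \<open>Both parameter systems can be increased to one common system whose moduli away from i
  are the maxima of the two.\<close>

lemma ratio_const:
  assumes u: "adm I \<epsilon> u nu" and v: "adm I \<epsilon> v nv" and i: "i \<in> I" and small: "norm (u i) < norm q" "norm (v i) < norm q"
  shows "ratio I \<epsilon> u nu = ratio I \<epsilon> v nv"
proof -
  have fin: "finite I" using u by (simp add: adm_def)
  define M where "M = (\<lambda>k. max (norm (u k)) (norm (v k)))"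
  have u0: "u k \<noteq> 0 \<and> norm (u k) < 1" "v k \<noteq> 0 \<and> norm (v k) < 1" if "k \<in> I" for k using u v that by (auto simp: adm_def)
  have M: "0 < M k" "M k < 1" "norm (u k) \<le> M k" "norm (v k) \<le> M k" if "k \<in> I" for k
    using u0[OF that] by (auto simp: M_def less_max_iff_disj)
  \<comment> \<open>The phases are irrelevant for \<open>ratio_increase\<close>, so real parameters
    are chosen; the value at i is dictated by the product condition.\<close>
  define w where "w = (\<lambda>k. if k = i then p * q / (\<Prod>k\<in>I - {i}. complex_of_real (M k)) else of_real (M k))"
  have w1: "(\<Prod>k\<in>I - {i}. w k) = (\<Prod>k\<in>I - {i}. complex_of_real (M k))" by (intro prod.cong) (auto simp: w_def)
  have w0: "(\<Prod>k\<in>I - {i}. complex_of_real (M k)) \<noteq> 0"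
    using M fin by (auto simp: prod_zero_iff) (metis less_irrefl)
  have "norm (w i) \<le> norm (u i)"
  proof -
    have e: "p * q = u i * (\<Prod>k\<in>I - {i}. u k)" using u fin i by (simp add: adm_def prod.remove[symmetric])
    have "norm (\<Prod>k\<in>I - {i}. u k) \<le> norm (\<Prod>k\<in>I - {i}. complex_of_real (M k))"
      unfolding prod_norm[symmetric] using M by (intro prod_mono) (auto simp: less_imp_le)
    then have "norm (u i) * norm (\<Prod>k\<in>I - {i}. u k) \<le> norm (u i) * norm (\<Prod>k\<in>I - {i}. complex_of_real (M k))"
      by (intro mult_left_mono) auto
    then show ?thesis using w0 unfolding w_def e by (simp add: norm_divide norm_mult field_simps)
  qed
  then have wi: "norm (w i) < 1" using u0[OF i] by linarith
  have a: "adm I \<epsilon> w nu"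
    unfolding adm_def
  proof (intro conjI ballI)
    show "(\<Prod>k\<in>I. w k) = p * q" using fin i w0 by (simp add: prod.remove[of I i] w1) (simp add: w_def)
    fix k assume k: "k \<in> I"
    show "w k \<noteq> 0" "norm (w k) < 1" using M[OF k] wi w0 p q by (cases "k = i"; auto simp: w_def)+
  qed (use u in \<open>auto simp: adm_def\<close>)
  have le: "norm (u k) \<le> norm (w k)" "norm (v k) \<le> norm (w k)" if "k \<in> I - {i}" for k
    using that M[of k] by (auto simp: w_def)
  show ?thesis
    using ratio_increase[OF u a i small(1) le(1)] ratio_increase[OF v a i small(2) le(2)] by simp
qed

text \<open>Moving the parameter at j to a real number close to 1 leaves almost the whole product at
  i, hence a modulus below |q|.\<close>

lemma ratio_normalize:
  assumes u: "adm I \<epsilon> u nu" and ij: "i \<in> I" "j \<in> I" "i \<noteq> j" and small: "norm (u i * u j) < norm q"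
  obtains u' where "adm I \<epsilon> u' nu" "norm (u' i) < norm q" "ratio I \<epsilon> u' nu = ratio I \<epsilon> u nu"
proof -
  have "norm (u i * u j) / norm q < 1" using small q by simp
  then obtain \<rho> where \<rho>: "max (norm (u i * u j) / norm q) (norm (u i * u j)) < \<rho>" "\<rho> < 1"
    using dense[of "max (norm (u i * u j) / norm q) (norm (u i * u j))" 1] adm_pair_norm[OF u ij] by auto
  have \<rho>0: "0 < \<rho>" using \<rho> norm_ge_zero[of "u i * u j"] by linarith
  define v where "v = u i * u j / of_real \<rho>"
  have v: "v * of_real \<rho> = u i * u j" using \<rho>0 by (simp add: v_def)
  have nv: "norm v < norm q" "norm v < 1" using \<rho> \<rho>0 q by (auto simp: v_def norm_divide field_simps)
  let ?u = "u(i := v, j := of_real \<rho>)"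
  have nn: "nu(i := nu i, j := nu j) = nu" by simp
  show ?thesis
  proof (rule that[of ?u])
    show "adm I \<epsilon> ?u nu" using adm_upd[OF u ij v nv(2), of "nu i" "nu j"] \<rho> \<rho>0 by simp
    show "norm (?u i) < norm q" using nv ij by simp
    show "ratio I \<epsilon> ?u nu = ratio I \<epsilon> u nu"
      using ratio_pair_move[OF u ij small v nv(2), of "nu i" "nu j"] \<rho> \<rho>0 by simp
  qed
qed

section \<open>Evaluation of the constant\<close>

text \<open>The difference quotient \<open>g\<close> of \<open>h\<close> at w is holomorphic across
  w, so its integrals over the two circles agree; the difference comes from h w / (z - w)
  alone.\<close>

lemma annulus_residue:
  fixes h :: "complex \<Rightarrow> complex"
  assumes h: "h holomorphic_on {z. a < norm z \<and> norm z < b}" and a: "0 < a" "a < 1" and w: "1 < norm w" "norm w < R" "R < b"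
  shows "contour_integral (circlepath 0 R) (\<lambda>z. h z / (z - w)) - contour_integral (circlepath 0 1) (\<lambda>z. h z / (z - w)) = 2 * pi * \<i> * h w"
proof -
  let ?A = "{z::complex. a < norm z \<and> norm z < b}"
  have opA: "open ?A"
  proof -
    have "?A = ball 0 b - cball 0 a" by auto
    then show ?thesis by (simp add: open_Diff)
  qed
  define g where "g = (\<lambda>z. if z = w then deriv h w else (h z - h w) / (z - w))"
  have g: "g holomorphic_on ?A" unfolding g_def by (rule pole_lemma_open[OF h opA])
  have R: "1 < R" "0 < R" using w by linarith+
  have int: "contour_integral (circlepath 0 \<rho>) (\<lambda>z. h z / (z - w)) = contour_integral (circlepath 0 \<rho>) (\<lambda>z. z * g z / z) + h w * contour_integral (circlepath 0 \<rho>) (\<lambda>z. 1 / (z - w))"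
    if \<rho>: "\<rho> = 1 \<or> \<rho> = R" for \<rho>
  proof -
    have \<rho>': "0 < \<rho>" "sphere 0 \<rho> \<subseteq> ?A" "w \<notin> sphere 0 \<rho>" using \<rho> R w a by auto
    have c1: "(\<lambda>z. z * g z / z) contour_integrable_on circlepath 0 \<rho>"
      by (intro circlepath_integrable continuous_intros continuous_on_subset[OF holomorphic_on_imp_continuous_on[OF g]]) (use \<rho>' in auto)
    have c2: "(\<lambda>z. 1 / (z - w)) contour_integrable_on circlepath 0 \<rho>"
      by (intro circlepath_integrable continuous_intros) (use \<rho>' in auto)
    have "contour_integral (circlepath 0 \<rho>) (\<lambda>z. h z / (z - w)) = contour_integral (circlepath 0 \<rho>) (\<lambda>z. z * g z / z + h w * (1 / (z - w)))"
    proof (rule contour_integral_cong)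
      fix z assume "z \<in> path_image (circlepath 0 \<rho>)"
      then have "z \<noteq> 0" "z \<noteq> w" using \<rho>' by auto
      then show "h z / (z - w) = z * g z / z + h w * (1 / (z - w))" by (simp add: g_def diff_divide_distrib)
    qed simp
    then show ?thesis using c1 c2 by (simp add: contour_integral_add contour_integral_lmul contour_integrable_lmul del: times_divide_eq_right mult_1_right)
  qed
  have "contour_integral (circlepath 0 R) (\<lambda>z. z * g z / z) = contour_integral (circlepath 0 1) (\<lambda>z. z * g z / z)"
    using circlepath_radius[of "\<lambda>z. z * g z" a b R] g a w R unfolding circ_def by (simp add: holomorphic_intros)
  moreover have "contour_integral (circlepath 0 R) (\<lambda>z. 1 / (z - w)) = 2 * pi * \<i>"
    using contour_integral_unique[OF Cauchy_integral_circlepath_simple[of "\<lambda>_. 1" 0 R w]] w by simp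
  moreover have "contour_integral (circlepath 0 1) (\<lambda>z. 1 / (z - w)) = 0"
  proof (rule contour_integral_unique, rule Cauchy_theorem_disc_simple[of _ 0 "norm w"])
    show "(\<lambda>z. 1 / (z - w)) holomorphic_on ball 0 (norm w)" by (intro holomorphic_intros) auto
  qed (use w in auto)
  ultimately show ?thesis using int[of 1] int[of R] by simp
qed

text \<open>Enlarging the circle from 1 to R crosses the simple poles i / s and - i / s; partial
  fractions reduce this to \<open>annulus_residue\<close>.\<close>

lemma circ_two_poles:
  fixes H :: "complex \<Rightarrow> complex"
  assumes H: "H holomorphic_on {z. a < norm z \<and> norm z < b}" and a: "0 < a" "a < 1" and s: "0 < s" "s < 1" and R: "1 / s < R" "R < b"
  shows "circ (\<lambda>z. H z / (1 + (of_real s * z)\<^sup>2)) = contour_integral (circlepath 0 R) (\<lambda>z. (H z / (1 + (of_real s * z)\<^sup>2)) / z)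
     + pi * \<i> * (H (- \<i> / of_real s) + H (\<i> / of_real s))"
proof -
  define h where "h = (\<lambda>z. H z / z)"
  define w where "w = \<i> / complex_of_real s"
  have w: "norm w = 1 / s" "w \<noteq> 0" "norm (- w) = 1 / s" using s by (auto simp: w_def norm_divide)
  have sw: "1 < 1 / s" "1 < R" using s R by (auto intro: less_trans[of 1 "1 / s"])
  have h: "h holomorphic_on {z. a < norm z \<and> norm z < b}" unfolding h_def
    by (intro holomorphic_intros H) (use a in auto)
  have cw: "w = \<i> / of_real s" "- w = - \<i> / of_real s" by (simp_all add: w_def)
  have sq: "1 + (of_real s * z)\<^sup>2 = (of_real s)\<^sup>2 * (z - w) * (z - - w)" for z
    using s by (simp add: w_def field_simps power2_eq_square)
  have pf: "(H z / (1 + (of_real s * z)\<^sup>2)) / z = 1 / (2 * \<i> * of_real s) * (h z / (z - w) - h z / (z - - w))" if "z \<noteq> w" "z \<noteq> - w" for z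
  proof -
    have "1 / (2 * \<i> * of_real s) * (h z / (z - w) - h z / (z - - w)) = 1 / (2 * \<i> * of_real s) * (h z * (2 * w) / ((z - w) * (z - - w)))"
    proof -
      have ne: "z - w \<noteq> 0" "z + w \<noteq> 0" using that by (auto simp: add_eq_0_iff2)
      then have "h z / (z - w) - h z / (z + w) = h z * (2 * w) / ((z - w) * (z + w))" by (simp add: divide_simps) (simp add: algebra_simps)
      then show ?thesis by simp
    qed
    also have "\<dots> = h z / ((of_real s)\<^sup>2 * (z - w) * (z - - w))"
      using s that by (simp add: w_def divide_simps power2_eq_square)
    finally show ?thesis unfolding sq h_def by simp
  qed
  have int: "contour_integral (circlepath 0 \<rho>) (\<lambda>z. (H z / (1 + (of_real s * z)\<^sup>2)) / z) =
     1 / (2 * \<i> * of_real s) * (contour_integral (circlepath 0 \<rho>) (\<lambda>z. h z / (z - w)) - contour_integral (circlepath 0 \<rho>) (\<lambda>z. h z / (z - - w)))"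
    if \<rho>: "\<rho> = 1 \<or> \<rho> = R" for \<rho>
  proof -
    have \<rho>': "0 < \<rho>" "sphere 0 \<rho> \<subseteq> {z. a < norm z \<and> norm z < b}" "w \<notin> sphere 0 \<rho>" "- w \<notin> sphere 0 \<rho>" using \<rho> R w a sw by auto
    have ne: "z \<noteq> w" "z \<noteq> - w" "z + w \<noteq> 0" if "norm z = \<rho>" for z
    proof -
      show "z \<noteq> w" "z \<noteq> - w" using that \<rho>' by auto
      then show "z + w \<noteq> 0" by (simp add: eq_neg_iff_add_eq_0)
    qed
    have c: "(\<lambda>z. h z / (z - w)) contour_integrable_on circlepath 0 \<rho>" "(\<lambda>z. h z / (z - - w)) contour_integrable_on circlepath 0 \<rho>"
      by (intro circlepath_integrable continuous_intros continuous_on_subset[OF holomorphic_on_imp_continuous_on[OF h]]; use \<rho>' ne in auto)+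
    have "contour_integral (circlepath 0 \<rho>) (\<lambda>z. (H z / (1 + (of_real s * z)\<^sup>2)) / z) = contour_integral (circlepath 0 \<rho>) (\<lambda>z. 1 / (2 * \<i> * of_real s) * (h z / (z - w) - h z / (z - - w)))"
    proof (rule contour_integral_cong)
      fix z assume "z \<in> path_image (circlepath 0 \<rho>)"
      then have "norm z = \<rho>" using \<rho>' by auto
      from pf[OF ne(1,2)[OF this]] show "(H z / (1 + (of_real s * z)\<^sup>2)) / z = 1 / (2 * \<i> * of_real s) * (h z / (z - w) - h z / (z - - w))" .
    qed simp
    also have "\<dots> = 1 / (2 * \<i> * of_real s) * contour_integral (circlepath 0 \<rho>) (\<lambda>z. h z / (z - w) - h z / (z - - w))"
      by (rule contour_integral_lmul) (intro contour_integrable_diff c)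
    also have "contour_integral (circlepath 0 \<rho>) (\<lambda>z. h z / (z - w) - h z / (z - - w)) = contour_integral (circlepath 0 \<rho>) (\<lambda>z. h z / (z - w)) - contour_integral (circlepath 0 \<rho>) (\<lambda>z. h z / (z - - w))"
      by (rule contour_integral_diff) (rule c)+
    finally show ?thesis .
  qed
  have exch: "B = A - C" if "A - B = C" for A B C :: complex using that by auto
  have r1: "contour_integral (circlepath 0 1) (\<lambda>z. h z / (z - w)) = contour_integral (circlepath 0 R) (\<lambda>z. h z / (z - w)) - 2 * pi * \<i> * h w"
    by (rule exch, rule annulus_residue[OF h a]) (use w sw R in simp_all)
  have r2: "contour_integral (circlepath 0 1) (\<lambda>z. h z / (z - - w)) = contour_integral (circlepath 0 R) (\<lambda>z. h z / (z - - w)) - 2 * pi * \<i> * h (- w)"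
    by (rule exch, rule annulus_residue[OF h a]) (use w sw R in simp_all)
  have hw: "h w = - \<i> * of_real s * H w" "h (- w) = \<i> * of_real s * H (- w)" using s by (simp_all add: h_def w_def)
  show ?thesis
  proof -
    have alg: "1 / (2 * \<i> * of_real s) * ((A - 2 * pi * \<i> * (- \<i> * of_real s * u)) - (B - 2 * pi * \<i> * (\<i> * of_real s * v)))
       = 1 / (2 * \<i> * of_real s) * (A - B) + pi * \<i> * (v + u)" for A B u v
      using s by (simp add: field_simps)
    show ?thesis
      unfolding circ_def int[OF disjI1[OF refl]] int[OF disjI2[OF refl]] r1 r2 hw cw[symmetric] by (rule alg)
  qed
qed

section \<open>Periodicity in the summation index, the case r = 1, and reflection of products over
  pairs\<close>

lemma theta_shift_exp_p: "theta (exp (u + of_nat r * lp)) (p ^ r) = exp (\<i> * pi - u) * theta (exp u) (p ^ r)"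
  using theta_shift[OF norms(1,2), of "exp u"] by (simp add: exp_diff exp_add pr)

lemma ker_period: "ker (exp (2 * y)) (k + 2 * int r) = exp ((of_nat r - 1) * (2 * of_int k + 2 * of_nat r) * (lp + lq)) * ker (exp (2 * y)) k"
proof -
  define \<mu> where "\<mu> = complex_of_int k"
  have 1: "of_int (k + 2 * int r) = \<mu> + 2 * of_nat r" by (simp add: \<mu>_def)
  have 2: "theta (exp ((\<mu> + 2 * of_nat r) * lq - 2 * y)) (q ^ r) = exp (\<i> * pi - (\<mu> * lq - 2 * y + of_nat r * lq)) * (exp (\<i> * pi - (\<mu> * lq - 2 * y)) * theta (exp (\<mu> * lq - 2 * y)) (q ^ r))"
  proof -
    have "(\<mu> + 2 * of_nat r) * lq - 2 * y = (\<mu> * lq - 2 * y + of_nat r * lq) + of_nat r * lq" by (simp add: algebra_simps)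
    then show ?thesis by (simp only: theta_shift_exp)
  qed
  have 3: "theta (exp (2 * y + (\<mu> + 2 * of_nat r) * lp)) (p ^ r) = exp (\<i> * pi - (2 * y + \<mu> * lp + of_nat r * lp)) * (exp (\<i> * pi - (2 * y + \<mu> * lp)) * theta (exp (2 * y + \<mu> * lp)) (p ^ r))"
  proof -
    have "2 * y + (\<mu> + 2 * of_nat r) * lp = (2 * y + \<mu> * lp + of_nat r * lp) + of_nat r * lp" by (simp add: algebra_simps)
    then show ?thesis by (simp only: theta_shift_exp_p)
  qed
  have 4: "exp ((\<mu> + 2 * of_nat r) * (\<mu> + 2 * of_nat r - 1) / 2 * (lp + lq)) * exp (\<i> * pi - (2 * y + \<mu> * lp + of_nat r * lp)) * exp (\<i> * pi - (2 * y + \<mu> * lp))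
     * exp (\<i> * pi - (\<mu> * lq - 2 * y + of_nat r * lq)) * exp (\<i> * pi - (\<mu> * lq - 2 * y)) = exp ((of_nat r - 1) * (2 * \<mu> + 2 * of_nat r) * (lp + lq)) * exp (\<mu> * (\<mu> - 1) / 2 * (lp + lq))"
    unfolding exp_add[symmetric] by (rule exp_eq_exp_2pi[where k = 2]) (simp add: field_simps)
  have "ker (exp (2 * y)) (k + 2 * int r) = (exp ((\<mu> + 2 * of_nat r) * (\<mu> + 2 * of_nat r - 1) / 2 * (lp + lq)) * exp (\<i> * pi - (2 * y + \<mu> * lp + of_nat r * lp)) * exp (\<i> * pi - (2 * y + \<mu> * lp))
     * exp (\<i> * pi - (\<mu> * lq - 2 * y + of_nat r * lq)) * exp (\<i> * pi - (\<mu> * lq - 2 * y))) * theta (exp (2 * y + \<mu> * lp)) (p ^ r) * theta (exp (\<mu> * lq - 2 * y)) (q ^ r)"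
    unfolding ker_exp 1 2 3 by (simp only: mult_ac)
  then show ?thesis unfolding 4 ker_exp \<mu>_def[symmetric] by (simp only: mult_ac)
qed

text \<open>The balancing conditions make the factors of the six parameter pairs inverse to the
  factor of the kernel, so any r consecutive indices give the same sum.\<close>

lemma W_period:
  assumes a: "adm I \<epsilon> t n" and z: "norm z = 1"
  shows "W I \<epsilon> t n z (m + int r) = W I \<epsilon> t n z m"
proof -
  obtain x where x: "\<And>b. b \<in> I \<Longrightarrow> t b = exp (x b)" "(\<Sum>b\<in>I. x b) = lp + lq" using adm_logs[OF a] by blast
  have I: "finite I" "card I = 6" and t: "\<And>b. b \<in> I \<Longrightarrow> t b \<noteq> 0 \<and> norm (t b) < 1" using a by (auto simp: adm_def)
  have "(\<Sum>b\<in>I. n b) = - 3 * \<epsilon>" using a by (simp add: adm_def)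
  then have sn: "(\<Sum>b\<in>I. complex_of_int (n b)) = - 3 * of_int \<epsilon>" unfolding of_int_sum[symmetric] by simp
  define y where "y = Ln z"
  have z0: "z \<noteq> 0" using z by auto
  then have zy: "z = exp y" by (simp add: y_def)
  have e1: "exp (x b + y) = t b * z" "exp (x b - y) = t b / z" if "b \<in> I" for b using x(1)[OF that] by (simp_all add: zy exp_add exp_diff)
  have d: "t b * z \<in> dom" "t b * z \<noteq> 1" "t b / z \<in> dom" "t b / z \<noteq> 1" if "b \<in> I" for b
    using t[OF that] z z0 unit_dom[of "t b * z"] unit_dom[of "t b / z"] by (simp_all add: norm_mult norm_divide)
  have z2: "z\<^sup>2 = exp (2 * y)" by (simp add: zy exp_double)
  have "(\<Prod>b\<in>I. gam (t b * z) (n b + \<epsilon> + (m + int r)) * gam (t b / z) (n b - (m + int r)))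
     = (\<Prod>b\<in>I. gam (exp (x b + y)) (n b + \<epsilon> + m + int r) * gam (exp (x b - y)) (n b - m - int r))"
  proof (intro prod.cong refl)
    fix b assume b: "b \<in> I"
    have "n b + \<epsilon> + (m + int r) = n b + \<epsilon> + m + int r" "n b - (m + int r) = n b - m - int r" by simp_all
    then show "gam (t b * z) (n b + \<epsilon> + (m + int r)) * gam (t b / z) (n b - (m + int r))
      = gam (exp (x b + y)) (n b + \<epsilon> + m + int r) * gam (exp (x b - y)) (n b - m - int r)" by (simp only: e1[OF b])
  qed
  also have "\<dots> = exp (\<Sum>b\<in>I. dper (x b + y) (of_int (n b + \<epsilon> + m)) (x b - y) (of_int (n b - m))) * (\<Prod>b\<in>I. gam (exp (x b + y)) (n b + \<epsilon> + m) * gam (exp (x b - y)) (n b - m))"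
    by (rule prod_pair_period[OF I(1)]) (use d e1 in auto)
  also have "(\<Prod>b\<in>I. gam (exp (x b + y)) (n b + \<epsilon> + m) * gam (exp (x b - y)) (n b - m)) = (\<Prod>b\<in>I. gam (t b * z) (n b + \<epsilon> + m) * gam (t b / z) (n b - m))"
    by (intro prod.cong refl) (simp add: e1)
  also have "exp (\<Sum>b\<in>I. dper (x b + y) (of_int (n b + \<epsilon> + m)) (x b - y) (of_int (n b - m))) =
     exp (- ((of_nat r - 1) * (2 * (2 * of_int m + of_int \<epsilon>) + 2 * of_nat r) * (lp + lq)))"
  proof -
    have "(\<Sum>b\<in>I. dper (x b + y) (of_int (n b + \<epsilon> + m)) (x b - y) (of_int (n b - m))) =
       (\<Sum>b\<in>I. dper (x b + 0 + y) (of_int (n b) + of_int \<epsilon> + of_int m + 0) (x b - y) (of_int (n b) - of_int m))" by simp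
    then show ?thesis unfolding dper_sum_aux[OF I] x(2) sn
      by (elim ssubst, intro exp_eq_exp_2pi[where k = "3 * (int r - 1) * (2 * m + \<epsilon> + int r)"]) (simp add: field_simps)
  qed
  finally have 1: "(\<Prod>b\<in>I. gam (t b * z) (n b + \<epsilon> + (m + int r)) * gam (t b / z) (n b - (m + int r))) =
    exp (- ((of_nat r - 1) * (2 * (2 * of_int m + of_int \<epsilon>) + 2 * of_nat r) * (lp + lq))) * (\<Prod>b\<in>I. gam (t b * z) (n b + \<epsilon> + m) * gam (t b / z) (n b - m))" .
  have 2: "ker (z\<^sup>2) (2 * (m + int r) + \<epsilon>) = exp ((of_nat r - 1) * (2 * (2 * of_int m + of_int \<epsilon>) + 2 * of_nat r) * (lp + lq)) * ker (z\<^sup>2) (2 * m + \<epsilon>)"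
    using ker_period[of y "2 * m + \<epsilon>"] unfolding z2 by (simp add: algebra_simps)
  show ?thesis unfolding W_def 1 2 by (simp add: exp_minus)
qed

lemma gam_r1:
  assumes r1: "r = 1" and z: "z \<in> dom" "z \<noteq> 1" shows "gam z m = gam z 0"
proof -
  have c: "cper z k = 1" for k
  proof -
    have "z \<noteq> 0" using z by (auto simp: dom_def)
    then have "cper z k = exp (per (Ln z) k)" using cper_exp[of "Ln z" k] by simp
    moreover have r0: "of_nat r - 1 = (0::complex)" using r1 by simp
    have "per (Ln z) k = 0" unfolding per_def r0 by simp
    ultimately show ?thesis by simp
  qed
  show ?thesis
  proof (induction m rule: int_induct[where k = 0])
    case (step1 i)
    then show ?case using gam_period[OF z, of i] c r1 by simp
  next
    case (step2 i)
    then show ?case using gam_period[OF z, of "i - 1"] c r1 by simp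
  qed simp
qed

lemma ker_r1:
  assumes r1: "r = 1" and z: "norm z = 1" shows "ker z m = ker z 0"
proof (cases "z = 1")
  case True
  have "theta (p powi k) p = 0" for k using theta_simple_zero_powi[OF p, of k] by blast
  then show ?thesis using r1 True unfolding ker_def by (simp add: theta_1[OF p])
next
  case False
  have z0: "z \<noteq> 0" using z by auto
  have d: "z \<in> dom" "1 / z \<in> dom" "1 / z \<noteq> 1" using z z0 False by (auto intro!: dom_unit simp: norm_divide)
  have "gam z m * gam (1 / z) (- m) * ker z m = 1" "gam z 0 * gam (1 / z) (- 0) * ker z 0 = 1"
    by (rule ker_eq[OF d(1,2) False])+
  moreover have "gam z m = gam z 0" "gam (1 / z) (- m) = gam (1 / z) 0" using gam_r1[OF r1] d False by blast+
  ultimately show ?thesis by (metis minus_zero mult_cancel_left mult_zero_left zero_neq_one)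
qed

text \<open>For r = 1 every integer is a period with factor 1, so the discrete parameters have no
  effect and \<epsilon> = 1 reduces to \<epsilon> = 0. The reduction is needed because the pinching
  argument has both indices 0 and - \<epsilon> in one window of r integers.\<close>

lemma ratio_r1:
  assumes r1: "r = 1" and a: "adm I \<epsilon> t n"
  shows "ratio I \<epsilon> t n = ratio I 0 t (\<lambda>_. 0)" "adm I 0 t (\<lambda>_. 0)"
proof -
  show a0: "adm I 0 t (\<lambda>_. 0)" using a by (simp add: adm_def)
  have t: "\<And>b. b \<in> I \<Longrightarrow> t b \<noteq> 0 \<and> norm (t b) < 1" using a by (auto simp: adm_def)
  have W0: "W I \<epsilon> t n z m = W I 0 t (\<lambda>_. 0) z m" if z: "norm z = 1" for z m
  proof -
    have z0: "z \<noteq> 0" using z by auto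
    have d: "t b * z \<in> dom" "t b * z \<noteq> 1" "t b / z \<in> dom" "t b / z \<noteq> 1" if "b \<in> I" for b
      using t[OF that] z z0 unit_dom[of "t b * z"] unit_dom[of "t b / z"] by (simp_all add: norm_mult norm_divide)
    have "(\<Prod>b\<in>I. gam (t b * z) (n b + \<epsilon> + m) * gam (t b / z) (n b - m)) = (\<Prod>b\<in>I. gam (t b * z) (0 + 0 + m) * gam (t b / z) (0 - m))"
    proof (intro prod.cong refl)
      fix b assume "b \<in> I"
      note d[OF this]
      then show "gam (t b * z) (n b + \<epsilon> + m) * gam (t b / z) (n b - m) = gam (t b * z) (0 + 0 + m) * gam (t b / z) (0 - m)"
        using gam_r1[OF r1] by metis
    qed
    moreover have "ker (z\<^sup>2) (2 * m + \<epsilon>) = ker (z\<^sup>2) (2 * m + 0)" using ker_r1[OF r1] z by (metis norm_power power_one)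
    ultimately show ?thesis unfolding W_def by (simp only:)
  qed
  have "BI I \<epsilon> t n = BI I 0 t (\<lambda>_. 0)" unfolding BI_def by (intro sum.cong refl circ_cong W0)
  moreover have "RH I \<epsilon> t n = RH I 0 t (\<lambda>_. 0)"
    unfolding RH_def
  proof (intro prod.cong refl)
    fix X assume "X \<in> pairs I"
    then have "X \<subseteq> I" "card X = 2" by (simp_all add: pairs_def)
    then obtain c b where X: "X = {c, b}" "c \<noteq> b" "c \<in> I" "b \<in> I" by (auto simp: card_2_iff)
    then have "(\<Prod>a\<in>X. t a) \<in> dom" "(\<Prod>a\<in>X. t a) \<noteq> 1"
      using adm_pair_norm[OF a X(3,4,2)] t[OF X(3)] t[OF X(4)] unit_dom[of "t c * t b"] by simp_all
    then show "gam (\<Prod>a\<in>X. t a) ((\<Sum>a\<in>X. n a) + \<epsilon>) = gam (\<Prod>a\<in>X. t a) ((\<Sum>a\<in>X. 0) + 0)" using gam_r1[OF r1] by metis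
  qed
  ultimately show "ratio I \<epsilon> t n = ratio I 0 t (\<lambda>_. 0)" by (simp add: ratio_def)
qed

lemma gam_mult_eq_1:
  assumes z: "z \<noteq> 0" "norm z < 1" and w: "w \<noteq> 0" "norm w < 1" and zw: "z * w = p * q" and kl: "k + l = 0"
  shows "gam z k * gam w l = 1"
proof -
  have "norm (p * q) < norm z" unfolding zw[symmetric] norm_mult using mult_strict_left_mono[OF w(2), of "norm z"] z by simp
  from gam_reflect[OF unit_dom[OF z] this, of k] show ?thesis
    using zw z kl by (simp add: field_simps flip: zw) (metis add_eq_0_iff mult.commute)
qed

lemma RH_four_expand:
  assumes e: "distinct [a, b, c, d]"
  shows "RH {a, b, c, d} \<epsilon> t n = (gam (t a * t b) (n a + n b + \<epsilon>) * gam (t c * t d) (n c + n d + \<epsilon>)) *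
      (gam (t a * t c) (n a + n c + \<epsilon>) * gam (t b * t d) (n b + n d + \<epsilon>)) * (gam (t a * t d) (n a + n d + \<epsilon>) * gam (t b * t c) (n b + n c + \<epsilon>))"
proof -
  have "pairs {d} = {}" by (auto simp: pairs_def card_2_iff subset_singleton_iff)
  then have "RH {d} \<epsilon> t n = 1" by (simp add: RH_def)
  then show ?thesis using e by (simp add: RH_insert mult_ac)
qed

lemma card_4_cases:
  assumes "finite B" "card B = 4"
  obtains a b c d :: nat where "B = {a, b, c, d}" "distinct [a, b, c, d]"
proof -
  obtain xs where "set xs = B" "distinct xs" using finite_distinct_list[OF assms(1)] by blast
  moreover from this have "length xs = 4" using assms distinct_card by metis
  ultimately show ?thesis using that by (auto simp: numeral_eq_Suc length_Suc_conv)
qed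

text \<open>Each two-element subset is matched with its complement: T u T v times t w t x equals p
  q, and the discrete parts add up to 0, so every matched pair of gamma factors is 1 by
  reflection.\<close>

lemma RH_complement:
  assumes B: "finite B" "card B = 4" and T: "\<And>b. b \<in> B \<Longrightarrow> T b \<noteq> 0 \<and> norm (T b) < 1" and t: "\<And>b. b \<in> B \<Longrightarrow> t b \<noteq> 0 \<and> norm (t b) < 1"
    and Tt: "\<And>b. b \<in> B \<Longrightarrow> T b = \<xi> * t b" and pT: "(\<Prod>b\<in>B. T b) = \<xi>\<^sup>2 * (p * q)" and \<xi>: "\<xi> \<noteq> 0"
    and Nn: "\<And>b. b \<in> B \<Longrightarrow> N b = n b + k" and sN: "(\<Sum>b\<in>B. N b) + \<epsilon> + \<rho> = 2 * k"
  shows "RH B \<epsilon> T N * RH B \<rho> t n = 1"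
proof -
  obtain a b c d where e: "B = {a, b, c, d}" "distinct [a, b, c, d]" using card_4_cases[OF B] .
  have *: "gam (T u * T v) (N u + N v + \<epsilon>) * gam (t w * t x) (n w + n x + \<rho>) = 1"
    if uv: "u \<in> B" "v \<in> B" "w \<in> B" "x \<in> B" and "T u * T v * (T w * T x) = \<xi>\<^sup>2 * (p * q)" "N u + N v + N w + N x + \<epsilon> + \<rho> = 2 * k" for u v w x
  proof (rule gam_mult_eq_1)
    show "T u * T v \<noteq> 0" "t w * t x \<noteq> 0" using T t uv by auto
    show "norm (T u * T v) < 1" "norm (t w * t x) < 1"
      using T t uv mult_strict_mono[of "norm (T u)" 1 "norm (T v)" 1] mult_strict_mono[of "norm (t w)" 1 "norm (t x)" 1] by (simp_all add: norm_mult)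
    have "\<xi>\<^sup>2 * (T u * T v * (t w * t x)) = \<xi>\<^sup>2 * (p * q)" using that(5) Tt[OF uv(3)] Tt[OF uv(4)] by (simp add: power2_eq_square mult_ac)
    then show "T u * T v * (t w * t x) = p * q" using \<xi> by simp
    show "N u + N v + \<epsilon> + (n w + n x + \<rho>) = 0" using that(6) Nn[OF uv(3)] Nn[OF uv(4)] by simp
  qed
  have s: "T a * T b * (T c * T d) = \<xi>\<^sup>2 * (p * q)" "N a + N b + N c + N d + \<epsilon> + \<rho> = 2 * k" using pT sN e by (simp_all add: mult_ac add_ac)
  have "gam (T a * T b) (N a + N b + \<epsilon>) * gam (t c * t d) (n c + n d + \<rho>) = 1" "gam (T c * T d) (N c + N d + \<epsilon>) * gam (t a * t b) (n a + n b + \<rho>) = 1"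
    "gam (T a * T c) (N a + N c + \<epsilon>) * gam (t b * t d) (n b + n d + \<rho>) = 1" "gam (T b * T d) (N b + N d + \<epsilon>) * gam (t a * t c) (n a + n c + \<rho>) = 1"
    "gam (T a * T d) (N a + N d + \<epsilon>) * gam (t b * t c) (n b + n c + \<rho>) = 1" "gam (T b * T c) (N b + N c + \<epsilon>) * gam (t a * t d) (n a + n d + \<rho>) = 1"
    by (rule *; use e s in \<open>auto simp: mult_ac\<close>)+
  moreover have "RH B \<epsilon> T N * RH B \<rho> t n =
     (gam (T a * T b) (N a + N b + \<epsilon>) * gam (t c * t d) (n c + n d + \<rho>)) * (gam (T c * T d) (N c + N d + \<epsilon>) * gam (t a * t b) (n a + n b + \<rho>)) *
     (gam (T a * T c) (N a + N c + \<epsilon>) * gam (t b * t d) (n b + n d + \<rho>)) * (gam (T b * T d) (N b + N d + \<epsilon>) * gam (t a * t c) (n a + n c + \<rho>)) *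
     (gam (T a * T d) (N a + N d + \<epsilon>) * gam (t b * t c) (n b + n c + \<rho>)) * (gam (T b * T c) (N b + N c + \<epsilon>) * gam (t a * t d) (n a + n d + \<rho>))"
    unfolding e(1) RH_four_expand[OF e(2)] by (simp only: mult_ac)
  ultimately show ?thesis by simp
qed

lemma RH_four:
  assumes B: "finite B" "card B = 4" and t: "\<And>b. b \<in> B \<Longrightarrow> t b \<noteq> 0 \<and> norm (t b) < 1"
    and pt: "(\<Prod>b\<in>B. t b) = p * q" and sn: "(\<Sum>b\<in>B. n b) + 2 * \<epsilon> = 0"
  shows "RH B \<epsilon> t n = 1"
proof -
  obtain a b c d where e: "B = {a, b, c, d}" "distinct [a, b, c, d]" using card_4_cases[OF B] .
  have *: "gam (t u * t v) (n u + n v + \<epsilon>) * gam (t w * t x) (n w + n x + \<epsilon>) = 1"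
    if uv: "u \<in> B" "v \<in> B" "w \<in> B" "x \<in> B" and "t u * t v * (t w * t x) = p * q" "n u + n v + n w + n x + 2 * \<epsilon> = 0" for u v w x
    by (rule gam_mult_eq_1)
       (use t uv that(5,6) mult_strict_mono[of "norm (t u)" 1 "norm (t v)" 1] mult_strict_mono[of "norm (t w)" 1 "norm (t x)" 1] in \<open>auto simp: norm_mult\<close>)
  have s: "t a * t b * (t c * t d) = p * q" "n a + n b + n c + n d + 2 * \<epsilon> = 0" using pt sn e by (simp_all add: mult_ac add_ac)
  have 1: "gam (t a * t b) (n a + n b + \<epsilon>) * gam (t c * t d) (n c + n d + \<epsilon>) = 1" by (rule *) (use e s in auto)
  have 2: "gam (t a * t c) (n a + n c + \<epsilon>) * gam (t b * t d) (n b + n d + \<epsilon>) = 1" by (rule *) (use e s in \<open>auto simp: mult_ac\<close>)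
  have 3: "gam (t a * t d) (n a + n d + \<epsilon>) * gam (t b * t c) (n b + n c + \<epsilon>) = 1" by (rule *) (use e s in \<open>auto simp: mult_ac\<close>)
  show ?thesis unfolding e(1) RH_four_expand[OF e(2)] 1 2 3 by simp
qed

text \<open>In the pinching limit one residue survives at m = - \<epsilon> and the other at m = 0;
  the shifted window starts at the first and, apart from r = 1 with \<epsilon> = 1, contains the
  second.\<close>

lemma BI_window:
  assumes a: "adm I \<epsilon> t n" and e: "\<epsilon> \<in> {0, 1}"
  shows "BI I \<epsilon> t n = (\<Sum>m<r. circ (\<lambda>z. W I \<epsilon> t n z (int m - \<epsilon>)))"
proof -
  define \<phi> where "\<phi> = (\<lambda>m. circ (\<lambda>z. W I \<epsilon> t n z m))"
  have per: "\<phi> (m + int r) = \<phi> m" for m unfolding \<phi>_def by (rule circ_cong) (rule W_period[OF a])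
  have "(\<Sum>m<r. \<phi> (int m - 1) - \<phi> (int (Suc m) - 1)) = \<phi> (int 0 - 1) - \<phi> (int r - 1)"
    by (rule sum_lessThan_telescope')
  also have "\<dots> = 0" using per[of "- 1"] by (simp add: algebra_simps)
  finally have "(\<Sum>m<r. \<phi> (int m - 1)) = (\<Sum>m<r. \<phi> (int m))" by (simp add: sum_subtractf)
  then show ?thesis using e unfolding BI_def \<phi>_def by auto
qed

section \<open>The pinching limit\<close>

lemma Gh_gam: "z \<in> dom \<Longrightarrow> z \<noteq> 1 \<Longrightarrow> Gh m z = (1 - z) * gam z m"
  by (simp add: gam_Gh)

lemma tendsto_at_left_1:
  fixes g :: "real \<Rightarrow> complex"
  assumes "continuous_on {s1<..1} g" "s1 < 1" shows "(g \<longlongrightarrow> g 1) (at_left 1)"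
proof -
  have "(g \<longlongrightarrow> g 1) (at 1 within {s1<..1})" using assms by (auto simp: continuous_on_def)
  moreover have "at 1 within {s1<..1} = at_left 1"
    by (rule at_within_nhd[where S = "{s1<..}"]) (use assms(2) in auto)
  ultimately show ?thesis by simp
qed

lemma Gh_compose_continuous:
  assumes "continuous_on S f" "\<And>z. z \<in> S \<Longrightarrow> f z \<in> dom" shows "continuous_on S (\<lambda>z. Gh m (f z))"
  by (rule continuous_on_compose2[OF holomorphic_on_imp_continuous_on[OF Gh_holomorphic] assms(1)]) (use assms(2) in auto)

text \<open>With parameters s i and - s i, the poles at z = s i and - s i inside the unit circle
  approach those at i / s and - i / s outside as s -> 1. The integral and the right hand side then
  grow like 1 / (1 - s^2). Since their quotient does not depend on s, it can be read off after
  multiplying both by 1 - s^2, where only the residues at the two outer poles remain.\<close>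

lemma beta_pinch:
  assumes I: "finite I" "card I = 6" and abi: "a \<in> I" "b \<in> I" "i \<in> I" "a \<noteq> b" "a \<noteq> i" "b \<noteq> i"
    and e: "\<epsilon> \<in> {0, 1}" and re: "r \<noteq> 1 \<or> \<epsilon> = 0"
  obtains t n where "adm I \<epsilon> t n" "norm (t i) < norm q" "ratio I \<epsilon> t n = 4 * pi * \<i> * Gh 0 1"
proof -
  define D where "D = I - {a, b, i}"
  define B where "B = insert i D"
  have D: "finite D" "a \<notin> D" "b \<notin> D" "i \<notin> D" "card D = 3" using I abi by (auto simp: D_def card_Diff_subset)
  have B: "finite B" "a \<notin> B" "b \<notin> B" "card B = 4" using D abi by (auto simp: B_def)
  have IB: "I = insert a (insert b B)" using abi by (auto simp: B_def D_def)
  \<comment> \<open>If |p| < \<rho> s^2, the parameter p q / (\<rho> s^2) at index \<open>i\<close>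
    has modulus below |q|, as \<open>ratio_const\<close> requires. The three remaining parameters
    are the cube root of \<rho>, so that the total product is p q.\<close>
  obtain \<rho> where \<rho>: "norm p < \<rho>" "\<rho> < 1" using dense p by blast
  have \<rho>0: "0 < \<rho>" using \<rho> norm_ge_zero[of p] by linarith
  define \<kappa> where "\<kappa> = root 3 \<rho>"
  have \<kappa>: "0 < \<kappa>" "\<kappa> < 1" "\<kappa> ^ 3 = \<rho>" using \<rho> \<rho>0 by (simp_all add: \<kappa>_def)
  define \<nu> where "\<nu> = max (norm p) (max (norm q) \<kappa>)"
  have \<nu>: "0 < \<nu>" "\<nu> < 1" "norm p \<le> \<nu>" "norm q \<le> \<nu>" "\<kappa> \<le> \<nu>" using p q \<kappa> by (auto simp: \<nu>_def less_max_iff_disj)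
  \<comment> \<open>The parameters in \<open>B\<close> are bounded by \<nu>, so gamma functions at T
    s k z are holomorphic for |z| < 1 / \<nu>. The radius R lies beyond the outer poles once 1 / s <
    R, which \<open>s1\<close> guarantees.\<close>
  obtain R0 where R0: "1 < R0" "R0 < 1 / \<nu>" using dense[of 1 "1 / \<nu>"] \<nu> by auto
  obtain R where R: "1 < R" "R < R0" using dense R0 by blast
  have R0\<nu>: "R0 * \<nu> < 1" using R0 \<nu> by (simp add: field_simps)
  have R0s: "x * y < 1" if "x < R0" "y \<le> \<nu>" "0 \<le> x" "0 \<le> y" for x y
    using mult_mono[of x R0 y \<nu>] that R0\<nu> R0 by linarith
  have "sqrt (norm p / \<rho>) < 1" "1 / R < 1" using \<rho> \<rho>0 R by simp_all
  then obtain s1 where s1: "max (sqrt (norm p / \<rho>)) (1 / R) < s1" "s1 < 1" using dense[of "max (sqrt (norm p / \<rho>)) (1 / R)" 1] by auto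
  have s10: "0 < s1" "1 / R < s1" using s1 R by (auto intro: less_trans[of 0 "1 / R"])
  have sp: "norm p < \<rho> * s\<^sup>2" "0 < s" "1 / s < R" if "s1 < s" for s
  proof -
    show "0 < s" using that s10 by linarith
    have "sqrt (norm p / \<rho>) < s" using that s1 by linarith
    then have "norm p / \<rho> < s\<^sup>2" using \<open>0 < s\<close> real_less_rsqrt real_sqrt_less_iff real_sqrt_unique
      by (metis less_eq_real_def real_sqrt_less_iff real_sqrt_unique)
    then show "norm p < \<rho> * s\<^sup>2" using \<rho>0 by (simp add: field_simps)
    have "1 / R < s" using that s10 by linarith
    then show "1 / s < R" using \<open>0 < s\<close> R by (simp add: field_simps)
  qed
  define T where "T = (\<lambda>(s::real) k. if k = a then of_real s * \<i> else if k = b then - (of_real s * \<i>)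
     else if k = i then p * q / (of_real \<rho> * (of_real s)\<^sup>2) else complex_of_real \<kappa>)"
  \<comment> \<open>The discrete parameters at a and b are chosen so that n a + n b + \<epsilon> =
    0: then the right hand side contains gam (s^2) 0, which has its pole at s = 1.\<close>
  define n where "n = (\<lambda>k. if k = b then - \<epsilon> else if k = i then - 2 * \<epsilon> else 0)"
  have Ta: "T s a = of_real s * \<i>" "T s b = - (of_real s * \<i>)" for s using abi by (simp_all add: T_def)
  have na: "n a = 0" "n b = - \<epsilon>" using abi by (simp_all add: n_def)
  have Ti: "T s i = p * q / (of_real \<rho> * (of_real s)\<^sup>2)" for s using abi by (simp add: T_def)
  have TD: "T s k = of_real \<kappa>" "n k = 0" if "k \<in> D" for s k using that D by (auto simp: T_def n_def)
  have nTi: "norm (T s i) < norm q" "T s i \<noteq> 0" if "s1 < s" for s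
  proof -
    have "norm (T s i) = norm q * (norm p / (\<rho> * s\<^sup>2))" using \<rho>0 by (simp add: Ti norm_divide norm_mult norm_power)
    also have "norm p / (\<rho> * s\<^sup>2) < 1" using sp(1)[OF that] \<rho>0 sp(2)[OF that] by simp
    finally show "norm (T s i) < norm q" using q by simp
    show "T s i \<noteq> 0" using p q \<rho>0 sp(2)[OF that] by (simp add: Ti)
  qed
  have TB: "T s k \<noteq> 0" "norm (T s k) \<le> \<nu>" if "k \<in> B" "s1 < s" for s k
    using that nTi[of s] \<nu> \<kappa> TD(1)[of k s] by (auto simp: B_def)
  have prB: "(\<Prod>k\<in>B. T s k) = p * q / (of_real s)\<^sup>2" if "s1 < s" for s
  proof -
    have "(\<Prod>k\<in>D. T s k) = (\<Prod>k\<in>D. complex_of_real \<kappa>)" by (intro prod.cong refl TD)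
    also have "\<dots> = of_real \<rho>" using D \<kappa>(3) by (simp flip: of_real_power)
    finally show ?thesis using D \<rho>0 by (simp add: B_def Ti)
  qed
  have snB: "(\<Sum>k\<in>B. n k) = - 2 * \<epsilon>"
  proof -
    have "(\<Sum>k\<in>D. n k) = 0" by (intro sum.neutral ballI TD)
    then show ?thesis using D abi by (simp add: B_def n_def)
  qed
  have ad: "adm I \<epsilon> (T s) n" if s: "s1 < s" "s < 1" for s
    unfolding adm_def
  proof (intro conjI ballI)
    show "(\<Prod>k\<in>I. T s k) = p * q"
      unfolding IB using B abi prB[OF s(1)] sp(2)[OF s(1)] by (simp add: Ta power2_eq_square)
    show "(\<Sum>k\<in>I. n k) + 3 * \<epsilon> = 0" unfolding IB using B abi snB by (simp add: na)
    fix k assume "k \<in> I"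
    then consider "k = a" | "k = b" | "k \<in> B" unfolding IB by auto
    then show "T s k \<noteq> 0" "norm (T s k) < 1"
      by (cases; use TB[OF _ s(1)] \<nu> sp(2)[OF s(1)] s in \<open>auto simp: Ta norm_mult intro: le_less_trans\<close>)+
  qed (use I in auto)
  have m1dom: "- 1 \<in> dom" "(- 1 :: complex) \<noteq> 1" by (auto intro!: dom_unit)
  \<comment> \<open>The two gamma functions with outer poles are replaced by their regular parts
    \<open>Gh\<close>; the denominators removed from them multiply to 1 + (s z)^2.\<close>
  define H where "H = (\<lambda>(s::real) z m. Gh (\<epsilon> + m) (of_real s * \<i> * z) * Gh m (- (of_real s * \<i>) * z)
     * (gam (of_real s * \<i> / z) (- m) * gam (- (of_real s * \<i>) / z) (- \<epsilon> - m)) * W B \<epsilon> (T s) n z m)"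
  \<comment> \<open>\<open>L1\<close> and \<open>L2\<close> are 1 - s^2 times the values of
    \<open>H\<close> at the two outer poles. Writing gam at s^2 as \<open>Gh\<close> makes them
    continuous up to s = 1.\<close>
  define L1 where "L1 = (\<lambda>(s::real) m. Gh (\<epsilon> + m) 1 * Gh m (- 1) * gam (- (of_real s)\<^sup>2) (- m) * Gh (- \<epsilon> - m) ((of_real s)\<^sup>2) * W B \<epsilon> (T s) n (- \<i> / of_real s) m)"
  define L2 where "L2 = (\<lambda>(s::real) m. Gh (\<epsilon> + m) (- 1) * Gh m 1 * Gh (- m) ((of_real s)\<^sup>2) * gam (- (of_real s)\<^sup>2) (- \<epsilon> - m) * W B \<epsilon> (T s) n (\<i> / of_real s) m)"
  define E where "E = (\<lambda>(s::real) m. contour_integral (circlepath 0 R) (\<lambda>z. (H s z m / (1 + (of_real s * z)\<^sup>2)) / z))"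
  have WBm: "T s k * z \<noteq> 0 \<and> norm (T s k * z) < 1" if "k \<in> B" "s1 < s" "z \<noteq> 0" "norm z < R0" for s k z
    using R0s[of "norm z" "norm (T s k)"] TB[OF that(1,2)] that by (simp add: norm_mult mult.commute)
  have sz_dom: "of_real s * \<i> * z \<in> dom" "- (of_real s * \<i>) * z \<in> dom" if s: "s1 < s" "s \<le> 1" and z: "z \<noteq> 0" "norm z < R0" for s z
  proof -
    have s0: "0 < s" using sp(2) s by blast
    have 1: "norm z * norm p < 1" "norm z * norm q < 1" using R0s[of "norm z"] z \<nu> by auto
    have "s * (norm z * norm p) \<le> norm z * norm p" "s * (norm z * norm q) \<le> norm z * norm q"
      using s s0 by (intro mult_left_le_one_le; simp)+
    then have "s * (norm z * norm p) < 1" "s * (norm z * norm q) < 1" using 1 by linarith+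
    then show "of_real s * \<i> * z \<in> dom" "- (of_real s * \<i>) * z \<in> dom"
      using z s0 by (simp_all add: dom_def norm_mult mult.assoc)
  qed
  have cirW: "circ (\<lambda>z. W I \<epsilon> (T s) n z m) = E s m + pi * \<i> * (H s (- \<i> / of_real s) m + H s (\<i> / of_real s) m)" if s: "s1 < s" "s < 1" for s m
  proof -
    have s0: "0 < s" using sp(2) s by blast
    define \<alpha> where "\<alpha> = max s \<nu>"
    have \<alpha>: "0 < \<alpha>" "\<alpha> < 1" "s \<le> \<alpha>" "\<nu> \<le> \<alpha>" using s0 s \<nu> by (auto simp: \<alpha>_def)
    let ?A = "{z::complex. \<alpha> < norm z \<and> norm z < R0}"
    note sd = sz_dom[OF s(1) less_imp_le[OF s(2)]]
    have "circ (\<lambda>z. W I \<epsilon> (T s) n z m) = circ (\<lambda>z. H s z m / (1 + (of_real s * z)\<^sup>2))"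
    proof (rule circ_cong)
      fix z :: complex assume z: "norm z = 1"
      then have z0: "z \<noteq> 0" "norm z < R0" using R0 by auto
      have ns: "norm (of_real s * \<i> * z) < 1" "norm (- (of_real s * \<i>) * z) < 1" using s s0 z by (simp_all add: norm_mult)
      have ne: "of_real s * \<i> * z \<noteq> 1" "- (of_real s * \<i>) * z \<noteq> 1" using ns by (metis less_irrefl norm_one)+
      have "(1 - of_real s * \<i> * z) * (1 - - (of_real s * \<i>) * z) = 1 + (of_real s * z)\<^sup>2"
        by (simp add: power2_eq_square algebra_simps)
      then show "W I \<epsilon> (T s) n z m = H s z m / (1 + (of_real s * z)\<^sup>2)"
        unfolding IB W_split2[OF B(1-3) abi(4)] H_def Ta na using gam_Gh[OF sd(1)[OF z0] ne(1)] gam_Gh[OF sd(2)[OF z0] ne(2)]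
        by (simp add: mult_ac flip: \<open>_ = 1 + (of_real s * z)\<^sup>2\<close>)
    qed
    also have "\<dots> = contour_integral (circlepath 0 R) (\<lambda>z. (H s z m / (1 + (of_real s * z)\<^sup>2)) / z)
       + pi * \<i> * (H s (- \<i> / of_real s) m + H s (\<i> / of_real s) m)"
    proof (rule circ_two_poles[OF _ \<alpha>(1,2) s0 s(2) sp(3)[OF s(1)] R(2)])
      have z0: "z \<noteq> 0" if "z \<in> ?A" for z using that \<alpha> by auto
      show "(\<lambda>z. H s z m) holomorphic_on ?A"
        unfolding H_def W_def
      proof (intro holomorphic_intros gam_compose_holomorphic ker_holomorphic)
        have Gc: "(\<lambda>z. Gh k (f z)) holomorphic_on ?A" if "f holomorphic_on ?A" "\<And>z. z \<in> ?A \<Longrightarrow> f z \<in> dom" for k f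
        proof -
          have "f ` ?A \<subseteq> dom" using that(2) by (intro image_subsetI)
          from holomorphic_on_compose[OF that(1) holomorphic_on_subset[OF Gh_holomorphic this]] show ?thesis by (simp add: o_def)
        qed
        show "(\<lambda>z. Gh (\<epsilon> + m) (of_real s * \<i> * z)) holomorphic_on ?A" "(\<lambda>z. Gh m (- (of_real s * \<i>) * z)) holomorphic_on ?A"
          by (intro Gc holomorphic_intros sd; use z0 in auto)+
        fix z k assume z: "z \<in> ?A" and k: "k \<in> B"
        show "T s k * z \<noteq> 0 \<and> norm (T s k * z) < 1" using WBm[OF k s(1) z0[OF z]] z by auto
        show "T s k / z \<noteq> 0 \<and> norm (T s k / z) < 1"
          using TB[OF k s(1)] z0[OF z] z \<alpha> by (auto simp: norm_divide)
      next
        fix z assume z: "z \<in> ?A"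
        show "of_real s * \<i> / z \<noteq> 0 \<and> norm (of_real s * \<i> / z) < 1" "- (of_real s * \<i>) / z \<noteq> 0 \<and> norm (- (of_real s * \<i>) / z) < 1"
          using z0[OF z] z \<alpha> s0 by (auto simp: norm_divide norm_mult)
      qed (use z0 \<alpha> in auto)
    qed
    finally show ?thesis by (simp add: E_def)
  qed
  have s2dom: "(of_real s)\<^sup>2 \<in> dom" "- (of_real s)\<^sup>2 \<in> dom" if "s1 < s" "s \<le> 1" for s
    using sp(2)[OF that(1)] that by (auto intro!: dom_unit simp: norm_power power_le_one)
  have m2ne: "- (of_real s)\<^sup>2 \<noteq> (1::complex)" for s :: real
  proof
    assume "- (of_real s)\<^sup>2 = (1::complex)"
    then have "Re (- (of_real s)\<^sup>2) = 1" by simp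
    moreover have "Re (- (of_real s)\<^sup>2) = - (s\<^sup>2)" by (simp flip: of_real_power)
    ultimately show False using zero_le_power2[of s] by linarith
  qed
  have sq_ne_1: "(of_real s)\<^sup>2 \<noteq> (1::complex)" if s: "s1 < s" "s < 1" for s :: real
  proof
    assume "(of_real s)\<^sup>2 = (1::complex)"
    then have "s\<^sup>2 = 1" by (metis of_real_eq_1_iff of_real_power)
    then show False using s sp(2)[OF s(1)] by (simp add: power2_eq_1_iff)
  qed
  have HL: "(1 - (of_real s)\<^sup>2) * H s (- \<i> / of_real s) m = L1 s m" "(1 - (of_real s)\<^sup>2) * H s (\<i> / of_real s) m = L2 s m" if s: "s1 < s" "s < 1" for s m
  proof -
    have s0: "0 < s" using sp(2) s by blast
    note s2 = sq_ne_1[OF s]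
    have a1: "of_real s * \<i> * (- \<i> / of_real s) = 1" "- (of_real s * \<i>) * (- \<i> / of_real s) = - 1"
       "of_real s * \<i> / (- \<i> / of_real s) = - (of_real s)\<^sup>2" "- (of_real s * \<i>) / (- \<i> / of_real s) = (of_real s)\<^sup>2"
       "of_real s * \<i> * (\<i> / of_real s) = - 1" "- (of_real s * \<i>) * (\<i> / of_real s) = 1"
       "of_real s * \<i> / (\<i> / of_real s) = (of_real s)\<^sup>2" "- (of_real s * \<i>) / (\<i> / of_real s) = - (of_real s)\<^sup>2"
      using s0 by (simp_all add: field_simps power2_eq_square)
    note g = Gh_gam[OF s2dom(1)[OF s(1) less_imp_le[OF s(2)]] s2]
    show "(1 - (of_real s)\<^sup>2) * H s (- \<i> / of_real s) m = L1 s m" unfolding H_def L1_def a1 g by (simp only: mult_ac)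
    show "(1 - (of_real s)\<^sup>2) * H s (\<i> / of_real s) m = L2 s m" unfolding H_def L2_def a1 g by (simp only: mult_ac)
  qed
  have contT: "continuous_on {s1<..1} (\<lambda>s. T s k)" for k
  proof -
    have s2: "(of_real s)\<^sup>2 \<noteq> (0::complex)" "of_real s \<noteq> (0::complex)" if "s \<in> {s1<..1}" for s :: real
      using sp(2)[of s] that by auto
    consider "k = a" | "k \<noteq> a" "k = b" | "k \<noteq> a" "k \<noteq> b" "k = i" | "k \<noteq> a" "k \<noteq> b" "k \<noteq> i" by blast
    then show ?thesis unfolding T_def
      by (cases; use \<rho>0 s2 in \<open>simp; intro continuous_intros; simp\<close>)
  qed
  have contWB: "continuous_on {s1<..1} (\<lambda>s. W B \<epsilon> (T s) n (f s) m)"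
    if f: "continuous_on {s1<..1} f" "\<And>s. s1 < s \<Longrightarrow> s \<le> 1 \<Longrightarrow> norm (f s) = 1 / s" for f m
  proof -
    have f0: "f s \<noteq> 0" "norm (f s) < R0" "1 \<le> norm (f s)" if "s1 < s" "s \<le> 1" for s
      using f(2)[OF that] sp(2,3)[OF that(1)] R(2) that by auto
    have "norm (T s k / f s) < 1" if "k \<in> B" "s1 < s" "s \<le> 1" for s k
    proof -
      have "norm (T s k / f s) \<le> norm (T s k)" using f0[OF that(2,3)] by (simp add: norm_divide divide_le_eq mult_le_cancel_left1)
      then show ?thesis using TB[OF that(1,2)] \<nu> by linarith
    qed
    then show ?thesis unfolding W_def
      by (intro continuous_intros gam_compose_continuous ker_continuous contT f)
         (use f0 WBm TB(1) in auto)
  qed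
  have contL1: "continuous_on {s1<..1} (\<lambda>s. L1 s m)" for m
    unfolding L1_def
    by (intro continuous_intros Gh_compose_continuous contWB continuous_on_compose2[OF holomorphic_on_imp_continuous_on[OF gam_holomorphic], of _ "\<lambda>s. - (complex_of_real s)\<^sup>2"])
       (use s2dom m2ne s10 in \<open>auto simp: norm_divide\<close>)
  have contL2: "continuous_on {s1<..1} (\<lambda>s. L2 s m)" for m
    unfolding L2_def
    by (intro continuous_intros Gh_compose_continuous contWB continuous_on_compose2[OF holomorphic_on_imp_continuous_on[OF gam_holomorphic], of _ "\<lambda>s. - (complex_of_real s)\<^sup>2"])
       (use s2dom m2ne s10 in \<open>auto simp: norm_divide\<close>)
  have contE: "continuous_on {s1<..1} (\<lambda>s. E s m)" for m
    unfolding E_def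
  proof (rule circlepath_param_continuous)
    have sz: "norm (of_real s * z) > 1" if "s1 < s" "norm z = R" for s :: real and z :: complex
      using sp(2,3)[OF that(1)] that by (simp add: norm_mult field_simps)
    have den: "1 + (of_real s * z)\<^sup>2 \<noteq> 0" if "s1 < s" "norm z = R" for s :: real and z :: complex
    proof
      assume "1 + (of_real s * z)\<^sup>2 = 0"
      then have "(of_real s * z)\<^sup>2 = - 1" by (simp add: add_eq_0_iff)
      then have "norm (of_real s * z) ^ 2 = 1" by (metis norm_minus_cancel norm_one norm_power)
      then show False using sz[OF that] by (simp add: power2_eq_1_iff)
    qed
    have z0: "z \<noteq> 0" "norm z < R0" if "norm z = R" for z :: complex using that R by auto
    have sd: "of_real s * \<i> * z \<in> dom" "- (of_real s * \<i>) * z \<in> dom" if "s1 < s" "s \<le> 1" "norm z = R" for s z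
      using sz_dom[OF that(1,2) z0[OF that(3)]] .
    have cT: "continuous_on ({s1<..1} \<times> sphere 0 R) (\<lambda>x. T (fst x) k)" for k
      by (rule continuous_on_compose2[OF contT]) (auto intro!: continuous_intros)
    have gd: "norm (of_real s * \<i> / z) < 1" "norm (- (of_real s * \<i>) / z) < 1" if "s1 < s" "s \<le> 1" "norm z = R" for s z
      using sp(2)[OF that(1)] that R by (simp_all add: norm_divide norm_mult)
    have td: "norm (T s k / z) < 1" if "k \<in> B" "s1 < s" "norm z = R" for s z k
    proof -
      have "norm (T s k / z) \<le> norm (T s k)" using R that(3) by (simp add: norm_divide divide_le_eq mult_le_cancel_left1)
      then show ?thesis using TB[OF that(1,2)] \<nu> by linarith
    qed
    have "continuous_on ({s1<..1} \<times> sphere 0 R) (\<lambda>x. H (fst x) (snd x) m / (1 + (of_real (fst x) * snd x)\<^sup>2))"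
      unfolding H_def W_def
      by (intro continuous_intros Gh_compose_continuous gam_compose_continuous ker_continuous cT)
         (use den z0 sd gd WBm TB(1) td sp(2) in \<open>fastforce+\<close>)
    then show "continuous_on ({s1<..1} \<times> sphere 0 R) (\<lambda>(s, z). H s z m / (1 + (of_real s * z)\<^sup>2))"
      by (simp add: case_prod_unfold)
  qed (use R in auto)
  \<comment> \<open>The right hand side multiplied by 1 - s^2, again in a form continuous up to s =
    1.\<close>
  define Rr where "Rr = (\<lambda>s::real. Gh 0 ((of_real s)\<^sup>2) * RH B \<epsilon> (T s) n * (\<Prod>k\<in>B. gam (- (of_real s * \<i>) * T s k) (n k)) * (\<Prod>k\<in>B. gam (of_real s * \<i> * T s k) (n k + \<epsilon>)))"
  have ssT: "of_real s * \<i> * T s k \<noteq> 0 \<and> norm (of_real s * \<i> * T s k) < 1" "- (of_real s * \<i>) * T s k \<noteq> 0 \<and> norm (- (of_real s * \<i>) * T s k) < 1"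
    if "k \<in> B" "s1 < s" "s \<le> 1" for s k
  proof -
    have s0: "0 < s" using sp(2) that by blast
    have "s * norm (T s k) \<le> norm (T s k)" using that s0 by (intro mult_left_le_one_le) auto
    then have "s * norm (T s k) < 1" using TB[OF that(1,2)] \<nu> by linarith
    then show "of_real s * \<i> * T s k \<noteq> 0 \<and> norm (of_real s * \<i> * T s k) < 1" "- (of_real s * \<i>) * T s k \<noteq> 0 \<and> norm (- (of_real s * \<i>) * T s k) < 1"
      using TB[OF that(1,2)] s0 by (simp_all add: norm_mult)
  qed
  have contRr: "continuous_on {s1<..1} Rr"
  proof -
    have "continuous_on {s1<..1} (\<lambda>s. RH B \<epsilon> (T s) n)"
      unfolding RH_def
    proof (intro continuous_intros gam_compose_continuous contT)
      fix X s assume "X \<in> pairs B" and s: "s \<in> {s1<..1}"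
      then have "X \<subseteq> B" "card X = 2" by (simp_all add: pairs_def)
      then obtain c d where X: "X = {c, d}" "c \<noteq> d" "c \<in> B" "d \<in> B" by (auto simp: card_2_iff)
      have "norm (T s c) < 1" "norm (T s d) < 1" "T s c \<noteq> 0" "T s d \<noteq> 0" using TB[OF X(3)] TB[OF X(4)] s \<nu> by (force intro: le_less_trans)+
      then show "(\<Prod>a\<in>X. T s a) \<noteq> 0 \<and> norm (\<Prod>a\<in>X. T s a) < 1"
        using X mult_strict_mono[of "norm (T s c)" 1 "norm (T s d)" 1] by (simp add: norm_mult)
    qed
    then show ?thesis unfolding Rr_def
      by (intro continuous_intros Gh_compose_continuous gam_compose_continuous contT) (use s2dom ssT in auto)
  qed
  have RRr: "(1 - (of_real s)\<^sup>2) * RH I \<epsilon> (T s) n = Rr s" if s: "s1 < s" "s < 1" for s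
  proof -
    have s0: "0 < s" using sp(2) s by blast
    note s2 = sq_ne_1[OF s]
    have ss: "of_real s * \<i> * - (of_real s * \<i>) = (of_real s)\<^sup>2" by (simp add: complex_eq_iff power2_eq_square)
    have "RH I \<epsilon> (T s) n = RH B \<epsilon> (T s) n * (\<Prod>k\<in>B. gam (- (of_real s * \<i>) * T s k) (n k)) * (gam ((of_real s)\<^sup>2) 0 * (\<Prod>k\<in>B. gam (of_real s * \<i> * T s k) (n k + \<epsilon>)))"
      unfolding IB using B abi by (simp add: RH_insert Ta na ss[symmetric] del: mult_minus_right mult_minus_left)
    then show ?thesis unfolding Rr_def Gh_gam[OF s2dom(1)[OF s(1) less_imp_le[OF s(2)]] s2] by (simp only: mult_ac)
  qed
  have in1: "1 \<in> {s1<..1}" using s1 by simp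
  define \<Theta> where "\<Theta> = (\<Prod>k\<in>B. gam (- \<i> * T 1 k) (n k)) * (\<Prod>k\<in>B. gam (\<i> * T 1 k) (n k + \<epsilon>))"
  have T1: "T 1 k \<noteq> 0" "norm (T 1 k) < 1" "norm (p * q) < norm (T 1 k)" if "k \<in> B" for k
  proof -
    have 1: "T 1 k \<noteq> 0" "norm (T 1 k) < 1" if "k \<in> B" for k using TB[OF that s1(2)] \<nu> by auto
    show "T 1 k \<noteq> 0" "norm (T 1 k) < 1" using 1[OF that] .
    have e: "p * q = T 1 k * (\<Prod>c\<in>B - {k}. T 1 c)" using prB[OF s1(2)] B that by (simp add: prod.remove[symmetric])
    have "card (B - {k}) = 3" using B that by simp
    then obtain c where c: "c \<in> B - {k}" by (metis all_not_in_conv card.empty zero_neq_numeral)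
    have "(\<Prod>c\<in>B - {k} - {c}. norm (T 1 c)) \<le> 1" by (intro prod_le_1) (use 1 in \<open>auto intro: less_imp_le\<close>)
    then have "norm (T 1 c) * (\<Prod>c\<in>B - {k} - {c}. norm (T 1 c)) \<le> norm (T 1 c) * 1" by (intro mult_left_mono) auto
    also have "\<dots> < 1" using 1 c by auto
    finally have "(\<Prod>c\<in>B - {k}. norm (T 1 c)) < 1" using c B by (simp add: prod.remove[of "B - {k}" c])
    then have "norm (T 1 k) * (\<Prod>c\<in>B - {k}. norm (T 1 c)) < norm (T 1 k) * 1" using 1[OF that] by (intro mult_strict_left_mono) auto
    then show "norm (p * q) < norm (T 1 k)" unfolding e norm_mult prod_norm by simp
  qed
  have \<Theta>0: "\<Theta> \<noteq> 0"
  proof -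
    have "gam (- \<i> * T 1 k) l \<noteq> 0" "gam (\<i> * T 1 k) l \<noteq> 0" if "k \<in> B" for k l
      by (rule gam_nonzero[OF unit_dom]; use T1[OF that] unit_dom(2)[of "- \<i> * T 1 k"] unit_dom(2)[of "\<i> * T 1 k"] in \<open>simp add: norm_mult\<close>)+
    then show ?thesis using B by (simp add: \<Theta>_def)
  qed
  have Rr1: "Rr 1 = Gh 0 1 * \<Theta>"
  proof -
    have "RH B \<epsilon> (T 1) n = 1"
      by (rule RH_four[OF B(1,4)]) (use T1 prB[OF s1(2)] snB in auto)
    then show ?thesis by (simp add: Rr_def \<Theta>_def)
  qed
  define C where "C = ratio I \<epsilon> (T ((s1 + 1) / 2)) n"
  have smid: "s1 < (s1 + 1) / 2" "(s1 + 1) / 2 < 1" using s1 by auto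
  have BIC: "BI I \<epsilon> (T s) n = C * RH I \<epsilon> (T s) n" if s: "s1 < s" "s < 1" for s
  proof -
    have "ratio I \<epsilon> (T s) n = C" unfolding C_def
      by (rule ratio_const[OF ad[OF s] ad[OF smid] abi(3)]) (use nTi s smid in auto)
    then show ?thesis using RH_nonzero[OF ad[OF s]] by (simp add: ratio_def field_simps)
  qed
  \<comment> \<open>The left hand side multiplied by 1 - s^2. The integrals over the larger circle
    stay bounded, so at s = 1 only \<open>L1\<close> and \<open>L2\<close> contribute.\<close>
  define Q where "Q = (\<lambda>s. \<Sum>m<r. (1 - (of_real s)\<^sup>2) * E s (int m - \<epsilon>) + pi * \<i> * (L1 s (int m - \<epsilon>) + L2 s (int m - \<epsilon>)))"
  have QC: "Q s = C * Rr s" if s: "s1 < s" "s < 1" for s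
  proof -
    have "C * Rr s = (1 - (of_real s)\<^sup>2) * BI I \<epsilon> (T s) n" unfolding BIC[OF s] RRr[OF s, symmetric] by simp
    also have "\<dots> = Q s"
      unfolding BI_window[OF ad[OF s] e] sum_distrib_left Q_def cirW[OF s] HL[OF s, symmetric]
      by (intro sum.cong refl) (simp add: algebra_simps)
    finally show ?thesis ..
  qed
  have "continuous_on {s1<..1} Q" unfolding Q_def by (intro continuous_intros contE contL1 contL2)
  then have "(Q \<longlongrightarrow> Q 1) (at_left 1)" by (rule tendsto_at_left_1) (rule s1)
  moreover have "((\<lambda>s. C * Rr s) \<longlongrightarrow> C * Rr 1) (at_left 1)" by (intro tendsto_intros tendsto_at_left_1[OF contRr] s1)
  moreover have "eventually (\<lambda>s. C * Rr s = Q s) (at_left 1)"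
    using eventually_at_left_real[OF s1(2)] by eventually_elim (simp add: QC)
  ultimately have "C * Rr 1 = Q 1"
    using Lim_transform_eventually tendsto_unique trivial_limit_at_left_real by blast
  also have "Q 1 = pi * \<i> * ((\<Sum>m<r. L1 1 (int m - \<epsilon>)) + (\<Sum>m<r. L2 1 (int m - \<epsilon>)))"
    unfolding Q_def by (simp add: sum.distrib sum_distrib_left distrib_left)
  \<comment> \<open>At s = 1 the factor Gh (\<epsilon> + m) 1 vanishes unless r divides \<epsilon> +
    m, and Gh m 1 unless r divides m. Each selects one index of the window, m = - \<epsilon> for
    \<open>L1\<close> and m = 0 for \<open>L2\<close>.\<close>
  also have "(\<Sum>m<r. L1 1 (int m - \<epsilon>)) = L1 1 (- \<epsilon>)"
  proof -
    have "L1 1 (int m - \<epsilon>) = 0" if "m < r" "m \<noteq> 0" for m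
    proof -
      have "\<not> int r dvd int m" using that by (auto dest: zdvd_imp_le)
      then show ?thesis by (simp add: L1_def Gh_1_eq_0)
    qed
    then have "(\<Sum>m<r. L1 1 (int m - \<epsilon>)) = (\<Sum>m\<in>{0}. L1 1 (int m - \<epsilon>))"
      using r by (intro sum.mono_neutral_right) auto
    then show ?thesis by simp
  qed
  also have "(\<Sum>m<r. L2 1 (int m - \<epsilon>)) = L2 1 0"
  proof -
    have er: "nat \<epsilon> < r" "int (nat \<epsilon>) = \<epsilon>" using e re r by auto
    have "L2 1 (int m - \<epsilon>) = 0" if "m < r" "m \<noteq> nat \<epsilon>" for m
    proof -
      have "int m - \<epsilon> \<noteq> 0" using that er by auto
      moreover have "\<bar>int m - \<epsilon>\<bar> < int r" using that er of_nat_0_le_iff[of "nat \<epsilon>"] by linarith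
      ultimately have "\<not> int r dvd (int m - \<epsilon>)" by (metis dvd_imp_le_int abs_of_nat not_le)
      then show ?thesis by (simp add: L2_def Gh_1_eq_0)
    qed
    then have "(\<Sum>m<r. L2 1 (int m - \<epsilon>)) = (\<Sum>m\<in>{nat \<epsilon>}. L2 1 (int m - \<epsilon>))"
      using er by (intro sum.mono_neutral_right) auto
    then show ?thesis using er by simp
  qed
  \<comment> \<open>The gamma functions at - 1 and the kernel at z^2 = - 1 multiply to 1 by
    \<open>ker_eq\<close>. The 2 is the factor 1 - z of \<open>Gh\<close> at z = - 1, and the two
    factors Gh 0 1 come from the pole of the integrand and from s^2 -> 1.\<close>
  also have "L1 1 (- \<epsilon>) = 2 * (Gh 0 1)\<^sup>2 * \<Theta>"
  proof -
    have "gam (- 1) (- \<epsilon>) * gam (- 1) \<epsilon> * ker (- 1) (- \<epsilon>) = 1"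
      using ker_eq[of "- 1" "- \<epsilon>"] m1dom by simp
    moreover have "W B \<epsilon> (T 1) n (- \<i>) (- \<epsilon>) = \<Theta> * ker (- 1) (- \<epsilon>)"
    proof -
      have "(\<Prod>k\<in>B. gam (T 1 k * - \<i>) (n k + \<epsilon> + - \<epsilon>) * gam (T 1 k / - \<i>) (n k - - \<epsilon>)) = \<Theta>"
        unfolding \<Theta>_def prod.distrib[symmetric] by (intro prod.cong refl) (simp add: mult.commute)
      then show ?thesis unfolding W_def by simp
    qed
    ultimately show ?thesis unfolding L1_def by (simp add: Gh_gam[OF m1dom] power2_eq_square mult_ac)
  qed
  also have "L2 1 0 = 2 * (Gh 0 1)\<^sup>2 * \<Theta>"
  proof -
    have "gam (- 1) \<epsilon> * gam (- 1) (- \<epsilon>) * ker (- 1) \<epsilon> = 1"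
      using ker_eq[of "- 1" "\<epsilon>"] m1dom by simp
    moreover have "W B \<epsilon> (T 1) n \<i> 0 = \<Theta> * ker (- 1) \<epsilon>"
    proof -
      have "(\<Prod>k\<in>B. gam (T 1 k * \<i>) (n k + \<epsilon> + 0) * gam (T 1 k / \<i>) (n k - 0)) = \<Theta>"
        unfolding \<Theta>_def prod.distrib[symmetric] by (intro prod.cong refl) (simp add: mult.commute)
      then show ?thesis unfolding W_def by simp
    qed
    ultimately show ?thesis unfolding L2_def by (simp add: Gh_gam[OF m1dom] power2_eq_square mult_ac)
  qed
  finally have fin: "C * (Gh 0 1 * \<Theta>) = (4 * pi * \<i> * Gh 0 1) * (Gh 0 1 * \<Theta>)"
    unfolding Rr1 by (simp add: power2_eq_square algebra_simps)
  have "Gh 0 1 \<noteq> 0" unfolding Gh_0_1 using norms by (simp add: qpoch_nonzero_norm)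
  then have "C = 4 * pi * \<i> * Gh 0 1" using fin \<Theta>0 by simp
  then show ?thesis using that[of "T ((s1 + 1) / 2)" n] ad[OF smid] nTi[OF smid(1)] by (simp add: C_def)
qed

theorem beta_integral:
  assumes a: "adm I \<epsilon> t n" and e: "\<epsilon> \<in> {0, 1}" and ij: "i \<in> I" "j \<in> I" "i \<noteq> j" and small: "norm (t i * t j) < norm q"
  shows "BI I \<epsilon> t n = 4 * pi * \<i> * Gh 0 1 * RH I \<epsilon> t n"
proof -
  have main: "ratio I \<epsilon> t n = 4 * pi * \<i> * Gh 0 1" if a: "adm I \<epsilon> t n" and e: "\<epsilon> \<in> {0, 1}" "r \<noteq> 1 \<or> \<epsilon> = 0" for \<epsilon> n
  proof -
    have I: "finite I" "card I = 6" using a by (auto simp: adm_def)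
    obtain u where u: "adm I \<epsilon> u n" "norm (u i) < norm q" "ratio I \<epsilon> u n = ratio I \<epsilon> t n"
      using ratio_normalize[OF a ij small] by blast
    have "card (I - {i, j}) = 4" using I ij by (simp add: card_Diff_subset)
    then obtain k where k: "k \<in> I" "k \<noteq> i" "k \<noteq> j" by (metis DiffE all_not_in_conv card.empty insertCI zero_neq_numeral)
    obtain t' n' where t': "adm I \<epsilon> t' n'" "norm (t' i) < norm q" "ratio I \<epsilon> t' n' = 4 * pi * \<i> * Gh 0 1"
      \<comment> \<open>The pinched pair consists of j and a third index k, so that i is free to
        carry the small parameter.\<close>
      using beta_pinch[OF I ij(2) k(1) ij(1) _ _ _ e] k ij by metis
    show ?thesis using ratio_const[OF u(1) t'(1) ij(1) u(2) t'(2)] u(3) t'(3) by simp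
  qed
  have "ratio I \<epsilon> t n = 4 * pi * \<i> * Gh 0 1"
  proof (cases "r = 1")
    case True
    show ?thesis using ratio_r1[OF True a] main[of 0 "\<lambda>_. 0"] by simp
  qed (use main[OF a e] in simp)
  then show ?thesis using RH_nonzero[OF a] by (simp add: ratio_def field_simps)
qed

end

section \<open>Bailey's transformation\<close>

context rarefied
begin

lemma circ_sum_swap:
  assumes c: "\<And>m l. continuous_on (sphere 0 1 \<times> sphere 0 1) (\<lambda>(z, w). F m l z w)"
  shows "(\<Sum>m<r. circ (\<lambda>z. \<Sum>l<r. circ (\<lambda>w. F m l z w))) = (\<Sum>l<r. circ (\<lambda>w. \<Sum>m<r. circ (\<lambda>z. F m l z w)))"
proof -
  have c': "continuous_on (sphere 0 1 \<times> sphere 0 1) (\<lambda>(w, z). F m l z w)" for m l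
    using continuous_on_compose2[OF c[of m l] continuous_on_swap[of "sphere 0 1 \<times> sphere 0 1"]]
    by (simp add: case_prod_unfold product_swap)
  have "(\<Sum>m<r. circ (\<lambda>z. \<Sum>l<r. circ (\<lambda>w. F m l z w))) = (\<Sum>m<r. \<Sum>l<r. circ (\<lambda>z. circ (\<lambda>w. F m l z w)))"
    by (intro sum.cong refl circ_sum) (auto intro: circ_param_continuous[OF c])
  also have "\<dots> = (\<Sum>l<r. \<Sum>m<r. circ (\<lambda>w. circ (\<lambda>z. F m l z w)))"
    unfolding circ_swap[OF c] by (rule sum.swap)
  also have "\<dots> = (\<Sum>l<r. circ (\<lambda>w. \<Sum>m<r. circ (\<lambda>z. F m l z w)))"
    by (intro sum.cong refl circ_sum[symmetric]) (auto intro: circ_param_continuous[OF c'])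
  finally show ?thesis .
qed

text \<open>Two extra slots carry the coupling: as parameters of an integrand in w, the values \<xi>
  z and \<xi> / z contribute the four gamma functions joining z and w.\<close>

definition ins_t :: "nat \<Rightarrow> nat \<Rightarrow> (nat \<Rightarrow> complex) \<Rightarrow> complex \<Rightarrow> complex \<Rightarrow> nat \<Rightarrow> complex" where
  "ins_t i j t \<xi> z = t(i := \<xi> * z, j := \<xi> / z)"

definition ins_n :: "nat \<Rightarrow> nat \<Rightarrow> (nat \<Rightarrow> int) \<Rightarrow> int \<Rightarrow> int \<Rightarrow> int \<Rightarrow> nat \<Rightarrow> int" where
  "ins_n i j n N \<epsilon> m = n(i := N + m, j := N - m - \<epsilon>)"

definition dil_t :: "nat set \<Rightarrow> (nat \<Rightarrow> complex) \<Rightarrow> complex \<Rightarrow> nat \<Rightarrow> complex" where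
  "dil_t B t \<xi> k = (if k \<in> B then \<xi> * t k else t k)"

definition dil_n :: "nat set \<Rightarrow> (nat \<Rightarrow> int) \<Rightarrow> int \<Rightarrow> nat \<Rightarrow> int" where
  "dil_n B n N k = (if k \<in> B then n k + N else n k)"

lemma W_union:
  assumes "finite A" "finite B" "A \<inter> B = {}"
  shows "W (A \<union> B) \<epsilon> t n z m = (\<Prod>b\<in>B. gam (t b * z) (n b + \<epsilon> + m) * gam (t b / z) (n b - m)) * W A \<epsilon> t n z m"
  unfolding W_def prod.union_disjoint[OF assms] by (simp only: mult_ac)

lemma adm_ins:
  assumes B: "finite B" "card B = 4" "i \<notin> B" "j \<notin> B" "i \<noteq> j"
    and t: "\<And>k. k \<in> B \<Longrightarrow> t k \<noteq> 0 \<and> norm (t k) < 1" and \<xi>: "\<xi> \<noteq> 0" "norm \<xi> < 1"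
    and pt: "(\<Prod>k\<in>B. t k) * \<xi>\<^sup>2 = p * q" and sn: "(\<Sum>k\<in>B. n k) + 2 * N - \<epsilon> + 3 * \<rho> = 0" and z: "norm z = 1"
  shows "adm (insert i (insert j B)) \<rho> (ins_t i j t \<xi> z) (ins_n i j n N \<epsilon> m)"
proof -
  have z0: "z \<noteq> 0" using z by auto
  have T: "ins_t i j t \<xi> z k = t k" "ins_n i j n N \<epsilon> m k = n k" if "k \<in> B" for k
    using that B by (auto simp: ins_t_def ins_n_def)
  have P: "(\<Prod>k\<in>B. ins_t i j t \<xi> z k) = (\<Prod>k\<in>B. t k)" "(\<Sum>k\<in>B. ins_n i j n N \<epsilon> m k) = (\<Sum>k\<in>B. n k)"
    by (intro prod.cong sum.cong refl T; assumption)+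
  have X: "ins_t i j t \<xi> z i = \<xi> * z" "ins_t i j t \<xi> z j = \<xi> / z" "ins_n i j n N \<epsilon> m i = N + m" "ins_n i j n N \<epsilon> m j = N - m - \<epsilon>"
    using B by (auto simp: ins_t_def ins_n_def)
  have "\<xi> * z * (\<xi> / z * (\<Prod>k\<in>B. t k)) = p * q"
    unfolding pt[symmetric] using z0 by (simp add: power2_eq_square)
  then show ?thesis unfolding adm_def using B sn T t \<xi> z z0
    by (auto simp: P X norm_mult norm_divide)
qed

text \<open>The inner integral over w is a beta integral with four parameters t b and the two
  coupling parameters. Of its right hand side, the pairs inside B and the pair of coupling
  parameters are independent of z; the mixed pairs are gamma functions at \<xi> t b z and \<xi> t b
  / z, that is, an integrand with B dilated by \<xi>.\<close>

lemma bailey_half: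
  assumes A: "finite A" and B: "finite B" "card B = 4" "A \<inter> B = {}" "i \<notin> B" "j \<notin> B" "i \<noteq> j"
    and t: "\<And>k. k \<in> A \<union> B \<Longrightarrow> t k \<noteq> 0 \<and> norm (t k) < 1" and \<xi>: "\<xi> \<noteq> 0" "norm \<xi> < 1"
    and pt: "(\<Prod>k\<in>B. t k) * \<xi>\<^sup>2 = p * q" and sn: "(\<Sum>k\<in>B. n k) + 2 * N - \<epsilon> + 3 * \<rho> = 0"
    and \<rho>: "\<rho> \<in> {0, 1}" and cd: "c \<in> B" "d \<in> B" "c \<noteq> d" "norm (t c * t d) < norm q"
  shows "(\<Sum>m<r. circ (\<lambda>z. \<Sum>l<r. circ (\<lambda>w. W (insert i (insert j B)) \<rho> (ins_t i j t \<xi> z) (ins_n i j n N \<epsilon> (int m)) w (int l) * W A \<epsilon> t n z (int m))))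
    = 4 * pi * \<i> * Gh 0 1 * gam (\<xi>\<^sup>2) (2 * N + \<rho> - \<epsilon>) * (RH B \<rho> t n * BI (A \<union> B) \<epsilon> (dil_t B t \<xi>) (dil_n B n (N + \<rho> - \<epsilon>)))"
proof -
  let ?J = "insert i (insert j B)"
  have tb: "dil_t B t \<xi> k \<noteq> 0 \<and> norm (dil_t B t \<xi> k) < 1" if "k \<in> A \<union> B" for k
    using t[OF that] \<xi> mult_strict_mono[of "norm \<xi>" 1 "norm (t k)" 1] by (simp add: dil_t_def norm_mult)
  have inner: "(\<Sum>l<r. circ (\<lambda>w. W ?J \<rho> (ins_t i j t \<xi> z) (ins_n i j n N \<epsilon> m) w (int l) * W A \<epsilon> t n z m))
    = 4 * pi * \<i> * Gh 0 1 * gam (\<xi>\<^sup>2) (2 * N + \<rho> - \<epsilon>) * RH B \<rho> t n * W (A \<union> B) \<epsilon> (dil_t B t \<xi>) (dil_n B n (N + \<rho> - \<epsilon>)) z m"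
    if z: "norm z = 1" for z m
  proof -
    define T K where "T = ins_t i j t \<xi> z" and "K = ins_n i j n N \<epsilon> m"
    have ad: "adm ?J \<rho> T K" unfolding T_def K_def by (rule adm_ins[OF B(1,2,4-6) _ \<xi> pt sn z]) (use t in auto)
    have TB: "T k = t k" "K k = n k" if "k \<in> B" for k using that B by (auto simp: T_def K_def ins_t_def ins_n_def)
    have X: "T i = \<xi> * z" "T j = \<xi> / z" "K i = N + m" "K j = N - m - \<epsilon>"
      using B by (auto simp: T_def K_def ins_t_def ins_n_def)
    have z0: "z \<noteq> 0" using z by auto
    have e: "\<xi> * z * (\<xi> / z) = \<xi>\<^sup>2" using z0 by (simp add: power2_eq_square)
    have "(\<Sum>l<r. circ (\<lambda>w. W ?J \<rho> T K w (int l) * W A \<epsilon> t n z m)) = BI ?J \<rho> T K * W A \<epsilon> t n z m"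
      unfolding BI_def sum_distrib_right
    proof (intro sum.cong refl)
      fix l
      have "continuous_on (sphere 0 1) (\<lambda>w. W ?J \<rho> T K w (int l))"
        by (rule W_continuous) (use ad in \<open>auto simp: adm_def\<close>)
      from circ_cmult[OF this, of "W A \<epsilon> t n z m"]
      show "circ (\<lambda>w. W ?J \<rho> T K w (int l) * W A \<epsilon> t n z m) = circ (\<lambda>w. W ?J \<rho> T K w (int l)) * W A \<epsilon> t n z m"
        by (simp add: mult.commute)
    qed
    also have "BI ?J \<rho> T K = 4 * pi * \<i> * Gh 0 1 * RH ?J \<rho> T K"
      by (rule beta_integral[OF ad \<rho>, of c d]) (use cd TB in auto)
    also have "RH ?J \<rho> T K = RH B \<rho> t n * (\<Prod>b\<in>B. gam (\<xi> / z * t b) (N - m - \<epsilon> + n b + \<rho>)) *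
        (gam (\<xi>\<^sup>2) (2 * N + \<rho> - \<epsilon>) * (\<Prod>b\<in>B. gam (\<xi> * z * t b) (N + m + n b + \<rho>)))"
    proof -
      have "(\<Prod>b\<in>B. gam (T j * T b) (K j + K b + \<rho>)) = (\<Prod>b\<in>B. gam (\<xi> / z * t b) (N - m - \<epsilon> + n b + \<rho>))"
        "(\<Prod>b\<in>B. gam (T i * T b) (K i + K b + \<rho>)) = (\<Prod>b\<in>B. gam (\<xi> * z * t b) (N + m + n b + \<rho>))"
        by (intro prod.cong refl, simp add: TB X)+
      moreover have "RH B \<rho> T K = RH B \<rho> t n" by (rule RH_cong) (use TB in auto)
      moreover have "K i + K j + \<rho> = 2 * N + \<rho> - \<epsilon>" by (simp add: X)
      moreover have "T i * T j = \<xi>\<^sup>2" by (simp only: X e)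
      moreover have "finite (insert j B)" "i \<notin> insert j B" using B by auto
      note RH_insert[OF this, of \<rho> T K]
      ultimately show ?thesis using B by (simp only: RH_insert[OF B(1) B(5)] prod.insert[OF B(1) B(5)])
    qed
    also have "4 * pi * \<i> * Gh 0 1 * (RH B \<rho> t n * (\<Prod>b\<in>B. gam (\<xi> / z * t b) (N - m - \<epsilon> + n b + \<rho>)) *
        (gam (\<xi>\<^sup>2) (2 * N + \<rho> - \<epsilon>) * (\<Prod>b\<in>B. gam (\<xi> * z * t b) (N + m + n b + \<rho>)))) * W A \<epsilon> t n z m
      = 4 * pi * \<i> * Gh 0 1 * gam (\<xi>\<^sup>2) (2 * N + \<rho> - \<epsilon>) * RH B \<rho> t n *
       (((\<Prod>b\<in>B. gam (\<xi> * z * t b) (N + m + n b + \<rho>)) * (\<Prod>b\<in>B. gam (\<xi> / z * t b) (N - m - \<epsilon> + n b + \<rho>))) * W A \<epsilon> t n z m)"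
      by (simp only: mult_ac)
    also have "((\<Prod>b\<in>B. gam (\<xi> * z * t b) (N + m + n b + \<rho>)) * (\<Prod>b\<in>B. gam (\<xi> / z * t b) (N - m - \<epsilon> + n b + \<rho>))) * W A \<epsilon> t n z m
       = W (A \<union> B) \<epsilon> (dil_t B t \<xi>) (dil_n B n (N + \<rho> - \<epsilon>)) z m"
    proof -
      have "W A \<epsilon> (dil_t B t \<xi>) (dil_n B n (N + \<rho> - \<epsilon>)) z m = W A \<epsilon> t n z m"
        by (rule W_cong) (use B(3) in \<open>auto simp: dil_t_def dil_n_def\<close>)
      moreover have "(\<Prod>b\<in>B. gam (dil_t B t \<xi> b * z) (dil_n B n (N + \<rho> - \<epsilon>) b + \<epsilon> + m) * gam (dil_t B t \<xi> b / z) (dil_n B n (N + \<rho> - \<epsilon>) b - m))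
        = (\<Prod>b\<in>B. gam (\<xi> * z * t b) (N + m + n b + \<rho>)) * (\<Prod>b\<in>B. gam (\<xi> / z * t b) (N - m - \<epsilon> + n b + \<rho>))"
        unfolding prod.distrib[symmetric] by (intro prod.cong refl) (simp add: dil_t_def dil_n_def algebra_simps)
      ultimately show ?thesis unfolding W_union[OF A B(1) B(3)] by simp
    qed
    finally show ?thesis unfolding T_def K_def .
  qed
  have "circ (\<lambda>z. \<Sum>l<r. circ (\<lambda>w. W ?J \<rho> (ins_t i j t \<xi> z) (ins_n i j n N \<epsilon> (int m)) w (int l) * W A \<epsilon> t n z (int m)))
    = 4 * pi * \<i> * Gh 0 1 * gam (\<xi>\<^sup>2) (2 * N + \<rho> - \<epsilon>) * RH B \<rho> t n * circ (\<lambda>z. W (A \<union> B) \<epsilon> (dil_t B t \<xi>) (dil_n B n (N + \<rho> - \<epsilon>)) z (int m))" for m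
    by (subst circ_cong[OF inner], assumption) (intro circ_cmult W_continuous tb)
  then show ?thesis by (simp only: BI_def sum_distrib_left mult_ac)
qed

text \<open>The double integral is symmetric in the two groups, so integrating over w first or over
  z first gives two evaluations of the same quantity. The constant and gam (\<xi>^2) cancel because
  they are nonzero and common to both.\<close>

theorem bailey:
  assumes A: "finite A" "card A = 4" and B: "finite B" "card B = 4" "A \<inter> B = {}"
    and t: "\<And>k. k \<in> A \<union> B \<Longrightarrow> t k \<noteq> 0 \<and> norm (t k) < 1" and \<xi>: "\<xi> \<noteq> 0" "norm \<xi> < 1"
    and ptA: "(\<Prod>k\<in>A. t k) * \<xi>\<^sup>2 = p * q" and snA: "(\<Sum>k\<in>A. n k) + 2 * N + \<rho> + \<epsilon> = 0"
    and ptB: "(\<Prod>k\<in>B. t k) * \<xi>\<^sup>2 = p * q" and snB: "(\<Sum>k\<in>B. n k) + 2 * N - \<epsilon> + 3 * \<rho> = 0"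
    and e: "\<epsilon> \<in> {0, 1}" "\<rho> \<in> {0, 1}"
    and ab: "a \<in> A" "b \<in> A" "a \<noteq> b" "norm (t a * t b) < norm q"
    and cd: "c \<in> B" "d \<in> B" "c \<noteq> d" "norm (t c * t d) < norm q"
  shows "BI (A \<union> B) \<epsilon> (dil_t B t \<xi>) (dil_n B n (N + \<rho> - \<epsilon>)) * RH B \<rho> t n
    = BI (A \<union> B) \<rho> (dil_t A t \<xi>) (dil_n A n N) * RH A \<epsilon> t n"
proof -
  obtain i where i: "i \<notin> A \<union> B" using ex_new_if_finite[of "A \<union> B"] A B by auto
  obtain j where j: "j \<notin> insert i (A \<union> B)" using ex_new_if_finite[of "insert i (A \<union> B)"] A B by auto
  have ij: "i \<notin> A" "i \<notin> B" "j \<notin> A" "j \<notin> B" "i \<noteq> j" using i j by auto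
  define F where "F = (\<lambda>m l z w. W (insert i (insert j B)) \<rho> (ins_t i j t \<xi> z) (ins_n i j n N \<epsilon> (int m)) w (int l) * W A \<epsilon> t n z (int m))"
  \<comment> \<open>Exchanging (z, m, \<epsilon>, A) and (w, l, \<rho>, B) leaves the integrand
    unchanged if N becomes N + \<rho> - \<epsilon>; this matches the discrete parts of the four
    coupling factors.\<close>
  have FF: "F m l z w = W (insert i (insert j A)) \<epsilon> (ins_t i j t \<xi> w) (ins_n i j n (N + \<rho> - \<epsilon>) \<rho> (int l)) z (int m) * W B \<rho> t n w (int l)" for m l z w
  proof -
    have "W B \<rho> (ins_t i j t \<xi> z) (ins_n i j n N \<epsilon> (int m)) w (int l) = W B \<rho> t n w (int l)"
      "W A \<epsilon> (ins_t i j t \<xi> w) (ins_n i j n (N + \<rho> - \<epsilon>) \<rho> (int l)) z (int m) = W A \<epsilon> t n z (int m)"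
      by (rule W_cong; use ij in \<open>auto simp: ins_t_def ins_n_def\<close>)+
    then show ?thesis unfolding F_def W_split2[OF B(1) ij(2,4,5)] W_split2[OF A(1) ij(1,3,5)]
      using ij(5) by (simp add: ins_t_def ins_n_def mult_ac algebra_simps)
  qed
  have cont: "continuous_on (sphere 0 1 \<times> sphere 0 1) (\<lambda>(z, w). F m l z w)" for m l
  proof -
    have 1: "continuous_on (sphere 0 1 \<times> sphere 0 1) (\<lambda>(z, w). W (insert i (insert j B)) \<rho> (ins_t i j t \<xi> z) (ins_n i j n N \<epsilon> (int m)) w (int l))"
    proof (rule W_param_continuous)
      fix k assume k: "k \<in> insert i (insert j B)"
      show "continuous_on (sphere 0 1) (\<lambda>z. ins_t i j t \<xi> z k)"
        using ij(5) by (cases "k = j"; cases "k = i"; simp add: ins_t_def; intro continuous_intros; auto)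
      fix z :: complex assume z: "z \<in> sphere 0 1"
      show "ins_t i j t \<xi> z k \<noteq> 0 \<and> norm (ins_t i j t \<xi> z k) < 1"
        using adm_ins[OF B(1,2) ij(2,4,5) _ \<xi> ptB snB, of z m] t z k by (auto simp: adm_def)
    qed (use B in simp)
    have "continuous_on (sphere 0 1) (\<lambda>z. W A \<epsilon> t n z (int m))" by (rule W_continuous) (use t in auto)
    then have 2: "continuous_on (sphere 0 1 \<times> sphere 0 1) (\<lambda>x. W A \<epsilon> t n (fst x) (int m))"
      by (rule continuous_on_compose2) (auto intro!: continuous_intros)
    show ?thesis unfolding F_def case_prod_unfold
      by (intro continuous_on_mult 1[unfolded case_prod_unfold] 2)
  qed
  \<comment> \<open>\<xi>^2 is the product of two parameters of an admissible system, hence lies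
    where gam has no zeros.\<close>
  have g: "gam (\<xi>\<^sup>2) k \<noteq> 0" for k
  proof -
    have 1: "adm (insert i (insert j B)) \<rho> (ins_t i j t \<xi> 1) (ins_n i j n N \<epsilon> 0)"
      by (rule adm_ins[OF B(1,2) ij(2,4,5) _ \<xi> ptB snB]) (use t in auto)
    have "ins_t i j t \<xi> 1 i * ins_t i j t \<xi> 1 j = \<xi>\<^sup>2" using ij by (simp add: ins_t_def power2_eq_square)
    then have "norm (p * q) < norm (\<xi>\<^sup>2)" "norm (\<xi>\<^sup>2) < 1" using adm_pair_norm[OF 1, of i j] ij by auto
    moreover have "\<xi>\<^sup>2 \<noteq> 0" using \<xi> by simp
    ultimately show ?thesis using unit_dom gam_nonzero by blast
  qed
  have g0: "Gh 0 1 \<noteq> 0" unfolding Gh_0_1 using norms by (simp add: qpoch_nonzero_norm)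
  have 1: "(\<Sum>m<r. circ (\<lambda>z. \<Sum>l<r. circ (\<lambda>w. F m l z w))) =
     4 * pi * \<i> * Gh 0 1 * gam (\<xi>\<^sup>2) (2 * N + \<rho> - \<epsilon>) * (RH B \<rho> t n * BI (A \<union> B) \<epsilon> (dil_t B t \<xi>) (dil_n B n (N + \<rho> - \<epsilon>)))"
    unfolding F_def by (rule bailey_half[OF A(1) B ij(2,4,5) t \<xi> ptB snB e(2) cd])
  have 2: "(\<Sum>l<r. circ (\<lambda>w. \<Sum>m<r. circ (\<lambda>z. F m l z w))) =
     4 * pi * \<i> * Gh 0 1 * gam (\<xi>\<^sup>2) (2 * (N + \<rho> - \<epsilon>) + \<epsilon> - \<rho>) * (RH A \<epsilon> t n * BI (B \<union> A) \<rho> (dil_t A t \<xi>) (dil_n A n (N + \<rho> - \<epsilon> + \<epsilon> - \<rho>)))"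
    unfolding FF by (rule bailey_half[OF B(1) A _ ij(1,3,5) _ \<xi> ptA _ e(1) ab]) (use B(3) t snA in auto)
  have e1: "2 * (N + \<rho> - \<epsilon>) + \<epsilon> - \<rho> = 2 * N + \<rho> - \<epsilon>" "N + \<rho> - \<epsilon> + \<epsilon> - \<rho> = N" by auto
  have "RH B \<rho> t n * BI (A \<union> B) \<epsilon> (dil_t B t \<xi>) (dil_n B n (N + \<rho> - \<epsilon>)) = RH A \<epsilon> t n * BI (B \<union> A) \<rho> (dil_t A t \<xi>) (dil_n A n N)"
    using circ_sum_swap[of F, OF cont] g[of "2 * N + \<rho> - \<epsilon>"] g0 unfolding 1 2 e1 by simp
  then show ?thesis by (simp add: mult.commute Un_commute)
qed

end

section \<open>Composition of two transformations and analytic continuation\<close>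

context rarefied
begin

text \<open>The transformation in terms of old parameters T and new ones S: those in A are
  multiplied by \<xi> and those in B divided by it. The product over B in the new parameters is the
  inverse of the one in the old parameters, by \<open>RH_complement\<close>, so only old parameters
  remain in the prefactor.\<close>

lemma bailey_step:
  assumes A: "finite A" "card A = 4" and B: "finite B" "card B = 4" "A \<inter> B = {}"
    and T: "\<And>k. k \<in> A \<union> B \<Longrightarrow> T k \<noteq> 0 \<and> norm (T k) < 1" and S: "\<And>k. k \<in> A \<union> B \<Longrightarrow> S k \<noteq> 0 \<and> norm (S k) < 1"
    and \<xi>: "\<xi> \<noteq> 0" "norm \<xi> < 1" and SA: "\<And>k. k \<in> A \<Longrightarrow> S k = \<xi> * T k" and SB: "\<And>k. k \<in> B \<Longrightarrow> T k = \<xi> * S k"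
    and ptA: "(\<Prod>k\<in>A. T k) * \<xi>\<^sup>2 = p * q" and ptB: "(\<Prod>k\<in>B. T k) = \<xi>\<^sup>2 * (p * q)"
    and snA: "(\<Sum>k\<in>A. n k) + 2 * N + \<rho> + \<epsilon> = 0" and snB: "(\<Sum>k\<in>B. n k) = 2 * N + \<rho> - 3 * \<epsilon>"
    and kA: "\<And>k. k \<in> A \<Longrightarrow> n' k = n k + N" and kB: "\<And>k. k \<in> B \<Longrightarrow> n' k = n k - N - \<rho> + \<epsilon>"
    and e: "\<epsilon> \<in> {0, 1}" "\<rho> \<in> {0, 1}"
    and ab: "a \<in> A" "b \<in> A" "a \<noteq> b" "norm (T a * T b) < norm q"
    and cd: "c \<in> B" "d \<in> B" "c \<noteq> d" "norm (S c * S d) < norm q"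
  shows "BI (A \<union> B) \<epsilon> T n = RH A \<epsilon> T n * RH B \<epsilon> T n * BI (A \<union> B) \<rho> S n'"
proof -
  define t where "t = (\<lambda>k. if k \<in> A then T k else S k)"
  define m where "m = (\<lambda>k. if k \<in> A then n k else n' k)"
  have tA: "t k = T k" "m k = n k" if "k \<in> A" for k using that by (simp_all add: t_def m_def)
  have tB: "t k = S k" "m k = n' k" if "k \<in> B" for k using that B(3) by (auto simp: t_def m_def)
  have P: "(\<Prod>k\<in>A. t k) = (\<Prod>k\<in>A. T k)" "(\<Prod>k\<in>B. t k) = (\<Prod>k\<in>B. S k)" "(\<Sum>k\<in>A. m k) = (\<Sum>k\<in>A. n k)" "(\<Sum>k\<in>B. m k) = (\<Sum>k\<in>B. n' k)"
    by (intro prod.cong sum.cong refl tA tB; assumption)+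
  have "(\<Prod>k\<in>B. T k) = \<xi> ^ 4 * (\<Prod>k\<in>B. S k)" using B by (simp add: SB prod.distrib)
  then have "\<xi>\<^sup>2 * ((\<Prod>k\<in>B. S k) * \<xi>\<^sup>2) = \<xi>\<^sup>2 * (p * q)" unfolding ptB[symmetric] by (simp add: power4_eq_xxxx power2_eq_square mult_ac)
  then have pS: "(\<Prod>k\<in>B. S k) * \<xi>\<^sup>2 = p * q" using \<xi> by simp
  have sS: "(\<Sum>k\<in>B. n' k) = (\<Sum>k\<in>B. n k) - 4 * (N + \<rho> - \<epsilon>)" using B by (simp add: kB sum.distrib sum_subtractf algebra_simps)
  have ba: "BI (A \<union> B) \<epsilon> (dil_t B t \<xi>) (dil_n B m (N + \<rho> - \<epsilon>)) * RH B \<rho> t m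
    = BI (A \<union> B) \<rho> (dil_t A t \<xi>) (dil_n A m N) * RH A \<epsilon> t m"
  proof (rule bailey[OF A B _ \<xi> _ _ _ _ e ab(1-3) _ cd(1-3)])
    show "t k \<noteq> 0 \<and> norm (t k) < 1" if "k \<in> A \<union> B" for k using that T S tA tB by auto
  qed (use pS sS snA snB ptA ab cd in \<open>auto simp: P tA tB\<close>)
  have 1: "BI (A \<union> B) \<epsilon> (dil_t B t \<xi>) (dil_n B m (N + \<rho> - \<epsilon>)) = BI (A \<union> B) \<epsilon> T n"
    by (rule BI_cong) (use B(3) SB kB in \<open>auto simp: dil_t_def dil_n_def tA tB\<close>)
  have 2: "BI (A \<union> B) \<rho> (dil_t A t \<xi>) (dil_n A m N) = BI (A \<union> B) \<rho> S n'"
    by (rule BI_cong) (use B(3) SA kA in \<open>auto simp: dil_t_def dil_n_def tA tB\<close>)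
  have 3: "RH A \<epsilon> t m = RH A \<epsilon> T n" by (rule RH_cong) (simp_all add: tA)
  have 4: "RH B \<rho> t m = RH B \<rho> S n'" by (rule RH_cong) (simp_all add: tB)
  have R: "RH B \<epsilon> T n * RH B \<rho> S n' = 1"
    by (rule RH_complement[OF B(1,2) _ _ SB ptB \<xi>(1), where k = "N + \<rho> - \<epsilon>"]) (use T S kB snB in auto)
  have "BI (A \<union> B) \<epsilon> T n = BI (A \<union> B) \<epsilon> T n * (RH B \<epsilon> T n * RH B \<rho> S n')" unfolding R by simp
  also have "\<dots> = RH B \<epsilon> T n * (BI (A \<union> B) \<epsilon> T n * RH B \<rho> S n')" by (simp only: mult_ac)
  also have "\<dots> = RH A \<epsilon> T n * RH B \<epsilon> T n * BI (A \<union> B) \<rho> S n'" unfolding ba[unfolded 1 2 3 4] by (simp only: mult_ac)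
  finally show ?thesis .
qed

text \<open>The logarithms of the transformed parameters; half sums of logarithms take the place of
  the square roots.\<close>

definition Ys :: "(nat \<Rightarrow> complex) \<Rightarrow> nat \<Rightarrow> complex" where
  "Ys X a = (if a \<le> 4 then (X 1 + X 2 + X 3 + X 4) / 2 else (X 5 + X 6 + X 7 + X 8) / 2) - X a"

text \<open>\<open>y1\<close> and \<open>y2\<close> are the logarithms of \<xi> in the two steps.
  \<open>y2\<close> can be stated in the original parameters because the first step leaves the
  product over {1, 2, 7, 8} unchanged: two factors gain \<xi> and two lose it.\<close>

definition y1 :: "(nat \<Rightarrow> complex) \<Rightarrow> complex" where "y1 X = (lp + lq - (X 1 + X 2 + X 5 + X 6)) / 2"
definition y2 :: "(nat \<Rightarrow> complex) \<Rightarrow> complex" where "y2 X = (lp + lq - (X 1 + X 2 + X 7 + X 8)) / 2"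
definition Ss :: "(nat \<Rightarrow> complex) \<Rightarrow> nat \<Rightarrow> complex" where
  "Ss X a = (if a \<in> {1, 2, 5, 6} then X a + y1 X else X a - y1 X)"

text \<open>The two steps produce the transformed parameters with 1, 2 and 3, 4 and 5, 6 and 7, 8
  interchanged; the integral is symmetric, so \<open>BI_swap\<close> undoes this.\<close>

definition swp :: "nat \<Rightarrow> nat" where "swp a = (if odd a then a + 1 else a - 1)"

lemma set_8: "{1..8::nat} = {1, 2, 3, 4, 5, 6, 7, 8}" and set_4: "{1..4::nat} = {1, 2, 3, 4}" and set_58: "{5..8::nat} = {5, 6, 7, 8}"
  by auto

lemma swp_values: "swp 1 = 2" "swp 2 = 1" "swp 3 = 4" "swp 4 = 3" "swp 5 = 6" "swp 6 = 5" "swp 7 = 8" "swp 8 = 7"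
  by (simp_all add: swp_def)

lemma BI_swap: "BI {1..8} \<epsilon> (\<lambda>a. t (swp a)) (\<lambda>a. n (swp a)) = BI {1..8} \<epsilon> t n"
proof -
  have "(\<Prod>a\<in>{1..8}. f (swp a)) = (\<Prod>a\<in>{1..8}. f a)" for f :: "nat \<Rightarrow> complex"
    by (rule prod.reindex_bij_witness[of _ swp swp]) (unfold set_8, auto simp: swp_def)
  from this[of "\<lambda>a. gam (t a * _) (n a + \<epsilon> + _) * gam (t a / _) (n a - _)"] show ?thesis
    unfolding BI_def W_def by simp
qed

text \<open>The conditions on y1, y2 and the intermediate parameters make both steps admissible, and
  those compared with Re lq are the smallness conditions of the four beta integrals used.\<close>

lemma elliptic_transformation_local:
  assumes sX: "(\<Sum>a=1..8. X a) = 2 * (lp + lq)" and \<epsilon>: "\<epsilon> \<in> {0, 1}" and \<rho>: "\<rho> \<in> {0, 1}"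
    and sn: "(\<Sum>a=1..8. n a) + 4 * \<epsilon> = 0" and k: "\<And>a. a \<in> {1..4} \<Longrightarrow> 2 * (k a + n a) = (\<Sum>l=1..4. n l) + \<epsilon> - \<rho>"
    "\<And>a. a \<in> {5..8} \<Longrightarrow> 2 * (k a + n a) = (\<Sum>l=5..8. n l) + \<epsilon> - \<rho>"
    and X: "\<And>a. a \<in> {1..8} \<Longrightarrow> Re (X a) < 0" and S: "\<And>a. a \<in> {1..8} \<Longrightarrow> Re (Ss X a) < 0" and Y: "\<And>a. a \<in> {1..8} \<Longrightarrow> Re (Ys X a) < 0"
    and y: "Re (y1 X) < 0" "Re (y2 X) < 0"
    and l: "Re (X 1) + Re (X 2) < Re lq" "Re (Ss X 3) + Re (Ss X 4) < Re lq" "Re (Ss X 1) + Re (Ss X 2) < Re lq" "Re (Ys X 3) + Re (Ys X 4) < Re lq"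
  shows "BI {1..8} \<epsilon> (\<lambda>a. exp (X a)) n = (\<Prod>b=1..4. \<Prod>c=1..4. gam (exp (X b) * exp (X (c + 4))) (n b + n (c + 4) + \<epsilon>)) * BI {1..8} \<rho> (\<lambda>a. exp (Ys X a)) k"
proof -
  \<comment> \<open>The type of the intermediate integral is forced by parity, so that N is an
    integer; for N' the parity follows from the integrality of \<open>k\<close>.\<close>
  define r1 where "r1 = (\<epsilon> + n 1 + n 2 + n 5 + n 6) mod 2"
  have r1: "r1 \<in> {0, 1}" by (auto simp: r1_def)
  have "even (- r1 - \<epsilon> - (n 1 + n 2 + n 5 + n 6))" unfolding r1_def by presburger
  then obtain N where "- r1 - \<epsilon> - (n 1 + n 2 + n 5 + n 6) = 2 * N" by (rule evenE)
  then have N: "n 1 + n 2 + n 5 + n 6 + 2 * N + r1 + \<epsilon> = 0" by linarith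
  define K where "K = (\<lambda>a. if a \<in> {1, 2, 5, 6} then n a + N else n a - N - r1 + \<epsilon>)"
  have sn': "n 1 + n 2 + n 3 + n 4 + n 5 + n 6 + n 7 + n 8 + 4 * \<epsilon> = 0" using sn unfolding set_8 by simp
  have k': "2 * (k a + n a) = n 1 + n 2 + n 3 + n 4 + \<epsilon> - \<rho>" if "a \<in> {1, 2, 3, 4}" for a using k(1)[of a] that unfolding set_4 by simp
  have k'': "2 * (k a + n a) = n 5 + n 6 + n 7 + n 8 + \<epsilon> - \<rho>" if "a \<in> {5, 6, 7, 8}" for a using k(2)[of a] that unfolding set_58 by simp
  have "even (- \<rho> - r1 - (K 1 + K 2 + K 7 + K 8))" using k'[of 1] N sn' unfolding K_def by simp presburger
  then obtain N' where "- \<rho> - r1 - (K 1 + K 2 + K 7 + K 8) = 2 * N'" by (rule evenE)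
  then have N': "K 1 + K 2 + K 7 + K 8 + 2 * N' + \<rho> + r1 = 0" by linarith
  have sX': "X 1 + X 2 + X 3 + X 4 + X 5 + X 6 + X 7 + X 8 = 2 * (lp + lq)" using sX unfolding set_8 by (simp add: add_ac)
  define T1 T2 T3 where "T1 = (\<lambda>a. exp (X a))" and "T2 = (\<lambda>a. exp (Ss X a))" and "T3 = (\<lambda>a. exp (Ys X (swp a)))"
  define k3 where "k3 = (\<lambda>a. k (swp a))"
  have swp8: "swp a \<in> {1..8}" if "a \<in> {1..8}" for a using that unfolding set_8 by (auto simp: swp_def)
  have n1: "norm (T1 a) < 1" "norm (T2 a) < 1" "norm (T3 a) < 1" if "a \<in> {1..8}" for a
    using X[OF that] S[OF that] Y[OF swp8[OF that]] by (simp_all add: T1_def T2_def T3_def)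
  have n0: "T1 a \<noteq> 0" "T2 a \<noteq> 0" "T3 a \<noteq> 0" for a by (simp_all add: T1_def T2_def T3_def)
  have pq: "p * q = exp (lp + lq)" by (simp add: exp_add)
  have lq: "norm q = exp (Re lq)" using norm_exp_eq_Re[of lq] by simp
  have un: "{1, 2, 5, 6} \<union> {3, 4, 7, 8} = {1..8::nat}" "{1, 2, 7, 8} \<union> {3, 4, 5, 6} = {1..8::nat}" unfolding set_8 by auto
  have st1: "BI ({1, 2, 5, 6} \<union> {3, 4, 7, 8}) \<epsilon> T1 n = RH {1, 2, 5, 6} \<epsilon> T1 n * RH {3, 4, 7, 8} \<epsilon> T1 n * BI ({1, 2, 5, 6} \<union> {3, 4, 7, 8}) r1 T2 K"
  proof (rule bailey_step[where \<xi> = "exp (y1 X)" and N = N and a = 1 and b = 2 and c = 3 and d = 4])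
    have "lp + lq = X 1 + X 2 + X 5 + X 6 + y1 X + y1 X" by (simp add: y1_def field_simps)
    then show "(\<Prod>k\<in>{1, 2, 5, 6}. T1 k) * (exp (y1 X))\<^sup>2 = p * q"
      unfolding pq T1_def power2_eq_square by (simp add: mult_exp_exp add_ac)
    have "X 3 + X 4 + X 7 + X 8 = y1 X + y1 X + (lp + lq)" using sX' by (simp add: y1_def complex_eq_iff)
    then show "(\<Prod>k\<in>{3, 4, 7, 8}. T1 k) = (exp (y1 X))\<^sup>2 * (p * q)"
      unfolding pq T1_def power2_eq_square by (simp add: mult_exp_exp add_ac)
    show "(\<Sum>k\<in>{1, 2, 5, 6}. n k) + 2 * N + r1 + \<epsilon> = 0" "(\<Sum>k\<in>{3, 4, 7, 8}. n k) = 2 * N + r1 - 3 * \<epsilon>" using N sn' by auto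
    show "norm (T1 1 * T1 2) < norm q" "norm (T2 3 * T2 4) < norm q" using l by (simp_all add: T1_def T2_def lq norm_mult mult_exp_exp)
    show "T1 a \<noteq> 0 \<and> norm (T1 a) < 1" "T2 a \<noteq> 0 \<and> norm (T2 a) < 1" if "a \<in> {1, 2, 5, 6} \<union> {3, 4, 7, 8}" for a
      using that n0 n1 unfolding un by auto
    show "T2 a = exp (y1 X) * T1 a" "K a = n a + N" if "a \<in> {1, 2, 5, 6}" for a
    proof -
      have "Ss X a = y1 X + X a" using that by (simp add: Ss_def)
      then show "T2 a = exp (y1 X) * T1 a" by (simp add: T1_def T2_def exp_add)
      show "K a = n a + N" using that by (simp add: K_def)
    qed
    show "T1 a = exp (y1 X) * T2 a" "K a = n a - N - r1 + \<epsilon>" if "a \<in> {3, 4, 7, 8}" for a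
    proof -
      have a: "a \<notin> {1, 2, 5, 6}" using that by auto
      then have "X a = y1 X + Ss X a" unfolding Ss_def by simp
      then show "T1 a = exp (y1 X) * T2 a" by (simp add: T1_def T2_def flip: exp_add)
      show "K a = n a - N - r1 + \<epsilon>" using a unfolding K_def by simp
    qed
  qed (use y \<epsilon> r1 in auto)
  have Y1: "Ys X (swp a) = y2 X + Ss X a" if "a \<in> {1, 2, 7, 8}" for a
  proof -
    have "Ys X (swp 1) = y2 X + Ss X 1" "Ys X (swp 2) = y2 X + Ss X 2" "Ys X (swp 7) = y2 X + Ss X 7" "Ys X (swp 8) = y2 X + Ss X 8"
      unfolding swp_values using sX' by (simp add: Ys_def y1_def y2_def Ss_def complex_eq_iff field_simps)+
    then show ?thesis using that by blast
  qed
  have Y2: "Ss X a = y2 X + Ys X (swp a)" if "a \<in> {3, 4, 5, 6}" for a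
  proof -
    have "Ss X 3 = y2 X + Ys X (swp 3)" "Ss X 4 = y2 X + Ys X (swp 4)" "Ss X 5 = y2 X + Ys X (swp 5)" "Ss X 6 = y2 X + Ys X (swp 6)"
      unfolding swp_values using sX' by (simp add: Ys_def y1_def y2_def Ss_def complex_eq_iff field_simps)+
    then show ?thesis using that by blast
  qed
  have st2: "BI ({1, 2, 7, 8} \<union> {3, 4, 5, 6}) r1 T2 K = RH {1, 2, 7, 8} r1 T2 K * RH {3, 4, 5, 6} r1 T2 K * BI ({1, 2, 7, 8} \<union> {3, 4, 5, 6}) \<rho> T3 k3"
  proof (rule bailey_step[where \<xi> = "exp (y2 X)" and N = N' and a = 1 and b = 2 and c = 3 and d = 4])
    have "lp + lq = Ss X 1 + Ss X 2 + Ss X 7 + Ss X 8 + y2 X + y2 X" by (simp add: Ss_def y2_def field_simps)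
    then show "(\<Prod>k\<in>{1, 2, 7, 8}. T2 k) * (exp (y2 X))\<^sup>2 = p * q"
      unfolding pq T2_def power2_eq_square by (simp add: mult_exp_exp add_ac)
    have "Ss X 3 + Ss X 4 + Ss X 5 + Ss X 6 = y2 X + y2 X + (lp + lq)" using sX' by (simp add: Ss_def y1_def y2_def complex_eq_iff)
    then show "(\<Prod>k\<in>{3, 4, 5, 6}. T2 k) = (exp (y2 X))\<^sup>2 * (p * q)"
      unfolding pq T2_def power2_eq_square by (simp add: mult_exp_exp add_ac)
    show "(\<Sum>k\<in>{1, 2, 7, 8}. K k) + 2 * N' + \<rho> + r1 = 0" "(\<Sum>k\<in>{3, 4, 5, 6}. K k) = 2 * N' + \<rho> - 3 * r1" using N' N sn' by (auto simp: K_def)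
    show "norm (T2 1 * T2 2) < norm q" "norm (T3 3 * T3 4) < norm q" using l by (simp_all add: T2_def T3_def swp_def lq norm_mult mult_exp_exp add_ac)
    show "T3 a = exp (y2 X) * T2 a" if "a \<in> {1, 2, 7, 8}" for a
      unfolding T2_def T3_def Y1[OF that] by (rule exp_add)
    show "T2 a = exp (y2 X) * T3 a" if "a \<in> {3, 4, 5, 6}" for a
      unfolding T2_def T3_def Y2[OF that] by (rule exp_add)
    show "k3 a = K a + N'" if "a \<in> {1, 2, 7, 8}" for a
    proof -
      have "k3 1 = K 1 + N'" "k3 2 = K 2 + N'" "k3 7 = K 7 + N'" "k3 8 = K 8 + N'"
        unfolding k3_def swp_values using k'[of 1] k'[of 2] k''[of 7] k''[of 8] N' N sn' by (simp_all add: K_def)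
      then show ?thesis using that by blast
    qed
    show "k3 a = K a - N' - \<rho> + r1" if "a \<in> {3, 4, 5, 6}" for a
    proof -
      have "k3 3 = K 3 - N' - \<rho> + r1" "k3 4 = K 4 - N' - \<rho> + r1" "k3 5 = K 5 - N' - \<rho> + r1" "k3 6 = K 6 - N' - \<rho> + r1"
        unfolding k3_def swp_values using k'[of 3] k'[of 4] k''[of 5] k''[of 6] N' N sn' by (simp_all add: K_def)
      then show ?thesis using that by blast
    qed
    show "T2 a \<noteq> 0 \<and> norm (T2 a) < 1" "T3 a \<noteq> 0 \<and> norm (T3 a) < 1" if "a \<in> {1, 2, 7, 8} \<union> {3, 4, 5, 6}" for a
      using that n0 n1 unfolding un by auto
  qed (use y r1 \<rho> in auto)
  define g where "g = (\<lambda>a b. gam (T1 a * T1 b) (n a + n b + \<epsilon>))"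
  define h where "h = (\<lambda>a b. gam (T2 a * T2 b) (K a + K b + r1))"
  \<comment> \<open>If exactly one of the two indices is dilated upwards, the factors exp (y1 X)
    cancel in the product, and the discrete parts agree likewise.\<close>
  have hg: "h a b = g a b" if "a \<in> {1, 2, 5, 6} \<and> b \<notin> {1, 2, 5, 6} \<or> a \<notin> {1, 2, 5, 6} \<and> b \<in> {1, 2, 5, 6}" for a b
  proof -
    have "T2 a * T2 b = T1 a * T1 b" "K a + K b + r1 = n a + n b + \<epsilon>"
      using that by (auto simp: T1_def T2_def Ss_def K_def mult_exp_exp)
    then show ?thesis by (simp add: g_def h_def)
  qed
  have c1: "g a b * h c d = 1" if "a \<in> {1..8}" "b \<in> {1..8}" "c \<in> {1..8}" "d \<in> {1..8}" "X a + X b + Ss X c + Ss X d = lp + lq" "n a + n b + \<epsilon> + K c + K d + r1 = 0" for a b c d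
    unfolding g_def h_def
  proof (rule gam_mult_eq_1)
    show "T1 a * T1 b * (T2 c * T2 d) = p * q" unfolding pq that(5)[symmetric] T1_def T2_def by (simp add: exp_add)
    show "norm (T1 a * T1 b) < 1" "norm (T2 c * T2 d) < 1"
      using n1(1)[OF that(1)] n1(1)[OF that(2)] n1(2)[OF that(3)] n1(2)[OF that(4)]
        mult_strict_mono[of "norm (T1 a)" 1 "norm (T1 b)" 1] mult_strict_mono[of "norm (T2 c)" 1 "norm (T2 d)" 1] by (simp_all add: norm_mult)
  qed (use n0 that in auto)
  \<comment> \<open>Of the 24 gamma factors of the two steps, these eight cancel by reflection; the
    other sixteen are the pairs with one index in {1, ..., 4} and one in {5, ..., 8}.\<close>
  have c: "g 1 2 * h 5 6 = 1" "g 5 6 * h 1 2 = 1" "g 3 4 * h 7 8 = 1" "g 7 8 * h 3 4 = 1"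
    by (rule c1; use sX' N sn' in \<open>simp add: Ss_def y1_def K_def complex_eq_iff\<close>)+
  have "RH {1, 2, 5, 6} \<epsilon> T1 n * RH {3, 4, 7, 8} \<epsilon> T1 n * (RH {1, 2, 7, 8} r1 T2 K * RH {3, 4, 5, 6} r1 T2 K)
    = ((g 1 2 * g 5 6) * (g 1 5 * g 2 6) * (g 1 6 * g 2 5)) * ((g 3 4 * g 7 8) * (g 3 7 * g 4 8) * (g 3 8 * g 4 7)) *
      (((h 1 2 * h 7 8) * (h 1 7 * h 2 8) * (h 1 8 * h 2 7)) * ((h 3 4 * h 5 6) * (h 3 5 * h 4 6) * (h 3 6 * h 4 5)))"
    by (simp add: RH_four_expand g_def h_def)
  also have "\<dots> = (g 1 2 * h 5 6) * (g 5 6 * h 1 2) * (g 3 4 * h 7 8) * (g 7 8 * h 3 4) *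
     (g 1 5 * g 1 6 * g 1 7 * g 1 8 * g 2 5 * g 2 6 * g 2 7 * g 2 8 * g 3 5 * g 3 6 * g 3 7 * g 3 8 * g 4 5 * g 4 6 * g 4 7 * g 4 8)"
    by (simp add: hg mult_ac)
  also have "\<dots> = (\<Prod>b=1..4. \<Prod>c=1..4. gam (exp (X b) * exp (X (c + 4))) (n b + n (c + 4) + \<epsilon>))"
    unfolding c set_4 by (simp add: g_def T1_def mult_ac)
  finally have RR: "RH {1, 2, 5, 6} \<epsilon> T1 n * RH {3, 4, 7, 8} \<epsilon> T1 n * (RH {1, 2, 7, 8} r1 T2 K * RH {3, 4, 5, 6} r1 T2 K)
    = (\<Prod>b=1..4. \<Prod>c=1..4. gam (exp (X b) * exp (X (c + 4))) (n b + n (c + 4) + \<epsilon>))" .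
  have "BI {1..8} \<rho> T3 k3 = BI {1..8} \<rho> (\<lambda>a. exp (Ys X a)) k"
    unfolding T3_def k3_def using BI_swap[of \<rho> "\<lambda>a. exp (Ys X a)" k] by simp
  with st1 st2 show ?thesis unfolding un RR[symmetric] by (simp add: T1_def mult_ac)
qed

end

text \<open>At z^2 = 1 the gamma functions in the denominator can have poles, where their default
  value need not be compatible with the kernel. On the unit circle these are only the two points 1
  and - 1, parametrised by 0, 1 / 2 and 1.\<close>

lemma circ_spike:
  assumes "\<And>z. norm z = 1 \<Longrightarrow> z\<^sup>2 \<noteq> 1 \<Longrightarrow> F z = G z" shows "circ F = circ G"
proof -
  let ?e = "\<lambda>t. exp (2 * pi * \<i> * of_real t)"
  have "integral {0..1} (\<lambda>t. 2 * pi * \<i> * F (1 * ?e t)) = integral {0..1} (\<lambda>t. 2 * pi * \<i> * G (1 * ?e t))"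
  proof (rule integral_spike[of "{0, 1 / 2, 1}"])
    fix t :: real assume t: "t \<in> {0..1} - {0, 1 / 2, 1}"
    have "(?e t)\<^sup>2 \<noteq> 1"
    proof
      assume "(?e t)\<^sup>2 = 1"
      then have "exp (of_real (4 * pi * t) * \<i>) = 1" by (simp add: exp_double[symmetric] mult_ac)
      then obtain k :: int where "4 * pi * t = of_int (2 * k) * pi" by (auto simp: exp_eq_1)
      then have "2 * t = of_int k" by simp
      moreover have "0 < t" "t < 1" "2 * t \<noteq> 1" using t by auto
      ultimately have "0 < real_of_int k" "real_of_int k < 2" "real_of_int k \<noteq> 1" by linarith+
      then have "0 < k" "k < 2" "k \<noteq> 1" by simp_all
      then show False by linarith
    qed
    moreover have "norm (?e t) = 1" by simp
    ultimately show "2 * pi * \<i> * G (1 * ?e t) = 2 * pi * \<i> * F (1 * ?e t)" using assms[of "?e t"] by simp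
  qed (rule negligible_finite, simp)
  then show ?thesis unfolding circ_def using circlepath_integral[of 1 F] circlepath_integral[of 1 G] by simp
qed

text \<open>Each modulus condition, read along a complex line in logarithmic coordinates, is such a
  set: a half plane, or everything or nothing when d = 0.\<close>

lemma open_convex_affine_Re_neg: "open {\<zeta>. Re (c + \<zeta> * d) < 0}" "convex {\<zeta>. Re (c + \<zeta> * d) < 0}"
proof -
  show "open {\<zeta>. Re (c + \<zeta> * d) < 0}" by (intro open_Collect_less continuous_intros)
  have "{\<zeta>. Re (c + \<zeta> * d) < 0} = {\<zeta>. inner (cnj d) \<zeta> < - Re c}" by (auto simp: inner_complex_def algebra_simps)
  then show "convex {\<zeta>. Re (c + \<zeta> * d) < 0}" by (simp add: convex_halfspace_lt)
qed

context rarefied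
begin

lemma rarefied_V_eq_BI:
  assumes t: "\<And>a. a \<in> {1..8} \<Longrightarrow> t a \<noteq> 0 \<and> norm (t a) < 1"
  shows "rarefied_V r p q \<epsilon> t n = qpoch_inf (p ^ r) (p ^ r) * qpoch_inf (q ^ r) (q ^ r) / (4 * of_real pi * \<i>) * BI {1..8} \<epsilon> t n"
proof -
  have "contour_integral (circlepath 0 1)
          (\<lambda>z. (\<Prod>a=1..8. gam (t a * z) (n a + \<epsilon> + int m) * gam (t a * inverse z) (n a - int m))
               / (gam (z\<^sup>2) (2 * int m + \<epsilon>) * gam (inverse (z\<^sup>2)) (- 2 * int m - \<epsilon>)) / z) = circ (\<lambda>z. W {1..8} \<epsilon> t n z (int m))" for m
    unfolding circ_def[symmetric]
  proof (rule circ_spike)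
    fix z :: complex assume z: "norm z = 1" "z\<^sup>2 \<noteq> 1"
    then have z0: "z \<noteq> 0" by auto
    have "z\<^sup>2 \<in> dom" "1 / z\<^sup>2 \<in> dom" by (rule dom_unit; use z z0 in \<open>simp add: norm_power norm_divide\<close>)+
    from ker_eq[OF this z(2), of "2 * int m + \<epsilon>"]
    have k: "gam (z\<^sup>2) (2 * int m + \<epsilon>) * gam (inverse (z\<^sup>2)) (- 2 * int m - \<epsilon>) * ker (z\<^sup>2) (2 * int m + \<epsilon>) = 1"
      by (simp add: inverse_eq_divide)
    then have "gam (z\<^sup>2) (2 * int m + \<epsilon>) * gam (inverse (z\<^sup>2)) (- 2 * int m - \<epsilon>) \<noteq> 0" by auto
    then have "x / (gam (z\<^sup>2) (2 * int m + \<epsilon>) * gam (inverse (z\<^sup>2)) (- 2 * int m - \<epsilon>)) = x * ker (z\<^sup>2) (2 * int m + \<epsilon>)" for x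
      using k by (metis mult.commute nonzero_eq_divide_eq mult.assoc mult_1_right)
    then show "(\<Prod>a=1..8. gam (t a * z) (n a + \<epsilon> + int m) * gam (t a * inverse z) (n a - int m))
               / (gam (z\<^sup>2) (2 * int m + \<epsilon>) * gam (inverse (z\<^sup>2)) (- 2 * int m - \<epsilon>)) = W {1..8} \<epsilon> t n z (int m)"
      unfolding W_def by (simp only: divide_inverse)
  qed
  then show ?thesis unfolding rarefied_V_def BI_def by simp
qed

text \<open>On the complex line through a base point \<open>X0\<close> and \<open>X\<close>, the
  conditions on the old and new parameters define a convex set \<Omega> containing 0 and 1. Both
  sides are holomorphic there, and they agree on the nonempty open part where the two-step argument
  is available.\<close>

theorem elliptic_transformation:
  assumes sX: "(\<Sum>a=1..8. X a) = 2 * (lp + lq)" and \<epsilon>: "\<epsilon> \<in> {0, 1}" and \<rho>: "\<rho> \<in> {0, 1}"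
    and sn: "(\<Sum>a=1..8. n a) + 4 * \<epsilon> = 0" and k: "\<And>a. a \<in> {1..4} \<Longrightarrow> 2 * (k a + n a) = (\<Sum>l=1..4. n l) + \<epsilon> - \<rho>"
    "\<And>a. a \<in> {5..8} \<Longrightarrow> 2 * (k a + n a) = (\<Sum>l=5..8. n l) + \<epsilon> - \<rho>"
    and X: "\<And>a. a \<in> {1..8} \<Longrightarrow> Re (X a) < 0" and Y: "\<And>a. a \<in> {1..8} \<Longrightarrow> Re (Ys X a) < 0"
  shows "BI {1..8} \<epsilon> (\<lambda>a. exp (X a)) n = (\<Prod>b=1..4. \<Prod>c=1..4. gam (exp (X b) * exp (X (c + 4))) (n b + n (c + 4) + \<epsilon>)) * BI {1..8} \<rho> (\<lambda>a. exp (Ys X a)) k"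
proof -
  \<comment> \<open>The base point satisfies all strict inequalities of the local version. For
    instance Re (X0 1) = Re lq / 2 + Re lp / 8, so Re (X0 1 + X0 2) lies below Re lq by the margin -
    Re lp / 4, and the contributions of \<kappa> cancel in the total sum.\<close>
  define \<kappa> where "\<kappa> = complex_of_real (- Re lp / 8)"
  define X0 where "X0 = (\<lambda>a::nat. if a \<in> {1, 2} then (lp + lq) / 2 + 3 * \<kappa> else if a \<in> {3, 4} then (lp + lq) / 2 + \<kappa> else - 2 * \<kappa>)"
  define F where "F = (\<lambda>\<zeta> a. X0 a + \<zeta> * (X a - X0 a))"
  have lpq: "Re lp < 0" "Re lq < 0" using p q norm_exp_eq_Re[of lp] norm_exp_eq_Re[of lq] by simp_all
  have F01: "F 0 = X0" "F 1 = X" by (auto simp: F_def)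
  have X0s: "(\<Sum>a=1..8. X0 a) = 2 * (lp + lq)" unfolding set_8 by (simp add: X0_def)
  have sF: "(\<Sum>a=1..8. F \<zeta> a) = 2 * (lp + lq)" for \<zeta>
    using sX X0s by (simp add: F_def sum.distrib sum_subtractf flip: sum_distrib_left)
  have FY: "Ys (F \<zeta>) a = Ys X0 a + \<zeta> * (Ys X a - Ys X0 a)" for \<zeta> a
    by (simp add: Ys_def F_def field_simps)
  have F: "F \<zeta> a = X0 a + \<zeta> * (X a - X0 a)" for \<zeta> a by (simp add: F_def)
  define \<Omega> where "\<Omega> = (\<Inter>a\<in>{1..8}. {\<zeta>. Re (F \<zeta> a) < 0} \<inter> {\<zeta>. Re (Ys (F \<zeta>) a) < 0})"
  have o: "open {\<zeta>. Re (F \<zeta> a) < 0}" "convex {\<zeta>. Re (F \<zeta> a) < 0}" "open {\<zeta>. Re (Ys (F \<zeta>) a) < 0}" "convex {\<zeta>. Re (Ys (F \<zeta>) a) < 0}" for a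
    unfolding FY F by (rule open_convex_affine_Re_neg)+
  have \<Omega>: "open \<Omega>" "convex \<Omega>" unfolding \<Omega>_def by (intro open_INT convex_INT convex_Int open_Int o ballI finite_atLeastAtMost)+
  define U where "U = (\<Inter>a\<in>{1..8}. {\<zeta>. Re (Ss (F \<zeta>) a) < 0}) \<inter> {\<zeta>. Re (y1 (F \<zeta>)) < 0} \<inter> {\<zeta>. Re (y2 (F \<zeta>)) < 0}
    \<inter> {\<zeta>. Re (F \<zeta> 1) + Re (F \<zeta> 2) < Re lq} \<inter> {\<zeta>. Re (Ss (F \<zeta>) 3) + Re (Ss (F \<zeta>) 4) < Re lq}
    \<inter> {\<zeta>. Re (Ss (F \<zeta>) 1) + Re (Ss (F \<zeta>) 2) < Re lq} \<inter> {\<zeta>. Re (Ys (F \<zeta>) 3) + Re (Ys (F \<zeta>) 4) < Re lq}"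
  have cF: "continuous_on UNIV (\<lambda>\<zeta>. F \<zeta> a)" "continuous_on UNIV (\<lambda>\<zeta>. Ys (F \<zeta>) a)" for a
    unfolding FY F by (intro continuous_intros)+
  have cy: "continuous_on UNIV (\<lambda>\<zeta>. y1 (F \<zeta>))" "continuous_on UNIV (\<lambda>\<zeta>. y2 (F \<zeta>))"
    unfolding y1_def y2_def by (intro continuous_intros cF; simp)+
  have cS: "continuous_on UNIV (\<lambda>\<zeta>. Ss (F \<zeta>) a)" for a
    unfolding Ss_def by (cases "a \<in> {1, 2, 5, 6}") (simp only: if_True if_False, intro continuous_intros cF cy)+
  have "open U" unfolding U_def
    by (intro open_Int open_INT ballI finite_atLeastAtMost open_Collect_less continuous_intros cF cy cS)
  have 0: "0 \<in> \<Omega> \<inter> U"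
  proof -
    have "Re (X0 a) < 0 \<and> Re (Ys X0 a) < 0 \<and> Re (Ss X0 a) < 0" if "a \<in> {1..8}" for a
      using that lpq unfolding set_8 by (auto simp: X0_def Ys_def Ss_def y1_def \<kappa>_def field_simps)
    moreover have "Re (y1 X0) < 0" "Re (y2 X0) < 0" "Re (X0 1) + Re (X0 2) < Re lq" "Re (Ss X0 3) + Re (Ss X0 4) < Re lq"
      "Re (Ss X0 1) + Re (Ss X0 2) < Re lq" "Re (Ys X0 3) + Re (Ys X0 4) < Re lq"
      using lpq by (simp_all add: X0_def Ss_def Ys_def y1_def y2_def \<kappa>_def field_simps)
    ultimately show ?thesis by (simp add: \<Omega>_def U_def F01)
  qed
  have 1: "1 \<in> \<Omega>" using X Y by (auto simp: \<Omega>_def F01)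
  have sm: "norm (exp (F \<zeta> a)) < 1" "norm (exp (Ys (F \<zeta>) a)) < 1" if "\<zeta> \<in> \<Omega>" "a \<in> {1..8}" for \<zeta> a
    using that by (auto simp: \<Omega>_def)
  define G where "G = (\<lambda>\<zeta>. (\<Prod>b=1..4. \<Prod>c=1..4. gam (exp (F \<zeta> b) * exp (F \<zeta> (c + 4))) (n b + n (c + 4) + \<epsilon>)) * BI {1..8} \<rho> (\<lambda>a. exp (Ys (F \<zeta>) a)) k)"
  have "BI {1..8} \<epsilon> (\<lambda>a. exp (F 1 a)) n = G 1"
  proof (rule analytic_continuation_open[where f = "\<lambda>\<zeta>. BI {1..8} \<epsilon> (\<lambda>a. exp (F \<zeta> a)) n" and g = G and s = "\<Omega> \<inter> U" and s' = \<Omega>])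
    show "open (\<Omega> \<inter> U)" using \<Omega> \<open>open U\<close> by blast
    show "\<Omega> \<inter> U \<noteq> {}" using 0 by blast
    show "connected \<Omega>" using \<Omega> convex_connected by blast
    show "(\<lambda>\<zeta>. BI {1..8} \<epsilon> (\<lambda>a. exp (F \<zeta> a)) n) holomorphic_on \<Omega>"
      by (intro BI_holomorphic \<Omega>) (use sm in \<open>auto simp: F intro!: holomorphic_intros\<close>)
    show "G holomorphic_on \<Omega>" unfolding G_def
    proof (intro holomorphic_intros gam_compose_holomorphic BI_holomorphic \<Omega>)
      show "(\<lambda>\<zeta>. F \<zeta> a) holomorphic_on \<Omega>" "(\<lambda>\<zeta>. F \<zeta> (a + 4)) holomorphic_on \<Omega>" "(\<lambda>\<zeta>. Ys (F \<zeta>) a) holomorphic_on \<Omega>" for a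
        unfolding FY F by (intro holomorphic_intros)+
      fix b c :: nat and \<zeta> assume "b \<in> {1..4}" "c \<in> {1..4}" "\<zeta> \<in> \<Omega>"
      then have "norm (exp (F \<zeta> b)) < 1" "norm (exp (F \<zeta> (c + 4))) < 1" by (intro sm; simp)+
      then show "exp (F \<zeta> b) * exp (F \<zeta> (c + 4)) \<noteq> 0 \<and> norm (exp (F \<zeta> b) * exp (F \<zeta> (c + 4))) < 1"
        using mult_strict_mono[of "norm (exp (F \<zeta> b))" 1 "norm (exp (F \<zeta> (c + 4)))" 1] by (simp add: norm_mult del: norm_exp_eq_Re)
    qed (use sm in auto)
    fix \<zeta> assume z: "\<zeta> \<in> \<Omega> \<inter> U"
    show "BI {1..8} \<epsilon> (\<lambda>a. exp (F \<zeta> a)) n = G \<zeta>" unfolding G_def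
      by (rule elliptic_transformation_local[OF sF \<epsilon> \<rho> sn k]) (use z in \<open>auto simp: \<Omega>_def U_def\<close>)
  qed (use \<Omega> 1 in auto)
  then show ?thesis unfolding G_def F01 .
qed

end

theorem mainTheorem7:
  fixes r :: nat and p q u v :: complex and \<epsilon> \<rho> :: int
    and t s :: "nat \<Rightarrow> complex" and n k :: "nat \<Rightarrow> int"
  assumes "r > 0"
    and "p \<noteq> 0" "q \<noteq> 0" "norm p < 1" "norm q < 1"
    and "\<epsilon> \<in> {0, 1}"
    and "\<And>a. a \<in> {1..8} \<Longrightarrow> t a \<noteq> 0"
    and "(\<Prod>a=1..8. t a) = (p * q)\<^sup>2"
    and "(\<Sum>a=1..8. n a) + 4 * \<epsilon> = 0"
    and "\<rho> \<in> {0, 1}" "even ((\<Sum>l=1..4. n l) + \<epsilon> - \<rho>)"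
    and "u\<^sup>2 = (\<Prod>a=1..4. t a)" "v\<^sup>2 = (\<Prod>a=5..8. t a)" "u * v = p * q"
    and "\<And>a. a \<in> {1..4} \<Longrightarrow> s a = u / t a"
    and "\<And>a. a \<in> {5..8} \<Longrightarrow> s a = v / t a"
    and "\<And>a. a \<in> {1..4} \<Longrightarrow> k a = - n a + ((\<Sum>l=1..4. n l) + \<epsilon> - \<rho>) div 2"
    and "\<And>a. a \<in> {5..8} \<Longrightarrow> k a = - n a + ((\<Sum>l=5..8. n l) + \<epsilon> - \<rho>) div 2"
    and "\<And>a. a \<in> {1..8} \<Longrightarrow> norm (t a) < 1"
    and "\<And>a. a \<in> {1..8} \<Longrightarrow> norm (s a) < 1"
  shows "rarefied_V r p q \<epsilon> t n =
      (\<Prod>b=1..4. \<Prod>c=1..4. rarefied_gamma r p q (t b * t (c + 4)) (n b + n (c + 4) + \<epsilon>))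
      * rarefied_V r p q \<rho> s k"
proof -
  interpret rarefied r p q by unfold_locales (use assms in auto)
  note t = assms(7,19) and s = assms(20) and k4 = assms(17,18)
  have uv0: "u \<noteq> 0" "v \<noteq> 0" using assms(2,3,14) by auto
  \<comment> \<open>Not \<open>Ln v\<close>: this logarithm of v adds up with \<open>Ln u\<close> to
    exactly lp + lq, without a multiple of 2 pi i.\<close>
  define Lv where "Lv = lp + lq - Ln u"
  have Lv: "exp Lv = v"
    unfolding Lv_def using uv0 assms(14) by (simp add: exp_diff exp_add field_simps)
  \<comment> \<open>The logarithms at 1 and 5 are adjusted so that the half sums over the two groups
    are exactly \<open>Ln u\<close> and \<open>Lv\<close>. This encodes the chosen square roots, and
    exp (Ys X a) becomes s a.\<close>
  define X where "X = (\<lambda>a::nat. if a = 1 then 2 * Ln u - (Ln (t 2) + Ln (t 3) + Ln (t 4))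
     else if a = 5 then 2 * Lv - (Ln (t 6) + Ln (t 7) + Ln (t 8)) else Ln (t a))"
  have t8: "t 1 \<noteq> 0" "t 2 \<noteq> 0" "t 3 \<noteq> 0" "t 4 \<noteq> 0" "t 5 \<noteq> 0" "t 6 \<noteq> 0" "t 7 \<noteq> 0" "t 8 \<noteq> 0" using t(1) by auto
  have eX: "exp (X a) = t a" if "a \<in> {1..8}" for a
  proof -
    have "exp (2 * Ln u) = u\<^sup>2" "exp (2 * Lv) = v\<^sup>2" unfolding exp_double using uv0 Lv by simp_all
    then have e: "exp (2 * Ln u) = t 1 * t 2 * t 3 * t 4" "exp (2 * Lv) = t 5 * t 6 * t 7 * t 8"
      unfolding assms(12,13) set_4 set_58 by (simp_all add: mult_ac)
    have "exp (X 1) = t 1" using t8 e by (simp add: X_def exp_diff exp_add)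
    moreover have "exp (X 5) = t 5" using t8 e by (simp add: X_def exp_diff exp_add)
    ultimately show ?thesis using t(1)[OF that] by (cases "a = 1"; cases "a = 5"; simp add: X_def)
  qed
  have sX: "X 1 + X 2 + X 3 + X 4 = 2 * Ln u" "X 5 + X 6 + X 7 + X 8 = 2 * Lv" by (simp_all add: X_def)
  have eY: "exp (Ys X a) = s a" if "a \<in> {1..8}" for a
  proof (cases "a \<le> 4")
    case True
    then show ?thesis using assms(15)[of a] that eX[OF that] uv0 unfolding Ys_def sX by (simp add: exp_diff)
  next
    case False
    then show ?thesis using assms(16)[of a] that eX[OF that] Lv unfolding Ys_def sX by (simp add: exp_diff)
  qed
  have s0: "s a \<noteq> 0" if "a \<in> {1..8}" for a using eY[OF that] exp_not_eq_zero by metis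
  have B1: "BI {1..8} \<epsilon> t n = BI {1..8} \<epsilon> (\<lambda>a. exp (X a)) n" and B2: "BI {1..8} \<rho> s k = BI {1..8} \<rho> (\<lambda>a. exp (Ys X a)) k"
    by (rule BI_cong; simp add: eX eY)+
  have "BI {1..8} \<epsilon> (\<lambda>a. exp (X a)) n = (\<Prod>b=1..4. \<Prod>c=1..4. gam (exp (X b) * exp (X (c + 4))) (n b + n (c + 4) + \<epsilon>)) * BI {1..8} \<rho> (\<lambda>a. exp (Ys X a)) k"
  proof (rule elliptic_transformation)
    have "(\<Sum>a=1..8. X a) = (X 1 + X 2 + X 3 + X 4) + (X 5 + X 6 + X 7 + X 8)" unfolding set_8 by (simp add: add_ac)
    then show "(\<Sum>a=1..8. X a) = 2 * (lp + lq)" unfolding sX Lv_def by simp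
    show "2 * (k a + n a) = (\<Sum>l=1..4. n l) + \<epsilon> - \<rho>" if "a \<in> {1..4}" for a
      using k4(1)[OF that] assms(11) by simp
    have "(\<Sum>a=1..8. n a) = (\<Sum>l=1..4. n l) + (\<Sum>l=5..8. n l)" unfolding set_8 set_4 set_58 by simp
    \<comment> \<open>The parity hypothesis concerns only the first four discrete parameters;
      balancing transfers it to the last four, so both divisions by 2 are exact.\<close>
    moreover have "b + \<epsilon> - \<rho> = - (a + \<epsilon> - \<rho>) - 2 * (\<epsilon> + \<rho>)" if "c = a + b" "c + 4 * \<epsilon> = 0" for a b c using that by simp
    ultimately have "(\<Sum>l=5..8. n l) + \<epsilon> - \<rho> = - ((\<Sum>l=1..4. n l) + \<epsilon> - \<rho>) - 2 * (\<epsilon> + \<rho>)" using assms(9) by blast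
    then have "even ((\<Sum>l=5..8. n l) + \<epsilon> - \<rho>)" using assms(11) by (simp only: dvd_minus_iff dvd_diff_left_iff dvd_triv_left)
    then show "2 * (k a + n a) = (\<Sum>l=5..8. n l) + \<epsilon> - \<rho>" if "a \<in> {5..8}" for a
      using k4(2)[OF that] by simp
    show "Re (X a) < 0" if "a \<in> {1..8}" for a using t(2)[OF that] norm_exp_eq_Re[of "X a"] by (simp add: eX[OF that])
    show "Re (Ys X a) < 0" if "a \<in> {1..8}" for a using s[OF that] norm_exp_eq_Re[of "Ys X a"] by (simp add: eY[OF that])
  qed (use assms in auto)
  moreover have "(\<Prod>b=1..4. \<Prod>c=1..4. gam (exp (X b) * exp (X (c + 4))) (n b + n (c + 4) + \<epsilon>)) = (\<Prod>b=1..4. \<Prod>c=1..4. gam (t b * t (c + 4)) (n b + n (c + 4) + \<epsilon>))"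
    by (intro prod.cong refl) (simp add: eX)
  ultimately have "BI {1..8} \<epsilon> t n = (\<Prod>b=1..4. \<Prod>c=1..4. gam (t b * t (c + 4)) (n b + n (c + 4) + \<epsilon>)) * BI {1..8} \<rho> s k"
    unfolding B1 B2 by simp
  then show ?thesis using rarefied_V_eq_BI[of t \<epsilon> n] rarefied_V_eq_BI[of s \<rho> k] t s s0 by (simp add: mult_ac)
qed

end
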